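(* Let $n\ge 1$ and let $\Omega\in\wp_n$ be a polytope in $\mathbb{R}^n$. If the first eigenfunction for the Laplace eigenvalue equation on $\Omega$ with the Dirichlet boundary condition extends to a real analytic function on $\mathbb{R}^n$, then it is a trigonometric eigenfunction. Moreover, all the eigenfunctions of $\Omega$ (for the Laplace eigenvalue equation with the Dirichlet boundary condition) are trigonometric.
   Context: Polytopes: $\wp_1$ is the set of all bounded open intervals $(a,b)$ with $-\infty<a<b<\infty$. Inductively, for $n\ge 2$, $\wp_n$ is the set of connected bounded domains (open sets) $\Omega\subset\mathbb{R}^n$ such that $\partial\Omega=\bigcup_{j=1}^m\overline{P_j}$ for finitely many sets $P_j$, where each $P_j$ is contained in an $(n-1)$-dimensional hyperplane, i.e. a set of the form $\{x\in\mathbb{R}^n: M\cdot x=b\}$ for some fixed $M\in\mathbb{R}^n$, $b\in\mathbb{R}$, and, under the canonical identification of this hyperplane with $\mathbb{R}^{n-1}$, $P_j$ is identified with an element $Q_j\in\wp_{n-1}$. A polytope in $\mathbb{R}^n$ is an element of $\wp_n$. Dirichlet eigenfunctions: $\Delta=-\sum_{k=1}^n\partial^2/\partial x_k^2$. The Laplace eigenvalue equation with the Dirichlet boundary condition on a bounded domain $\Omega$ is to find functions $u\not\equiv 0$ and constants $\lambda$ with $\Delta u=\lambda u$ in $\Omega$ and $u|_{\partial\Omega}=0$. The eigenvalues are discrete and positive, $0<\lambda_1\le\lambda_2\le\cdots\uparrow\infty$; the first eigenfunction is the eigenfunction with eigenvalue $\lambda_1$ (unique up to a nonzero scalar). Trigonometric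 eigenfunctions: an eigenfunction $u$ for the Laplacian, with eigenvalue $\lambda$, is trigonometric if it can be expressed as a finite sum $u(x)=\sum_{j=1}^m a_j\sin(L_j\cdot x)+b_j\cos(M_j\cdot x)$, where $a_j,b_j\in\mathbb{C}$ and $L_j,M_j\in\mathbb{R}^n$ satisfy $\|L_j\|^2=\|M_j\|^2=\lambda$ for all $j=1,\dots,m$. *)

theory Defs
  imports "HOL-Analysis.Analysis"
begin

section \<open>Polytopes\<close>

text \<open>
  The classes \<open>\<wp>\<^sub>n\<close> are defined by recursion on the dimension, identifying each hyperplane
  with the Euclidean space of one dimension less. Here all dimensions live in one ambient space:
  \<open>flat_polytope k P\<close> says that \<open>P\<close> is an element of \<open>\<wp>\<^sub>k\<close> inside its \<open>k\<close>-dimensional affine hull,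
  openness and boundary being taken relative to that hull. The lemmas
  \<open>flat_polytope_isometric_image\<close>, \<open>flat_polytope_1_real\<close> and \<open>flat_polytope_recursion\<close> below show
  that this is invariant under isometric identifications and satisfies the original recursion.
\<close>

inductive flat_polytope :: "nat \<Rightarrow> 'a::euclidean_space set \<Rightarrow> bool" where
  interval: "a \<noteq> b \<Longrightarrow> flat_polytope 1 (open_segment a b)"
| step: "\<lbrakk>1 \<le> k; aff_dim P = int (Suc k); rel_open P; connected P; bounded P;
          finite F; rel_frontier P = (\<Union>Q\<in>F. closure Q); \<forall>Q\<in>F. flat_polytope k Q\<rbrakk>
         \<Longrightarrow> flat_polytope (Suc k) P"

definition polytope_domain :: "(real^'n) set \<Rightarrow> bool" where
  "polytope_domain \<Omega> \<longleftrightarrow> flat_polytope CARD('n) \<Omega>"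

lemma flat_polytope_0: "\<not> flat_polytope 0 P"
  by (auto elim: flat_polytope.cases)

lemma flat_polytope_1: "flat_polytope (Suc 0) P \<longleftrightarrow> (\<exists>a b. a \<noteq> b \<and> P = open_segment a b)"
proof
  assume "flat_polytope (Suc 0) P"
  then show "\<exists>a b. a \<noteq> b \<and> P = open_segment a b"
    by (cases rule: flat_polytope.cases) auto
next
  assume "\<exists>a b. a \<noteq> b \<and> P = open_segment a b"
  then show "flat_polytope (Suc 0) P"
    using flat_polytope.interval by auto
qed

lemma flat_polytope_Suc:
  assumes "1 \<le> k"
  shows "flat_polytope (Suc k) P \<longleftrightarrow>
    aff_dim P = int (Suc k) \<and> rel_open P \<and> connected P \<and> bounded P \<and>
    (\<exists>F. finite F \<and> rel_frontier P = (\<Union>Q\<in>F. closure Q) \<and> (\<forall>Q\<in>F. flat_polytope k Q))"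
proof
  assume "flat_polytope (Suc k) P"
  then show "aff_dim P = int (Suc k) \<and> rel_open P \<and> connected P \<and> bounded P \<and>
    (\<exists>F. finite F \<and> rel_frontier P = (\<Union>Q\<in>F. closure Q) \<and> (\<forall>Q\<in>F. flat_polytope k Q))"
    by (cases rule: flat_polytope.cases) (use assms in auto)
next
  assume "aff_dim P = int (Suc k) \<and> rel_open P \<and> connected P \<and> bounded P \<and>
    (\<exists>F. finite F \<and> rel_frontier P = (\<Union>Q\<in>F. closure Q) \<and> (\<forall>Q\<in>F. flat_polytope k Q))"
  then show "flat_polytope (Suc k) P"
    using assms by (blast intro: flat_polytope.step)
qed

lemma flat_polytope_aff_dim:
  assumes "flat_polytope k P"
  shows "aff_dim P = int k"
  using assms
proof (cases rule: flat_polytope.cases)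
  case (interval a b)
  then have "affine hull P = affine hull {a, b}"
    by (metis affine_hull_open_segment segment_convex_hull affine_hull_convex_hull)
  then have "aff_dim P = aff_dim {a, b}"
    by (metis aff_dim_affine_hull)
  then show ?thesis
    using interval by (simp add: aff_dim_2)
qed auto

lemma rel_frontier_injective_linear_image:
  fixes f :: "'a::euclidean_space \<Rightarrow> 'b::euclidean_space"
  assumes "linear f" "inj f"
  shows "rel_frontier (f ` P) = f ` rel_frontier P"
  unfolding rel_frontier_def closure_injective_linear_image[OF assms, symmetric]
    rel_interior_injective_linear_image[OF assms(1)[unfolded linear_conv_bounded_linear] assms(2)] image_set_diff[OF assms(2)] ..

lemma flat_polytope_injective_linear_image:
  fixes f :: "'a::euclidean_space \<Rightarrow> 'b::euclidean_space"
  assumes f: "linear f" "inj f"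
  shows "flat_polytope k (f ` P) \<longleftrightarrow> flat_polytope k P"
proof (induction k arbitrary: P)
  case 0
  then show ?case by (simp add: flat_polytope_0)
next
  case (Suc k)
  have Inj: "f ` A = f ` B \<longleftrightarrow> A = B" for A B
    using f(2) by (rule inj_image_eq_iff)
  obtain g where g: "linear g" "g \<circ> f = id"
    using linear_injective_left_inverse f by blast
  then have gf: "g ` f ` A = A" for A
    by (metis image_comp image_id id_apply)
  show ?case
  proof (cases "k = 0")
    case True
    have "(\<exists>a b. a \<noteq> b \<and> f ` P = open_segment a b) \<longleftrightarrow> (\<exists>a b. a \<noteq> b \<and> P = open_segment a b)"
    proof
      assume "\<exists>a b. a \<noteq> b \<and> f ` P = open_segment a b"
      then obtain a b where ab: "a \<noteq> b" "f ` P = open_segment a b" by blast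
      have "closed (range f)"
        using f(1) by (simp add: closed_subspace linear_subspace_image)
      moreover have "open_segment a b \<subseteq> range f" using ab by (metis image_mono top_greatest)
      ultimately have "closure (open_segment a b) \<subseteq> range f"
        by (intro closure_minimal)
      then have "closed_segment a b \<subseteq> range f" using ab(1) by (simp only: closure_open_segment if_False)
      then obtain a' b' where "a = f a'" "b = f b'" by (metis ends_in_segment subsetD imageE)
      then have "a' \<noteq> b'" "P = open_segment a' b'"
        using ab f Inj by (auto simp: open_segment_linear_image)
      then show "\<exists>a b. a \<noteq> b \<and> P = open_segment a b" by blast
    next
      assume "\<exists>a b. a \<noteq> b \<and> P = open_segment a b"
      then show "\<exists>a b. a \<noteq> b \<and> f ` P = open_segment a b"
        using f by (metis open_segment_linear_image injD)
    qed
    then show ?thesis using True by (simp add: flat_polytope_1)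
  next
    case False
    then have k: "1 \<le> k" by simp
    have "rel_open (f ` P) \<longleftrightarrow> rel_open P"
      unfolding rel_open_def using f Inj
      by (metis linear_conv_bounded_linear rel_interior_injective_linear_image)
    moreover have "connected (f ` P) \<longleftrightarrow> connected P"
      by (metis gf f(1) g(1) connected_continuous_image linear_continuous_on linear_conv_bounded_linear)
    moreover have "bounded (f ` P) \<longleftrightarrow> bounded P"
      by (metis gf f(1) g(1) bounded_linear_image linear_conv_bounded_linear)
    moreover have "(\<exists>F. finite F \<and> rel_frontier (f ` P) = (\<Union>Q\<in>F. closure Q) \<and> (\<forall>Q\<in>F. flat_polytope k Q))
       \<longleftrightarrow> (\<exists>F. finite F \<and> rel_frontier P = (\<Union>Q\<in>F. closure Q) \<and> (\<forall>Q\<in>F. flat_polytope k Q))"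
      (is "?L \<longleftrightarrow> ?R")
    proof
      assume ?L
      then obtain F where F: "finite F" "rel_frontier (f ` P) = (\<Union>Q\<in>F. closure Q)"
        "\<forall>Q\<in>F. flat_polytope k Q" by blast
      have sub: "f ` g ` Q = Q" if "Q \<in> F" for Q
      proof -
        have "Q \<subseteq> f ` rel_frontier P"
          using F(2) that closure_subset by (metis UN_upper f rel_frontier_injective_linear_image subset_trans)
        then obtain R where "Q = f ` R" by (meson subset_imageE)
        then show ?thesis using gf by simp
      qed
      have "f ` rel_frontier P = (\<Union>Q\<in>F. f ` closure (g ` Q))"
        using F(2) sub f
        by (simp add: rel_frontier_injective_linear_image closure_injective_linear_image)
      then have "f ` rel_frontier P = f ` (\<Union>Q\<in>(`) g ` F. closure Q)"
        by (simp only: image_UN image_image)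
      then have "rel_frontier P = (\<Union>Q\<in>(`) g ` F. closure Q)" by (simp only: Inj)
      moreover have "\<forall>Q\<in>(`) g ` F. flat_polytope k Q"
        using F(3) sub Suc.IH by (metis imageE)
      ultimately show ?R using F(1) by (intro exI[of _ "(`) g ` F"]) auto
    next
      assume ?R
      then obtain F where F: "finite F" "rel_frontier P = (\<Union>Q\<in>F. closure Q)"
        "\<forall>Q\<in>F. flat_polytope k Q" by blast
      have "rel_frontier (f ` P) = (\<Union>Q\<in>(`) f ` F. closure Q)"
        using F(2) f
        by (simp add: rel_frontier_injective_linear_image image_UN closure_injective_linear_image)
      then show ?L using F Suc.IH by (intro exI[of _ "(`) f ` F"]) auto
    qed
    ultimately show ?thesis
      using f by (simp add: flat_polytope_Suc[OF k])
  qed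
qed

lemma flat_polytope_translation_imp:
  assumes "flat_polytope k P"
  shows "flat_polytope k ((+) c ` P)"
  using assms
proof (induction k arbitrary: P)
  case 0
  then show ?case by (simp add: flat_polytope_0)
next
  case (Suc k)
  show ?case
  proof (cases "k = 0")
    case True
    then show ?thesis using Suc.prems
      by (simp add: flat_polytope_1) (metis open_segment_translation add_left_cancel)
  next
    case False
    then have k: "1 \<le> k" by simp
    from Suc.prems obtain F where F: "aff_dim P = int (Suc k)" "rel_open P" "connected P"
      "bounded P" "finite F" "rel_frontier P = (\<Union>Q\<in>F. closure Q)" "\<forall>Q\<in>F. flat_polytope k Q"
      unfolding flat_polytope_Suc[OF k] by blast
    have fr: "rel_frontier ((+) c ` P) = (\<Union>Q\<in>(`) ((+) c) ` F. closure Q)"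
      using F(6) by (simp add: rel_frontier_translation image_UN closure_translation)
    show ?thesis
      unfolding flat_polytope_Suc[OF k]
    proof (intro conjI exI[of _ "(`) ((+) c) ` F"])
      show "rel_open ((+) c ` P)"
        using F(2) by (simp add: rel_open_def rel_interior_translation)
      show "connected ((+) c ` P)"
        using F(3) by (intro connected_continuous_image continuous_intros)
    qed (use F fr Suc.IH in \<open>auto simp: aff_dim_translation_eq bounded_translation\<close>)
  qed
qed

lemma flat_polytope_translation: "flat_polytope k ((+) c ` P) \<longleftrightarrow> flat_polytope k P"
  using flat_polytope_translation_imp[of k P c] flat_polytope_translation_imp[of k "(+) c ` P" "- c"]
  by (auto simp: image_image)

lemma flat_polytope_isometric_image:
  fixes f :: "'a::euclidean_space \<Rightarrow> 'b::euclidean_space"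
  assumes "linear f" "\<And>x. norm (f x) = norm x"
  shows "flat_polytope k ((\<lambda>x. c + f x) ` P) \<longleftrightarrow> flat_polytope k P"
proof -
  have "inj f"
    using assms by (metis linear_injective_0 norm_eq_zero)
  then show ?thesis
    using flat_polytope_translation[of k c "f ` P"] flat_polytope_injective_linear_image[OF assms(1)]
    by (simp add: image_image)
qed

lemma flat_polytope_1_real:
  "flat_polytope 1 (\<Omega> :: real set) \<longleftrightarrow> (\<exists>a b. a < b \<and> \<Omega> = {a<..<b})"
proof -
  have "(\<exists>a b. a \<noteq> b \<and> \<Omega> = open_segment a b) \<longleftrightarrow> (\<exists>a b. a < b \<and> \<Omega> = {a<..<b})"
    by (metis open_segment_eq_real_ivl open_segment_commute less_imp_le linorder_neqE order_less_irrefl)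
  then show ?thesis
    by (simp add: flat_polytope_1)
qed

text \<open>The recursive clause in its original form, with an isometry \<open>x \<mapsto> c + f x\<close> from the
  lower-dimensional space onto the hyperplane.\<close>

lemma flat_polytope_recursion:
  fixes \<Omega> :: "'a::euclidean_space set"
  assumes dim: "DIM('a) = Suc DIM('b::euclidean_space)"
  shows "flat_polytope DIM('a) \<Omega> \<longleftrightarrow>
    open \<Omega> \<and> \<Omega> \<noteq> {} \<and> connected \<Omega> \<and> bounded \<Omega> \<and>
    (\<exists>F. finite F \<and> frontier \<Omega> = (\<Union>P\<in>F. closure P) \<and>
      (\<forall>P\<in>F. \<exists>M b c (f :: 'b \<Rightarrow> 'a) Q.
         M \<noteq> 0 \<and> linear f \<and> (\<forall>x. norm (f x) = norm x) \<and>
         range (\<lambda>x. c + f x) = {x. M \<bullet> x = b} \<and>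
         P = (\<lambda>x. c + f x) ` Q \<and> flat_polytope DIM('b) Q))"
proof -
  have k: "1 \<le> DIM('b)"
    using DIM_positive[where 'a='b] by linarith
  have face: "(\<exists>M b c (f :: 'b \<Rightarrow> 'a) Q.
         M \<noteq> 0 \<and> linear f \<and> (\<forall>x. norm (f x) = norm x) \<and>
         range (\<lambda>x. c + f x) = {x. M \<bullet> x = b} \<and>
         P = (\<lambda>x. c + f x) ` Q \<and> flat_polytope DIM('b) Q) \<longleftrightarrow> flat_polytope DIM('b) P"
    (is "?L \<longleftrightarrow> _") for P :: "'a set"
  proof
    assume ?L
    then show "flat_polytope DIM('b) P"
      by (metis flat_polytope_isometric_image)
  next
    assume P: "flat_polytope DIM('b) P"
    then have "aff_dim P = int DIM('b)"
      by (rule flat_polytope_aff_dim)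
    then have "aff_dim P = int (DIM('a) - 1)"
      using dim by simp
    then have "\<exists>M b. M \<noteq> 0 \<and> affine hull P = {x. M \<bullet> x = b}"
      by (simp only: aff_dim_eq_hyperplane)
    then obtain M b where M: "M \<noteq> 0" "affine hull P = {x. M \<bullet> x = b}"
      by (elim exE conjE)
    have "P \<noteq> {}"
      using \<open>aff_dim P = int DIM('b)\<close> by (intro notI) simp
    then obtain c where c: "c \<in> P" by blast
    then have cb: "M \<bullet> c = b"
      using M hull_subset[of P affine] by blast
    have "dim (UNIV :: 'b set) = dim {x. M \<bullet> x = 0}"
      using M(1) dim by (simp add: dim_hyperplane)
    then obtain f :: "'b \<Rightarrow> 'a" where f: "linear f" "f ` UNIV = {x. M \<bullet> x = 0}"
        "\<And>x. norm (f x) = norm x"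
      using isometry_subspaces[OF subspace_UNIV subspace_hyperplane] by (metis UNIV_I)
    have range: "range (\<lambda>x. c + f x) = {x. M \<bullet> x = b}"
    proof -
      have "y \<in> range (\<lambda>x. c + f x)" if "M \<bullet> y = b" for y
      proof -
        have "y - c \<in> f ` UNIV" using f(2) that cb by (simp add: inner_diff_right)
        then obtain x where "f x = y - c" by (metis imageE)
        then have "y = c + f x" by simp
        then show ?thesis by blast
      qed
      moreover have "M \<bullet> (c + f x) = b" for x
        using f(2) cb by (auto simp: inner_add_right)
      ultimately show ?thesis by blast
    qed
    have "P \<subseteq> range (\<lambda>x. c + f x)"
      using range M hull_subset[of P affine] by blast
    then obtain Q where Q: "P = (\<lambda>x. c + f x) ` Q" by (meson subset_imageE)
    then have "flat_polytope DIM('b) Q"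
      using P f by (simp add: flat_polytope_isometric_image)
    then show ?L using M(1) f(1) f(3) range Q by (intro exI conjI allI)
  qed
  have top: "aff_dim \<Omega> = int (Suc DIM('b)) \<and> rel_open \<Omega> \<longleftrightarrow> open \<Omega> \<and> \<Omega> \<noteq> {}"
  proof
    assume A: "aff_dim \<Omega> = int (Suc DIM('b)) \<and> rel_open \<Omega>"
    then have "affine hull \<Omega> = UNIV" using aff_dim_eq_full[of \<Omega>] dim by simp
    with A have "open \<Omega>" by (metis rel_open_def rel_interior_interior open_interior)
    with A show "open \<Omega> \<and> \<Omega> \<noteq> {}" by auto
  next
    assume "open \<Omega> \<and> \<Omega> \<noteq> {}"
    then show "aff_dim \<Omega> = int (Suc DIM('b)) \<and> rel_open \<Omega>"
      using dim by (simp add: aff_dim_open rel_open_def rel_interior_open)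
  qed
  have "rel_frontier \<Omega> = frontier \<Omega>" if "open \<Omega>"
    using that by (simp add: rel_frontier_def frontier_def rel_interior_open interior_open)
  then show ?thesis
    unfolding face unfolding dim flat_polytope_Suc[OF k] using top by metis
qed

section \<open>Dirichlet eigenfunctions\<close>

definition partial_deriv :: "'n::finite \<Rightarrow> (real^'n \<Rightarrow> complex) \<Rightarrow> real^'n \<Rightarrow> complex" where
  "partial_deriv i u x = vector_derivative (\<lambda>t. u (x + t *\<^sub>R axis i 1)) (at 0)"

text \<open>Class \<open>C\<^sup>k\<close> on an open set \<open>S\<close>: all partial derivatives up to order \<open>k\<close> exist and are
  continuous on \<open>S\<close>.\<close>

primrec Ck_on :: "nat \<Rightarrow> (real^'n::finite) set \<Rightarrow> (real^'n \<Rightarrow> complex) \<Rightarrow> bool" where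
  "Ck_on 0 S u \<longleftrightarrow> continuous_on S u"
| "Ck_on (Suc k) S u \<longleftrightarrow> continuous_on S u \<and>
     (\<forall>i. (\<forall>x\<in>S. (\<lambda>t::real. u (x + t *\<^sub>R axis i 1)) differentiable (at 0)) \<and>
          Ck_on k S (partial_deriv i u))"

text \<open>The sign convention makes the Laplacian a nonnegative operator.\<close>

definition laplacian :: "(real^'n::finite \<Rightarrow> complex) \<Rightarrow> real^'n \<Rightarrow> complex" where
  "laplacian u x = - (\<Sum>i\<in>UNIV. partial_deriv i (partial_deriv i u) x)"

text \<open>Only the values of \<open>u\<close> on \<open>closure \<Omega>\<close> matter. Continuity up to the boundary is what gives
  the boundary condition its meaning.\<close>

definition dirichlet_eigenfunction ::
    "(real^'n::finite) set \<Rightarrow> real \<Rightarrow> (real^'n \<Rightarrow> complex) \<Rightarrow> bool" where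
  "dirichlet_eigenfunction \<Omega> lam u \<longleftrightarrow>
     Ck_on 2 \<Omega> u \<and> continuous_on (closure \<Omega>) u \<and>
     (\<exists>x\<in>\<Omega>. u x \<noteq> 0) \<and>
     (\<forall>x\<in>\<Omega>. laplacian u x = of_real lam * u x) \<and>
     (\<forall>x\<in>frontier \<Omega>. u x = 0)"

definition first_dirichlet_eigenfunction ::
    "(real^'n::finite) set \<Rightarrow> real \<Rightarrow> (real^'n \<Rightarrow> complex) \<Rightarrow> bool" where
  "first_dirichlet_eigenfunction \<Omega> lam u \<longleftrightarrow>
     dirichlet_eigenfunction \<Omega> lam u \<and>
     (\<forall>mu w. dirichlet_eigenfunction \<Omega> mu w \<longrightarrow> lam \<le> mu)"

definition trigonometric_eigenfunction ::
    "(real^'n::finite) set \<Rightarrow> real \<Rightarrow> (real^'n \<Rightarrow> complex) \<Rightarrow> bool" where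
  "trigonometric_eigenfunction \<Omega> lam u \<longleftrightarrow>
     dirichlet_eigenfunction \<Omega> lam u \<and>
     (\<exists>(m::nat) a b L M.
        (\<forall>j\<in>{1..m}. (norm (L j :: real^'n))\<^sup>2 = lam \<and> (norm (M j :: real^'n))\<^sup>2 = lam) \<and>
        (\<forall>x\<in>closure \<Omega>. u x = (\<Sum>j=1..m. a j * of_real (sin (L j \<bullet> x)) + b j * of_real (cos (M j \<bullet> x)))))"

section \<open>Real analytic functions\<close>

text \<open>Local expansion into an (unconditionally convergent) power series in several variables;
  \<open>\<alpha>\<close> ranges over all multi-indices.\<close>

definition real_analytic_on :: "(real^'n::finite \<Rightarrow> complex) \<Rightarrow> (real^'n) set \<Rightarrow> bool" where
  "real_analytic_on v S \<longleftrightarrow>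
     (\<forall>p\<in>S. \<exists>r>0. \<exists>c :: ('n \<Rightarrow> nat) \<Rightarrow> complex. \<forall>x\<in>ball p r.
        ((\<lambda>\<alpha>. c \<alpha> * of_real (\<Prod>i\<in>UNIV. (x $ i - p $ i) ^ \<alpha> i)) has_sum v x) UNIV)"

end

theory Submission
  imports Defs "HOL-Probability.Probability" "HOL-Complex_Analysis.Great_Picard"
begin

text \<open>
  Let v be a real or imaginary part of the analytic first eigenfunction that does not vanish
  identically. First, v has no zero in the domain: there is a positive eigenfunction, and the
  minimality of the first eigenvalue lets it be compared with the positive and negative parts of v
  (ground_state_exists, first_eigenfunction_nonvanishing). Secondly, v vanishes on every facet, and
  by analyticity on the hyperplane spanned by it and satisfies the equation on the whole space. On
  such a hyperplane the equation and the zero data make all even normal derivatives vanish, so v is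
  odd under reflection in it (analytic_eigenfunction_odd).

  Hence the domain is a chamber of the group generated by the facet reflections: an odd function
  vanishes on every mirror, v vanishes nowhere inside, so no mirror enters the domain. The images of
  the closed domain cover the space, the linear parts of the group are finitely many, and the group
  contains translations in a basis of directions (cover, linear_parts_finite, periods).

  Every other eigenfunction extends oddly to a bounded continuous function U on the whole space
  (odd_extension), which is then periodic. It satisfies the resolvent equation U = (1 + lam) Y U
  with Y the inverse of one minus the Laplacian: the defect is odd, vanishes on the boundary, and
  satisfies a maximum principle inside. Comparing Fourier coefficients, only frequencies of squared
  length lam survive, and these are finitely many (periodic_resolvent_trig).

  Boundary regularity and interior regularity are elementary here. Solutions are tested with the
  polynomial bumps max(0, 1 - |z|^2)^m only, and Y is the average over the law of a Gaussian vector
  at an independent exponential time, so that positivity and the maximum principle are immediate.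
\<close>

notation scaleR (infixr "*R" 75)
notation inner (infix "*." 70)
notation divideR (infixl "'/R" 70)
abbreviation cont :: "('a::topological_space => 'b::topological_space) => bool" where "cont f == continuous_on UNIV f"
notation LIMSEQ (infixr "---->" 60)
abbreviation lborel_integral :: "('a::euclidean_space => real) => real" (binder "LB " [60] 60)
 where "lborel_integral f == integral\<^sup>L lborel f"

lemma lborel_integral_translate:
 fixes f :: "'a::euclidean_space => real"
 assumes [measurable]: "f : borel_measurable borel"
 shows "(LB x. f (c + x)) = (LB x. f x)"
proof -
 have "(LB x. f x) = (LINT x|distr lborel borel ((+) c). f x)"
  by (simp add: lborel_distr_plus)
 also have "... = (LB x. f (c + x))"
  by (subst integral_distr) auto
 finally show ?thesis by simp
qed

lemma lborel_integral_scale: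
 fixes f :: "'a::euclidean_space => real"
 assumes [measurable]: "f : borel_measurable borel" and c: "c > 0"
 shows "(LB x. f (t + c *R x)) = (LB x. f x) / c ^ DIM('a)"
proof -
 have "(LB x. f x) = (LINT x|density (distr lborel borel (%x::'a. t + c *R x)) (%_. ennreal (abs c ^ DIM('a))). f x)"
  using c by (subst lborel_affine[of c t]) auto
 also have "... = (LINT x|distr lborel borel (%x::'a. t + c *R x). c ^ DIM('a) * f x)"
  using c by (subst integral_density) auto
 also have "... = (LB x. c ^ DIM('a) * f (t + c *R x))"
  by (subst integral_distr) auto
 also have "... = c ^ DIM('a) * (LB x. f (t + c *R x))"
  by simp
 finally show ?thesis using c by (simp add: field_simps)
qed

lemma integrable_continuous_bounded_support:
 fixes f :: "'a::euclidean_space => real"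
 assumes "cont f" "!!x. x ~: K ==> f x = 0" "bounded K"
 shows "integrable lborel f"
proof -
 obtain B where "ALL x:K. norm x <= B"
  using assms(3) unfolding bounded_iff by blast
 hence B: "K <= cball 0 B" by auto
 have "integrable lborel (%x. indicat_real (cball 0 B) x *R f x)"
  using assms(1) by (intro borel_integrable_compact) (auto intro: continuous_on_subset)
 moreover have "(%x. indicat_real (cball 0 B) x *R f x) = f"
 proof
  fix x show "indicat_real (cball 0 B) x *R f x = f x"
   using B assms(2)[of x] subsetD[OF B, of x] by (cases "x : cball 0 B") (auto simp: indicator_def)
 qed
 ultimately show ?thesis by simp
qed

lemma deriv_along_line:
 fixes G :: "'a::real_normed_vector => real"
 assumes "DERIV (%t. G ((x + s *R i) + t *R i)) 0 :> D"
 shows "DERIV (%t. G (x + t *R i)) s :> D"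
proof -
 have "DERIV (%t. G (x + (t + s) *R i)) 0 :> D"
  using assms by (simp add: algebra_simps)
 thus ?thesis
  using DERIV_shift[of "%t. G (x + t *R i)" D 0 s] by simp
qed

text \<open>Difference quotients of G have integral zero by translation invariance; pass to the limit under a common
  bound.\<close>

lemma integral_partial_derivative_eq_0:
 fixes G G' :: "'a::euclidean_space => real"
 assumes i: "i : Basis"
  and d: "!!x. DERIV (%t. G (x + t *R i)) 0 :> G' x"
  and c: "cont G" "cont G'"
  and K: "bounded K" "!!x. x ~: K ==> G x = 0"
 shows "(LB x. G' x) = 0"
proof -
 obtain B where "ALL x:K. norm x <= B" and "B > 0"
  using K(1) unfolding bounded_pos by blast
 hence B: "K <= cball 0 B" by auto
 have "compact (G' ` cball 0 (B+2))"
  using c(2) by (intro compact_continuous_image) (auto intro: continuous_on_subset)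
 then obtain M where M: "!!x. x : cball 0 (B+2) ==> abs (G' x) <= M" "M > 0"
  using compact_imp_bounded[of "G' ` cball 0 (B+2)"] unfolding bounded_pos by fastforce
 define h where "h n = 1 / (real n + 1)" for n
 have h: "0 < h n" "h n <= 1" for n by (auto simp: h_def)
 have hlim: "h ----> 0" unfolding h_def by real_asymp
 define q where "q n x = (G (x + h n *R i) - G x) / h n" for n x
 have cq: "cont (q n)" for n
  unfolding q_def using h(1)[of n]
  by (intro continuous_intros continuous_on_compose2[OF c(1)]) auto
 have meas: "G : borel_measurable borel" "G' : borel_measurable borel" "q n : borel_measurable borel" for n
  using c cq by (auto intro: borel_measurable_continuous_onI)
 have Gint: "integrable lborel G"
  using c(1) K by (intro integrable_continuous_bounded_support[of G K])
 have Gint2: "integrable lborel (%x. G (x + h n *R i))" for n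
 proof (rule integrable_continuous_bounded_support[where K = "cball 0 (B+1)"])
  show "cont (%x. G (x + h n *R i))"
   by (intro continuous_on_compose2[OF c(1)] continuous_intros) auto
  show "G (x + h n *R i) = 0" if "x ~: cball 0 (B+1)" for x
  proof -
   have "norm x <= norm (x + h n *R i) + norm (h n *R i)"
    by (metis add_diff_cancel_right' norm_triangle_ineq4)
   also have "norm (h n *R i) <= 1" using h[of n] i by simp
   finally have "x + h n *R i ~: cball 0 B" using that by auto
   thus ?thesis using B K(2) by blast
  qed
 qed auto
 have q0: "(LB x. q n x) = 0" for n
 proof -
  have "(LB x. G (x + h n *R i)) = (LB x. G x)"
   using lborel_integral_translate[OF meas(1), of "h n *R i"] by (simp add: add.commute)
  thus ?thesis
   unfolding q_def using Gint Gint2[of n] by simp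
 qed
 have qout: "q n x = 0" if "x ~: cball 0 (B+1)" for n x
 proof -
  have "norm x <= norm (x + h n *R i) + norm (h n *R i)"
   by (metis add_diff_cancel_right' norm_triangle_ineq4)
  also have "norm (h n *R i) <= 1" using h[of n] i by simp
  finally have "x + h n *R i ~: cball 0 B" "x ~: cball 0 B" using that by auto
  hence "G (x + h n *R i) = 0" "G x = 0" using B K(2) by blast+
  thus ?thesis by (simp add: q_def)
 qed
 have qb: "abs (q n x) <= M" if x: "x : cball 0 (B+1)" for n x
 proof -
  have "DERIV (%t. G (x + t *R i)) s :> G' (x + s *R i)" for s
   by (rule deriv_along_line) (rule d)
  then obtain z where z: "0 < z" "z < h n"
   "G (x + h n *R i) - G (x + 0 *R i) = (h n - 0) * G' (x + z *R i)"
   using MVT2[of 0 "h n" "%t. G (x + t *R i)" "%t. G' (x + t *R i)"] h(1)[of n] by blast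
  have "norm (x + z *R i) <= norm x + norm (z *R i)" by (rule norm_triangle_ineq)
  also have "... <= (B + 1) + 1" using x z h(2)[of n] i by (intro add_mono) auto
  finally have "abs (G' (x + z *R i)) <= M" by (intro M) auto
  moreover have "q n x = G' (x + z *R i)" using z h(1)[of n] by (simp add: q_def field_simps)
  ultimately show ?thesis by simp
 qed
 have lim: "(%n. q n x) ----> G' x" for x
 proof -
  have "((%t. (G (x + t *R i) - G x) / t) \<longlongrightarrow> G' x) (at 0)"
   using d[of x] by (simp add: has_field_derivative_iff)
  moreover have "filterlim h (at 0) sequentially"
   using hlim h(1) by (auto simp: filterlim_at intro!: always_eventually) (metis less_irrefl)
  ultimately show ?thesis unfolding q_def by (rule filterlim_compose)
 qed
 have "(%n. LB x. q n x) ----> (LB x. G' x)"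
 proof (rule integral_dominated_convergence[where w = "%x. M * indicat_real (cball 0 (B+1)) x"])
  have "emeasure lborel (cball (0::'a) (B+1)) < \<infinity>" by (rule emeasure_lborel_cball_finite)
  thus "integrable lborel (%x. M * indicat_real (cball (0::'a) (B+1)) x)"
   by (intro integrable_mult_right) (simp add: integrable_indicator_iff)
  show "AE x in lborel. norm (q n x) <= M * indicat_real (cball 0 (B+1)) x" for n
   using qb qout by (auto simp: indicator_def)
 qed (use lim meas in auto)
 thus ?thesis
  unfolding q0 using LIMSEQ_const_iff by metis
qed

lemma has_real_derivative_integral_dominated:
 fixes f :: "real => 'a => real"
 assumes r: "a < r" "r < b"
  and int: "!!s. s : {a<..<b} ==> integrable M (f s)"
  and d: "!!s w. s : {a<..<b} ==> w : space M ==> DERIV (%s. f s w) s :> f' s w"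
  and bd: "!!s w. s : {a<..<b} ==> w : space M ==> abs (f' s w) <= g w"
  and g: "integrable M g"
 shows "DERIV (%s. LINT w|M. f s w) r :> (LINT w|M. f' r w)"
proof -
 define S where "S = {a - r<..<b - r}"
 have S: "open S" "0 : S" using r by (auto simp: S_def)
 have "((%h. ((LINT w|M. f (r + h) w) - (LINT w|M. f r w)) / h) \<longlongrightarrow> (LINT w|M. f' r w)) (at 0 within S)"
  unfolding tendsto_at_iff_sequentially comp_def
 proof (intro allI impI)
  fix X :: "nat => real" assume X: "ALL i. X i : S - {0}" "X ----> 0"
  define q where "q i w = (f (r + X i) w - f r w) / X i" for i w
  have rX: "r + X i : {a<..<b}" for i using X(1) by (auto simp: S_def algebra_simps)
  have rr: "r : {a<..<b}" using r by auto
  have q: "(LINT w|M. q i w) = ((LINT w|M. f (r + X i) w) - (LINT w|M. f r w)) / X i" for i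
   unfolding q_def using int[OF rX[of i]] int[OF rr] by simp
  have lim: "(%i. q i w) ----> f' r w" if w: "w : space M" for w
  proof -
   have "filterlim X (at 0) sequentially"
    using X by (auto simp: filterlim_at intro!: always_eventually)
   thus ?thesis using d[OF rr w] DERIV_def q_def filterlim_compose by fastforce
  qed
  have bnd: "abs (q i w) <= g w" if w: "w : space M" for i w
  proof -
   have "abs (f (r + X i) w - f r w) <= g w * abs ((r + X i) - r)"
   proof (rule field_differentiable_bound[where S = "{a<..<b}" and f = "%s. f s w" and f' = "%s. f' s w", unfolded real_norm_def])
    show "((%s. f s w) has_real_derivative f' s w) (at s within {a<..<b})" if "s : {a<..<b}" for s
     using d[OF that w] has_field_derivative_at_within by blast
   qed (use bd w rX rr in auto)
   moreover have "X i ~= 0" using X(1) by auto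
   ultimately show ?thesis unfolding q_def abs_divide by (simp add: divide_le_eq)
  qed
  have qm: "q i : borel_measurable M" for i
   unfolding q_def using int[OF rX[of i]] int[OF rr] by (intro borel_measurable_divide borel_measurable_diff) auto
  have fm: "f' r : borel_measurable M"
   by (rule borel_measurable_LIMSEQ_real[OF lim qm])
  show "(%i. ((LINT w|M. f (r + X i) w) - (LINT w|M. f r w)) / X i) ----> (LINT w|M. f' r w)" using integral_dominated_convergence[OF fm qm g] lim bnd q by simp
 qed
 thus ?thesis by (simp add: at_within_open[OF S(2,1)] DERIV_def)
qed

section \<open>Bumps\<close>

text \<open>The Laplacian of a bump is a combination of bumps of lower order, so the family is closed under the
  computations below.\<close>

definition bump :: "nat => 'a::euclidean_space => real" where
 "bump m z = (max 0 (1 - z *. z)) ^ m"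

definition lap_bump :: "nat => 'a::euclidean_space => real" where
 "lap_bump m z = 4 * real m * real (m - 1) * (z *. z) * bump (m - 2) z
   - 2 * real m * real DIM('a) * bump (m - 1) z"

lemma pos_part_power_deriv:
 assumes m: "m >= 2"
 shows "DERIV (%t::real. max 0 t ^ m) t :> real m * max 0 t ^ (m - 1)"
proof -
 consider "t > 0" | "t < 0" | "t = 0" by linarith
 thus ?thesis
 proof cases
  case 1
  have "DERIV (%t::real. t ^ m) t :> real m * t ^ (m - 1)"
   by (auto intro!: derivative_eq_intros)
  thus ?thesis
   using 1 by (rule_tac has_field_derivative_transform_within_open[where S = "{0<..}" and f = "%t. t ^ m"]) auto
 next
  case 2
  have "DERIV (%t::real. 0) t :> 0" by simp
  thus ?thesis
   using 2 m by (rule_tac has_field_derivative_transform_within_open[where S = "{..<0}" and f = "%t. 0"]) (auto simp: zero_power)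
 next
  case 3
  have "((%h. (max 0 h ^ m) / h) \<longlongrightarrow> 0) (at (0::real))"
  proof (rule tendsto_0_le[where K = 1])
   show "((%h::real. h ^ (m - 1)) \<longlongrightarrow> 0) (at 0)"
    using m by (auto intro!: tendsto_eq_intros)
   show "\<forall>\<^sub>F h in at (0::real). norm (max 0 h ^ m / h) <= norm (h ^ (m - 1)) * 1"
   proof (rule always_eventually, rule allI)
    fix h :: real
    have "h ^ m = h * h ^ (m - 1)" using m by (metis One_nat_def Suc_1 Suc_leD Suc_le_eq power_minus_mult mult.commute)
    thus "norm (max 0 h ^ m / h) <= norm (h ^ (m - 1)) * 1"
     using m by (cases "h > 0") (auto simp: max_def zero_power)
   qed
  qed
  thus ?thesis using 3 m by (simp add: DERIV_def zero_power)
 qed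
qed

lemma bump_nonneg [simp]: "0 <= bump m z" by (simp add: bump_def)
lemma bump_le_1 [simp]: "bump m z <= 1" by (auto simp: bump_def intro: power_le_one)
lemma bump_0 [simp]: "bump m 0 = 1" by (simp add: bump_def)
lemma bump_outside: "m > 0 ==> norm z >= 1 ==> bump m z = 0"
 by (simp add: bump_def dot_square_norm)
lemma bump_pos: "norm z < 1 ==> bump m z > 0"
 by (simp add: bump_def dot_square_norm abs_square_less_1)
lemma continuous_on_bump [continuous_intros]: "continuous_on A f ==> continuous_on A (%x. bump m (f x))"
 unfolding bump_def by (intro continuous_intros)
lemma continuous_on_lap_bump [continuous_intros]: "continuous_on A f ==> continuous_on A (%x. lap_bump m (f x))"
 unfolding lap_bump_def by (intro continuous_intros)
lemma lap_bump_outside: "m >= 3 ==> norm z >= 1 ==> lap_bump m z = 0"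
 by (simp add: lap_bump_def bump_outside)
lemma bump_measurable [measurable]: "bump m : borel_measurable borel"
 by (intro borel_measurable_continuous_onI continuous_intros)
lemma lap_bump_measurable [measurable]: "lap_bump m : borel_measurable borel"
 by (intro borel_measurable_continuous_onI continuous_intros)

lemma bump_has_derivative:
 assumes "m >= 2"
 shows "(bump m has_derivative (%h. - 2 * real m * bump (m - 1) z * (z *. h))) (at z)"
proof -
 have "((%z::'a. 1 - z *. z) has_derivative (%h. - 2 * (z *. h))) (at z)"
  by (auto intro!: derivative_eq_intros simp: inner_commute)
 hence "((%z::'a. max 0 (1 - z *. z) ^ m) has_derivative
   (%h. (- 2 * (z *. h)) * (real m * max 0 (1 - z *. z) ^ (m - 1)))) (at z)"
  by (rule has_derivative_compose) (rule has_derivative_eq_rhs[OF pos_part_power_deriv[OF assms, unfolded has_field_derivative_def]], auto)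
 thus ?thesis
  by (simp add: bump_def[abs_def] mult_ac)
qed

lemma bump_line_deriv:
 assumes "m >= 2"
 shows "DERIV (%t. bump m (z + t *R d)) 0 :> - 2 * real m * bump (m - 1) z * (z *. d)"
proof -
 have "((%t::real. z + t *R d) has_derivative (%t. t *R d)) (at 0)"
  by (auto intro!: derivative_eq_intros)
 hence "((%t. bump m (z + t *R d)) has_derivative
  (%t. - 2 * real m * bump (m - 1) z * (z *. (t *R d)))) (at 0)"
  by (rule has_derivative_compose) (use bump_has_derivative[OF assms, of z] in simp)
 thus ?thesis
  unfolding has_field_derivative_def by (rule has_derivative_eq_rhs) (auto simp: algebra_simps)
qed

text \<open>The mixed second derivative, in directions \<open>d\<close> and \<open>e\<close>.\<close>

lemma bump_line_deriv2:
 assumes "m >= 3"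
 shows "DERIV (%t. - 2 * real m * bump (m - 1) (z + t *R e) * ((z + t *R e) *. d)) 0 :> 4 * real m * real (m - 1) * bump (m - 2) z * (z *. d) * (z *. e) - 2 * real m * bump (m - 1) z * (e *. d)"
proof -
 have m: "m - 1 >= 2" "m - 1 - 1 = m - 2" using assms by auto
 have 1: "DERIV (%t. (z + t *R e) *. d) 0 :> e *. d"
  by (auto intro!: derivative_eq_intros simp: inner_add_left)
 show ?thesis
  using DERIV_mult[OF DERIV_cmult[OF bump_line_deriv[OF m(1), of z e], of "- 2 * real m"] 1]
  by (rule DERIV_cong) (simp add: m(2) algebra_simps numeral_2_eq_2)
qed

lemma lap_bump_sum:
 "(SUM i:Basis. 4 * real m * real (m - 1) * bump (m - 2) z * (z *. i) * (z *. i) - 2 * real m * bump (m - 1) z * (i *. i))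
  = lap_bump m (z::'a::euclidean_space)"
proof -
 have "(SUM i:Basis. 4 * real m * real (m - 1) * bump (m - 2) z * (z *. i) * (z *. i))
   = 4 * real m * real (m - 1) * bump (m - 2) z * (z *. z)"
  by (subst (3) euclidean_inner) (simp add: sum_distrib_left mult_ac)
 thus ?thesis
  by (simp add: sum_subtractf lap_bump_def mult_ac)
qed

section \<open>Functions with a Laplacian\<close>

definition laplace_on :: "'a::euclidean_space set => ('a => real) => ('a => real) => bool" where
 "laplace_on S f L \<longleftrightarrow> continuous_on S f & (EX g h.
   (ALL i:Basis. continuous_on S (g i) & continuous_on S (h i) &
    (ALL x:S. DERIV (%t. f (x + t *R i)) 0 :> g i x &
        DERIV (%t. g i (x + t *R i)) 0 :> h i x)) &
   (ALL x:S. L x = (SUM i:Basis. h i x)))"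

lemma continuous_on_mult_kernel:
 fixes u k :: "'a::euclidean_space => real"
 assumes "continuous_on S u" "open S" "cball 0 1 <= S" "cont k" "!!z. norm z >= 1 ==> k z = 0"
 shows "cont (%z. u z * k z)"
proof -
 have "continuous_on (S \<union> - cball 0 1) (%z. u z * k z)"
 proof (rule continuous_on_open_Un)
  show "continuous_on S (%z. u z * k z)"
   using assms by (intro continuous_intros) (auto intro: continuous_on_subset)
  show "continuous_on (- cball 0 1) (%z. u z * k z)"
   by (rule continuous_on_eq[OF continuous_on_const[of _ 0]]) (use assms(5) in auto)
 qed (use assms in auto)
 moreover have "S \<union> - cball 0 1 = UNIV" using assms by auto
 ultimately show ?thesis by simp
qed

lemma integrable_mult_kernel:
 fixes u k :: "'a::euclidean_space => real"
 assumes "continuous_on (cball x r) u" "r > 0" "cont k" "!!z. norm z >= 1 ==> k z = 0"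
 shows "integrable lborel (%z. u (x + r *R z) * k z)"
proof -
 have "continuous_on (cball 0 1) (%z. u (x + r *R z) * k z)"
  using assms(2) by (intro continuous_intros continuous_on_compose2[OF assms(1)] continuous_on_subset[OF assms(3)])
   (auto simp: dist_norm)
 hence "integrable lborel (%z. indicat_real (cball 0 1) z *R (u (x + r *R z) * k z))"
  by (intro borel_integrable_compact) auto
 moreover have "(%z. indicat_real (cball 0 1) z *R (u (x + r *R z) * k z)) = (%z. u (x + r *R z) * k z)"
  using assms(4) by (auto simp: indicator_def fun_eq_iff)
 ultimately show ?thesis by simp
qed

text \<open>Green's identity for a bump: two integrations by parts in each coordinate, without boundary terms because
  a bump of order three is twice differentiable across its sphere.\<close>

lemma integral_lap_bump_by_parts:
 fixes u :: "'a::euclidean_space => real"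
 assumes u: "laplace_on S u L" and S: "open S" "cball 0 1 <= S" and m: "m >= 3"
 shows "(LB z. u z * lap_bump m z) = (LB z. L z * bump m z)"
proof -
 obtain g h where cu: "continuous_on S u"
  and g: "!!i. i : Basis ==> continuous_on S (g i)" and h: "!!i. i : Basis ==> continuous_on S (h i)"
  and dg: "!!i x. i : Basis ==> x : S ==> DERIV (%t. u (x + t *R i)) 0 :> g i x"
  and dh: "!!i x. i : Basis ==> x : S ==> DERIV (%t. g i (x + t *R i)) 0 :> h i x"
  and L: "!!x. x : S ==> L x = (SUM i:Basis. h i x)"
  using u unfolding laplace_on_def by blast
 define p where "p i z = - 2 * real m * bump (m - 1) z * (z *. i)" for i z :: 'a
 define q where "q i z = 4 * real m * real (m - 1) * bump (m - 2) z * (z *. i) * (z *. i) - 2 * real m * bump (m - 1) z * (i *. i)" for i z :: 'a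
 have out: "norm z >= 1 ==> p i z = 0" "norm z >= 1 ==> q i z = 0" "norm z >= 1 ==> bump m z = 0" for i z
  using m by (auto simp: p_def q_def bump_outside)
 have cp: "cont (p i)" "cont (q i)" "cont (bump m :: 'a => real)" for i
  unfolding p_def q_def by (intro continuous_intros)+
 have dp: "DERIV (%t. bump m (z + t *R i)) 0 :> p i z"
      "DERIV (%t. p i (z + t *R i)) 0 :> q i z" for z i
  unfolding p_def q_def using m bump_line_deriv[of m z i] bump_line_deriv2[of m z i i] by auto
 have cont: "cont (%z. f z * k z)" if "continuous_on S f" "k : {p i, q i, bump m}" for f k i
  by (rule continuous_on_mult_kernel[OF that(1) S]) (use that(2) cp out in auto)
 have int: "integrable lborel (%z. f z * k z)" if "continuous_on S f" "k : {p i, q i, bump m}" for f k i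
  by (rule integrable_continuous_bounded_support[OF cont[OF that], of "cball 0 1"]) (use that(2) out in auto)
 have key: "(LB z. u z * q i z) = (LB z. h i z * bump m z)" if i: "i : Basis" for i
 proof -
  have "(LB z. u z * q i z - h i z * bump m z) = 0"
  proof (rule integral_partial_derivative_eq_0[OF i, where G = "%z. u z * p i z - g i z * bump m z" and K = "cball 0 1"])
   fix x :: 'a
   show "DERIV (%t. u (x + t *R i) * p i (x + t *R i) - g i (x + t *R i) * bump m (x + t *R i)) 0 :> u x * q i x - h i x * bump m x"
   proof (cases "x : S")
    case True
    show ?thesis
     using DERIV_diff[OF DERIV_mult[OF dg[OF i True] dp(2)[of i x]] DERIV_mult[OF dh[OF i True] dp(1)[of x i]]]
     by (rule DERIV_cong) (simp add: algebra_simps)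
   next
    case False
    hence x: "norm x > 1" using S by force
    have "DERIV (%t::real. 0::real) 0 :> 0" by simp
    moreover have "open ((%t. x + t *R i) -` (- cball 0 1))"
     by (rule open_vimage) (auto intro!: continuous_intros)
    ultimately have "DERIV (%t. u (x + t *R i) * p i (x + t *R i) - g i (x + t *R i) * bump m (x + t *R i)) 0 :> 0"
     by (rule has_field_derivative_transform_within_open) (use x out in auto)
    thus ?thesis using x out by simp
   qed
   show "cont (%z. u z * p i z - g i z * bump m z)"
      "cont (%z. u z * q i z - h i z * bump m z)"
    using cu g h i by (intro continuous_on_diff cont; auto)+
  qed (use out in auto)
  moreover have "integrable lborel (%z. u z * q i z)" "integrable lborel (%z. h i z * bump m z)"
   using cu g h i by (intro int; auto)+
  ultimately show ?thesis by simp
 qed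
 have "(LB z. u z * lap_bump m z) = (LB z. (SUM i:Basis. u z * q i z))"
  unfolding lap_bump_sum[symmetric] q_def sum_distrib_left ..
 also have "... = (SUM i:Basis. LB z. u z * q i z)"
  by (intro Bochner_Integration.integral_sum int[OF cu]) auto
 also have "... = (SUM i:Basis. LB z. h i z * bump m z)"
  using key by auto
 also have "... = (LB z. (SUM i:Basis. h i z * bump m z))"
  using h by (intro Bochner_Integration.integral_sum[symmetric] int) auto
 also have "... = (LB z. L z * bump m z)"
 proof (intro Bochner_Integration.integral_cong refl)
  fix z :: 'a
  show "(SUM i:Basis. h i z * bump m z) = L z * bump m z"
  proof (cases "z : S")
   case True thus ?thesis by (simp add: L sum_distrib_right)
  next
   case False
   hence "norm z >= 1" using S by force
   thus ?thesis using out by simp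
  qed
 qed
 finally show ?thesis .
qed

section \<open>Weak solutions and their means\<close>

text \<open>Weak form of -Laplacian y = F, tested only with the scaled bumps of order at least three: exactly what
  the mean value arguments consume, and stable under locally bounded convergence.\<close>

definition wsol :: "'a::euclidean_space set => ('a => real) => ('a => real) => bool" where
 "wsol S y F \<longleftrightarrow> continuous_on S y & continuous_on S F &
   (ALL x r m. 0 < r --> 3 <= m --> cball x r <= S -->
    (LB z. y (x + r *R z) * lap_bump m z) = - r\<^sup>2 * (LB z. F (x + r *R z) * bump m z))"

text \<open>Not normalised; the kernel is the bump itself.\<close>

definition mean :: "nat => ('a::euclidean_space => real) => 'a => real => real" where
 "mean m y x r = (LB z. y (x + r *R z) * bump m z)"

lemma wsol_continuous: "wsol S y F ==> continuous_on S y" "wsol S y F ==> continuous_on S F"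
 by (auto simp: wsol_def)

lemma wsol_subset: "wsol S y F ==> T <= S ==> wsol T y F"
 unfolding wsol_def by (blast intro: continuous_on_subset)

lemma integrable_bump_mult:
 assumes "continuous_on (cball x r) u" "r > 0" "m > 0"
 shows "integrable lborel (%z. u (x + r *R z) * bump m z)"
 by (rule integrable_mult_kernel[OF assms(1,2)]) (use assms(3) in "auto intro!: continuous_intros simp: bump_outside")

lemma integrable_lap_bump_mult:
 assumes "continuous_on (cball x r) u" "r > 0" "m >= 3"
 shows "integrable lborel (%z. u (x + r *R z) * lap_bump m z)"
 by (rule integrable_mult_kernel[OF assms(1,2)]) (use assms(3) in "auto intro!: continuous_intros simp: lap_bump_outside")

lemma wsol_add:
 assumes "wsol S y F" "wsol S u G"
 shows "wsol S (%x. y x + u x) (%x. F x + G x)"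
 unfolding wsol_def
proof (intro conjI allI impI)
 fix x r m assume r: "(0::real) < r" "3 <= (m::nat)" "cball x r <= S"
 have c: "continuous_on (cball x r) y" "continuous_on (cball x r) u" "continuous_on (cball x r) F" "continuous_on (cball x r) G"
  using assms r(3) by (auto simp: wsol_def intro: continuous_on_subset)
 show "(LB z. (y (x + r *R z) + u (x + r *R z)) * lap_bump m z)
   = - r\<^sup>2 * (LB z. (F (x + r *R z) + G (x + r *R z)) * bump m z)"
  using assms r integrable_lap_bump_mult[OF c(1) r(1,2)] integrable_lap_bump_mult[OF c(2) r(1,2)]
   integrable_bump_mult[OF c(3) r(1), of m] integrable_bump_mult[OF c(4) r(1), of m]
  by (simp add: wsol_def distrib_right ring_distribs)
qed (use assms in "auto simp: wsol_def intro!: continuous_intros")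

lemma wsol_cmult:
 assumes "wsol S y F"
 shows "wsol S (%x. c * y x) (%x. c * F x)"
 unfolding wsol_def
proof (intro conjI allI impI)
 fix x r m assume r: "(0::real) < r" "3 <= (m::nat)" "cball x r <= S"
 show "(LB z. c * y (x + r *R z) * lap_bump m z)
   = - r\<^sup>2 * (LB z. c * F (x + r *R z) * bump m z)"
  using assms r by (simp add: wsol_def mult.assoc)
qed (use assms in "auto simp: wsol_def intro!: continuous_intros")

lemma wsol_diff:
 assumes "wsol S y F" "wsol S u G"
 shows "wsol S (%x. y x - u x) (%x. F x - G x)"
 using wsol_add[OF assms(1) wsol_cmult[OF assms(2), of "-1"]] by simp

lemma wsol_cong:
 assumes "wsol S y F" "!!x. x : S ==> y x = y' x" "!!x. x : S ==> F x = F' x"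
 shows "wsol S y' F'"
 unfolding wsol_def
proof (intro conjI allI impI)
 show "continuous_on S y'" "continuous_on S F'"
  using assms by (auto simp: wsol_def cong: continuous_on_cong_simp)
 fix x r m assume r: "(0::real) < r" "3 <= (m::nat)" "cball x r <= S"
 have in_S: "x + r *R z : S" if "norm z < 1" for z
 proof -
  have "norm (r *R z) <= r" using that r by (simp add: mult_left_le)
  thus ?thesis using r(3) by (auto simp: subset_iff dist_norm)
 qed
 have A: "y' (x + r *R z) * lap_bump m z = y (x + r *R z) * lap_bump m z" for z
  using assms(2) in_S lap_bump_outside[OF r(2), of z] by (cases "norm z < 1") auto
 have B: "F' (x + r *R z) * bump m z = F (x + r *R z) * bump m z" for z
  using assms(3) in_S bump_outside[of m z] r by (cases "norm z < 1") auto
 show "(LB z. y' (x + r *R z) * lap_bump m z)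
   = - r\<^sup>2 * (LB z. F' (x + r *R z) * bump m z)"
  unfolding A B using assms(1) r unfolding wsol_def by blast
qed

lemma laplace_onI:
 assumes "continuous_on S f"
  and "!!i. i : Basis ==> continuous_on S (g i)" and "!!i. i : Basis ==> continuous_on S (h i)"
  and "!!i x. i : Basis ==> x : S ==> DERIV (%t. f (x + t *R i)) 0 :> g i x"
  and "!!i x. i : Basis ==> x : S ==> DERIV (%t. g i (x + t *R i)) 0 :> h i x"
  and "!!x. x : S ==> L x = (SUM i:Basis. h i x)"
 shows "laplace_on S f L"
 unfolding laplace_on_def by (rule conjI, fact, rule exI[of _ g], rule exI[of _ h]) (use assms in blast)

lemma laplace_on_scaled:
 assumes "laplace_on S f L"
 shows "laplace_on {z. x + r *R z : S} (%z. f (x + r *R z)) (%z. r\<^sup>2 * L (x + r *R z))"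
proof -
 obtain g h where cu: "continuous_on S f"
  and g: "!!i. i : Basis ==> continuous_on S (g i)" and h: "!!i. i : Basis ==> continuous_on S (h i)"
  and dg: "!!i x. i : Basis ==> x : S ==> DERIV (%t. f (x + t *R i)) 0 :> g i x"
  and dh: "!!i x. i : Basis ==> x : S ==> DERIV (%t. g i (x + t *R i)) 0 :> h i x"
  and L: "!!x. x : S ==> L x = (SUM i:Basis. h i x)"
  using assms unfolding laplace_on_def by blast
 have sc: "DERIV (%t. u (x + r *R (z + t *R i))) 0 :> r * D"
  if "DERIV (%t. u (x + r *R z + t *R i)) 0 :> D" for u :: "'a => real" and z i D
 proof -
  have "DERIV (%t. u (x + r *R z + (r * t) *R i)) 0 :> D * r"
   by (rule DERIV_chain'[where g = "%t. u (x + r *R z + t *R i)" and f = "%t. r * t"])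
    (use that in "auto intro!: derivative_eq_intros")
  thus ?thesis by (simp add: algebra_simps)
 qed
 have cc: "continuous_on {z. x + r *R z : S} (%z. u (x + r *R z))" if "continuous_on S u" for u :: "'a => real"
  by (rule continuous_on_compose2[OF that]) (auto intro!: continuous_intros)
 show ?thesis
 proof (rule laplace_onI[of _ _ "%i z. r * g i (x + r *R z)" "%i z. r\<^sup>2 * h i (x + r *R z)"])
  fix i :: 'a and z assume i: "i : Basis" and z: "z : {z. x + r *R z : S}"
  show "DERIV (%t. f (x + r *R (z + t *R i))) 0 :> r * g i (x + r *R z)"
   by (rule sc) (use dg i z in auto)
  show "DERIV (%t. r * g i (x + r *R (z + t *R i))) 0 :> r\<^sup>2 * h i (x + r *R z)"
   using DERIV_cmult[OF sc[of "g i" z i], of "h i (x + r *R z)" r] dh i z by (simp add: power2_eq_square mult.assoc)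
 qed (use cc cu g h L in "auto intro!: continuous_intros simp: sum_distrib_left")
qed

lemma laplace_on_imp_wsol:
 assumes f: "laplace_on S f L" and S: "open S"
 shows "wsol S f (%x. - L x)"
proof -
 have cf: "continuous_on S f" using f by (auto simp: laplace_on_def)
 obtain g h where "continuous_on S f" and "!!i. i : Basis ==> continuous_on S (g i)" and h: "!!i. i : Basis ==> continuous_on S (h i)"
  and "!!i x. i : Basis ==> x : S ==> DERIV (%t. f (x + t *R i)) 0 :> g i x"
  and "!!i x. i : Basis ==> x : S ==> DERIV (%t. g i (x + t *R i)) 0 :> h i x"
  and L: "!!x. x : S ==> L x = (SUM i:Basis. h i x)"
  using f unfolding laplace_on_def by blast
 have cL: "continuous_on S L" by (simp add: h continuous_intros continuous_on_eq L)
 show ?thesis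
  unfolding wsol_def
 proof (intro conjI allI impI)
  fix x r m assume r: "(0::real) < r" "3 <= (m::nat)" "cball x r <= S"
  have "(LB z. f (x + r *R z) * lap_bump m z) = (LB z. (r^2 * L (x + r *R z)) * bump m z)"
  proof (rule integral_lap_bump_by_parts[OF laplace_on_scaled[OF f] _ _ r(2)])
   show "open {z. x + r *R z : S}"
   proof -
    have "cont (%z. x + r *R z)" by (intro continuous_intros)
    from open_vimage[OF S this] show ?thesis by (simp add: vimage_def)
   qed
   show "cball 0 1 <= {z. x + r *R z : S}"
    using r by (auto simp: subset_iff dist_norm mult_left_le)
  qed
  thus "(LB z. f (x + r *R z) * lap_bump m z) = - r\<^sup>2 * (LB z. - L (x + r *R z) * bump m z)"
   by (simp add: mult.assoc)
 qed (use cf cL in "auto intro!: continuous_intros")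
qed

lemma lap_bump_bound:
 assumes "m >= 2"
 shows "abs (lap_bump (m+1) (z::'a::euclidean_space)) <= 2 * real (m+1) * (2 * real m + real DIM('a))"
proof -
 have "(z *. z) * bump (m - 1) z <= 1"
 proof (cases "norm z < 1")
  case True
  thus ?thesis by (simp add: dot_square_norm power_le_one bump_le_1 bump_nonneg inner_ge_zero mult_le_one)
 qed (use assms in "simp add: bump_outside")
 hence a: "abs ((z *. z) * bump (m - 1) z) <= 1" by simp
 have "lap_bump (m+1) z = 2 * real (m+1) * (2 * real m * ((z *. z) * bump (m - 1) z) - real DIM('a) * bump m z)"
  by (simp add: lap_bump_def algebra_simps numeral_2_eq_2)
 moreover have "abs (2 * real m * ((z *. z) * bump (m - 1) z) - real DIM('a) * bump m z)
   <= 2 * real m * 1 + real DIM('a) * 1"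
 proof -
  have "abs (2 * real m * ((z *. z) * bump (m - 1) z)) <= 2 * real m * 1"
   unfolding abs_mult[of "2 * real m"] using a by (intro mult_mono) auto
  moreover have "abs (real DIM('a) * bump m z) <= real DIM('a) * 1"
   unfolding abs_mult by (intro mult_mono) auto
  ultimately show ?thesis by linarith
 qed
 ultimately show ?thesis
  by (simp add: abs_mult)
qed

lemma mean_rescale:
 fixes y :: "'a::euclidean_space => real"
 assumes "continuous_on (cball x R) y" "0 < r" "r <= R" "k : borel_measurable borel" "!!z. norm z >= 1 ==> k z = 0"
 shows "(LB z. y (x + r *R z) * k z) = (LB w. (indicat_real (cball x R) (x + w) * y (x + w)) * k (w /R r)) / r ^ DIM('a)"
proof -
 have m: "(%w::'a. indicat_real (cball x R) w *R y w) : borel_measurable borel"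
  by (rule borel_measurable_continuous_on_indicator) (use assms in auto)
 define Y where "Y w = indicat_real (cball x R) w * y w" for w
 have [measurable]: "Y : borel_measurable borel" using m by (simp add: Y_def[abs_def])
 note [measurable] = assms(4)
 have "(%w::'a. Y (x + w) * k (w /R r)) : borel_measurable borel" by measurable
 hence "(%w::'a. (indicat_real (cball x R) (x + w) * y (x + w)) * k (w /R r)) : borel_measurable borel"
  unfolding Y_def .
 from lborel_integral_scale[OF this assms(2), of 0]
 have "(LB w. (indicat_real (cball x R) (x + w) * y (x + w)) * k (w /R r)) / r ^ DIM('a)
   = (LB z. (indicat_real (cball x R) (x + r *R z) * y (x + r *R z)) * k z)"
  using assms(2) by simp
 also have "... = (LB z. y (x + r *R z) * k z)"
 proof (intro Bochner_Integration.integral_cong refl)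
  fix z :: 'a
  show "(indicat_real (cball x R) (x + r *R z) * y (x + r *R z)) * k z = y (x + r *R z) * k z"
  proof (cases "norm z < 1")
   case True
   hence "r * norm z <= r" using assms(2) by (simp add: mult_left_le)
   hence "x + r *R z : cball x R" using assms(2,3) order_trans[of "r * norm z" r R] by (simp add: dist_norm)
   thus ?thesis by simp
  qed (use assms(5) in simp)
 qed
 finally show ?thesis by simp
qed

text \<open>After rescaling to the integration variable w = r z, only the smooth kernel depends on the radius, so the
  derivative falls on the bump and no regularity of y is used.\<close>

lemma mean_deriv:
 fixes y :: "'a::euclidean_space => real"
 assumes y: "continuous_on (cball x R) y" and r: "0 < r" "r < R" and m: "m >= 2"
 shows "DERIV (%r. mean m y x r) r :> (LB z. y (x + r *R z) * lap_bump (m+1) z) / (2 * real (m+1) * r)"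
proof -
 define N where "N = DIM('a)"
 define y0 where "y0 w = indicat_real (cball x R) (x + w) * y (x + w)" for w
 define k where "k z = lap_bump (m+1) z / (2 * real (m+1))" for z :: 'a
 have k: "k z = 2 * real m * (z *. z) * bump (m - 1) z - real N * bump m z" for z
  using m by (simp add: k_def lap_bump_def N_def field_simps numeral_2_eq_2)
 have kb: "abs (k z) <= 2 * real m + real N" for z
  using lap_bump_bound[OF m, of z] by (simp add: k_def N_def abs_mult field_simps)
 have mm: "(%w::'a. indicat_real (cball x R) w *R y w) : borel_measurable borel"
  by (rule borel_measurable_continuous_on_indicator) (use y in auto)
 have y0m[measurable]: "y0 : borel_measurable borel"
  using measurable_compose[OF _ mm, of "%w. x + w" borel] by (simp add: y0_def[abs_def])
 have y0i: "integrable lborel y0"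
 proof -
  have "integrable lborel (%w. indicat_real (cball 0 R) w *R y (x + w))"
   by (intro borel_integrable_compact continuous_on_compose2[OF y] continuous_intros) (auto simp: dist_norm)
  moreover have "(%w. indicat_real (cball 0 R) w *R y (x + w)) = y0"
   by (auto simp: y0_def indicator_def dist_norm fun_eq_iff)
  ultimately show ?thesis by simp
 qed
 have inv: "((%s::real. w /R s) has_vector_derivative - (w /R s) /R s) (at s)" if "s > 0" for w :: 'a and s
  using that by (auto intro!: derivative_eq_intros simp: power2_eq_square)
 have main: "DERIV (%s. LB w. y0 w * (bump m (w /R s) / s ^ N)) r :> (LB w. y0 w * (k (w /R r) / r ^ (N+1)))"
 proof (rule has_real_derivative_integral_dominated[where a = "r/2" and b = R
    and g = "%w. abs (y0 w) * ((2 * real m + real N) / (r/2) ^ (N+1))"])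
  fix s assume s: "s : {r/2<..<R}"
  hence s0: "s > 0" using r by auto
  show "integrable lborel (%w. y0 w * (bump m (w /R s) / s ^ N))"
  proof (rule Bochner_Integration.integrable_bound)
   show "integrable lborel (%w. y0 w * (1 / s ^ N))" using y0i by simp
   show "AE w in lborel. norm (y0 w * (bump m (w /R s) / s ^ N)) <= norm (y0 w * (1 / s ^ N))"
   proof (rule AE_I2)
    fix w show "norm (y0 w * (bump m (w /R s) / s ^ N)) <= norm (y0 w * (1 / s ^ N))"
     using s0 mult_left_le[OF bump_le_1, of "abs (y0 w)" m "w /R s"] by (simp add: abs_mult divide_right_mono)
   qed
  qed (use s0 in simp)
  fix w :: 'a
  have "((%s. bump m (w /R s)) has_vector_derivative
    - 2 * real m * bump (m - 1) (w /R s) * ((w /R s) *. (- (w /R s) /R s))) (at s)"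
   using vector_derivative_diff_chain_within[where S = UNIV, OF inv[OF s0] has_derivative_at_withinI[OF bump_has_derivative[OF m]], of w]
   by (simp only: o_def)
  hence "DERIV (%s. bump m (w /R s)) s :> 2 * real m * bump (m - 1) (w /R s) * ((w /R s) *. (w /R s)) / s"
   using s0 by (simp add: has_real_derivative_iff_has_vector_derivative field_simps)
  hence "DERIV (%s. bump m (w /R s) * inverse (s ^ N)) s :> (2 * real m * bump (m - 1) (w /R s) * ((w /R s) *. (w /R s)) / s) * inverse (s ^ N)
     + bump m (w /R s) * (- (real N * s ^ (N - 1)) * inverse ((s ^ N)^2))"
   using s0 by (auto intro!: derivative_eq_intros simp: power2_eq_square field_simps)
  moreover have e: "real N * s ^ (N - 1) * inverse ((s ^ N)^2) = real N / s ^ (N + 1)"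
   using s0 DIM_positive[where 'a='a] by (cases N) (auto simp: N_def power2_eq_square field_simps)
  ultimately have "DERIV (%s. bump m (w /R s) / s ^ N) s :> k (w /R s) / s ^ (N+1)"
   unfolding divide_inverse[of "bump m _"]
   by (elim DERIV_cong, simp only: mult_minus_left mult_minus_right e) (use s0 in "simp add: k field_simps")
  thus "DERIV (%s. y0 w * (bump m (w /R s) / s ^ N)) s :> y0 w * (k (w /R s) / s ^ (N+1))"
   by (rule DERIV_cmult)
  have le: "abs (k (w /R s)) / s ^ (N+1) <= (2 * real m + real N) / (r/2) ^ (N+1)"
   using s r by (intro frac_le kb power_mono) auto
  thus "abs (y0 w * (k (w /R s) / s ^ (N+1))) <= abs (y0 w) * ((2 * real m + real N) / (r/2) ^ (N+1))"
  proof -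
   have "abs (y0 w * (k (w /R s) / s ^ (N+1))) = abs (y0 w) * (abs (k (w /R s)) / s ^ (N+1))"
    using s0 by (simp add: abs_mult)
   also have "... <= abs (y0 w) * ((2 * real m + real N) / (r/2) ^ (N+1))"
    by (rule mult_left_mono[OF le]) simp
   finally show ?thesis .
  qed
 qed (use r y0i in auto)
 have eq1: "mean m y x s = (LB w. y0 w * (bump m (w /R s) / s ^ N))" if "s : {0<..<R}" for s
 proof -
  have "mean m y x s = (LB w. y0 w * bump m (w /R s)) / s ^ N"
   unfolding mean_def y0_def N_def using that m by (intro mean_rescale[OF y]) (auto simp: bump_outside)
  also have "... = (LB w. y0 w * bump m (w /R s) / s ^ N)" by simp
  finally show ?thesis by simp
 qed
 have "DERIV (%s. mean m y x s) r :> (LB w. y0 w * (k (w /R r) / r ^ (N+1)))"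
  by (rule has_field_derivative_transform_within_open[OF main, of "{0<..<R}"]) (use r eq1 in auto)
 moreover have "(LB w. y0 w * (k (w /R r) / r ^ (N+1))) =
   (LB z. y (x + r *R z) * lap_bump (m+1) z) / (2 * real (m+1) * r)"
 proof -
  have "(LB z. y (x + r *R z) * k z) = (LB w. y0 w * k (w /R r)) / r ^ N"
   unfolding y0_def N_def using r m
   by (intro mean_rescale[OF y]) (auto simp: k_def lap_bump_outside)
  hence "(LB w. y0 w * k (w /R r)) / r ^ (N+1) = (LB z. y (x + r *R z) * k z) / r"
   using r by (simp add: field_simps)
  thus ?thesis by (simp add: k_def)
 qed
 ultimately show ?thesis by simp
qed

text \<open>The radial derivative of the mean of order m is a multiple of the tested Laplacian of order m + 1; this
  turns the weak equation into an ordinary differential inequality in the radius.\<close>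

lemma wsol_mean_deriv:
 assumes w: "wsol S y F" and R: "cball x R <= S" and r: "0 < r" "r < R" and m: "m >= 2"
 shows "DERIV (%r. mean m y x r) r :> - (r / (2 * real (m+1))) * mean (m+1) F x r"
proof -
 have "continuous_on (cball x R) y" using w R by (auto simp: wsol_def intro: continuous_on_subset)
 from mean_deriv[OF this r m] have "DERIV (%r. mean m y x r) r :> (LB z. y (x + r *R z) * lap_bump (m+1) z) / (2 * real (m+1) * r)" .
 moreover have "cball x r <= S" and three: "3 <= m + 1" using R r m by (auto simp: subset_iff)
 hence "(LB z. y (x + r *R z) * lap_bump (m+1) z) = - r\<^sup>2 * mean (m+1) F x r"
  using w r(1) three unfolding wsol_def mean_def by blast
 moreover have "(- r\<^sup>2 * M) / (c * r) = - (r / c) * M" if "c ~= 0" for c M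
  using that r by (simp add: power2_eq_square field_simps)
 ultimately show ?thesis by simp
qed

lemma mean_0:
 fixes y :: "'a::euclidean_space => real"
 shows "mean m y x 0 = y x * (LB z. bump m (z::'a::euclidean_space))"
 by (simp add: mean_def)

lemma integrable_bump: "m > 0 ==> integrable lborel (bump m :: 'a::euclidean_space => real)"
 by (rule integrable_continuous_bounded_support[of _ "cball 0 1"]) (auto intro!: continuous_intros simp: bump_outside)

lemma bump_integral_pos:
 assumes "m > 0"
 shows "(LB z. bump m (z::'a::euclidean_space)) > 0"
proof (rule ccontr)
 assume "~ ?thesis"
 moreover have "(LB z. bump m (z::'a)) >= 0" by (intro integral_nonneg_AE) auto
 ultimately have "AE z in lborel. bump m (z::'a) = 0" using integral_nonneg_eq_0_iff_AE[OF integrable_bump[OF assms]] by fastforce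
 hence "negligible {z::'a. bump m z ~= 0}" by (metis AE_completion eventually_ae_filter_negligible negligible_subset)
 hence "negligible (ball (0::'a) 1)"
  by (rule negligible_subset) (use bump_pos[of _ m] in "fastforce simp: less_le")
 thus False using open_not_negligible[of "ball (0::'a) 1"] by auto
qed

lemma mean_mono:
 assumes "continuous_on (cball x r) u" "continuous_on (cball x r) v" "r > 0" "m > 0"
  and "!!x'. x' : ball x r ==> u x' <= v x'"
 shows "mean m u x r <= mean m v x r"
 unfolding mean_def
proof (rule integral_mono[OF integrable_bump_mult[OF assms(1,3,4)] integrable_bump_mult[OF assms(2,3,4)]])
 fix z
 show "u (x + r *R z) * bump m z <= v (x + r *R z) * bump m z"
  using assms(5)[of "x + r *R z"] bump_outside[OF assms(4), of z] assms(3)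
  by (cases "norm z < 1") (auto simp: dist_norm intro!: mult_right_mono)
qed

lemma mean_const:
 fixes x :: "'a::euclidean_space"
 shows "mean m (%_. c) x r = c * (LB z. bump m (z::'a::euclidean_space))"
 by (simp add: mean_def)

lemma mean_tendsto_0:
 fixes y :: "'a::euclidean_space => real"
 assumes y: "continuous_on (cball x R) y" and R: "R > 0" and m: "m > 0"
 shows "((%r. mean m y x r) \<longlongrightarrow> mean m y x 0) (at_right 0)"
proof (rule tendstoI)
 fix e :: real assume e: "e > 0"
 define b where "b = (LB z. bump m (z::'a))"
 have b: "b > 0" unfolding b_def by (rule bump_integral_pos[OF m])
 have "continuous (at x within cball x R) y" using y R by (auto simp: continuous_on_eq_continuous_within)
 then obtain d where d: "d > 0" "!!x'. x' : cball x R ==> dist x' x < d ==> dist (y x') (y x) < e / (2*b)"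
  using divide_pos_pos[OF e, of "2*b"] b unfolding continuous_within_eps_delta by auto
 have "\<forall>\<^sub>F r in at_right 0. r : {0<..<min d R}"
  by (rule eventually_at_right_real) (use d R in auto)
 thus "\<forall>\<^sub>F r in at_right 0. dist (mean m y x r) (mean m y x 0) < e"
 proof eventually_elim
  case (elim r)
  hence r: "0 < r" "r < d" "r < R" by auto
  have c: "continuous_on (cball x r) y" by (rule continuous_on_subset[OF y]) (use r in auto)
  have "abs (y x' - y x) <= e / (2*b)" if "x' : ball x r" for x'
   using d(2)[of x'] that r by (auto simp: dist_commute dist_real_def)
  hence *: "y x - e/(2*b) <= y x'" "y x' <= y x + e/(2*b)" if "x' : ball x r" for x'
   using that by (auto simp: abs_le_iff algebra_simps)
  have "mean m y x r <= (y x + e/(2*b)) * b" "(y x - e/(2*b)) * b <= mean m y x r"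
   using mean_mono[OF c continuous_on_const r(1) m *(2)] mean_mono[OF continuous_on_const c r(1) m *(1)]
   by (auto simp: mean_const b_def)
  moreover have eb: "e/(2*b) * b = e/2" using b by simp
  ultimately have "mean m y x r <= y x * b + e/2" "y x * b - e/2 <= mean m y x r"
   unfolding distrib_right left_diff_distrib by linarith+
  hence "abs (mean m y x r - y x * b) <= e/2" by linarith
  thus ?case using e by (simp add: mean_0 b_def dist_real_def)
 qed
qed

lemma mean_continuous_on:
 assumes w: "wsol S y F" and R: "cball x R <= S" and r: "0 < r" "r < R" and m: "m >= 2"
 shows "continuous_on {0..r} (%r. mean m y x r)"
 unfolding continuous_on_eq_continuous_within
proof
 fix s assume s: "s : {0..r}"
 show "continuous (at s within {0..r}) (mean m y x)"
 proof (cases "s = 0")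
  case True
  have "continuous_on (cball x R) y" using w R by (auto simp: wsol_def intro: continuous_on_subset)
  hence "((%r. mean m y x r) \<longlongrightarrow> mean m y x 0) (at_right 0)"
   using r m by (intro mean_tendsto_0[where R = R]) auto
  thus ?thesis
   unfolding continuous_within True using r by (simp add: at_within_Icc_at_right)
 next
  case False
  have "isCont (mean m y x) s"
   by (rule DERIV_isCont[OF wsol_mean_deriv[OF w R _ _ m]]) (use s r False in auto)
  thus ?thesis by (rule continuous_at_imp_continuous_at_within)
 qed
qed

text \<open>The means are monotone in the radius and tend to the value at the centre.\<close>

lemma wsol_subharmonic_mean:
 fixes y :: "'a::euclidean_space => real"
 assumes w: "wsol S y F" and R: "cball x R <= S" and r: "0 < r" "r < R" and m: "m >= 2"
  and F: "!!x'. x' : ball x r ==> F x' <= 0"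
 shows "mean m y x r >= y x * (LB z. bump m (z::'a))"
proof -
 obtain l z where lz: "0 < z" "z < r" "DERIV (%r. mean m y x r) z :> l"
   "mean m y x r - mean m y x 0 = (r - 0) * l"
  using MVT[OF r(1) mean_continuous_on[OF w R r m]] wsol_mean_deriv[OF w R _ _ m] r
  by (meson differentiableI has_field_derivative_imp_has_derivative order.strict_trans real_differentiable_def)
 have "l = - (z / (2 * real (m+1))) * mean (m+1) F x z"
  using DERIV_unique[OF lz(3) wsol_mean_deriv[OF w R _ _ m]] lz r by auto
 moreover have "mean (m+1) F x z <= mean (m+1) (%_. 0) x z"
 proof (rule mean_mono)
  show "continuous_on (cball x z) F"
   using w R lz r by (auto simp: wsol_def intro!: continuous_on_subset[of S F])
 qed (use F lz r in auto)
 ultimately have "l = (z / (2 * real (m+1))) * (- mean (m+1) F x z)" "- mean (m+1) F x z >= 0"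
  by (simp_all add: mean_const)
 hence "(r - 0) * l >= 0" using lz(1) divide_nonneg_nonneg less_imp_le mult_nonneg_nonneg of_nat_0_le_iff zero_le_numeral r by (smt (verit))
 thus ?thesis using lz(4) by (simp add: mean_0)
qed

lemma mean_eq_imp_const:
 fixes y :: "'a::euclidean_space => real"
 assumes y: "continuous_on (cball x r) y" and r: "r > 0" and m: "m > 0"
  and le: "!!x'. x' : ball x r ==> y x' <= c" and mean: "mean m y x r >= c * (LB z. bump m (z::'a))"
 shows "x' : ball x r ==> y x' = c"
proof -
 have i: "integrable lborel (%z. y (x + r *R z) * bump m z)" by (rule integrable_bump_mult[OF y r m])
 have i2: "integrable lborel (%z. c * bump m (z::'a) - y (x + r *R z) * bump m z)"
  using i integrable_bump[OF m] by auto
 have ge: "y (x + r *R z) * bump m z <= c * bump m z" for z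
  using le[of "x + r *R z"] bump_outside[OF m, of z] r
  by (cases "norm z < 1") (auto simp: dist_norm intro!: mult_right_mono)
 have "(LB z. c * bump m (z::'a) - y (x + r *R z) * bump m z) >= 0"
  using ge by (intro integral_nonneg_AE) auto
 moreover have "(LB z. c * bump m (z::'a) - y (x + r *R z) * bump m z) <= 0"
  using mean i integrable_bump[OF m, where 'a='a] by (simp add: mean_def)
 ultimately have "(LB z. c * bump m (z::'a) - y (x + r *R z) * bump m z) = 0" by linarith
 hence "AE z in lebesgue. c * bump m (z::'a) - y (x + r *R z) * bump m z = 0" using integral_nonneg_eq_0_iff_AE[THEN iffD1, OF i2, rotated] ge AE_completion by auto
 hence neg: "negligible {z::'a. c * bump m z - y (x + r *R z) * bump m z ~= 0}"
  by (auto simp: eventually_ae_filter_negligible intro: negligible_subset)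
 let ?T = "ball 0 1 \<inter> (%z. y (x + r *R z)) -` (- {c})"
 have "continuous_on (ball 0 1) (%z. y (x + r *R z))"
  using r by (intro continuous_on_compose2[OF y] continuous_intros) (auto simp: dist_norm mult_left_le)
 hence "open ?T"
  by (intro continuous_open_preimage) auto
 moreover have "negligible ?T"
 proof (rule negligible_subset[OF neg], safe)
  fix z :: 'a assume z: "z : ball 0 1" "y (x + r *R z) ~= c" "c * bump m z - y (x + r *R z) * bump m z = 0"
  hence "(c - y (x + r *R z)) * bump m z = 0" by (simp add: algebra_simps)
  thus False using z bump_pos[of z m] by auto
 qed
 ultimately have T: "?T = {}" using open_not_negligible by blast
 show "y x' = c" if "x' : ball x r" for x'
 proof -
  have "norm ((x' - x) /R r) = norm (x' - x) / r" using r by (simp add: divide_inverse mult.commute)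
  hence "(x' - x) /R r : ball 0 1" using that r by (simp add: dist_norm norm_minus_commute)
  moreover have "x + r *R ((x' - x) /R r) = x'" using r by simp
  ultimately show ?thesis using T by (metis (no_types, lifting) ComplI IntI empty_iff singletonD vimageI2)
 qed
qed

lemma wsol_strong_max:
 assumes w: "wsol S y F" and R: "cball x0 R <= S"
  and le: "!!x. x : ball x0 R ==> y x <= y x0" and F: "!!x. x : ball x0 R ==> F x <= 0"
  and x: "x : ball x0 R"
 shows "y x = y x0"
proof -
 have "R > 0" using x by (auto intro: le_less_trans[OF zero_le_dist])
 obtain r where r: "dist x0 x < r" "r < R" using x dense[of "dist x0 x" R] by auto
 hence r0: "0 < r" by (auto intro: le_less_trans[OF zero_le_dist])
 show ?thesis
 proof (rule mean_eq_imp_const[where m = 2 and r = r and x = x0 and c = "y x0"])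
  show "continuous_on (cball x0 r) y"
   using w R r by (auto simp: wsol_def intro!: continuous_on_subset[of S y])
  show "y x0 * (LB z. bump 2 (z::'a)) <= mean 2 y x0 r"
   by (rule wsol_subharmonic_mean[OF w R r0 r(2)]) (use F r in auto)
 qed (use r r0 le in auto)
qed

text \<open>At a positive maximum the mean value inequality forces D to be constant nearby; following the maximum set
  up to the boundary contradicts the boundary values.\<close>

lemma wsol_max_principle:
 assumes w: "wsol S D F" and S: "open S" "bounded S" and c: "continuous_on (closure S) D"
  and F: "!!x. x : S ==> D x > 0 ==> F x <= 0" and fr: "!!x. x : frontier S ==> D x <= 0"
  and x: "x : S"
 shows "D x <= 0"
proof (rule ccontr)
 assume "~ D x <= 0"
 hence Dx: "D x > 0" by simp
 have comp: "compact (closure S)" using S by (simp add: compact_closure)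
 have "closure S ~= {}" using x closure_subset by auto
 then obtain m where m: "m : closure S" "!!y. y : closure S ==> D y <= D m"
  using continuous_attains_sup[OF comp _ c] by blast
 have Dm: "D m > 0" using Dx m(2)[of x] x closure_subset by force
 define Z where "Z = {y : closure S. D y = D m}"
 have "closed Z"
  unfolding Z_def using c by (intro continuous_closed_preimage_constant) auto
 hence "compact Z" using comp by (metis (no_types, lifting) Z_def closed_Int_compact inf.orderE mem_Collect_eq subsetI)
 moreover have "m : Z" using m by (simp add: Z_def)
 moreover obtain i :: 'a where i: "i : Basis" using nonempty_Basis by blast
 moreover have "continuous_on Z (%y. y *. i)" by (intro continuous_intros)
 ultimately obtain x0 where x0: "x0 : Z" "!!y. y : Z ==> y *. i <= x0 *. i"
  using continuous_attains_sup[of Z "%y. y *. i"] by blast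
 have x0S: "x0 : S"
 proof (rule ccontr)
  assume "x0 ~: S"
  hence "x0 : frontier S" using x0(1) S by (auto simp: Z_def frontier_def interior_open)
  thus False using fr[of x0] Dm x0(1) by (auto simp: Z_def)
 qed
 have "open (S \<inter> D -` {0<..})"
  using S c by (intro continuous_open_preimage) (auto intro: continuous_on_subset closure_subset[THEN subsetD])
 moreover have "x0 : S \<inter> D -` {0<..}" using x0S x0(1) Dm by (auto simp: Z_def)
 ultimately obtain R where R: "R > 0" "cball x0 R <= S \<inter> D -` {0<..}"
  by (meson open_contains_cball)
 have "x0 + (R/2) *R i : ball x0 R" using R i by (simp add: dist_norm)
 hence "D (x0 + (R/2) *R i) = D x0"
 proof (rule wsol_strong_max[OF w, rotated 3])
  show "cball x0 R <= S" using R by auto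
  show "D x <= D x0" if "x : ball x0 R" for x
  proof -
   have "x : closure S" using that R closure_subset by fastforce
   thus ?thesis using m(2) x0(1) by (simp add: Z_def)
  qed
  show "F x <= 0" if "x : ball x0 R" for x
  proof (rule F)
   have "x : cball x0 R" using that by simp
   thus "x : S" "D x > 0" using R(2) by blast+
  qed
 qed
 moreover have "x0 + (R/2) *R i : closure S"
  using \<open>x0 + (R/2) *R i : ball x0 R\<close> R closure_subset by fastforce
 ultimately have "x0 + (R/2) *R i : Z" using x0(1) by (simp add: Z_def)
 thus False using x0(2)[of "x0 + (R/2) *R i"] R i by (simp add: inner_add_left)
qed

section \<open>Mean values of Helmholtz solutions\<close>

lemma laplace_on_cos:
 fixes xi :: "'a::euclidean_space"
 shows "laplace_on UNIV (%x. cos (xi *. x + c)) (%x. - (xi *. xi) * cos (xi *. x + c))"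
proof (rule laplace_onI[of _ _ "%i x. - sin (xi *. x + c) * (xi *. i)" "%i x. - cos (xi *. x + c) * (xi *. i) * (xi *. i)"])
 fix x :: 'a
 have "(SUM i:Basis. (xi *. i) * (xi *. i)) = xi *. xi" by (rule euclidean_inner[symmetric])
 thus "- (xi *. xi) * cos (xi *. x + c) = (SUM i:Basis. - cos (xi *. x + c) * (xi *. i) * (xi *. i))"
  by (simp add: mult.assoc sum_negf flip: sum_distrib_left)
next
 fix i x :: 'a
 have 1: "DERIV (%t. cos (a + t * b)) 0 :> - sin a * b"
  and 2: "DERIV (%t. - sin (a + t * b) * b) 0 :> - cos a * b * b" for a b :: real
  by (auto intro!: derivative_eq_intros)
 have e: "xi *. (x + t *R i) + c = (xi *. x + c) + t * (xi *. i)" for t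
  by (simp add: inner_add_right)
 show "DERIV (%t. cos (xi *. (x + t *R i) + c)) 0 :> - sin (xi *. x + c) * (xi *. i)"
  unfolding e by (rule 1)
 show "DERIV (%t. - sin (xi *. (x + t *R i) + c) * (xi *. i)) 0 :> - cos (xi *. x + c) * (xi *. i) * (xi *. i)"
  unfolding e by (rule 2)
qed (intro continuous_intros)+

lemma abs_le_of_abs_deriv_le:
 fixes f phi :: "real => real"
 assumes r: "0 <= r" and cf: "continuous_on {0..r} f" and cphi: "continuous_on {0..r} phi"
  and df: "!!s. 0 < s ==> s < r ==> (f has_real_derivative f' s) (at s)"
  and dphi: "!!s. 0 < s ==> s < r ==> (phi has_real_derivative phi' s) (at s)"
  and le: "!!s. 0 < s ==> s < r ==> abs (f' s) <= phi' s"
  and 0: "f 0 = 0" "phi 0 = 0"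
 shows "abs (f r) <= phi r"
proof -
 have *: "0 <= phi r - k * f r" if k: "abs k <= 1" for k :: real
 proof (cases "r = 0")
  case False
  hence r: "0 < r" using r by simp
  have d: "DERIV (%s. phi s - k * f s) s :> phi' s - k * f' s" if "0 < s" "s < r" for s
   using df[OF that] dphi[OF that] by (auto intro!: derivative_eq_intros)
  have "continuous_on {0..r} (%s. phi s - k * f s)" using cf cphi by (intro continuous_intros)
  moreover have "(%s. phi s - k * f s) differentiable (at s)" if "0 < s" "s < r" for s
   using d[OF that] real_differentiable_def by blast
  ultimately obtain l z where lz: "0 < z" "z < r" "DERIV (%s. phi s - k * f s) z :> l"
    "(phi r - k * f r) - (phi 0 - k * f 0) = (r - 0) * l"
   using MVT[OF r, of "%s. phi s - k * f s"] by blast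
  have l: "l = phi' z - k * f' z" using DERIV_unique[OF lz(3) d[OF lz(1,2)]] .
  have "abs (k * f' z) <= 1 * phi' z" unfolding abs_mult using k le[OF lz(1,2)] by (intro mult_mono) auto
  hence "0 <= l" using l by (simp add: abs_le_iff)
  hence "0 <= (r - 0) * l" using r by simp
  thus ?thesis using lz(4) 0 by simp
 qed (use 0 in simp)
 show ?thesis using *[of 1] *[of "-1"] by (simp add: abs_le_iff)
qed

lemma abs_mean_le:
 fixes x :: "'a::euclidean_space"
 assumes "continuous_on (cball x r) u" "r > 0" "m > 0" and B: "!!x'. x' : ball x r ==> abs (u x') <= B" "B >= 0"
 shows "abs (mean m u x r) <= B * (LB z. bump 1 (z::'a))"
proof -
 have "mean m u x r <= mean m (%_. B) x r" "mean m (%_. - B) x r <= mean m u x r"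
  using B(1) by (intro mean_mono assms continuous_on_const; force simp: abs_le_iff)+
 hence "abs (mean m u x r) <= B * (LB z. bump m (z::'a))"
  by (simp add: mean_const abs_le_iff)
 also have "(LB z. bump m (z::'a)) <= (LB z. bump 1 (z::'a))"
 proof (intro integral_mono integrable_bump)
  fix z :: 'a
  show "bump m z <= bump 1 z"
   unfolding bump_def using assms(3) power_decreasing[of 1 m "max 0 (1 - z *. z)"] by simp
 qed (use assms in auto)
 finally show ?thesis using B(2) by (simp add: mult_left_mono)
qed

text \<open>Both sides satisfy the same radial initial value problem, the right-hand side because cos is itself an
  eigenfunction; the difference is bounded by iterating the derivative formula through the bump orders.\<close>

lemma helmholtz_mean:
 fixes w :: "'a::euclidean_space => real" and xi :: 'a
 assumes w: "wsol S w (%x. mu * w x)" and xi: "xi *. xi = mu" and R: "cball x R <= S" and r: "0 < r" "r < R" and m: "m >= 2"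
 shows "mean m w x r = w x * mean m (%y. cos (xi *. y)) 0 r"
proof -
 have mu: "mu >= 0" using xi by auto
 have wC: "wsol UNIV (%y. cos (xi *. y)) (%y. mu * cos (xi *. y))"
  using laplace_on_imp_wsol[OF laplace_on_cos[of xi 0]] xi by simp
 have R0: "cball (0::'a) R <= UNIV" by simp
 define D where "D m s = mean m w x s - w x * mean m (%y. cos (xi *. y)) 0 s" for m s
 have dD: "(D m has_real_derivative - (mu * s / (2 * real (m+1))) * D (m+1) s) (at s)" if "0 < s" "s < R" "m >= 2" for m s
 proof -
  have sc: "mean (m+1) (%x. mu * u x) y s = mu * mean (m+1) u y s" for u :: "'a => real" and y
   by (simp add: mean_def mult.assoc)
  have C: "(mean m (%y. cos (xi *. y)) 0 has_real_derivative
    - (s / (2 * real (m+1))) * mean (m+1) (%y. mu * cos (xi *. y)) 0 s) (at s)"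
   by (rule wsol_mean_deriv[OF wC R0]) (use that in auto)
  show ?thesis
   unfolding D_def
   using DERIV_diff[OF wsol_mean_deriv[OF w R that] DERIV_cmult[OF C, of "w x"]]
   by (rule DERIV_cong) (simp only: sc, simp add: algebra_simps)
 qed
 have cD: "continuous_on {0..s} (D m)" if "0 <= s" "s < R" "m >= 2" for m s
 proof (cases "s = 0")
  case False
  thus ?thesis
   unfolding D_def using that by (intro continuous_intros mean_continuous_on[OF w R] mean_continuous_on[OF wC R0]) auto
 qed simp
 have D0: "D m 0 = 0" for m by (simp add: D_def mean_0)
 have cw: "continuous_on (cball x R) w" using w R by (auto simp: wsol_def intro: continuous_on_subset)
 hence "bounded (w ` cball x R)" by (intro compact_imp_bounded compact_continuous_image) auto
 then obtain B where B: "B > 0" "!!x'. x' : cball x R ==> abs (w x') <= B" unfolding bounded_pos by auto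
 define K where "K = 2 * B * (LB z. bump 1 (z::'a))"
 have b1: "(LB z. bump 1 (z::'a)) > 0" by (rule bump_integral_pos) simp
 have DK: "abs (D m s) <= K" if "0 <= s" "s < R" "m >= 2" for m s
 proof (cases "s = 0")
  case True thus ?thesis using D0 B b1 by (simp add: K_def)
 next
  case False
  hence s: "s > 0" using that by simp
  have 1: "abs (mean m w x s) <= B * (LB z. bump 1 (z::'a))"
   using that s B by (intro abs_mean_le continuous_on_subset[OF cw]) (auto simp: subset_iff)
  have 2: "abs (mean m (%y. cos (xi *. y)) (0::'a) s) <= 1 * (LB z. bump 1 (z::'a))"
   using that s by (intro abs_mean_le continuous_intros) auto
  have "abs (w x) <= B" using B(2)[of x] r by auto
  hence "abs (w x * mean m (%y. cos (xi *. y)) 0 s) <= B * (1 * (LB z. bump 1 (z::'a)))"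
   unfolding abs_mult using 2 B by (intro mult_mono) auto
  thus ?thesis using 1 unfolding D_def K_def by linarith
 qed
 have claim: "abs (D m s) <= K * (mu * s^2) ^ j / fact j" if "0 <= s" "s < R" "m >= 2" for j m s
  using that
 proof (induction j arbitrary: m s)
  case 0 thus ?case using DK by simp
 next
  case (Suc j)
  define phi where "phi s = (K * mu ^ Suc j / fact (Suc j)) * s ^ (2 * j + 2)" for s :: real
  define phi' where "phi' s = (K * mu ^ Suc j / fact (Suc j)) * (real (2 * j + 2) * s ^ (2 * j + 2 - Suc 0))" for s :: real
  have "abs (D m s) <= phi s"
  proof (rule abs_le_of_abs_deriv_le[where f = "D m" and phi = phi and r = s and f' = "%s. - (mu * s / (2 * real (m+1))) * D (m+1) s" and phi' = phi'])
   show "continuous_on {0..s} (D m)" using cD Suc.prems by blast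
   show "continuous_on {0..s} phi" unfolding phi_def by (intro continuous_intros)
   fix t assume t: "0 < t" "t < s"
   show "(D m has_real_derivative - (mu * t / (2 * real (m+1))) * D (m+1) t) (at t)"
    using dD t Suc.prems by auto
   show "(phi has_real_derivative phi' t) (at t)"
    unfolding phi_def phi'_def by (intro DERIV_cmult DERIV_pow)
   have "abs (- (mu * t / (2 * real (m+1))) * D (m+1) t) = (mu * t / (2 * real (m+1))) * abs (D (m+1) t)"
    using mu t by (simp add: abs_mult)
   also have "... <= (mu * t * 2) * (K * (mu * t^2) ^ j / fact j)"
   proof (rule mult_mono)
    have "mu * t / (2 * real (m+1)) <= mu * t / 1" using mu t by (intro divide_left_mono) auto
    also have "... <= mu * t * 2" using mu t by simp
    finally show "mu * t / (2 * real (m+1)) <= mu * t * 2" .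
    show "abs (D (m+1) t) <= K * (mu * t^2) ^ j / fact j"
     using Suc.prems t by (intro Suc.IH) auto
   qed (use mu t in auto)
   also have "... = phi' t"
   proof -
    have "(mu * t^2) ^ j = mu ^ j * t ^ (2 * j)" by (simp add: power_mult_distrib power_mult)
    moreover have "(2::real) * (1 + real j) / fact (Suc j) = 2 / fact j"
    proof -
     have "2 * c / (c * f) = 2 / f" if "c ~= 0" for c f :: real using that by simp
     from this[of "1 + real j" "fact j"] show ?thesis by (simp add: algebra_simps)
    qed
    moreover have "phi' t = K * mu ^ j * mu * t * t ^ (2 * j) * (2 * (1 + real j) / fact (Suc j))"
     by (simp add: phi'_def)
    ultimately show ?thesis by simp
   qed
   finally show "abs (- (mu * t / (2 * real (m+1))) * D (m+1) t) <= phi' t" .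
  qed (use D0 Suc.prems in "auto simp: phi_def")
  also have "phi s = K * (mu * s^2) ^ Suc j / fact (Suc j)"
  proof -
   show ?thesis by (simp add: power_mult power2_eq_square phi_def power_mult_distrib)
  qed
  finally show ?case .
 qed
 have "(%j. K * ((mu * r^2) ^ j / fact j)) ----> K * 0"
 proof (intro tendsto_intros)
  have "summable (%j. (mu * r^2) ^ j / fact j)"
   using summable_exp_generic[of "mu * r^2"] by (simp add: divide_inverse mult.commute)
  thus "(%j. (mu * r^2) ^ j / fact j) ----> 0" by (rule summable_LIMSEQ_zero)
 qed
 moreover have "abs (D m r) <= K * ((mu * r^2) ^ j / fact j)" for j
  using claim[of r m j] r m by simp
 ultimately have "abs (D m r) <= K * 0"
  by (intro LIMSEQ_le_const) auto
 thus ?thesis by (simp add: D_def)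
qed

section \<open>Regularity\<close>

definition conv :: "('a::euclidean_space => real) => real => ('a => real) => 'a => real" where
 "conv K s w x = (LB y. w y * K ((y - x) /R s))"

lemma integrable_mult_bounded:
 fixes f g :: "'a::euclidean_space => real"
 assumes "integrable lborel f" "g : borel_measurable borel" "!!x. abs (g x) <= B"
 shows "integrable lborel (%x. f x * g x)"
proof (rule Bochner_Integration.integrable_bound)
 show "integrable lborel (%x. f x * B)" using assms(1) by simp
 show "AE x in lborel. norm (f x * g x) <= norm (f x * B)"
 proof (rule AE_I2)
  fix x
  have "abs (g x) <= abs B" using assms(3)[of x] by linarith
  thus "norm (f x * g x) <= norm (f x * B)" by (simp add: abs_mult mult_left_mono)
 qed
 show "(%x. f x * g x) : borel_measurable lborel" using assms(1) assms(2) by simp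
qed

lemma conv_continuous:
 assumes w: "integrable lborel w" and K: "cont K" "!!z. abs (K z) <= B"
 shows "continuous_on A (conv K s w)"
proof -
 have "cont (conv K s w)"
  unfolding continuous_on_sequentially comp_def
 proof (intro allI ballI impI)
  fix X :: "nat => 'a" and x assume X: "(ALL n. X n : UNIV) & X ----> x"
  show "(%n. conv K s w (X n)) ----> conv K s w x"
   unfolding conv_def
  proof (rule integral_dominated_convergence[where w = "%y. abs (w y) * B"])
   have m: "(%y. K ((y - x) /R s)) : borel_measurable borel" for x
    by (intro borel_measurable_continuous_onI continuous_on_compose2[OF K(1)] continuous_intros) auto
   show "(%y. w y * K ((y - x) /R s)) : borel_measurable lborel" "(%y. w y * K ((y - X n) /R s)) : borel_measurable lborel" for n
    using w m by (auto intro!: borel_measurable_times)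
   show "integrable lborel (%y. abs (w y) * B)" using w by simp
   have "isCont K z" for z using K(1) by (simp add: continuous_on_eq_continuous_at)
   thus "AE y in lborel. (%n. w y * K ((y - X n) /R s)) ----> w y * K ((y - x) /R s)"
    using X by (intro AE_I2 tendsto_intros isCont_tendsto_compose[where g = K]) auto
   show "AE y in lborel. norm (w y * K ((y - X n) /R s)) <= abs (w y) * B" for n
    using K(2) by (intro AE_I2) (simp add: abs_mult mult_left_mono)
  qed
 qed
 thus ?thesis by (rule continuous_on_subset) simp
qed

lemma conv_line_deriv:
 fixes K K' :: "'a::euclidean_space => real"
 assumes w: "integrable lborel w" and K: "cont K" "!!z. abs (K z) <= B"
  and K': "!!z. abs (K' z) <= B'"
  and d: "!!z. DERIV (%t. K (z + t *R d)) 0 :> K' z" and s: "s > 0"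
 shows "DERIV (%t. conv K s w (x + t *R d)) 0 :> - (conv K' s w x / s)"
proof -
 have "DERIV (%t. LB y. w y * K ((y - (x + t *R d)) /R s)) 0 :> (LB y. w y * (K' ((y - (x + 0 *R d)) /R s) * (- 1 / s)))"
 proof (rule has_real_derivative_integral_dominated[where a = "-1" and b = 1 and g = "%y. abs (w y) * (B' / s)"])
  fix t :: real
  show "integrable lborel (%y. w y * K ((y - (x + t *R d)) /R s))"
   by (rule integrable_mult_bounded[OF w _ K(2)])
    (intro borel_measurable_continuous_onI continuous_on_compose2[OF K(1)] continuous_intros, auto)
  fix y :: 'a
  have "((%u. K ((y - x) /R s + u *R d)) has_real_derivative K' ((y - x) /R s + (- t / s) *R d)) (at (- t / s))"
   by (rule deriv_along_line) (rule d)
  hence "DERIV (%t. K ((y - x) /R s + (- t / s) *R d)) t :> K' ((y - x) /R s + (- t / s) *R d) * (- 1 / s)"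
   by (rule DERIV_chain'[rotated]) (use s in "auto intro!: derivative_eq_intros")
  moreover have "(y - x) /R s + (- t / s) *R d = (y - (x + t *R d)) /R s" for t
   by (simp add: algebra_simps divide_inverse)
  ultimately show "DERIV (%t. w y * K ((y - (x + t *R d)) /R s)) t :> w y * (K' ((y - (x + t *R d)) /R s) * (- 1 / s))" using DERIV_cmult by fastforce
  show "abs (w y * (K' ((y - (x + t *R d)) /R s) * (- 1 / s))) <= abs (w y) * (B' / s)"
   using K' s unfolding abs_mult by (intro mult_left_mono) (auto simp: divide_right_mono)
 qed (use w in auto)
 moreover have "(LB y. w y * (K' ((y - (x + 0 *R d)) /R s) * (- 1 / s))) = - (conv K' s w x / s)"
  by (simp add: conv_def flip: mult.assoc)
 ultimately show ?thesis by (simp add: conv_def)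
qed

lemma kernel_bounded:
 fixes k :: "'a::euclidean_space => real"
 assumes "cont k" "!!z. norm z >= 1 ==> k z = 0"
 obtains B where "!!z. abs (k z) <= B"
proof -
 have "bounded (k ` cball 0 1)"
  using assms(1) by (intro compact_imp_bounded compact_continuous_image) (auto intro: continuous_on_subset)
 then obtain B where B: "B > 0" "!!z. z : cball 0 1 ==> abs (k z) <= B" unfolding bounded_pos by auto
 have "abs (k z) <= B" for z using B assms(2)[of z] by (cases "norm z <= 1") auto
 thus ?thesis by (rule that)
qed

text \<open>By the mean value formula w is, up to a nonzero factor, its own convolution with a smooth bump, so
  derivatives may be put on the kernel.\<close>

lemma helmholtz_regular_local:
 fixes w :: "'a::euclidean_space => real"
 assumes w: "wsol S w (%x. mu * w x)" and mu: "mu >= 0" and S: "open S" and x0: "x0 : S"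
 obtains s G H where "s > 0" "ball x0 s <= S"
  "!!i. continuous_on (ball x0 s) (G i)" "!!i j. continuous_on (ball x0 s) (H i j)"
  "!!i x. x : ball x0 s ==> DERIV (%t. w (x + t *R i)) 0 :> G i x"
  "!!i j x. x : ball x0 s ==> DERIV (%t. G i (x + t *R j)) 0 :> H i j x"
  "!!x. x : ball x0 s ==> (SUM i:Basis. H i i x) = - mu * w x"
proof -
 define m :: nat where "m = 3"
 define N where "N = DIM('a)"
 obtain s1 where s1: "s1 > 0" "cball x0 s1 <= S" using S x0 open_contains_cball by blast
 define s where "s = min (s1 / 3) (1 / (sqrt mu + 1))"
 have s: "s > 0" "3 * s <= s1" "sqrt mu * s <= 1"
 proof -
  show "s > 0" "3 * s <= s1" using s1 mu by (auto simp: s_def add_nonneg_pos)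
  have "sqrt mu * s <= sqrt mu * (1 / (sqrt mu + 1))" using mu by (intro mult_left_mono) (auto simp: s_def)
  also have "... <= 1" using mu by (simp add: divide_le_eq_1 add_nonneg_pos)
  finally show "sqrt mu * s <= 1" .
 qed
 define T where "T = cball x0 (3 * s)"
 have T: "T <= S" using s s1 by (auto simp: T_def subset_iff)
 have cwT: "continuous_on T w" using w T by (auto simp: wsol_def intro: continuous_on_subset)
 define w0 where "w0 y = indicat_real T y * w y" for y
 have w0: "integrable lborel w0"
  using borel_integrable_compact[of T w] cwT by (simp add: w0_def[abs_def] T_def)
 obtain i0 :: 'a where i0: "i0 : Basis" using nonempty_Basis by blast
 define xi where "xi = sqrt mu *R i0"
 have xi: "xi *. xi = mu" using mu i0 by (simp add: xi_def)
 define M0 where "M0 = mean m (%y. cos (xi *. y)) 0 s"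
 have M0: "M0 > 0"
 proof -
  have "mean m (%_. cos 1) (0::'a) s <= M0"
   unfolding M0_def
  proof (rule mean_mono)
   fix y :: 'a assume y: "y : ball 0 s"
   have "abs (xi *. y) <= norm xi * norm y" by (rule Cauchy_Schwarz_ineq2)
   also have "... <= sqrt mu * s" using y i0 mu by (intro mult_mono) (auto simp: xi_def)
   finally have "abs (xi *. y) <= 1" using s by simp
   hence "cos 1 <= cos \<bar>xi *. y\<bar>"
    using pi_gt3 by (intro cos_monotone_0_pi_le) auto
   thus "cos 1 <= cos (xi *. y)" by simp
  qed (use s m_def in "auto intro!: continuous_intros")
  moreover have "cos (1::real) > 0" using pi_gt3 by (intro cos_gt_zero_pi) auto
  ultimately show ?thesis
   using bump_integral_pos[of m, where 'a='a] by (simp add: mean_const m_def) (smt (verit) mult_pos_pos)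
 qed
 have resc: "(LB z. w (x + s *R z) * k z) = conv k s w0 x / s ^ N"
  if x: "x : ball x0 s" and k: "cont k" "!!z. norm z >= 1 ==> k z = 0" for x k
 proof -
  have [measurable]: "w0 : borel_measurable borel" "k : borel_measurable borel"
   using w0 k borel_measurable_continuous_onI by auto
  have "(LB z. w0 (x + s *R z) * k (((x + s *R z) - x) /R s)) = conv k s w0 x / s ^ N"
   unfolding conv_def N_def by (rule lborel_integral_scale[where f = "%y. w0 y * k ((y - x) /R s)"]) (use s in measurable)
  moreover have "w0 (x + s *R z) * k (((x + s *R z) - x) /R s) = w (x + s *R z) * k z" for z
  proof (cases "norm z < 1")
   case True
   have "norm (x0 - (x + s *R z)) <= norm (x0 - x) + norm (s *R z)"
    by (metis diff_diff_eq norm_triangle_ineq4)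
   also have "... <= s + s * 1" using x True s by (intro add_mono) (auto simp: dist_norm)
   finally have "x + s *R z : T" using s by (simp add: T_def dist_norm)
   thus ?thesis using s by (simp add: w0_def)
  qed (use k s in simp)
  ultimately show ?thesis by simp
 qed
 define c where "c = 1 / (s ^ N * M0)"
 define p where "p i z = - 2 * real m * bump (m - 1) z * (z *. i)" for i z :: 'a
 define q where "q i j z = 4 * real m * real (m - 1) * bump (m - 2) z * (z *. i) * (z *. j) - 2 * real m * bump (m - 1) z * (j *. i)" for i j z :: 'a
 have out: "norm z >= 1 ==> p i z = 0" "norm z >= 1 ==> q i j z = 0" "norm z >= 1 ==> bump m z = 0" for i j z
  by (auto simp: p_def q_def bump_outside m_def)
 have cp: "cont (p i)" "cont (q i j)" "cont (bump m :: 'a => real)" for i j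
  unfolding p_def q_def by (intro continuous_intros)+
 have dp: "DERIV (%t. bump m (z + t *R i)) 0 :> p i z"
      "DERIV (%t. p i (z + t *R j)) 0 :> q i j z" for z i j
  unfolding p_def q_def using bump_line_deriv[of m z i] bump_line_deriv2[of m z j i] by (auto simp: m_def)
 define G where "G i x = - (c / s) * conv (p i) s w0 x" for i x
 define H where "H i j x = (c / s^2) * conv (q i j) s w0 x" for i j x
 have rep: "w x = c * conv (bump m) s w0 x" if x: "x : ball x0 s" for x
 proof -
  have "cball x (2 * s) <= S"
  proof -
   have "cball x (2 * s) <= T"
   proof
    fix y assume "y : cball x (2 * s)"
    thus "y : T" using x dist_triangle[of x0 y x] dist_commute T_def by simp
   qed
   thus ?thesis using T by blast
  qed
  hence "mean m w x s = w x * M0"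
   unfolding M0_def using s by (intro helmholtz_mean[OF w xi]) (auto simp: m_def)
  moreover have "mean m w x s = conv (bump m) s w0 x / s ^ N"
   unfolding mean_def by (rule resc[OF x]) (use cp out in auto)
  ultimately show ?thesis using M0 s by (simp add: c_def field_simps)
 qed
 show ?thesis
 proof (rule that[of s G H])
  show "s > 0" by fact
  show "ball x0 s <= S" using T s by (auto simp: T_def subset_iff)
  fix i j
  obtain B where B: "!!z. abs (p i z) <= B" using kernel_bounded[OF cp(1)[of i] out(1)[of _ i]] by blast
  obtain B' where B': "!!z. abs (q i j z) <= B'" using kernel_bounded[OF cp(2)[of i j] out(2)[of _ i j]] by blast
  have Bm: "abs (bump m (z::'a)) <= 1" for z by simp
  show "continuous_on (ball x0 s) (G i)"
   unfolding G_def by (intro continuous_intros conv_continuous[OF w0 cp(1) B])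
  show "continuous_on (ball x0 s) (H i j)"
   unfolding H_def by (intro continuous_intros conv_continuous[OF w0 cp(2) B'])
  fix x assume x: "x : ball x0 s"
  have op: "open ((%t. x + t *R i) -` ball x0 s)"
   by (rule open_vimage) (auto intro!: continuous_intros)
  have "DERIV (%t. c * conv (bump m) s w0 (x + t *R i)) 0 :> G i x" using DERIV_cmult conv_line_deriv[OF w0 cp(3) Bm B dp(1) s(1)] G_def by fastforce
  thus "DERIV (%t. w (x + t *R i)) 0 :> G i x"
   by (rule has_field_derivative_transform_within_open[OF _ op]) (use x rep in auto)
  have "DERIV (%t. - (c / s) * conv (p i) s w0 (x + t *R j)) 0 :> - (c / s) * (- (conv (q i j) s w0 x / s))"
   by (intro DERIV_cmult conv_line_deriv[OF w0 cp(1) B B' dp(2) s(1)])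
  thus "DERIV (%t. G i (x + t *R j)) 0 :> H i j x"
   by (simp add: G_def H_def power2_eq_square)
 next
  fix x assume x: "x : ball x0 s"
  have i: "integrable lborel (%y. w0 y * q i j ((y - x) /R s))" for i j
  proof -
   obtain B' where B': "!!z. abs (q i j z) <= B'" using kernel_bounded[OF cp(2)[of i j] out(2)[of _ i j]] by blast
   show ?thesis
    by (rule integrable_mult_bounded[OF w0 _ B'])
     (intro borel_measurable_continuous_onI continuous_on_compose2[OF cp(2)] continuous_intros, auto)
  qed
  have "(SUM i:Basis. H i i x) = (c / s^2) * (SUM i:Basis. conv (q i i) s w0 x)"
   by (simp add: H_def sum_distrib_left)
  also have "(SUM i:Basis. conv (q i i) s w0 x) = (LB y. (SUM i:Basis. w0 y * q i i ((y - x) /R s)))"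
   unfolding conv_def by (intro Bochner_Integration.integral_sum[symmetric] i)
  also have "... = conv (lap_bump m) s w0 x"
   unfolding conv_def lap_bump_sum[symmetric] q_def sum_distrib_left ..
  also have "conv (lap_bump m) s w0 x / s ^ N = (LB z. w (x + s *R z) * lap_bump m z)"
   by (rule resc[OF x, symmetric]) (auto intro!: continuous_intros simp: m_def lap_bump_outside)
  hence "conv (lap_bump m) s w0 x = s ^ N * (LB z. w (x + s *R z) * lap_bump m z)"
   using s by (simp add: field_simps)
  also have "(LB z. w (x + s *R z) * lap_bump m z) = - s\<^sup>2 * (mu * mean m w x s)"
  proof -
   have "cball x s <= T"
   proof
    fix y assume "y : cball x s"
    thus "y : T" using x dist_triangle[of x0 y x] dist_commute s T_def by simp
   qed
   hence "cball x s <= S" using T by blast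
   hence "(LB z. w (x + s *R z) * lap_bump m z) = - s\<^sup>2 * (LB z. mu * w (x + s *R z) * bump m z)"
    using w s unfolding wsol_def m_def by blast
   thus ?thesis by (simp add: mean_def mult.assoc)
  qed
  also have "mean m w x s = conv (bump m) s w0 x / s ^ N"
   unfolding mean_def by (rule resc[OF x]) (use cp out in auto)
  finally show "(SUM i:Basis. H i i x) = - mu * w x"
   using rep[OF x] s by (simp add: power2_eq_square field_simps)
 qed
qed

lemma helmholtz_regular:
 fixes w :: "'a::euclidean_space => real"
 assumes w: "wsol S w (%x. mu * w x)" and mu: "mu >= 0" and S: "open S"
 obtains g h where
  "!!i. continuous_on S (g i)" "!!i j. continuous_on S (h i j)"
  "!!i x. x : S ==> DERIV (%t. w (x + t *R i)) 0 :> g i x"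
  "!!i j x. x : S ==> DERIV (%t. g i (x + t *R j)) 0 :> h i j x"
  "!!x. x : S ==> (SUM i:Basis. h i i x) = - mu * w x"
proof -
 define g where "g i x = deriv (%t. w (x + t *R i)) 0" for i x
 define h where "h i j x = deriv (%t. g i (x + t *R j)) 0" for i j x
 have loc: "EX s>0. ball x0 s <= S & (ALL i j. continuous_on (ball x0 s) (g i) & continuous_on (ball x0 s) (h i j) &
    DERIV (%t. w (x0 + t *R i)) 0 :> g i x0 &
    DERIV (%t. g i (x0 + t *R j)) 0 :> h i j x0) & (SUM i:Basis. h i i x0) = - mu * w x0"
  if x0: "x0 : S" for x0
 proof -
  obtain s G H where s: "s > 0" "ball x0 s <= S" and
   c: "!!i. continuous_on (ball x0 s) (G i)" "!!i j. continuous_on (ball x0 s) (H i j)" and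
   dG: "!!i x. x : ball x0 s ==> DERIV (%t. w (x + t *R i)) 0 :> G i x" and
   dH: "!!i j x. x : ball x0 s ==> DERIV (%t. G i (x + t *R j)) 0 :> H i j x" and
   L: "!!x. x : ball x0 s ==> (SUM i:Basis. H i i x) = - mu * w x"
   using helmholtz_regular_local[OF w mu S x0] by blast
  have gG: "g i x = G i x" if "x : ball x0 s" for i x
   unfolding g_def by (rule DERIV_imp_deriv) (rule dG[OF that])
  have dg: "DERIV (%t. g i (x + t *R j)) 0 :> H i j x" if x: "x : ball x0 s" for i j x
  proof -
   have op: "open ((%t. x + t *R j) -` ball x0 s)"
    by (rule open_vimage) (auto intro!: continuous_intros)
   show ?thesis
    by (rule has_field_derivative_transform_within_open[OF dH[OF x] op]) (use x gG in auto)
  qed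
  have hH: "h i j x = H i j x" if "x : ball x0 s" for i j x
   unfolding h_def by (rule DERIV_imp_deriv) (rule dg[OF that])
  have x0b: "x0 : ball x0 s" using s by simp
  have "continuous_on (ball x0 s) (g i)" "continuous_on (ball x0 s) (h i j)" for i j
   using c gG hH by (auto cong: continuous_on_cong_simp)
  thus ?thesis
   using s dG[OF x0b] dg[OF x0b] L[OF x0b] gG[OF x0b] hH[OF x0b] by (intro exI[of _ s]) auto
 qed
 have cont: "continuous_on S f" if "!!x0. x0 : S ==> EX s>0. continuous_on (ball x0 s) f" for f :: "'a => real"
 proof (rule continuous_at_imp_continuous_on, rule ballI)
  fix x0 assume "x0 : S"
  from that[OF this] obtain s where "s > 0" "continuous_on (ball x0 s) f" by blast
  thus "isCont f x0" by (simp add: continuous_on_eq_continuous_at)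
 qed
 show ?thesis
 proof (rule that[of g h])
  show "continuous_on S (g i)" for i
  proof (rule cont)
   fix x0 assume "x0 : S" from loc[OF this] show "EX s>0. continuous_on (ball x0 s) (g i)" by blast
  qed
  show "continuous_on S (h i j)" for i j
  proof (rule cont)
   fix x0 assume "x0 : S" from loc[OF this] show "EX s>0. continuous_on (ball x0 s) (h i j)" by blast
  qed
  fix x0 assume "x0 : S"
  from loc[OF this] show "DERIV (%t. w (x0 + t *R i)) 0 :> g i x0"
   "DERIV (%t. g i (x0 + t *R j)) 0 :> h i j x0"
   "(SUM i:Basis. h i i x0) = - mu * w x0" for i j by blast+
 qed
qed

section \<open>Gaussian averages\<close>

lemma integrable_gauss:
 assumes c: "c > 0"
 shows "integrable lborel (%z::'a::euclidean_space. exp (- c * (z *. z)))"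
proof -
 have "integrable lborel (%x. sqrt (2 * pi * (sqrt (1 / (2 * c)))^2) * normal_density 0 (sqrt (1 / (2 * c))) x)"
  by (intro integrable_mult_right integrable_normal_density) (use c in simp)
 moreover have "sqrt (2 * pi * (sqrt (1 / (2 * c)))^2) * normal_density 0 (sqrt (1 / (2 * c))) x = exp (- c * x^2)" for x
  using c by (simp add: normal_density_def field_simps)
 ultimately have 1: "integrable lborel (%x::real. exp (- c * x^2))" by simp
 have ps: "product_sigma_finite (%_::'a. lborel :: real measure)" ..
 have "integrable (Pi\<^sub>M Basis (%_::'a. lborel)) (%f. \<Prod>b\<in>Basis. exp (- c * (f b)^2))"
  by (rule product_sigma_finite.product_integrable_prod[OF ps]) (use 1 in auto)
 moreover have "(\<Prod>b\<in>Basis. exp (- c * (f b)^2)) = exp (- c * ((SUM b:Basis. f b *R b) *. (SUM b:Basis. f b *R b)))" for f :: "'a => real"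
 proof -
  have "(SUM b:Basis. f b *R b) *. (SUM b:Basis. f b *R b) = (SUM b:Basis. (f b)\<^sup>2)"
   by (subst euclidean_inner) (simp add: power2_eq_square)
  thus ?thesis by (simp add: exp_sum sum_distrib_left flip: exp_sum)
 qed
 ultimately have "integrable (Pi\<^sub>M Basis (%_::'a. lborel)) (%f. exp (- c * ((SUM b:Basis. f b *R b) *. (SUM b:Basis. f b *R (b::'a)))))"
  by simp
 thus ?thesis
  by (subst lborel_eq, subst integrable_distr_eq) auto
qed

definition gauss :: "'a::euclidean_space => real" where
 "gauss z = exp (- (z *. z) / 2) / (LB z. exp (- ((z::'a) *. z) / 2))"

lemma gauss_continuous [continuous_intros]: "continuous_on A f ==> continuous_on A (%x. gauss (f x))"
 unfolding gauss_def divide_inverse by (intro continuous_intros)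

lemma gauss_measurable [measurable]: "gauss : borel_measurable borel"
 by (intro borel_measurable_continuous_onI continuous_intros)

lemma integrable_gauss_half: "integrable lborel (%z::'a::euclidean_space. exp (- (z *. z) / 2))"
 using integrable_gauss[of "1/2", where 'a='a] by simp

lemma gauss_norm_pos: "(LB z. exp (- ((z::'a::euclidean_space) *. z) / 2)) > 0"
proof -
 have "0 < (LB z. bump 1 (z::'a)) * exp (-1/2)"
  using bump_integral_pos[of 1, where 'a='a] by simp
 also have "... = (LB z. bump 1 (z::'a) * exp (-1/2))" by simp
 also have "... <= (LB z. exp (- ((z::'a::euclidean_space) *. z) / 2))"
 proof (rule integral_mono)
  fix z :: 'a
  show "bump 1 z * exp (-1/2) <= exp (- (z *. z) / 2)"
  proof (cases "norm z < 1")
   case True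
   hence "z *. z <= 1" by (simp add: dot_square_norm power_le_one)
   hence "bump 1 z * exp (-1/2) <= 1 * exp (- (z *. z) / 2)" by (intro mult_mono) auto
   thus ?thesis by simp
  qed (simp add: bump_outside)
 qed (use integrable_bump[of 1] integrable_gauss_half in auto)
 finally show ?thesis .
qed

lemma gauss_pos: "gauss z > 0" unfolding gauss_def using gauss_norm_pos by (intro divide_pos_pos) auto
lemma gauss_nonneg [simp]: "0 <= gauss z" by (rule less_imp_le[OF gauss_pos])
lemma integrable_gauss' [simp]: "integrable lborel gauss" unfolding gauss_def[abs_def] by (rule integrable_divide, rule integrable_gauss_half)
lemma integral_gauss: "(LB z. gauss (z::'a::euclidean_space)) = 1"
 unfolding gauss_def using gauss_norm_pos[where 'a='a] by simp
lemma gauss_minus: "gauss (- z) = gauss z" by (simp add: gauss_def)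

lemma integrable_norm_gauss [simp]: "integrable lborel (%z::'a::euclidean_space. norm z * gauss z)"
proof (rule Bochner_Integration.integrable_bound)
 define C where "C = (LB z. exp (- ((z::'a) *. z) / 2))"
 have C: "C > 0" unfolding C_def by (rule gauss_norm_pos)
 show "integrable lborel (%z::'a. exp (- (1/4) * (z *. z)) / C)"
  by (intro integrable_divide integrable_gauss) simp
 show "AE z::'a in lborel. norm (norm z * gauss z) <= norm (exp (- (1/4) * (z *. z)) / C)"
 proof (rule AE_I2)
  fix z :: 'a
  have "norm z <= 1 + (norm z)^2 / 4"
   using zero_le_power2[of "1 - norm z / 2"] by (simp add: power2_eq_square algebra_simps)
  also have "... <= exp ((z *. z) / 4)" using exp_ge_add_one_self[of "(z *. z) / 4"] by (simp add: dot_square_norm)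
  finally have "norm z * exp (- (z *. z) / 2) <= exp ((z *. z) / 4) * exp (- (z *. z) / 2)"
   by (intro mult_right_mono) auto
  also have "... = exp (- (1/4) * (z *. z))" by (simp flip: exp_add)
  finally have "norm z * exp (- (z *. z) / 2) / C <= exp (- (1/4) * (z *. z)) / C"
   using C by (intro divide_right_mono) auto
  moreover have "norm z * gauss z = norm z * exp (- (z *. z) / 2) / C"
   unfolding gauss_def C_def by simp
  ultimately show "norm (norm z * gauss z) <= norm (exp (- (1/4) * (z *. z)) / C)"
   using C gauss_pos[of z] by (simp only: real_norm_def abs_mult abs_divide) simp
 qed
qed simp

lemma gauss_line_deriv: "DERIV (%t. gauss (z + t *R i)) 0 :> - (z *. i) * gauss z"
proof -
 define C where "C = (LB z. exp (- ((z::'a) *. z) / 2))"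
 have e: "gauss (z + t *R i) = exp (- (z *. z + 2 * t * (z *. i) + t * t * (i *. i)) / 2) / C" for t
  by (simp add: gauss_def C_def inner_add_left inner_add_right inner_commute algebra_simps)
 have "DERIV (%t. exp (- (z *. z + 2 * t * (z *. i) + t * t * (i *. i)) / 2)) 0 :> exp (- (z *. z) / 2) * (- (z *. i))"
  by (auto intro!: derivative_eq_intros)
 hence "DERIV (%t. exp (- (z *. z + 2 * t * (z *. i) + t * t * (i *. i)) / 2) / C) 0 :> exp (- (z *. z) / 2) * (- (z *. i)) / C"
  by (rule DERIV_cdivide)
 thus ?thesis unfolding e by (simp add: gauss_def C_def mult.commute)
qed

text \<open>The radial cut-offs bump 2 (z / R) make the integrand compactly supported; R tends to infinity.\<close>

lemma gauss_by_parts: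
 fixes h h' :: "'a::euclidean_space => real"
 assumes i: "i : Basis" and h: "cont h" "!!z. abs (h z) <= B"
  and h': "cont h'" "!!z. abs (h' z) <= B'"
  and d: "!!z. DERIV (%t. h (z + t *R i)) 0 :> h' z"
 shows "(LB z. h z * (z *. i) * gauss z) = (LB z. h' z * gauss z)"
proof -
 have B: "B >= 0" "B' >= 0" using h(2)[of 0] h'(2)[of 0] by linarith+
 define R where "R n = real n + 1" for n
 have R: "R n >= 1" for n by (simp add: R_def)
 define G' where "G' n z = h' z * gauss z * bump 2 (z /R R n) - h z * ((z *. i) * gauss z) * bump 2 (z /R R n)
    + h z * gauss z * (- 4 * bump 1 (z /R R n) * ((z /R R n) *. i) / R n)" for n z
 have int0: "(LB z. G' n z) = 0" for n
 proof (rule integral_partial_derivative_eq_0[OF i, where G = "%z. h z * gauss z * bump 2 (z /R R n)" and K = "cball 0 (R n)"])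
  fix z
  have "DERIV (%t. bump 2 (z /R R n + (t / R n) *R i)) 0 :> (- 4 * bump 1 (z /R R n) * ((z /R R n) *. i)) * (1 / R n)"
   by (rule DERIV_chain'[where g = "%t. bump 2 (z /R R n + t *R i)" and f = "%t. t / R n"])
    (use bump_line_deriv[of 2 "z /R R n" i] R[of n] in \<open>auto intro!: derivative_eq_intros simp: numeral_2_eq_2\<close>)
  moreover have "z /R R n + (t / R n) *R i = (z + t *R i) /R R n" for t
   by (simp add: scaleR_add_right divide_inverse mult.commute)
  ultimately have b: "DERIV (%t. bump 2 ((z + t *R i) /R R n)) 0 :> (- 4 * bump 1 (z /R R n) * ((z /R R n) *. i)) / R n"
   by simp
  show "DERIV (%t. h (z + t *R i) * gauss (z + t *R i) * bump 2 ((z + t *R i) /R R n)) 0 :> G' n z"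
   using DERIV_mult[OF DERIV_mult[OF d[of z] gauss_line_deriv[of z i]] b]
   by (rule DERIV_cong) (simp add: G'_def algebra_simps)
 next
  show "h z * gauss z * bump 2 (z /R R n) = 0" if "z ~: cball 0 (R n)" for z
  proof -
   have "norm (z /R R n) >= 1" using that R[of n] by (simp add: field_simps)
   thus ?thesis by (simp add: bump_outside)
  qed
  show "cont (%z. h z * gauss z * bump 2 (z /R R n))" "cont (G' n)"
   unfolding G'_def using h h' R[of n] by (intro continuous_intros; auto)+
 qed simp
 have hm[measurable]: "h : borel_measurable borel" "h' : borel_measurable borel"
  using h h' by (auto intro: borel_measurable_continuous_onI)
 have lim: "(%n. G' n z) ----> h' z * gauss z - h z * ((z *. i) * gauss z)" for z
 proof -
  have r: "(%n. 1 / R n) ----> 0" unfolding R_def by real_asymp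
  hence "(%n. (1 / R n) *R z) ----> 0 *R z" by (intro tendsto_intros)
  hence s: "(%n. z /R R n) ----> 0" by (simp add: divide_inverse)
  have cb: "isCont (bump m) (0::'a)" for m
   using continuous_on_bump[of UNIV "%x::'a. x" m] by (simp add: continuous_on_eq_continuous_at)
  have b: "(%n. bump m (z /R R n)) ----> 1" for m
   using isCont_tendsto_compose[OF cb s, of m] by simp
  have "(%n. h' z * gauss z * bump 2 (z /R R n) - h z * ((z *. i) * gauss z) * bump 2 (z /R R n)
    + h z * gauss z * (- 4 * bump 1 (z /R R n) * ((z /R R n) *. i) * (1 / R n)))
   ----> h' z * gauss z * 1 - h z * ((z *. i) * gauss z) * 1 + h z * gauss z * (- 4 * 1 * (0 *. i) * 0)"
   by (intro tendsto_intros b s r)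
  thus ?thesis by (simp add: G'_def)
 qed
 have i1: "integrable lborel (%z. h' z * gauss z)"
  using integrable_mult_bounded[OF integrable_gauss' hm(2) h'(2)] by (simp add: mult.commute)
 have zi: "abs (z *. i) <= norm z" for z using Basis_le_norm[OF i] by simp
 have i2: "integrable lborel (%z. h z * ((z *. i) * gauss z))"
 proof (rule Bochner_Integration.integrable_bound)
  show "integrable lborel (%z::'a. B * (norm z * gauss z))" using integrable_norm_gauss by simp
  show "AE z in lborel. norm (h z * ((z *. i) * gauss z)) <= norm (B * (norm z * gauss z))"
   using h(2) zi B gauss_pos by (intro AE_I2) (simp add: abs_mult mult_mono less_imp_le)
 qed simp
 have "(%n. LB z. G' n z) ----> (LB z. h' z * gauss z - h z * ((z *. i) * gauss z))"
 proof (rule integral_dominated_convergence[where w = "%z. B' * gauss z + B * (norm z * gauss z) + 4 * B * (norm z * gauss z)"])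
  show "integrable lborel (%z::'a. B' * gauss z + B * (norm z * gauss z) + 4 * B * (norm z * gauss z))"
   using integrable_norm_gauss integrable_gauss' by (intro Bochner_Integration.integrable_add integrable_mult_right)
  show "AE z in lborel. norm (G' n z) <= B' * gauss z + B * (norm z * gauss z) + 4 * B * (norm z * gauss z)" for n
  proof (rule AE_I2)
   fix z :: 'a
   have g: "gauss z >= 0" using gauss_pos[of z] by simp
   have t1: "abs (h' z * gauss z * bump 2 (z /R R n)) <= B' * gauss z * 1"
    unfolding abs_mult using g B h'(2)[of z] by (intro mult_mono) auto
   have t2: "abs (h z * ((z *. i) * gauss z) * bump 2 (z /R R n)) <= B * (norm z * gauss z) * 1"
    unfolding abs_mult using g B h(2)[of z] zi[of z] by (intro mult_mono) auto
   have t3: "abs (h z * gauss z * (- 4 * bump 1 (z /R R n) * ((z /R R n) *. i) / R n)) <= B * gauss z * (4 * norm z)"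
   proof -
    have "abs (- 4 * bump 1 (z /R R n) * ((z /R R n) *. i) / R n) = 4 * bump 1 (z /R R n) * (abs (z *. i) / (R n * R n))"
     using R[of n] by (simp add: abs_mult divide_inverse)
    also have "... <= 4 * 1 * (norm z / 1)"
    proof (intro mult_mono frac_le zi)
     show "1 <= R n * R n" using R[of n] mult_mono[of 1 "R n" 1 "R n"] by simp
    qed auto
    finally show ?thesis
     unfolding abs_mult[of "h z * gauss z"] using g B h(2)[of z] by (intro mult_mono) (auto simp: abs_mult intro!: mult_mono)
   qed
   have "abs (a - b + c) <= abs a + abs b + abs c" for a b c :: real by linarith
   hence "norm (G' n z) <= abs (h' z * gauss z * bump 2 (z /R R n)) + abs (h z * ((z *. i) * gauss z) * bump 2 (z /R R n))
     + abs (h z * gauss z * (- 4 * bump 1 (z /R R n) * ((z /R R n) *. i) / R n))"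
    unfolding G'_def real_norm_def .
   also have "... <= B' * gauss z * 1 + B * (norm z * gauss z) * 1 + B * gauss z * (4 * norm z)"
    by (intro add_mono t1 t2 t3)
   finally show "norm (G' n z) <= B' * gauss z + B * (norm z * gauss z) + 4 * B * (norm z * gauss z)"
    by (simp add: mult_ac)
  qed
 qed (use lim in "auto simp: G'_def")
 hence "(LB z. h' z * gauss z - h z * ((z *. i) * gauss z)) = 0"
  unfolding int0 by (simp add: LIMSEQ_const_iff)
 thus ?thesis using i1 i2 by (simp add: mult.assoc)
qed

section \<open>The Yukawa measure\<close>

definition gaussM :: "'a::euclidean_space measure" where
 "gaussM = density lborel (%z. ennreal (gauss z))"

definition expM :: "real measure" where
 "expM = density lborel (%x. ennreal (exponential_density 1 x))"

text \<open>The law of sqrt(2 tau) z for a Gaussian vector z and an exponential time tau; its density is the Yukawa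
  potential.\<close>

definition yukM :: "'a::euclidean_space measure" where
 "yukM = distr (expM \<Otimes>\<^sub>M gaussM) borel (%(tau, z). sqrt (2 * tau) *R z)"

lemma sets_gaussM [simp, measurable_cong]: "sets gaussM = sets borel" by (simp add: gaussM_def)
lemma sets_expM [simp, measurable_cong]: "sets expM = sets borel" by (simp add: expM_def)
lemma sets_yukM [simp, measurable_cong]: "sets yukM = sets borel" by (simp add: yukM_def)
lemma space_yukM [simp]: "space yukM = UNIV" by (simp add: yukM_def)
lemma space_gaussM [simp]: "space gaussM = UNIV" by (simp add: gaussM_def)
lemma space_expM [simp]: "space expM = UNIV" by (simp add: expM_def)

lemma prob_gaussM: "prob_space (gaussM :: 'a::euclidean_space measure)"
proof
 have "emeasure (gaussM :: 'a measure) (space gaussM) = (\<integral>\<^sup>+ z. ennreal (gauss (z::'a)) \<partial>lborel)"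
  by (simp add: gaussM_def emeasure_density)
 also have "... = ennreal (LB z. gauss (z::'a))"
  by (rule nn_integral_eq_integral[OF integrable_gauss']) (use gauss_pos less_imp_le in auto)
 finally show "emeasure (gaussM :: 'a measure) (space gaussM) = 1" by (simp add: integral_gauss)
qed

lemma prob_expM: "prob_space expM"
 unfolding expM_def by (rule prob_space_exponential_density) simp

lemma prob_yukM: "prob_space (yukM :: 'a::euclidean_space measure)"
 unfolding yukM_def
 by (rule prob_space.prob_space_distr[OF prob_space_pair[OF prob_expM prob_gaussM]]) measurable

lemma integrable_yukM:
 fixes g :: "'a::euclidean_space => real"
 assumes "g : borel_measurable borel" "!!x. abs (g x) <= B"
 shows "integrable yukM g"
proof -
 interpret prob_space "yukM :: 'a measure" by (rule prob_yukM)
 show ?thesis by (rule integrable_const_bound[where B = B]) (use assms in auto)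
qed

lemma integral_yukM:
 fixes g :: "'a::euclidean_space => real"
 assumes g[measurable]: "g : borel_measurable borel" and B: "!!x. abs (g x) <= B"
 shows "(LINT x|yukM. g x) = (LINT tau|expM. LINT z|gaussM. g (sqrt (2 * tau) *R z))"
proof -
 interpret e: prob_space expM by (rule prob_expM)
 interpret p: prob_space "gaussM :: 'a measure" by (rule prob_gaussM)
 interpret ep: pair_prob_space expM "gaussM :: 'a measure" ..
 have "(LINT x|yukM. g x) = (LINT p|(expM \<Otimes>\<^sub>M gaussM). g (case p of (tau, z) => sqrt (2 * tau) *R z))"
  unfolding yukM_def by (rule integral_distr) auto
 also have "... = (LINT tau|expM. LINT z|gaussM. g (case (tau, z) of (tau, z) => sqrt (2 * tau) *R z))"
  by (rule ep.integral_fst'[symmetric], rule ep.P.integrable_const_bound[where B = B]) (use B in auto)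
 finally show ?thesis by simp
qed

lemma integral_gaussM:
 fixes g :: "'a::euclidean_space => real"
 assumes "g : borel_measurable borel"
 shows "(LINT z|gaussM. g z) = (LB z. g z * gauss z)"
 unfolding gaussM_def using assms
 by (subst integral_density) (auto simp: mult.commute intro!: AE_I2 less_imp_le[OF gauss_pos])

definition test_fun :: "('a::euclidean_space => real) => ('a => real) => bool" where
 "test_fun phi L \<longleftrightarrow> (EX g h B. (ALL x. (phi has_derivative (%v. g x *. v)) (at x)) & cont g &
   (ALL i:Basis. cont (h i) & (ALL x. abs (h i x) <= B & DERIV (%t. g (x + t *R i) *. i) 0 :> h i x)) &
   (ALL x. abs (phi x) <= B & norm (g x) <= B & L x = (SUM i:Basis. h i x)))"

lemma test_fun_facts:
 assumes "test_fun phi L"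
 shows "cont phi" "cont L" "EX B. ALL x. abs (phi x) <= B" "EX B. ALL x. abs (L x) <= B"
proof -
 obtain g h B where *: "ALL x. (phi has_derivative (%v. g x *. v)) (at x)"
  "ALL i:Basis. cont (h i) & (ALL x. abs (h i x) <= B & DERIV (%t. g (x + t *R i) *. i) 0 :> h i x)"
   "ALL x. abs (phi x) <= B & norm (g x) <= B & L x = (SUM i:Basis. h i x)"
  using assms unfolding test_fun_def by (elim exE conjE) (rule that)
 hence d: "!!x. (phi has_derivative (%v. g x *. v)) (at x)" and h: "!!i. i : Basis ==> cont (h i)"
  "!!i x. i : Basis ==> abs (h i x) <= B" and b: "!!x. abs (phi x) <= B" and L: "!!x. L x = (SUM i:Basis. h i x)"
  by blast+
 show "cont phi" using d by (meson continuous_at_imp_continuous_on has_derivative_continuous)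
 show "cont L" by (simp add: L h continuous_intros)
 show "EX B. ALL x. abs (phi x) <= B" using b by blast
 have "abs (L x) <= (SUM i:(Basis::'a set). B)" for x
  unfolding L using h(2) by (intro order_trans[OF sum_abs] sum_mono) auto
 thus "EX B. ALL x. abs (L x) <= B" by blast
qed

text \<open>Let Phi(tau) be the Gaussian average at time tau. It solves the heat equation, so its derivative is the
  average of L; integrating against the exponential density by parts leaves the value at time 0.\<close>

lemma yukM_test_fun_0:
 fixes phi L :: "'a::euclidean_space => real"
 assumes t: "test_fun phi L"
 shows "(LINT x|yukM. phi x - L x) = phi 0"
proof -
 obtain g h B where d: "!!x. (phi has_derivative (%v. g x *. v)) (at x)" and cg: "cont g"
  and h: "!!i. i : Basis ==> cont (h i)"
  and hB: "!!i x. i : Basis ==> abs (h i x) <= B"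
  and dh: "!!i x. i : Basis ==> DERIV (%t. g (x + t *R i) *. i) 0 :> h i x"
  and b: "!!x. abs (phi x) <= B" "!!x. norm (g x) <= B" and L: "!!x. L x = (SUM i:Basis. h i x)"
 proof -
  obtain g h B where "ALL x. (phi has_derivative (%v. g x *. v)) (at x)" "cont g"
   "ALL i:Basis. cont (h i) & (ALL x. abs (h i x) <= B & DERIV (%t. g (x + t *R i) *. i) 0 :> h i x)"
   "ALL x. abs (phi x) <= B & norm (g x) <= B & L x = (SUM i:Basis. h i x)"
   using assms unfolding test_fun_def by (elim exE conjE) (rule that)
  thus ?thesis by (intro that[of g h B]) blast+
 qed
 note facts = test_fun_facts[OF t]
 obtain BL where BL: "!!x. abs (L x) <= BL" using facts(4) by blast
 have B0: "B >= 0" using b(1)[of 0] by linarith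
 have m[measurable]: "phi : borel_measurable borel" "L : borel_measurable borel" "g : borel_measurable borel"
  using facts cg by (auto intro: borel_measurable_continuous_onI)
 define Phi where "Phi f tau = (LB z. f (sqrt (2 * tau) *R z) * gauss (z::'a))" for f tau
 have int: "integrable lborel (%z. f (s *R z) * gauss z)" if [measurable]: "f : borel_measurable borel" and "!!x. abs (f x) <= C" for f :: "'a => real" and s C
  using integrable_mult_bounded[OF integrable_gauss', of "%z. f (s *R z)" C] that by (simp add: mult.commute)
 have Phib: "abs (Phi f tau) <= C" if [measurable]: "f : borel_measurable borel" and "!!x. abs (f x) <= C" for f tau C
 proof -
  have "abs (Phi f tau) <= (LB z. C * gauss (z::'a))"
   unfolding Phi_def
  proof (rule integral_abs_bound_integral)
   show "integrable lborel (%z. f (sqrt (2 * tau) *R z) * gauss z)" by (rule int) (use that in auto)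
   show "abs (f (sqrt (2 * tau) *R z) * gauss z) <= C * gauss z" for z
    using that(2) gauss_pos[of z] by (simp add: abs_mult)
  qed (use integrable_gauss' in simp)
  thus ?thesis by (simp add: integral_gauss)
 qed
 have Phic: "((%t. Phi f t) \<longlongrightarrow> Phi f tau) (at tau within A)" if f: "cont f" "!!x. abs (f x) <= C" for f tau C A
  unfolding tendsto_at_iff_sequentially comp_def Phi_def
 proof (intro allI impI)
  have [measurable]: "f : borel_measurable borel" using f by (auto intro: borel_measurable_continuous_onI)
  fix X assume X: "ALL i. X i : A - {tau}" "X ----> tau"
  show "(%i. LB z. f (sqrt (2 * X i) *R z) * gauss (z::'a)) ----> (LB z. f (sqrt (2 * tau) *R z) * gauss z)"
  proof (rule integral_dominated_convergence[where w = "%z::'a. C * gauss z"])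
   have "isCont f x" for x using f(1) by (simp add: continuous_on_eq_continuous_at)
   thus "AE z in lborel. (%i. f (sqrt (2 * X i) *R z) * gauss z) ----> f (sqrt (2 * tau) *R z) * gauss z"
    by (intro AE_I2 tendsto_intros isCont_tendsto_compose[where g = f] X(2))
   show "AE z in lborel. norm (f (sqrt (2 * X i) *R z) * gauss z) <= C * gauss z" for i
    using f(2) by (intro AE_I2) (simp add: abs_mult mult_right_mono)
  qed (use integrable_gauss' in auto)
 qed
 have dPhi: "DERIV (%t. Phi phi t) tau :> Phi L tau" if tau: "tau > 0" for tau
 proof -
  define s where "s = sqrt (2 * tau)"
  have s: "s > 0" using tau by (simp add: s_def)
  have "DERIV (%t. LB z. phi (sqrt (2 * t) *R z) * gauss (z::'a)) tau :> (LB z. (g (sqrt (2 * tau) *R z) *. z) / sqrt (2 * tau) * gauss z)"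
  proof (rule has_real_derivative_integral_dominated[where a = "tau/2" and b = "2*tau" and g = "%z. (B / sqrt tau) * (norm z * gauss z)"])
   fix t assume t: "t : {tau/2<..<2*tau}"
   hence t0: "t > 0" using tau by auto
   show "integrable lborel (%z::'a. phi (sqrt (2 * t) *R z) * gauss z)" by (rule int) (use b in auto)
   fix z :: 'a
   have "DERIV (%t. sqrt (2 * t)) t :> (1 / sqrt (2 * t))"
    using t0 by (auto intro!: derivative_eq_intros simp: field_simps)
   hence "((%t. sqrt (2 * t) *R z) has_vector_derivative (1 / sqrt (2 * t)) *R z) (at t)"
    using has_vector_derivative_scaleR[of "%t. sqrt (2 * t)" "1 / sqrt (2 * t)" t UNIV "%_. z" 0] by simp
   from vector_derivative_diff_chain_within[where S = UNIV, OF this has_derivative_at_withinI[OF d]]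
   show "DERIV (%t. phi (sqrt (2 * t) *R z) * gauss z) t :> (g (sqrt (2 * t) *R z) *. z) / sqrt (2 * t) * gauss z" by (simp add: has_real_derivative_iff_has_vector_derivative o_def derivative_eq_intros)
   have "abs (g (sqrt (2 * t) *R z) *. z) / sqrt (2 * t) <= (B * norm z) / sqrt tau"
   proof (intro frac_le)
    show "abs (g (sqrt (2 * t) *R z) *. z) <= B * norm z"
     using Cauchy_Schwarz_ineq2[of "g (sqrt (2 * t) *R z)" z] b(2)[of "sqrt (2 * t) *R z"]
     by (meson mult_right_mono norm_ge_zero order_trans)
   qed (use t tau B0 in auto)
   from mult_right_mono[OF this gauss_nonneg[of z]]
   show "abs ((g (sqrt (2 * t) *R z) *. z) / sqrt (2 * t) * gauss z) <= (B / sqrt tau) * (norm z * gauss z)"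
    using t0 by (simp add: abs_mult mult_ac)
  qed (use tau integrable_norm_gauss in auto)
  moreover have "(LB z. (g (sqrt (2 * tau) *R z) *. z) / sqrt (2 * tau) * gauss (z::'a)) = Phi L tau"
  proof -
   have gi: "abs (g x *. i) <= B" if "i : Basis" for x i
    using Basis_le_norm[OF that, of "g x"] b(2)[of x] by linarith
   have key: "(LB z. (g (s *R z) *. i) * (z *. i) * gauss z) = s * (LB z. h i (s *R z) * gauss z)" if i: "i : Basis" for i
   proof -
    have "(LB z. (g (s *R z) *. i) * (z *. i) * gauss z) = (LB z. (s * h i (s *R z)) * gauss z)"
    proof (rule gauss_by_parts[OF i])
     show "cont (%z. g (s *R z) *. i)" "cont (%z. s * h i (s *R z))"
      using cg h[OF i] by (auto intro!: continuous_intros continuous_on_compose2[of UNIV g] continuous_on_compose2[of UNIV "h i"])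
     show "abs (g (s *R z) *. i) <= B" "abs (s * h i (s *R z)) <= s * B" for z
      using gi[OF i] hB[OF i] s by (auto simp: abs_mult)
     fix z
     have "DERIV (%t. g (s *R z + (s * t) *R i) *. i) 0 :> h i (s *R z) * s"
      by (rule DERIV_chain'[where g = "%t. g (s *R z + t *R i) *. i" and f = "%t. s * t"])
       (use dh[OF i, of "s *R z"] in \<open>auto intro!: derivative_eq_intros\<close>)
     thus "DERIV (%t. g (s *R (z + t *R i)) *. i) 0 :> s * h i (s *R z)"
      by (simp add: scaleR_add_right mult.commute)
    qed
    also have "... = s * (LB z. h i (s *R z) * gauss z)" by (simp add: mult.assoc)
    finally show ?thesis .
   qed
   have i1: "integrable lborel (%z. (g (s *R z) *. i) * (z *. i) * gauss z)" if i: "i : Basis" for i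
   proof (rule Bochner_Integration.integrable_bound)
    show "integrable lborel (%z::'a. B * (norm z * gauss z))" using integrable_norm_gauss by simp
    show "AE z in lborel. norm ((g (s *R z) *. i) * (z *. i) * gauss z) <= norm (B * (norm z * gauss z))"
     using gi[OF i] Basis_le_norm[OF i] B0 gauss_pos
     by (intro AE_I2) (simp add: abs_mult mult.assoc[symmetric] mult_mono less_imp_le)
   qed simp
   have i2: "integrable lborel (%z. h i (s *R z) * gauss z)" if i: "i : Basis" for i
    by (rule int[OF borel_measurable_continuous_onI[OF h[OF i]] hB[OF i]])
   have e: "(g (s *R z) *. z) / s * gauss z = (1 / s) * (SUM i:Basis. (g (s *R z) *. i) * (z *. i) * gauss z)" for z
    by (subst euclidean_inner) (simp add: sum_distrib_right sum_divide_distrib)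
   have "(LB z. (g (s *R z) *. z) / s * gauss z) = (LB z. (1 / s) * (SUM i:Basis. (g (s *R z) *. i) * (z *. i) * gauss z))"
    unfolding e ..
   also have "... = (1 / s) * (LB z. (SUM i:Basis. (g (s *R z) *. i) * (z *. i) * gauss z))" by simp
   also have "(LB z. (SUM i:Basis. (g (s *R z) *. i) * (z *. i) * gauss z)) = (SUM i:Basis. s * (LB z. h i (s *R z) * gauss z))"
    using i1 key by (simp add: Bochner_Integration.integral_sum)
   also have "... = s * (LB z. (SUM i:Basis. h i (s *R z) * gauss z))"
    using i2 by (simp add: Bochner_Integration.integral_sum sum_distrib_left)
   also have "... = s * Phi L tau" by (simp add: Phi_def L s_def sum_distrib_right)
   finally show ?thesis using s by (simp add: s_def)
  qed
  ultimately show ?thesis by (simp add: Phi_def)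
 qed
 have Phi0: "Phi phi 0 = phi 0" by (simp add: Phi_def integral_gauss)
 have inner: "(LINT z|gaussM. phi (sqrt (2 * tau) *R z) - L (sqrt (2 * tau) *R z)) = Phi phi tau - Phi L tau" for tau
 proof -
  have "(LINT z|gaussM. phi (sqrt (2 * tau) *R z) - L (sqrt (2 * tau) *R z))
    = (LB z. phi (sqrt (2 * tau) *R z) * gauss z - L (sqrt (2 * tau) *R z) * gauss z)"
   by (subst integral_gaussM) (auto simp: left_diff_distrib)
  also have "... = Phi phi tau - Phi L tau"
   unfolding Phi_def by (intro Bochner_Integration.integral_diff int[OF _ b(1)] int[OF _ BL]) auto
  finally show ?thesis .
 qed
 have contPhi: "cont (%tau. Phi phi tau - Phi L tau)"
  unfolding continuous_on_def using Phic[OF facts(1) b(1)] Phic[OF facts(2) BL] by (auto intro!: tendsto_intros)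
 hence [measurable]: "(%tau. Phi phi tau - Phi L tau) : borel_measurable borel" by (rule borel_measurable_continuous_onI)
 have "(LINT x|yukM. phi x - L x) = (LINT tau|expM. Phi phi tau - Phi L tau)"
 proof -
  have "abs (phi x - L x) <= B + BL" for x using b(1)[of x] BL[of x] by linarith
  hence "(LINT x|yukM. phi x - L x) = (LINT tau|expM. LINT z|gaussM. phi (sqrt (2 * tau) *R z) - L (sqrt (2 * tau) *R z))"
   by (intro integral_yukM) auto
  thus ?thesis by (simp add: inner)
 qed
 also have "... = (LB tau. exponential_density 1 tau * (Phi phi tau - Phi L tau))"
  unfolding expM_def by (subst integral_density) (auto simp: exponential_density_def)
 also have "... = (LB tau. indicator (einterval 0 \<infinity>) tau *R (exp (- tau) * (Phi phi tau - Phi L tau)))"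
 proof (rule integral_cong_AE)
  have "AE tau in lborel. tau ~= (0::real)" by (rule AE_lborel_singleton)
  thus "AE tau in lborel. exponential_density 1 tau * (Phi phi tau - Phi L tau) = indicator (einterval 0 \<infinity>) tau *R (exp (- tau) * (Phi phi tau - Phi L tau))"
   by eventually_elim (auto simp: exponential_density_def indicator_def einterval_def zero_ereal_def)
 qed auto
 also have "... = (LBINT tau=0..\<infinity>. exp (- tau) * (Phi phi tau - Phi L tau))"
  by (simp add: interval_lebesgue_integral_def set_lebesgue_integral_def)
 also have "... = 0 - (- phi 0)"
 proof (rule interval_integral_FTC_integrable[where F = "%tau. - exp (- tau) * Phi phi tau"])
  fix tau :: real assume "0 < ereal tau"
  hence tau: "tau > 0" by simp
  have "DERIV (%tau. - exp (- tau) * Phi phi tau) tau :> exp (- tau) * Phi phi tau + - exp (- tau) * Phi L tau"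
   using dPhi[OF tau] by (auto intro!: derivative_eq_intros)
  thus "((%tau. - exp (- tau) * Phi phi tau) has_vector_derivative exp (- tau) * (Phi phi tau - Phi L tau)) (at tau)"
   by (simp add: has_real_derivative_iff_has_vector_derivative algebra_simps)
  have "isCont (%tau. Phi phi tau - Phi L tau) tau" using contPhi by (simp add: continuous_on_eq_continuous_at)
  thus "isCont (%tau. exp (- tau) * (Phi phi tau - Phi L tau)) tau"
   by (rule continuous_mult[rotated]) (intro continuous_intros)
 next
  have "integrable lborel (%tau. exponential_density 1 tau * (Phi phi tau - Phi L tau))"
  proof (rule integrable_mult_bounded)
   interpret prob_space expM by (rule prob_expM)
   have "integrable expM (%_. 1::real)" by simp
   thus "integrable lborel (exponential_density 1)"
    unfolding expM_def by (subst (asm) integrable_density) (auto simp: exponential_density_def[abs_def])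
   show "abs (Phi phi tau - Phi L tau) <= B + BL" for tau
    using Phib[of phi B tau] Phib[of L BL tau] b(1) BL by force
  qed simp
  thus "set_integrable lborel (einterval 0 \<infinity>) (%tau. exp (- tau) * (Phi phi tau - Phi L tau))"
   unfolding set_integrable_def
  proof (rule integrable_cong_AE_imp)
   have "AE tau in lborel. tau ~= (0::real)" by (rule AE_lborel_singleton)
   thus "AE tau in lborel. exponential_density 1 tau * (Phi phi tau - Phi L tau) = indicator (einterval 0 \<infinity>) tau *R (exp (- tau) * (Phi phi tau - Phi L tau))"
    by eventually_elim (auto simp: exponential_density_def indicator_def einterval_def zero_ereal_def)
  qed simp
  have "((%tau. - exp (- tau) * Phi phi tau) \<longlongrightarrow> - exp (- 0) * Phi phi 0) (at_right 0)"
   using Phic[OF facts(1) b(1)] by (intro tendsto_intros)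
  hence "((%tau. - exp (- tau) * Phi phi tau) \<longlongrightarrow> - phi 0) (at_right 0)" by (simp add: Phi0)
  thus "(((%tau. - exp (- tau) * Phi phi tau) \<circ> real_of_ereal) \<longlongrightarrow> - phi 0) (at_right 0)"
   unfolding zero_ereal_def by (simp add: ereal_tendsto_simps)
  have "((%tau. - exp (- tau) * Phi phi tau) \<longlongrightarrow> 0) at_top"
  proof (rule tendsto_0_le[where K = B])
   show "((%tau::real. exp (- tau)) \<longlongrightarrow> 0) at_top" by real_asymp
   show "\<forall>\<^sub>F tau in at_top. norm (- exp (- tau) * Phi phi tau) <= norm (exp (- tau)) * B"
    using Phib[of phi B] b(1) by (intro always_eventually allI) (simp add: abs_mult)
  qed
  thus "(((%tau. - exp (- tau) * Phi phi tau) \<circ> real_of_ereal) \<longlongrightarrow> 0) (at_left \<infinity>)"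
   by (simp add: ereal_tendsto_simps)
 qed simp
 finally show ?thesis by simp
qed

section \<open>The Yukawa operator\<close>

definition bcont :: "('a::euclidean_space => real) => bool" where
 "bcont g \<longleftrightarrow> cont g & (EX B. ALL x. abs (g x) <= B)"

text \<open>The inverse of 1 - a^2 times the Laplacian.\<close>

definition yuk :: "real => ('a::euclidean_space => real) => 'a => real" where
 "yuk a g x = (LINT xi|yukM. g (x + a *R xi))"

lemma bcontD: "bcont g ==> cont g" "bcont g ==> g : borel_measurable borel"
 by (auto simp: bcont_def intro: borel_measurable_continuous_onI)

lemma bcont_bound: "bcont g ==> (!!B. B >= 0 ==> (!!x. abs (g x) <= B) ==> P) ==> P"
 unfolding bcont_def by (metis abs_ge_zero order_trans)

lemma bcontI: "cont g ==> (!!x. abs (g x) <= B) ==> bcont g"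
 by (auto simp: bcont_def)

lemma bcont_const [simp]: "bcont (%_. c)" by (rule bcontI[of _ "abs c"]) auto

lemma bcont_add:
 assumes "bcont f" "bcont g" shows "bcont (%x. f x + g x)"
proof -
 from assms obtain B C where "!!x. abs (f x) <= B" "!!x. abs (g x) <= C" unfolding bcont_def by blast
 hence "abs (f x + g x) <= B + C" for x by (meson abs_triangle_ineq add_mono order_trans)
 thus ?thesis using assms by (intro bcontI[of _ "B + C"] continuous_intros) (auto dest: bcontD)
qed

lemma bcont_mult:
 assumes "bcont f" "bcont g" shows "bcont (%x. f x * g x)"
proof -
 from assms obtain B C where BC: "B >= 0" "!!x. abs (f x) <= B" "!!x. abs (g x) <= C" by (metis bcont_bound)
 hence "abs (f x * g x) <= B * C" for x unfolding abs_mult by (intro mult_mono) auto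
 thus ?thesis using assms by (intro bcontI[of _ "B * C"] continuous_intros) (auto dest: bcontD)
qed

lemma bcont_cmult: "bcont f ==> bcont (%x. c * f x)" by (intro bcont_mult bcont_const)

lemma bcont_diff: "bcont f ==> bcont g ==> bcont (%x. f x - g x)"
 using bcont_add[of f "%x. -1 * g x"] bcont_cmult[of g "-1"] by simp

lemma bcont_compose:
 assumes "bcont g" "cont f" shows "bcont (%x. g (f x))"
 using assms unfolding bcont_def by (auto intro: continuous_on_compose2[of UNIV g])

lemma integrable_yuk:
 fixes g :: "'a::euclidean_space => real"
 assumes "bcont g"
 shows "integrable yukM (%xi. g (x + a *R xi))"
proof -
 have b: "bcont (%xi. g (x + a *R xi))" by (rule bcont_compose[OF assms]) (intro continuous_intros)
 then obtain B where "!!xi. abs (g (x + a *R xi)) <= B" unfolding bcont_def by blast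
 thus ?thesis by (rule integrable_yukM[OF bcontD(2)[OF b]])
qed

lemma yuk_const [simp]: "yuk a (%_. c) x = c"
proof -
 interpret prob_space "yukM :: 'a measure" by (rule prob_yukM)
 show ?thesis unfolding yuk_def using prob_space by simp
qed

lemma yuk_mono: "bcont f ==> bcont g ==> (!!x. f x <= g x) ==> yuk a f x <= yuk a g x"
 unfolding yuk_def by (intro integral_mono integrable_yuk) auto

lemma yuk_add: "bcont f ==> bcont g ==> yuk a (%x. f x + g x) x = yuk a f x + yuk a g x"
 unfolding yuk_def by (intro Bochner_Integration.integral_add integrable_yuk)

lemma yuk_diff: "bcont f ==> bcont g ==> yuk a (%x. f x - g x) x = yuk a f x - yuk a g x"
 unfolding yuk_def by (intro Bochner_Integration.integral_diff integrable_yuk)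

lemma yuk_cmult: "yuk a (%x. c * f x) x = c * yuk a f x"
 unfolding yuk_def by simp

lemma yuk_bound:
 assumes "bcont f" "!!x. abs (f x) <= B" shows "abs (yuk a f x) <= B"
proof -
 have *: "f x <= B" "- B <= f x" for x using assms(2)[of x] by linarith+
 have "yuk a (%_. - B) x <= yuk a f x" by (rule yuk_mono[OF bcont_const assms(1) *(2)])
 thus ?thesis using yuk_mono[OF assms(1) bcont_const *(1)] abs_le_iff by fastforce
qed

lemma yuk_bcont:
 assumes "bcont (g :: 'a::euclidean_space => real)"
 shows "bcont (yuk a g)"
proof -
 obtain B where B: "!!x. abs (g x) <= B" using assms unfolding bcont_def by blast
 show ?thesis
 proof (rule bcontI[of _ B])
  show "abs (yuk a g x) <= B" for x by (rule yuk_bound[OF assms B])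
  show "cont (yuk a g)"
   unfolding continuous_on_sequentially comp_def
  proof (intro allI ballI impI)
   fix X :: "nat => 'a" and x assume X: "(ALL n. X n : UNIV) & X ----> x"
   interpret prob_space "yukM :: 'a measure" by (rule prob_yukM)
   show "(%n. yuk a g (X n)) ----> yuk a g x"
    unfolding yuk_def
   proof (rule integral_dominated_convergence[where w = "%_. B"])
    have c: "isCont g z" for z using bcontD(1)[OF assms] by (simp add: continuous_on_eq_continuous_at)
    show "AE xi in yukM. (%n. g (X n + a *R xi)) ----> g (x + a *R xi)"
     using X by (intro AE_I2 isCont_tendsto_compose[OF c] tendsto_intros) auto
    show "AE xi in yukM. norm (g (X n + a *R xi)) <= B" for n using B by (intro AE_I2) simp
   qed (use integrable_yuk[OF assms] in "auto intro: borel_measurable_integrable")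
  qed
 qed
qed

lemma test_fun_bcont:
 assumes "test_fun phi L"
 shows "bcont phi" "bcont L"
 using test_fun_facts[OF assms] by (auto simp: bcont_def)

lemma test_fun_affine:
 assumes "test_fun phi L"
 shows "test_fun (%z. phi (x + a *R z)) (%z. a\<^sup>2 * L (x + a *R z))"
proof -
 obtain g h B where *: "ALL x. (phi has_derivative (%v. g x *. v)) (at x)" "cont g"
   "ALL i:Basis. cont (h i) & (ALL x. abs (h i x) <= B & DERIV (%t. g (x + t *R i) *. i) 0 :> h i x)"
   "ALL x. abs (phi x) <= B & norm (g x) <= B & L x = (SUM i:Basis. h i x)"
   using assms unfolding test_fun_def by (elim exE conjE) (rule that)
 have B0: "B >= 0" using *(4) abs_ge_zero order_trans by blast
 define B' where "B' = B * (1 + abs a + a^2)"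
 have B': "B <= B'" "abs a * B <= B'" "a\<^sup>2 * B <= B'"
  using B0 by (auto simp: B'_def algebra_simps)
 show ?thesis
  unfolding test_fun_def
 proof (rule exI[of _ "%z. a *R g (x + a *R z)"], rule exI[of _ "%i z. a\<^sup>2 * h i (x + a *R z)"], rule exI[of _ B'], intro conjI ballI allI)
  fix z
  have "((%z. x + a *R z) has_derivative (%v. a *R v)) (at z)" by (auto intro!: derivative_eq_intros)
  from has_derivative_compose[OF this, of phi "%v. g (x + a *R z) *. v"]
  show "((%z. phi (x + a *R z)) has_derivative (%v. (a *R g (x + a *R z)) *. v)) (at z)"
   using *(1) by simp
  show "abs (phi (x + a *R z)) <= B'" using *(4) B'(1) order_trans by blast
  have "abs a * norm (g (x + a *R z)) <= abs a * B" using *(4) by (intro mult_left_mono) auto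
  thus "norm (a *R g (x + a *R z)) <= B'" using B'(2) by simp
  show "a\<^sup>2 * L (x + a *R z) = (SUM i:Basis. a\<^sup>2 * h i (x + a *R z))" using *(4) by (simp add: sum_distrib_left)
 next
  fix i :: 'a and z assume i: "i : Basis"
  have "abs (a^2 * h i (x + a *R z)) <= a^2 * B" using *(3) i by (simp add: abs_mult mult_left_mono)
  thus "abs (a^2 * h i (x + a *R z)) <= B'" using B'(3) by linarith
  have "DERIV (%t. g ((x + a *R z) + t *R i) *. i) 0 :> h i (x + a *R z)" using *(3) i by blast
  hence "DERIV (%t. g ((x + a *R z) + (a * t) *R i) *. i) 0 :> h i (x + a *R z) * a"
   by (intro DERIV_chain'[where g = "%t. g ((x + a *R z) + t *R i) *. i" and f = "%t. a * t"]) (auto intro!: derivative_eq_intros)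
  from DERIV_cmult[OF this, of a]
  show "DERIV (%t. (a *R g (x + a *R (z + t *R i))) *. i) 0 :> a\<^sup>2 * h i (x + a *R z)"
   by (simp add: scaleR_add_right add.assoc power2_eq_square mult_ac)
  have hi: "cont (h i)" using *(3) i by blast
  show "cont (%z. a\<^sup>2 * h i (x + a *R z))" by (simp add: continuous_on_compose2[OF hi] continuous_intros)
 next
  show "cont (%z. a *R g (x + a *R z))" by (simp add: continuous_on_compose2[OF *(2)] continuous_intros)
 qed
qed

text \<open>The resolvent equation on test functions, obtained at every point by translation and scaling.\<close>

lemma yuk_test_fun:
 assumes "test_fun phi L"
 shows "yuk a phi x - a\<^sup>2 * yuk a L x = phi x"
proof -
 have "(LINT xi|yukM. phi (x + a *R xi) - a\<^sup>2 * L (x + a *R xi)) = yuk a phi x - a\<^sup>2 * yuk a L x"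
  unfolding yuk_def using test_fun_bcont[OF assms]
  by (subst Bochner_Integration.integral_diff) (auto intro!: integrable_yuk)
 thus ?thesis by (simp add: yukM_test_fun_0[OF test_fun_affine[OF assms]])
qed

lemma test_fun_bump0:
 assumes m: "m >= 3"
 shows "test_fun (bump m :: 'a::euclidean_space => real) (lap_bump m)"
proof -
 define g where "g z = (- 2 * real m * bump (m - 1) z) *R z" for z :: 'a
 define q where "q i z = 4 * real m * real (m - 1) * bump (m - 2) z * (z *. i) * (z *. i) - 2 * real m * bump (m - 1) z * (i *. i)" for i z :: 'a
 have cg: "cont g" "cont (q i)" for i
  unfolding g_def q_def by (intro continuous_intros)+
 have out: "norm z >= 1 ==> q i z = 0" for i z using m by (auto simp: q_def bump_outside)
 have ex: "EX B. ALL z. abs (q i z) <= B" for i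
  using kernel_bounded[OF cg(2)[of i] out[of _ i]] by blast
 then obtain Bq where Bq: "!!i z. abs (q i z) <= Bq i" by metis
 have Bq0: "Bq i >= 0" for i using Bq[of i 0] by linarith
 define B where "B = 1 + 2 * real m + (SUM i:Basis. Bq i)"
 have s: "(SUM i:Basis. Bq i) >= 0" using Bq0 by (intro sum_nonneg) auto
 show ?thesis
  unfolding test_fun_def
 proof (rule exI[of _ g], rule exI[of _ q], rule exI[of _ B], intro conjI ballI allI)
  fix z :: 'a
  show "(bump m has_derivative (%v. g z *. v)) (at z)"
   using bump_has_derivative[of m z] m by (simp add: g_def)
  have "abs (bump m z) <= 1" by simp
  thus "abs (bump m z) <= B" using s unfolding B_def by linarith
  show "norm (g z) <= B"
  proof (cases "norm z < 1")
   case True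
   have "norm (g z) = 2 * real m * bump (m - 1) z * norm z" by (simp add: g_def abs_mult)
   also have "... <= 2 * real m * 1 * 1" using True by (intro mult_mono) auto
   finally show ?thesis using s by (simp add: B_def)
  next
   case False
   thus ?thesis using s m by (simp add: B_def g_def bump_outside)
  qed
  show "lap_bump m z = (SUM i:Basis. q i z)" unfolding q_def by (rule lap_bump_sum[symmetric])
 next
  fix i z :: 'a assume i: "i : Basis"
  have "Bq i <= (SUM i:Basis. Bq i)" using i Bq0 by (intro member_le_sum) auto
  thus "abs (q i z) <= B" using Bq[of i z] by (simp add: B_def)
  show "DERIV (%t. g (z + t *R i) *. i) 0 :> q i z"
   using bump_line_deriv2[OF m, of z i i] by (simp add: g_def q_def)
 qed (use cg in auto)
qed

lemma test_fun_bump: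
 assumes "m >= 3" "r > 0"
 shows "test_fun (%y. bump m ((y - x) /R r)) (%y. lap_bump m ((y - x) /R r) / r^2)"
proof -
 have e: "- (x /R r) + (1 / r) *R y = (y - x) /R r" for y
  by (simp add: scaleR_diff_right divide_inverse)
 have "(%z. (1 / r)\<^sup>2 * lap_bump m ((z - x) /R r)) = (%z. lap_bump m ((z - x) /R r) / r^2)"
  by (simp add: power_divide)
 thus ?thesis
  using test_fun_affine[OF test_fun_bump0[OF assms(1)], of "- (x /R r)" "1 / r"] unfolding e by simp
qed

lemma test_fun_cos:
 fixes eta :: "'a::euclidean_space"
 shows "test_fun (%x. cos (eta *. x + c)) (%x. - (eta *. eta) * cos (eta *. x + c))"
 unfolding test_fun_def
proof (rule exI[of _ "%x. (- sin (eta *. x + c)) *R eta"], rule exI[of _ "%i x. - cos (eta *. x + c) * (eta *. i) * (eta *. i)"],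
  rule exI[of _ "1 + norm eta + (norm eta)^2"], intro conjI ballI allI)
 fix x :: 'a
 have "((%x. eta *. x + c) has_derivative (%v. eta *. v)) (at x)" by (auto intro!: derivative_eq_intros)
 hence "((%x. cos (eta *. x + c)) has_derivative (%v. (eta *. v) * - sin (eta *. x + c))) (at x)"
  by (rule DERIV_compose_FDERIV[OF DERIV_cos])
 thus "((%x. cos (eta *. x + c)) has_derivative (%v. ((- sin (eta *. x + c)) *R eta) *. v)) (at x)"
  by (simp add: mult.commute)
 show "abs (cos (eta *. x + c)) <= 1 + norm eta + (norm eta)^2"
  by (rule order_trans[OF abs_cos_le_one]) simp
 have "abs (sin (eta *. x + c)) * norm eta <= 1 * norm eta" by (intro mult_right_mono) auto
 thus "norm ((- sin (eta *. x + c)) *R eta) <= 1 + norm eta + (norm eta)^2" by (simp add: add_increasing2)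
 have "(SUM i:Basis. (eta *. i) * (eta *. i)) = eta *. eta" by (rule euclidean_inner[symmetric])
 thus "- (eta *. eta) * cos (eta *. x + c) = (SUM i:Basis. - cos (eta *. x + c) * (eta *. i) * (eta *. i))"
  by (simp add: mult.assoc sum_negf flip: sum_distrib_left)
next
 fix i x :: 'a assume i: "i : Basis"
 have 2: "DERIV (%t. - sin (a + t * b) * b) 0 :> - cos a * b * b" for a b :: real
  by (auto intro!: derivative_eq_intros)
 have e: "eta *. (x + t *R i) + c = (eta *. x + c) + t * (eta *. i)" for t
  by (simp add: inner_add_right)
 show "DERIV (%t. ((- sin (eta *. (x + t *R i) + c)) *R eta) *. i) 0 :> - cos (eta *. x + c) * (eta *. i) * (eta *. i)"
  unfolding e using 2 by simp
 have "abs (eta *. i) <= norm eta" using Basis_le_norm[OF i] by simp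
 hence "abs (- cos (eta *. x + c) * (eta *. i) * (eta *. i)) <= 1 * norm eta * norm eta"
  unfolding abs_mult by (intro mult_mono) auto
 thus "abs (- cos (eta *. x + c) * (eta *. i) * (eta *. i)) <= 1 + norm eta + (norm eta)^2"
  by (simp add: power2_eq_square add_increasing)
qed (intro continuous_intros)+

lemma lborel_distr_minus: "distr lborel borel (%x. c - x) = (lborel :: 'a::euclidean_space measure)"
 using lborel_affine[of "-1" c] by (simp add: density_1)

lemma yukM_uminus:
 fixes g :: "'a::euclidean_space => real"
 assumes "bcont g"
 shows "(LINT xi|yukM. g (- xi)) = (LINT xi|yukM. g xi)"
proof -
 have [measurable]: "g : borel_measurable borel" using assms by (rule bcontD)
 obtain B where B: "!!x. abs (g x) <= B" using assms unfolding bcont_def by blast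
 have "(LINT z|gaussM. g (- (s *R z))) = (LINT z|gaussM. g (s *R z))" for s
 proof -
  have "(LINT z|gaussM. g (s *R z)) = (LB z. g (s *R z) * gauss z)"
   by (rule integral_gaussM) simp
  also have "... = (LINT z|distr lborel borel (%x. 0 - x). g (s *R z) * gauss z)"
   unfolding lborel_distr_minus ..
  also have "... = (LB z. g (s *R (0 - z)) * gauss (0 - z))"
   by (rule integral_distr) auto
  also have "... = (LINT z|gaussM. g (- (s *R z)))"
   by (subst integral_gaussM) (auto simp: gauss_minus)
  finally show ?thesis by simp
 qed
 thus ?thesis
  using B by (simp add: integral_yukM[of g B] integral_yukM[of "%x. g (- x)" B])
qed

text \<open>Fubini, and the invariance of the measure under reflection at the origin.\<close>

lemma yuk_symmetric:
 fixes g psi :: "'a::euclidean_space => real"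
 assumes g: "bcont g" and psi: "bcont psi" "integrable lborel psi"
 shows "(LB x. yuk a g x * psi x) = (LB x. g x * yuk a psi x)"
proof -
 have [measurable]: "g : borel_measurable borel" "psi : borel_measurable borel"
  using g psi by (auto dest: bcontD)
 obtain B where B: "!!x. abs (g x) <= B" using g unfolding bcont_def by blast
 interpret y: prob_space "yukM :: 'a measure" by (rule prob_yukM)
 interpret P: pair_sigma_finite "yukM :: 'a measure" "lborel :: 'a measure" ..
 have psi_int: "integrable lborel (%x. psi (x - a *R xi))" for xi
 proof -
  have "integrable (distr lborel borel ((+) (- a *R xi))) psi" using psi(2) by (simp add: lborel_distr_plus)
  thus ?thesis by (subst (asm) integrable_distr_eq) auto
 qed
 have int1: "integrable lborel (%x. g (x + a *R xi) * psi x)" for xi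
  using integrable_mult_bounded[OF psi(2), of "%x. g (x + a *R xi)" B] B by (simp add: mult.commute)
 have int2: "integrable lborel (%x. g x * psi (x - a *R xi))" for xi
  using integrable_mult_bounded[OF psi_int, of g B] B by (simp add: mult.commute)
 have transl: "(LB x. abs (psi (x - a *R xi))) = (LB x. abs (psi x))" for xi
  using lborel_integral_translate[of "%x. abs (psi x)" "- a *R xi"] by simp
 have F1: "integrable (yukM \<Otimes>\<^sub>M lborel) (%(xi, x). g (x + a *R xi) * psi x)"
 proof (rule P.Fubini_integrable)
  show "integrable yukM (%xi. LB x. norm (case (xi, x) of (xi, x) => g (x + a *R xi) * psi x))"
  proof (rule y.integrable_const_bound[where B = "B * (LB x. abs (psi x))"])
   show "AE xi in yukM. norm (LB x. norm (case (xi, x) of (xi, x) => g (x + a *R xi) * psi x)) <= B * (LB x. abs (psi x))"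
   proof (rule AE_I2)
    fix xi :: 'a
    have "(LB x. abs (g (x + a *R xi) * psi x)) <= (LB x. B * abs (psi x))"
    proof (rule integral_mono[OF integrable_abs[OF int1]])
     show "integrable lborel (%x. B * abs (psi x))" using psi(2) by simp
    qed (use B in "simp add: abs_mult mult_right_mono")
    moreover have "0 <= (LB x. abs (g (x + a *R xi) * psi x))" by (intro integral_nonneg_AE) auto
    ultimately show "norm (LB x. norm (case (xi, x) of (xi, x) => g (x + a *R xi) * psi x)) <= B * (LB x. abs (psi x))"
     by simp
   qed
  qed simp
 qed (use int1 in auto)
 have F2: "integrable (yukM \<Otimes>\<^sub>M lborel) (%(xi, x). g x * psi (x - a *R xi))"
 proof (rule P.Fubini_integrable)
  show "integrable yukM (%xi. LB x. norm (case (xi, x) of (xi, x) => g x * psi (x - a *R xi)))"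
  proof (rule y.integrable_const_bound[where B = "B * (LB x. abs (psi x))"])
   show "AE xi in yukM. norm (LB x. norm (case (xi, x) of (xi, x) => g x * psi (x - a *R xi))) <= B * (LB x. abs (psi x))"
   proof (rule AE_I2)
    fix xi :: 'a
    have "(LB x. abs (g x * psi (x - a *R xi))) <= (LB x. B * abs (psi (x - a *R xi)))"
    proof (rule integral_mono[OF integrable_abs[OF int2]])
     show "integrable lborel (%x. B * abs (psi (x - a *R xi)))" using psi_int by simp
    qed (use B in "simp add: abs_mult mult_right_mono")
    moreover have "0 <= (LB x. abs (g x * psi (x - a *R xi)))" by (intro integral_nonneg_AE) auto
    ultimately show "norm (LB x. norm (case (xi, x) of (xi, x) => g x * psi (x - a *R xi))) <= B * (LB x. abs (psi x))"
     by (simp add: transl)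
   qed
  qed simp
 qed (use int2 in auto)
 have "(LB x. yuk a g x * psi x) = (LB x. LINT xi|yukM. g (x + a *R xi) * psi x)"
  by (simp add: yuk_def)
 also have "... = (LINT xi|yukM. LB x. g (x + a *R xi) * psi x)"
  by (rule P.Fubini_integral[OF F1])
 also have "... = (LINT xi|yukM. LB x. g x * psi (x - a *R xi))"
 proof (rule Bochner_Integration.integral_cong[OF refl])
  fix xi :: 'a
  show "(LB x. g (x + a *R xi) * psi x) = (LB x. g x * psi (x - a *R xi))"
   using lborel_integral_translate[of "%x. g x * psi (x - a *R xi)" "a *R xi"] by (simp add: add.commute)
 qed
 also have "... = (LB x. LINT xi|yukM. g x * psi (x - a *R xi))"
  by (rule P.Fubini_integral[OF F2, symmetric])
 also have "... = (LB x. g x * yuk a psi x)"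
 proof (intro Bochner_Integration.integral_cong refl)
  fix x :: 'a
  have "bcont (%xi. psi (x + a *R xi))" by (rule bcont_compose[OF psi(1)]) (intro continuous_intros)
  from yukM_uminus[OF this] show "(LINT xi|yukM. g x * psi (x - a *R xi)) = g x * yuk a psi x"
   by (simp add: yuk_def)
 qed
 finally show ?thesis .
qed

text \<open>Move the operator onto the bump by symmetry, where the resolvent equation holds classically.\<close>

lemma yuk_wsol:
 fixes g :: "'a::euclidean_space => real"
 assumes g: "bcont g" and a: "a ~= 0"
 shows "wsol UNIV (yuk a g) (%x. (g x - yuk a g x) / a^2)"
 unfolding wsol_def
proof (intro conjI allI impI)
 show "cont (yuk a g)" using yuk_bcont[OF g] by (rule bcontD)
 show "cont (%x. (g x - yuk a g x) / a^2)"
  using a g yuk_bcont[OF g] by (intro continuous_intros) (auto dest: bcontD)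
 fix x :: 'a and r :: real and m :: nat assume r: "0 < r" "3 <= m" "cball x r <= UNIV"
 define psi where "psi y = bump m ((y - x) /R r)" for y
 define L where "L y = lap_bump m ((y - x) /R r) / r^2" for y
 have t: "test_fun psi L" unfolding psi_def L_def by (rule test_fun_bump) (use r in auto)
 note bc = test_fun_bcont[OF t]
 have out: "psi y = 0" "L y = 0" if "y ~: cball x r" for y
 proof -
  have "norm ((y - x) /R r) = norm (y - x) / r" using r by (simp add: divide_inverse mult.commute)
  hence "norm ((y - x) /R r) >= 1" using that r by (simp add: dist_norm norm_minus_commute)
  thus "psi y = 0" "L y = 0" using r by (auto simp: psi_def L_def bump_outside lap_bump_outside)
 qed
 have int: "integrable lborel psi" "integrable lborel L"
  using bc out by (auto intro!: integrable_continuous_bounded_support[of _ "cball x r"] dest: bcontD)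
 have int': "integrable lborel (%y. f y * psi y)" "integrable lborel (%y. f y * L y)" if "bcont f" for f
  using that bc out by (auto intro!: integrable_continuous_bounded_support[of _ "cball x r"] bcontD bcont_mult)
 have "(LB y. yuk a g y * (psi y - a\<^sup>2 * L y)) = (LB y. g y * yuk a (%y. psi y - a\<^sup>2 * L y) y)"
  using int bc by (intro yuk_symmetric g bcont_diff bcont_cmult) auto
 also have "... = (LB y. g y * psi y)"
  using yuk_test_fun[OF t, of a] bc by (simp add: yuk_diff bcont_cmult yuk_cmult)
 finally have eq0: "(LB y. yuk a g y * psi y) - a\<^sup>2 * (LB y. yuk a g y * L y) = (LB y. g y * psi y)"
  using int'[OF yuk_bcont[OF g]] by (simp add: right_diff_distrib mult.left_commute[of _ "a\<^sup>2"])
 have 1: "(LB y. yuk a g y * L y) = - (LB y. (g y - yuk a g y) / a^2 * psi y)"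
 proof -
  have "(LB y. (g y - yuk a g y) / a^2 * psi y) = (LB y. (g y * psi y - yuk a g y * psi y) / a^2)"
   by (simp add: left_diff_distrib)
  also have "... = ((LB y. g y * psi y) - (LB y. yuk a g y * psi y)) / a^2"
   using int'(1)[OF g] int'(1)[OF yuk_bcont[OF g]] by simp
  finally have F: "(LB y. (g y - yuk a g y) / a^2 * psi y) = ((LB y. g y * psi y) - (LB y. yuk a g y * psi y)) / a^2" .
  have "Q = - ((R - P) / A)" if "A ~= 0" "P - A * Q = R" for P Q R A :: real
   using that by (auto simp: field_simps)
  from this[OF _ eq0] show ?thesis unfolding F using a by simp
 qed
 have sc: "(LB z. f (x + r *R z) * k z) = (LB y. f y * k ((y - x) /R r)) / r ^ DIM('a)"
  if "bcont f" "k : borel_measurable borel" for f k :: "'a => real"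
 proof -
  have [measurable]: "f : borel_measurable borel" "k : borel_measurable borel" using that bcontD(2) by blast+
  show ?thesis
   using lborel_integral_scale[of "%y. f y * k ((y - x) /R r)" r x] r by simp
 qed
 have bF: "bcont (%x. (g x - yuk a g x) / a^2)"
  using bcont_cmult[OF bcont_diff[OF g yuk_bcont[OF g]], of "1/a^2"] by simp
 show "(LB z. yuk a g (x + r *R z) * lap_bump m z) = - r\<^sup>2 * (LB z. (g (x + r *R z) - yuk a g (x + r *R z)) / a^2 * bump m z)"
  unfolding sc[OF yuk_bcont[OF g] lap_bump_measurable] sc[OF bF bump_measurable]
 proof -
  have 2: "(LB y. yuk a g y * lap_bump m ((y - x) /R r)) = r^2 * (LB y. yuk a g y * L y)"
   using r by (simp add: L_def)
  show "(LB y. yuk a g y * lap_bump m ((y - x) /R r)) / r ^ DIM('a) = - r\<^sup>2 * ((LB y. (g y - yuk a g y) / a^2 * bump m ((y - x) /R r)) / r ^ DIM('a))"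
   unfolding 2 1 psi_def by simp
 qed
qed

section \<open>Resolvent blow-up\<close>

text \<open>A square in disguise: the constant is chosen to make the difference 24 u (1 - c u)^2 with u = 1 - |z|^2.
  It makes a bump a subsolution with an explicit growth rate.\<close>

lemma neg_lap_bump3_le:
 fixes z :: "'a::euclidean_space"
 shows "- lap_bump 3 z <= (24 + 6 * real DIM('a))^2 / 96 * bump 3 z"
proof (cases "norm z < 1")
 case True
 define N where "N = real DIM('a)"
 define u where "u = 1 - z *. z"
 have u: "0 < u" "z *. z = 1 - u" using True by (auto simp: u_def dot_square_norm abs_square_less_1)
 have b: "bump m z = u ^ m" for m using u by (simp add: bump_def)
 have "lap_bump 3 z = 24 * (1 - u) * u - 6 * N * u^2"
  by (simp add: lap_bump_def b u(2) N_def)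
 moreover have "0 <= (24 + 6 * N)^2 / 96 * u ^ 3 + (24 * (1 - u) * u - 6 * N * u^2)"
 proof -
  have "0 <= 24 * (1 - (24 + 6 * N) / 48 * u)^2 * u" using u by simp
  also have "... = (24 + 6 * N)^2 / 96 * u ^ 3 + (24 * (1 - u) * u - 6 * N * u^2)"
   by (simp add: power2_eq_square power3_eq_cube field_simps)
  finally show ?thesis .
 qed
 ultimately show ?thesis by (simp add: b N_def)
qed (simp add: bump_outside lap_bump_outside)

locale killed =
 fixes ch :: "'a::euclidean_space => real" and a :: real
 assumes chi: "bcont ch" "!!x. 0 <= ch x" "!!x. ch x <= 1" and a0: "a ~= 0"
begin

definition A where "A g = yuk a (%x. ch x * g x)"

lemma A_bcont: "bcont g ==> bcont (A g)"
 unfolding A_def by (intro yuk_bcont bcont_mult chi)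

lemma A_mono: "bcont f ==> bcont g ==> (!!x. f x <= g x) ==> A f x <= A g x"
 unfolding A_def by (intro yuk_mono bcont_mult chi mult_left_mono) auto

lemma A_cmult: "A (%x. c * g x) x = c * A g x"
 unfolding A_def by (simp add: mult.left_commute[of _ c] yuk_cmult)

lemma A_add: "bcont f ==> bcont g ==> A (%x. f x + g x) x = A f x + A g x"
 unfolding A_def by (simp add: distrib_left yuk_add bcont_mult chi)

primrec G where "G 0 = (%_. 1)" | "G (Suc m) = A (G m)"

lemma G_bcont: "bcont (G m)" by (induction m) (auto intro: A_bcont)

lemma G_bounds: "0 <= G m x & G m x <= 1"
proof (induction m arbitrary: x)
 case (Suc m)
 have "A (%_. 0) x <= A (G m) x" by (rule A_mono) (use Suc G_bcont in auto)
 moreover have "A (%_. 0) x = 0" by (simp add: A_def)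
 moreover have "A (G m) x <= yuk a (%_. 1) x"
  unfolding A_def
 proof (rule yuk_mono)
  show "ch x * G m x <= 1" for x using chi(2,3)[of x] Suc[of x] by (simp add: mult_le_one)
 qed (auto intro: bcont_mult chi G_bcont)
 ultimately show ?case by simp
qed simp

text \<open>The parameters up to which the iterates of the killed resolvent decay fast enough for the Neumann series.\<close>

definition T where "T = {t. 0 <= t & (EX B. ALL m x. t ^ m * G m x <= B)}"

lemma one_in_T: "1 : T" unfolding T_def using G_bounds by auto

definition U where "U t x = (\<Sum>m. t ^ m * G m x)"

text \<open>The Neumann series of the killed resolvent converges geometrically below any parameter that keeps its
  terms bounded.\<close>

lemma U_facts:
 assumes t: "0 <= t" "t < t1" "t1 : T"
 shows "bcont (U t)" "!!x. U t x = 1 + t * A (U t) x" "!!x. U t x >= 1"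
proof -
 obtain B0 where B0: "!!m x. t1 ^ m * G m x <= B0" using t unfolding T_def by blast
 define B where "B = max B0 0"
 have B: "B >= 0" "t1 ^ m * G m x <= B" for m x using B0[of m x] by (auto simp: B_def)
 define q where "q = t / t1"
 have q: "0 <= q" "q < 1" using t by (auto simp: q_def)
 have b: "abs (t ^ m * G m x) <= B * q ^ m" for m x
 proof -
  have "t ^ m * G m x = (t1 ^ m * G m x) * q ^ m"
   using t by (simp add: q_def power_divide)
  also have "... <= B * q ^ m" using B q by (intro mult_right_mono) auto
  finally show ?thesis using t G_bounds[of m x] by (simp add: abs_mult)
 qed
 have sq: "summable (%m. B * q ^ m)" using q by (intro summable_mult summable_geometric) auto
 have s: "summable (%m. t ^ m * G m x)" for x
  by (rule summable_comparison_test'[OF sq, of 0]) (use b in auto)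
 define S where "S n x = (\<Sum>m<n. t ^ m * G m x)" for n x
 have ul: "uniform_limit UNIV S (U t) sequentially"
  unfolding S_def[abs_def] U_def[abs_def] by (rule Weierstrass_m_test[OF _ sq]) (use b in auto)
 have bS: "bcont (S n)" for n
 proof (induction n)
  case 0 thus ?case by (simp add: S_def[abs_def])
 next
  case (Suc n)
  show ?case using bcont_add Suc bcont_cmult G_bcont S_def[abs_def] by fastforce
 qed
 have Sb: "abs (S n x) <= B / (1 - q)" for n x
 proof -
  have "abs (S n x) <= (\<Sum>m<n. B * q ^ m)" unfolding S_def using b by (intro order_trans[OF sum_abs] sum_mono) auto
  also have "... <= (\<Sum>m. B * q ^ m)" using B q sq by (intro sum_le_suminf) auto
  also have "... = B / (1 - q)" using q by (simp add: suminf_mult summable_geometric suminf_geometric divide_inverse)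
  finally show ?thesis .
 qed
 have Slim: "(%n. S n x) ----> U t x" for x
  unfolding S_def U_def using s[of x] by (rule summable_LIMSEQ)
 have Ub: "abs (U t x) <= B / (1 - q)" for x
  using tendsto_rabs[OF Slim[of x]] Sb by (intro LIMSEQ_le_const2) auto
 show bU: "bcont (U t)" using uniform_limit_theorem[OF always_eventually ul] bcontD(1)[OF bS] Ub bcontI by auto
 show "U t x >= 1" for x
 proof -
  have "(\<Sum>m<1. t ^ m * G m x) <= (\<Sum>m. t ^ m * G m x)"
   using s t G_bounds by (intro sum_le_suminf) auto
  thus ?thesis by (simp add: U_def)
 qed
 have rec: "S (Suc n) x = 1 + t * A (S n) x" for n x
 proof (induction n arbitrary: x)
  case 0 thus ?case by (simp add: S_def[abs_def] A_def)
 next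
  case (Suc n)
  have e: "S (Suc n) = (%x. S n x + t ^ n * G n x)" for n by (simp add: S_def fun_eq_iff)
  have "A (S (Suc n)) x = A (S n) x + t ^ n * A (G n) x"
   unfolding e by (subst A_add) (auto intro: bS bcont_cmult G_bcont simp: A_cmult)
  hence "1 + t * A (S (Suc n)) x = S (Suc n) x + t ^ Suc n * G (Suc n) x"
   by (simp add: Suc.IH algebra_simps)
  moreover have "S (Suc (Suc n)) x = S (Suc n) x + t ^ Suc n * G (Suc n) x" by (simp add: S_def)
  ultimately show ?case by (simp only:)
 qed
 have Alim: "(%n. A (S n) x) ----> A (U t) x" for x
  unfolding A_def yuk_def
 proof (rule integral_dominated_convergence[where w = "%_. B / (1 - q)"])
  interpret prob_space "yukM :: 'a measure" by (rule prob_yukM)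
  show "integrable yukM (%_::'a. B / (1 - q))" by simp
  show "(%xi. ch (x + a *R xi) * U t (x + a *R xi)) : borel_measurable yukM"
   "(%xi. ch (x + a *R xi) * S n (x + a *R xi)) : borel_measurable yukM" for n
   using integrable_yuk[OF bcont_mult[OF chi(1) bU], of x a] integrable_yuk[OF bcont_mult[OF chi(1) bS], of x a n] by auto
  show "AE xi in yukM. (%n. ch (x + a *R xi) * S n (x + a *R xi)) ----> ch (x + a *R xi) * U t (x + a *R xi)"
   using Slim by (intro AE_I2 tendsto_intros)
  show "AE xi in yukM. norm (ch (x + a *R xi) * S n (x + a *R xi)) <= B / (1 - q)" for n
  proof (rule AE_I2)
   fix xi :: 'a
   have "abs (ch (x + a *R xi)) * abs (S n (x + a *R xi)) <= 1 * (B / (1 - q))"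
    using chi(2,3)[of "x + a *R xi"] Sb by (intro mult_mono) auto
   thus "norm (ch (x + a *R xi) * S n (x + a *R xi)) <= B / (1 - q)" by (simp add: abs_mult)
  qed
 qed
 show "U t x = 1 + t * A (U t) x" for x
 proof (rule LIMSEQ_unique)
  show "(%n. S (Suc n) x) ----> U t x" using Slim by (rule LIMSEQ_Suc)
  show "(%n. S (Suc n) x) ----> 1 + t * A (U t) x" unfolding rec by (intro tendsto_intros Alim)
 qed
qed

text \<open>A bump f inside the region where ch = 1 satisfies f <= c0 A f with c0 just above 1, so the terms t^m A^m
  1 grow at least like (t / c0)^m f.\<close>

lemma T_le:
 assumes rho: "rho > 0" and one: "!!x. x : cball x0 rho ==> ch x = 1" and t: "t : T"
 shows "t <= 1 + (24 + 6 * real DIM('a))^2 / 96 * a^2 / rho^2"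
proof (rule ccontr)
 define C where "C = (24 + 6 * real DIM('a))^2 / 96"
 define c0 where "c0 = 1 + C * a^2 / rho^2"
 have c0: "c0 >= 1" by (simp add: C_def c0_def)
 assume "~ ?thesis"
 hence tc: "t > c0" by (simp add: c0_def C_def)
 define f where "f y = bump 3 ((y - x0) /R rho)" for y
 define L where "L y = lap_bump 3 ((y - x0) /R rho) / rho^2" for y
 have tf: "test_fun f L" unfolding f_def L_def by (rule test_fun_bump) (use rho in auto)
 note bc = test_fun_bcont[OF tf]
 have f01: "0 <= f y" "f y <= 1" for y by (auto simp: f_def)
 have chif: "ch y * f y = f y" for y
 proof (cases "y : cball x0 rho")
  case False
  have "norm ((y - x0) /R rho) = norm (y - x0) / rho" using rho by (simp add: divide_inverse mult.commute)
  hence "norm ((y - x0) /R rho) >= 1" using False rho by (simp add: dist_norm norm_minus_commute)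
  thus ?thesis by (simp add: f_def bump_outside)
 qed (simp add: one)
 have key: "f y <= c0 * A f y" for y
 proof -
  have "f y = yuk a f y - a\<^sup>2 * yuk a L y" by (rule yuk_test_fun[OF tf, symmetric])
  also have "... = yuk a (%y. f y - a\<^sup>2 * L y) y" using bc by (simp add: yuk_diff bcont_cmult yuk_cmult)
  also have "... <= yuk a (%y. c0 * f y) y"
  proof (rule yuk_mono)
   fix y
   have "- lap_bump 3 ((y - x0) /R rho) * (a^2 / rho^2) <= (C * bump 3 ((y - x0) /R rho)) * (a^2 / rho^2)"
    unfolding C_def using neg_lap_bump3_le by (intro mult_right_mono) auto
   thus "f y - a\<^sup>2 * L y <= c0 * f y" by (simp add: f_def L_def c0_def algebra_simps)
  qed (use bc in "auto intro: bcont_diff bcont_cmult")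
  also have "... = c0 * A f y" by (simp add: yuk_cmult A_def chif)
  finally show ?thesis .
 qed
 have fG: "f y <= c0 ^ m * G m y" for m y
 proof (induction m arbitrary: y)
  case 0 thus ?case using f01 by simp
 next
  case (Suc m)
  have "f y <= c0 * A f y" by (rule key)
  also have "A f y <= A (%y. c0 ^ m * G m y) y"
   using bc Suc by (intro A_mono bcont_cmult G_bcont) auto
  finally have "f y <= c0 * A (%y. c0 ^ m * G m y) y" using c0 by simp
  thus ?case by (simp add: A_cmult)
 qed
 obtain B where B: "!!m x. t ^ m * G m x <= B" using t unfolding T_def by blast
 have "(t / c0) ^ m <= B" for m
 proof -
  have "1 <= c0 ^ m * G m x0" using fG[of x0 m] by (simp add: f_def)
  hence "(t / c0) ^ m * 1 <= (t / c0) ^ m * (c0 ^ m * G m x0)" using tc c0 by (intro mult_left_mono) auto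
  also have "... = t ^ m * G m x0" using c0 by (simp add: power_divide)
  also have "... <= B" by (rule B)
  finally show ?thesis by simp
 qed
 moreover have "1 < t / c0" using tc c0 by simp
 ultimately show False using real_arch_pow[of "t / c0" B] by (meson not_less)
qed

text \<open>Below the critical parameter the series solves U = 1 + t A U and its supremum is unbounded as t rises to
  it. Dividing by the supremum leaves an almost homogeneous solution: the inhomogeneity eta is as small as
  desired.\<close>

lemma blow_up:
 assumes rho: "rho > 0" and one: "!!x. x : cball x0 rho ==> ch x = 1" and e: "e > 0"
 obtains y t eta where "bcont y" "!!x. 0 <= y x" "!!x. y x <= 1" "EX x. y x >= 1/2" "0 <= eta" "eta <= e"
  "1 - e <= t" "0 < t" "t <= 1 + (24 + 6 * real DIM('a))^2 / 96 * a^2 / rho^2"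
  "!!x. y x = t * yuk a (%x. ch x * y x) x + eta"
proof -
 define c0 where "c0 = 1 + (24 + 6 * real DIM('a))^2 / 96 * a^2 / rho^2"
 have Tc: "t <= c0" if "t : T" for t unfolding c0_def by (rule T_le[OF rho one that])
 hence bdd: "bdd_above T" by (auto simp: bdd_above_def)
 define ts where "ts = Sup T"
 have ts: "1 <= ts" "ts <= c0" unfolding ts_def using one_in_T bdd Tc
  by (auto intro: cSup_upper cSup_least)
 define K where "K = 2 + 1 / e"
 have K: "K > 1" "K > 1/e" using e by (auto simp: K_def add_pos_pos)
 define q where "q = 1 - 1 / K"
 have q: "0 < q" "q < 1" using K by (auto simp: q_def)
 define t where "t = (max (q * ts) (max (1 - e) (1/2)) + ts) / 2"
 have mx: "max (q * ts) (max (1 - e) (1/2)) < ts" using q ts e by auto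
 hence "max (q * ts) (max (1 - e) (1/2)) < t" and tts: "t < ts" by (simp_all add: t_def)
 hence t: "q * ts < t" "1 - e < t" "0 < t" "t < ts" by auto
 obtain t1 where t1: "t1 : T" "t < t1" using t(4) less_cSup_iff[of T t] bdd one_in_T unfolding ts_def by blast
 note U = U_facts[OF less_imp_le[OF t(3)] t1(2,1)]
 have "EX x. U t x > K"
 proof (rule ccontr)
  assume "~ ?thesis"
  hence UK: "U t x <= K" for x by (meson not_less)
  have AU: "A (U t) x <= (q / t) * U t x" for x
  proof -
   have "t * A (U t) x = U t x - 1" using U(2)[of x] by simp
   also have "... <= U t x - U t x / K" using UK[of x] K by simp
   also have "... = q * U t x" by (simp add: q_def algebra_simps)
   finally show ?thesis using t by (simp add: field_simps)
  qed
  have GU: "G m x <= (q / t) ^ m * U t x" for m x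
  proof (induction m arbitrary: x)
   case 0 thus ?case using U(3) by simp
  next
   case (Suc m)
   have "G (Suc m) x <= A (%x. (q / t) ^ m * U t x) x"
    using Suc by (auto intro!: A_mono G_bcont bcont_cmult U(1))
   also have "... = (q / t) ^ m * A (U t) x" by (rule A_cmult)
   also have "... <= (q / t) ^ m * ((q / t) * U t x)" using AU q t by (intro mult_left_mono) auto
   finally show ?case by (simp add: mult_ac)
  qed
  have "(t / q) ^ m * G m x <= K" for m x
  proof -
   have "(t / q) ^ m * G m x <= (t / q) ^ m * ((q / t) ^ m * U t x)" using GU q t by (intro mult_left_mono) auto
   also have "... = U t x" using q t by (simp add: power_divide)
   finally show ?thesis using UK[of x] by linarith
  qed
  hence "t / q : T" using q t unfolding T_def by auto
  hence "t / q <= ts" unfolding ts_def using bdd by (rule cSup_upper)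
  thus False using t(1) q by (simp add: field_simps)
 qed
 then obtain x1 where x1: "U t x1 > K" by blast
 obtain B where B: "!!x. abs (U t x) <= B" using U(1) unfolding bcont_def by blast
 have bddU: "bdd_above (range (U t))" using B by (auto simp: bdd_above_def abs_le_iff)
 define s where "s = Sup (range (U t))"
 have s: "s > K" using x1 cSup_upper[OF _ bddU, of "U t x1"] by (auto simp: s_def)
 have Us: "U t x <= s" for x unfolding s_def using bddU by (intro cSup_upper) auto
 have s0: "s > 0" using s K by linarith
 obtain x2 where x2: "U t x2 > s / 2"
  using less_cSup_iff[of "range (U t)" "s/2"] bddU s0 by (auto simp: s_def)
 show ?thesis
 proof (rule that[of "%x. (1/s) * U t x" "1/s" t])
  show "bcont (%x. (1/s) * U t x)" by (intro bcont_cmult U(1))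
  show "0 <= (1/s) * U t x" for x using U(3)[of x] s0 by simp
  show "(1/s) * U t x <= 1" for x using Us[of x] s0 by simp
  show "EX x. 1/2 <= (1/s) * U t x" using x2 s0 by (intro exI[of _ x2]) (simp add: field_simps)
  have "1 / s <= 1 / (1 / e)" using s K(2) e s0 by (intro divide_left_mono) auto
  thus "1/s <= e" by simp
  show "t <= 1 + (24 + 6 * real DIM('a))^2 / 96 * a^2 / rho^2" using t(4) ts(2) by (simp add: c0_def)
  show "(1/s) * U t x = t * yuk a (%x. ch x * ((1/s) * U t x)) x + 1/s" for x
  proof -
   have "t * yuk a (%x. ch x * ((1/s) * U t x)) x + 1/s = (1/s) * (1 + t * A (U t) x)"
    using A_cmult[of "1/s" "U t" x] by (simp add: A_def algebra_simps)
   thus ?thesis using U(2)[of x] by simp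
  qed
 qed (use t s0 in auto)
qed

end

section \<open>Boundary decay\<close>

lemma line_derivs:
 fixes x q i :: "'a::euclidean_space"
 shows "DERIV (%t. v *. (x + t *R i - q)) 0 :> v *. i" "DERIV (%t. (x + t *R i - q) *. v) 0 :> i *. v"
  "(x + t *R i - q) *. (x + t *R i - q) = (x - q) *. (x - q) + t * (2 * ((x - q) *. i)) + t * t * (i *. i)"
proof -
 show "DERIV (%t. v *. (x + t *R i - q)) 0 :> v *. i" "DERIV (%t. (x + t *R i - q) *. v) 0 :> i *. v"
  by (auto intro!: derivative_eq_intros simp: inner_diff_right inner_add_right inner_diff_left inner_add_left)
qed (simp add: inner_add_left inner_add_right inner_diff_left inner_diff_right inner_commute algebra_simps)

lemma laplace_quadratic:
 fixes q n :: "'a::euclidean_space"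
 assumes n: "norm n = 1"
 shows "laplace_on UNIV (%x. A * ((x - q) *. (x - q)) + b * (n *. (x - q)) + c * (n *. (x - q))^2 + d)
  (%_. 2 * real DIM('a) * A + 2 * c)"
proof (rule laplace_onI[of _ _ "%i x. 2 * A * ((x - q) *. i) + b * (n *. i) + 2 * c * (n *. (x - q)) * (n *. i)"
   "%i x. 2 * A * (i *. i) + 2 * c * (n *. i)^2"])
 fix i x :: 'a
 note v = line_derivs(1,2) and Q = line_derivs(3)
 show "DERIV (%t. A * ((x + t *R i - q) *. (x + t *R i - q)) + b * (n *. (x + t *R i - q)) + c * (n *. (x + t *R i - q))^2 + d) 0 :> 2 * A * ((x - q) *. i) + b * (n *. i) + 2 * c * (n *. (x - q)) * (n *. i)"
  unfolding Q by (auto intro!: derivative_eq_intros v)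
 show "DERIV (%t. 2 * A * ((x + t *R i - q) *. i) + b * (n *. i) + 2 * c * (n *. (x + t *R i - q)) * (n *. i)) 0 :> 2 * A * (i *. i) + 2 * c * (n *. i)^2"
  by (auto intro!: derivative_eq_intros v simp: power2_eq_square)
next
 have "(SUM i:Basis. (n *. i)\<^sup>2) = 1" using n unfolding power2_eq_square euclidean_inner[symmetric] by (simp add: norm_eq_1)
 thus "2 * real DIM('a) * A + 2 * c = (SUM i:Basis. 2 * A * (i *. i) + 2 * c * (n *. i)^2)"
  by (simp add: sum.distrib sum_distrib_left[symmetric])
qed (auto intro!: continuous_intros)

lemma laplace_gauss:
 fixes q :: "'a::euclidean_space"
 shows "laplace_on UNIV (%x. exp (- a * ((x - q) *. (x - q))))
  (%x. (4 * a^2 * ((x - q) *. (x - q)) - 2 * a * real DIM('a)) * exp (- a * ((x - q) *. (x - q))))"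
proof (rule laplace_onI[of _ _ "%i x. - 2 * a * ((x - q) *. i) * exp (- a * ((x - q) *. (x - q)))"
   "%i x. (4 * a^2 * ((x - q) *. i)^2 - 2 * a * (i *. i)) * exp (- a * ((x - q) *. (x - q)))"])
 fix i x :: 'a
 note v = line_derivs(1,2) and Q = line_derivs(3)
 show E: "DERIV (%t. exp (- a * ((x + t *R i - q) *. (x + t *R i - q)))) 0 :> - 2 * a * ((x - q) *. i) * exp (- a * ((x - q) *. (x - q)))"
  unfolding Q by (auto intro!: derivative_eq_intros)
 have "DERIV (%t. - 2 * a * ((x + t *R i - q) *. i)) 0 :> - 2 * a * (i *. i)" by (intro DERIV_cmult v)
 from DERIV_mult[OF this E]
 show "DERIV (%t. - 2 * a * ((x + t *R i - q) *. i) * exp (- a * ((x + t *R i - q) *. (x + t *R i - q)))) 0 :> (4 * a^2 * ((x - q) *. i)^2 - 2 * a * (i *. i)) * exp (- a * ((x - q) *. (x - q)))"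
  by (rule DERIV_cong) (simp add: power2_eq_square algebra_simps)
next
 fix x :: 'a
 have "(x - q) *. (x - q) = (SUM i:Basis. ((x - q) *. i)\<^sup>2)" unfolding power2_eq_square by (rule euclidean_inner)
 thus "(4 * a^2 * ((x - q) *. (x - q)) - 2 * a * real DIM('a)) * exp (- a * ((x - q) *. (x - q)))
   = (SUM i:Basis. (4 * a^2 * ((x - q) *. i)^2 - 2 * a * (i *. i)) * exp (- a * ((x - q) *. (x - q))))"
  by (simp add: sum_distrib_right[symmetric] sum_subtractf sum_distrib_left[symmetric])
qed (auto intro!: continuous_intros)

lemma barrier_comparison:
 assumes y: "wsol UNIV y F" and B: "wsol UNIV B G" and S: "open S" "bounded S"
  and F: "!!x. x : S ==> F x <= G x" and fr: "!!x. x : closure S ==> x ~: S ==> y x <= B x" and x: "x : S"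
 shows "y x <= B x"
proof -
 have w: "wsol UNIV (%x. y x - B x) (%x. F x - G x)" by (rule wsol_diff[OF y B])
 have "y x - B x <= 0"
 proof (rule wsol_max_principle[OF wsol_subset[OF w] S _ _ _ x])
  show "continuous_on (closure S) (%x. y x - B x)" using wsol_continuous(1)[OF w] by (rule continuous_on_subset) simp
  show "F x - G x <= 0" if "x : S" for x using F[OF that] by simp
  show "y x - B x <= 0" if "x : frontier S" for x using fr[of x] that S(1) by (simp add: frontier_def interior_open)
 qed simp
 thus ?thesis by simp
qed

text \<open>The disc cuts the ball into half balls. On each, |x-q|^2 plus N times s (rho - s) is harmonic for s the
  distance to the disc, nonnegative, and at least rho^2 on the spherical part.\<close>

lemma half_ball_bound:
 fixes y F :: "'a::euclidean_space => real"
 assumes w: "wsol UNIV y F" and om: "omg >= 0" "!!x. norm (x - q) <= rho ==> y x <= omg"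
  and C: "C >= 0" "!!x. norm (x - q) < rho ==> F x <= C" and rho: "rho > 0" and n: "norm n = 1" and eps: "eps >= 0"
  and D: "!!x. n *. (x - q) = 0 ==> norm (x - q) <= rho ==> y x <= eps"
  and x: "norm (x - q) < rho" "n *. (x - q) > 0"
 shows "y x <= omg * ((norm (x - q) / rho)^2 + real DIM('a) * (norm (x - q) / rho)) + eps + C * rho^2 / 2"
proof -
 define N where "N = real DIM('a)"
 have N: "N >= 1" using DIM_ge_Suc0[where 'a='a] by (simp add: N_def)
 define s Q where "s x = n *. (x - q)" and "Q x = (x - q) *. (x - q)" for x
 define B where "B x = (omg / rho^2 - C / (2 * N)) * Q x + omg * N / rho * s x + (- omg * N / rho^2) * (s x)^2 + (eps + C * rho^2 / (2 * N))" for x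
 have B: "B x = omg * (Q x / rho^2) + omg * N * (s x / rho - (s x / rho)\<^sup>2) + C * ((rho^2 - Q x) / (2 * N)) + eps" for x
  by (simp add: B_def algebra_simps diff_divide_distrib power_divide)
 have L: "laplace_on UNIV B (%_. 2 * N * (omg / rho^2 - C / (2 * N)) + 2 * (- omg * N / rho^2))"
  unfolding B_def s_def Q_def N_def by (rule laplace_quadratic[OF n])
 have L: "wsol UNIV B (%_. C)" by (rule wsol_cong[OF laplace_on_imp_wsol[OF L open_UNIV]]) (use N in "simp_all add: algebra_simps")
 have Q: "Q x = (norm (x - q))^2" for x by (simp add: Q_def power2_norm_eq_inner)
 have s: "s x <= norm (x - q)" for x using Cauchy_Schwarz_ineq2[of n "x - q"] n by (simp add: s_def)
 define S where "S = ball q rho \<inter> {x. s x > 0}"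
 have "y x <= B x"
 proof (rule barrier_comparison[OF w L])
  show "open S" unfolding S_def s_def by (intro open_Int open_ball open_Collect_less continuous_intros)
  show "bounded S" unfolding S_def by blast
  show "x : S" using x by (simp add: S_def s_def dist_norm norm_minus_commute)
  show "F x <= C" if "x : S" for x using C(2)[of x] that by (simp add: S_def dist_norm norm_minus_commute)
  fix x assume x: "x : closure S" "x ~: S"
  have "closure S <= cball q rho \<inter> {x. s x >= 0}"
   unfolding s_def by (rule closure_minimal) (auto simp: S_def s_def intro!: closed_Int closed_Collect_le continuous_intros)
  hence x': "norm (x - q) <= rho" "s x >= 0" using x(1) by (auto simp: dist_norm norm_minus_commute)
  hence Qle: "Q x <= rho^2" unfolding Q by (intro power_mono) auto
  have sr: "s x / rho >= 0" "s x / rho <= 1" using s[of x] x' rho by auto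
  hence "(s x / rho)\<^sup>2 <= s x / rho" unfolding power2_eq_square by (intro mult_left_le)
  hence nn: "omg * N * (s x / rho - (s x / rho)\<^sup>2) >= 0" "C * ((rho^2 - Q x) / (2 * N)) >= 0" "omg * (Q x / rho^2) >= 0"
   using om N C Qle by (auto simp: Q)
  show "y x <= B x"
  proof (cases "s x = 0")
   case True
   hence "y x <= eps" using D x' by (simp add: s_def)
   thus ?thesis unfolding B using nn by linarith
  next
   case False
   hence "norm (x - q) = rho" using x(2) x' by (auto simp: S_def dist_norm norm_minus_commute)
   hence "omg * (Q x / rho^2) = omg" using rho by (simp add: Q)
   thus ?thesis unfolding B using nn om(2)[OF x'(1)] eps by linarith
  qed
 qed
 also have "B x <= omg * ((norm (x - q) / rho)^2 + N * (norm (x - q) / rho)) + eps + C * rho^2 / 2"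
 proof -
  have "s x / rho - (s x / rho)\<^sup>2 <= norm (x - q) / rho"
   using divide_right_mono[OF s[of x], of rho] rho zero_le_power2[of "s x / rho"] by linarith
  hence "omg * N * (s x / rho - (s x / rho)\<^sup>2) <= omg * N * (norm (x - q) / rho)" using om N by (intro mult_left_mono) auto
  moreover have "(rho^2 - Q x) / (2 * N) <= rho^2 / 2" by (rule frac_le) (use N in "auto simp: Q")
  hence "C * ((rho^2 - Q x) / (2 * N)) <= C * (rho^2 / 2)" using C by (intro mult_left_mono) auto
  moreover have "omg * ((norm (x - q) / rho)^2 + N * (norm (x - q) / rho)) = omg * (Q x / rho^2) + omg * N * (norm (x - q) / rho)"
   by (simp add: Q power_divide algebra_simps)
  ultimately show ?thesis unfolding B by simp
 qed
 finally show ?thesis by (simp add: N_def)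
qed

text \<open>Outside a small ball a Gaussian of small enough width is subharmonic, so its negative is a barrier; the
  halved bound on the small ball spreads to the annulus with a loss that depends on R / rho only.\<close>

lemma annulus_bound:
 fixes y F :: "'a::euclidean_space => real"
 assumes w: "wsol UNIV y F" and om: "omg >= 0" "!!x. norm (x - q) <= R ==> y x <= omg"
  and C: "C >= 0" "!!x. norm (x - q) < R ==> F x <= C" and rho: "rho > 0" and d: "d >= 0"
  and inner: "!!x. norm (x - q) <= rho ==> y x <= omg / 2 + d" and x: "norm (x - q) <= R / 2" and R: "R > 0"
  and a: "a = real DIM('a) / 2 * (R / rho)^2"
 shows "y x <= (1 - (exp (- a / 4) - exp (- a)) / 2) * omg + d + C * R^2 / 2"
proof -
 define N where "N = real DIM('a)"
 have N: "N >= 1" using DIM_ge_Suc0[where 'a='a] by (simp add: N_def)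
 define al where "al = N / (2 * rho^2)"
 have al: "al > 0" "al * R^2 = a" using N rho by (auto simp: al_def a N_def power_divide)
 define Q E where "Q x = (x - q) *. (x - q)" and "E x = exp (- al * Q x)" for x
 have Q: "Q x = (norm (x - q))^2" for x by (simp add: Q_def power2_norm_eq_inner)
 define e0 :: 'a where "e0 = (SOME i. i : Basis)"
 have e0: "norm e0 = 1" unfolding e0_def by (rule norm_Basis[OF SOME_Basis])
 define P where "P x = (- C / (2 * N)) * Q x + 0 * (e0 *. (x - q)) + 0 * (e0 *. (x - q))^2 + (omg * (1 + exp (- a) / 2) + d + C * R^2 / (2 * N))" for x
 define B where "B x = P x - (omg / 2) * E x" for x
 have B: "B x = omg * (1 - (E x - exp (- a)) / 2) + d + C * ((R^2 - Q x) / (2 * N))" for x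
  by (simp add: B_def P_def algebra_simps diff_divide_distrib add_divide_distrib)
 have e1: "exp (- a) <= 1" "exp (- a / 4) <= 1" "exp (- a) <= exp (- a / 4)" using al N by (auto simp: a)
 have k: "(1 - (p - r) / 2) * omg >= omg / 2" if "p <= 1" "r > 0" for p r :: real
  using mult_right_mono[of "1 / 2" "1 - (p - r) / 2" omg] om that by simp
 have C0: "C * ((R^2 - Q x) / (2 * N)) >= 0" if "norm (x - q) <= R" for x
  using power_mono[OF that, of 2] C N by (simp add: Q)
 show ?thesis
 proof (cases "norm (x - q) <= rho")
  case True
  have "C * R^2 / 2 >= 0" using C by simp
  thus ?thesis using inner[OF True] k[OF e1(2) exp_gt_zero[of "- a"]] by linarith
 next
  case False
  have "laplace_on UNIV P (%_. 2 * N * (- C / (2 * N)) + 2 * 0)" unfolding P_def Q_def N_def by (rule laplace_quadratic[OF e0])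
  from laplace_on_imp_wsol[OF this open_UNIV]
  have P: "wsol UNIV P (%_. C)" by (rule wsol_cong) (use N in auto)
  have "laplace_on UNIV E (%x. (4 * al^2 * Q x - 2 * al * N) * E x)" unfolding E_def Q_def N_def by (rule laplace_gauss)
  from wsol_diff[OF P wsol_cmult[OF laplace_on_imp_wsol[OF this open_UNIV], of "omg / 2"]]
  have L: "wsol UNIV B (%x. C - omg / 2 * - ((4 * al^2 * Q x - 2 * al * N) * E x))" unfolding B_def .
  define S where "S = ball q R - cball q rho"
  have "y x <= B x"
  proof (rule barrier_comparison[OF w L])
   show "open S" "bounded S" unfolding S_def by (auto intro: open_Diff bounded_diff)
   show "x : S" using x R False by (simp add: S_def dist_norm norm_minus_commute)
   fix x
   show "F x <= C - omg / 2 * - ((4 * al^2 * Q x - 2 * al * N) * E x)" if x: "x : S"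
   proof -
    have "rho\<^sup>2 <= Q x" unfolding Q using x rho by (intro power_mono) (auto simp: S_def dist_norm norm_minus_commute)
    hence "(4 * al^2) * rho^2 <= (4 * al^2) * Q x" by (intro mult_left_mono) auto
    moreover have "(4 * al^2) * rho^2 = 2 * al * N" using rho by (simp add: al_def power2_eq_square)
    ultimately have "omg / 2 * ((4 * al^2 * Q x - 2 * al * N) * E x) >= 0" using om by (simp add: E_def)
    moreover have "F x <= C" using C(2)[of x] x by (simp add: S_def dist_norm norm_minus_commute)
    ultimately show ?thesis by simp
   qed
   assume x: "x : closure S" "x ~: S"
   have "closure S <= cball q R \<inter> - ball q rho" by (rule closure_minimal) (auto simp: S_def intro!: closed_Int closed_Compl)
   hence x': "norm (x - q) <= R" "norm (x - q) >= rho" using x(1) by (auto simp: dist_norm norm_minus_commute)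
   show "y x <= B x"
   proof (cases "norm (x - q) = R")
    case True
    hence "E x = exp (- a)" by (simp add: E_def Q al(2))
    thus ?thesis unfolding B using om(2)[OF x'(1)] C0[OF x'(1)] d by simp
   next
    case False
    hence "norm (x - q) = rho" using x(2) x' by (auto simp: S_def dist_norm norm_minus_commute)
    hence "y x <= omg / 2 + d" by (intro inner) simp
    moreover have "E x <= 1" using al by (auto simp: E_def Q)
    from k[OF this exp_gt_zero[of "- a"]] have "omg / 2 <= omg * (1 - (E x - exp (- a)) / 2)" by (simp only: mult.commute)
    ultimately show ?thesis unfolding B using C0[OF x'(1)] by linarith
   qed
  qed
  moreover have "E x >= exp (- a / 4)"
  proof -
   have "al * Q x <= al * (R / 2)^2" unfolding Q using x al by (intro mult_left_mono power_mono) auto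
   thus ?thesis using al(2) by (simp add: E_def power_divide)
  qed
  hence "omg * (1 - (E x - exp (- a)) / 2) <= omg * (1 - (exp (- a / 4) - exp (- a)) / 2)" using om by (intro mult_left_mono) auto
  moreover have "(R^2 - Q x) / (2 * N) <= R^2 / 2" by (rule frac_le) (use N in "auto simp: Q")
  hence "C * ((R^2 - Q x) / (2 * N)) <= C * (R^2 / 2)" using C by (intro mult_left_mono) auto
  ultimately show ?thesis unfolding B by (simp add: mult.commute)
 qed
qed

text \<open>The factor by which one step towards the boundary lowers the bound.\<close>

definition barrier_theta :: "'a::euclidean_space itself => real => real" where
 "barrier_theta _ c = (let N = real DIM('a); a = N / 2 * (8 * (N + 1) / c)^2 in 1 - (exp (- a / 4) - exp (- a)) / 2)"

lemma barrier_theta: "0 < c ==> 0 < barrier_theta TYPE('a::euclidean_space) c & barrier_theta TYPE('a) c < 1"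
proof -
 assume c: "0 < c"
 define a where "a = real DIM('a) / 2 * (8 * (real DIM('a) + 1) / c)^2"
 have "a > 0" using c by (simp add: a_def)
 hence e: "exp (- a) < exp (- a / 4)" "exp (- a / 4) < 1" "exp (- a) > 0" by auto
 have "barrier_theta TYPE('a) c = 1 - (exp (- a / 4) - exp (- a)) / 2" by (simp only: barrier_theta_def Let_def a_def)
 moreover have "0 < 1 - (p - q) / 2 & 1 - (p - q) / 2 < 1" if "q < p" "p < 1" "q > 0" for p q :: real using that by auto
 ultimately show ?thesis using e by (simp only:)
qed

text \<open>Near the centre of the disc the bound is halved by the two half balls, and the annulus carries the gain
  to a neighbourhood of the boundary point.\<close>

lemma barrier_step:
 fixes y F :: "'a::euclidean_space => real"
 assumes w: "wsol UNIV y F" and om: "omg >= 0" "!!x. x : cball x0 r ==> y x <= omg"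
  and C: "C >= 0" "!!x. x : ball x0 r ==> F x <= C" and r: "r > 0" and c: "0 < c" "c <= 1"
  and n: "norm n = 1" and q: "dist q x0 <= r / 5" and eps: "eps >= 0"
  and D: "!!x. n *. (x - q) = 0 ==> norm (x - q) <= c * (r / 5) ==> y x <= eps"
  and x: "x : cball x0 (r / 5)"
 shows "y x <= barrier_theta TYPE('a) c * omg + eps + C * r^2"
proof -
 define N where "N = real DIM('a)"
 have N: "N >= 1" using DIM_ge_Suc0[where 'a='a] by (simp add: N_def)
 define rho R where "rho = c * (r / 5)" and "R = 4 * r / 5"
 have rho: "rho > 0" "rho <= R" "rho <= r" and R: "R > 0" "R <= r" using c r by (auto simp: rho_def R_def intro: order_trans[OF mult_right_mono[of c 1]])
 have near: "x : cball x0 r" "norm (x - q) < R ==> x : ball x0 r" if "norm (x - q) <= R" for x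
  using norm_triangle_ineq[of "x - q" "q - x0"] q that by (auto simp: R_def dist_norm norm_minus_commute)
 have half: "y z <= omg * ((norm (z - q) / rho)^2 + N * (norm (z - q) / rho)) + eps + C * rho^2 / 2"
  if z: "norm (z - q) < rho" "m *. (z - q) > 0" and m: "m = n | m = - n" for m z
  unfolding N_def
 proof (rule half_ball_bound[OF w om(1) _ C(1) _ rho(1) _ eps _ z])
  show "y x <= omg" if "norm (x - q) <= rho" for x using om(2) near(1) that rho by simp
  show "F x <= C" if "norm (x - q) < rho" for x using C(2) near(2) that rho by simp
 qed (use m n D in "auto simp: rho_def")
 have inner: "y z <= omg / 2 + (eps + C * rho^2 / 2)" if z: "norm (z - q) <= rho / (2 * (N + 1))" for z
 proof (cases "n *. (z - q) = 0")
  case True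
  have "rho / (2 * (N + 1)) <= rho" using rho N by (simp add: field_simps)
  hence "y z <= eps" using D[OF True] order_trans[OF z] unfolding rho_def by blast
  moreover have "C * rho^2 / 2 >= 0" using C by simp
  ultimately show ?thesis using om(1) by linarith
 next
  case False
  define t where "t = norm (z - q) / rho"
  have t: "0 <= t" "t * (N + 1) <= 1 / 2" using z rho N by (auto simp: t_def field_simps)
  hence t1: "t < 1" using N mult_left_mono[of 1 "N + 1" t] by linarith
  hence "norm (z - q) < rho" using rho by (simp add: t_def)
  hence "y z <= omg * (t^2 + N * t) + eps + C * rho^2 / 2"
   using half[of z n] half[of z "- n"] False unfolding t_def by (cases "n *. (z - q) > 0") auto
  moreover have "t\<^sup>2 + N * t <= 1 / 2" using mult_left_le[of t t] t t1 by (simp add: power2_eq_square algebra_simps)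
  hence "omg * (t^2 + N * t) <= omg * (1 / 2)" using om by (intro mult_left_mono)
  ultimately show ?thesis by simp
 qed
 define a where "a = N / 2 * (8 * (N + 1) / c)^2"
 have "R / (rho / (2 * (N + 1))) = 8 * (N + 1) / c" using r c N by (simp add: R_def rho_def field_simps)
 hence a: "a = real DIM('a) / 2 * (R / (rho / (2 * (N + 1))))^2" by (simp add: a_def N_def)
 have "y x <= (1 - (exp (- a / 4) - exp (- a)) / 2) * omg + (eps + C * rho^2 / 2) + C * R^2 / 2"
 proof (rule annulus_bound[OF w om(1) _ C(1) _ _ _ inner _ R(1) a])
  show "y x <= omg" if "norm (x - q) <= R" for x using om(2) near(1) that by simp
  show "F x <= C" if "norm (x - q) < R" for x using C(2) near(2) that by simp
  show "norm (x - q) <= R / 2" using norm_triangle_ineq[of "x - x0" "x0 - q"] x q by (auto simp: R_def dist_norm norm_minus_commute)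
 qed (use rho N C eps in auto)
 moreover have "C * rho^2 <= C * r^2" "C * R^2 <= C * r^2" using rho R C by (auto intro!: mult_left_mono power_mono)
 moreover have "barrier_theta TYPE('a) c = 1 - (exp (- a / 4) - exp (- a)) / 2" by (simp only: barrier_theta_def Let_def a_def N_def)
 ultimately show ?thesis by simp
qed

text \<open>Flat discs in the complement, of size comparable to the scale, are what a polytope offers at every
  boundary point, including those of slits, where no exterior ball exists.\<close>

definition corkscrew :: "'a::euclidean_space set => 'a => bool" where
 "corkscrew Om x0 \<longleftrightarrow> (EX c r0. 0 < c & c <= 1 & 0 < r0 & (ALL r. 0 < r --> r < r0 -->
   (EX q n. norm n = 1 & dist q x0 <= r & (ALL x. n *. (x - q) = 0 --> norm (x - q) <= c * r --> x ~: Om))))"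

text \<open>One step multiplies the bound by a fixed factor below one at the price of an arbitrarily small error, so
  the infimum of the achievable bounds is zero.\<close>

lemma boundary_decay:
 fixes y F :: "nat => 'a::euclidean_space => real"
 assumes w: "!!k. wsol UNIV (y k) (F k)" and y1: "!!k x. y k x <= 1" and C: "C >= 0" "!!k x. F k x <= C"
  and out: "!!eps. eps > 0 ==> EX K. ALL k>=K. ALL x. x ~: Om --> y k x <= eps"
  and cork: "corkscrew Om x0" and s: "sig > 0"
 shows "EX r>0. EX K. ALL k>=K. ALL x:cball x0 r. y k x <= sig"
proof -
 obtain c r0 where c: "0 < c" "c <= 1" and r0: "0 < r0"
  and ck: "!!r. 0 < r ==> r < r0 ==> EX q n. norm n = 1 & dist q x0 <= r & (ALL x. n *. (x - q) = 0 --> norm (x - q) <= c * r --> x ~: Om)"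
  using cork unfolding corkscrew_def by blast
 define tht where "tht = barrier_theta TYPE('a) c"
 have th: "0 < tht" "tht < 1" using barrier_theta[OF c(1), where 'a='a] by (auto simp: tht_def)
 define P where "P sig \<longleftrightarrow> (EX r>0. EX K. ALL k>=K. ALL x:cball x0 r. y k x <= sig)" for sig
 have P1: "P 1" unfolding P_def using y1 by (intro exI[of _ 1]) auto
 have step: "P (tht * sig + eps)" if sig: "sig >= 0" "P sig" and eps: "eps > 0" for sig eps
 proof -
  obtain r1 K1 where r1: "r1 > 0" "!!k x. k >= K1 ==> x : cball x0 r1 ==> y k x <= sig" using sig unfolding P_def by blast
  obtain K2 where K2: "!!k x. k >= K2 ==> x ~: Om ==> y k x <= eps / 2" using out[of "eps/2"] eps by auto
  define r where "r = min (min r1 r0) (min 1 (eps / (2 * (C + 1))))"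
  have r: "r > 0" "r <= r1" "r <= r0" "r <= 1" "r <= eps / (2 * (C + 1))" using r1 r0 eps C by (auto simp: r_def)
  have Cr: "C * r^2 <= eps / 2"
  proof -
   have "r\<^sup>2 <= r" using r by (simp add: power2_eq_square mult_left_le)
   hence "C * r^2 <= (C + 1) * (eps / (2 * (C + 1)))" using C r by (intro mult_mono) auto
   moreover have "(C + 1) * (eps / (2 * (C + 1))) = eps / 2" using C by (simp add: field_simps)
   ultimately show ?thesis by (simp only:)
  qed
  obtain q n where q: "norm n = 1" "dist q x0 <= r / 5" "!!x. n *. (x - q) = 0 ==> norm (x - q) <= c * (r / 5) ==> x ~: Om"
   using ck[of "r/5"] r by auto
  have "y k x <= tht * sig + eps" if k: "k >= max K1 K2" and x: "x : cball x0 (r/5)" for k x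
  proof -
   have "y k x <= tht * sig + eps / 2 + C * r^2"
    unfolding tht_def
   proof (rule barrier_step[OF w sig(1) _ C(1) _ r(1) c q(1,2) _ _ x])
    show "y k x <= sig" if "x : cball x0 r" for x using r1(2) k that r(2) by auto
    show "y k x <= eps / 2" if "n *. (x - q) = 0" "norm (x - q) <= c * (r / 5)" for x using K2 k q(3)[OF that] by auto
   qed (use C eps in auto)
   thus ?thesis using Cr by linarith
  qed
  thus ?thesis unfolding P_def using r(1) by (intro exI[of _ "r/5"] conjI exI[of _ "max K1 K2"]) auto
 qed
 define Z where "Z = {sig. sig >= 0 & P sig}"
 have "1 : Z" using P1 by (simp add: Z_def)
 hence Z: "Z ~= {}" "bdd_below Z" by (blast, auto simp: Z_def bdd_below_def)
 define s0 where "s0 = Inf Z"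
 have s0: "s0 >= 0" unfolding s0_def using Z by (intro cInf_greatest) (auto simp: Z_def)
 have "s0 = 0"
 proof (rule ccontr)
  assume "s0 ~= 0"
  hence pos: "s0 > 0" using s0 by simp
  define eps where "eps = (1 - tht) * s0 / 4"
  have eps: "eps > 0" using th pos by (simp add: eps_def)
  obtain sig1 where s1: "sig1 : Z" "sig1 < s0 + eps" using cInf_lessD[OF Z(1), of "s0 + eps"] eps by (auto simp: s0_def)
  have "tht * sig1 + eps : Z" using step[of sig1 eps] s1 eps th by (auto simp: Z_def)
  hence "s0 <= tht * sig1 + eps" unfolding s0_def using Z by (intro cInf_lower)
  moreover have "tht * sig1 <= tht * (s0 + eps)" using s1 th by (intro mult_left_mono) auto
  moreover have "tht * (s0 + eps) <= tht * s0 + eps" using th eps by (simp add: distrib_left)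
  moreover have "2 * eps = (s0 - tht * s0) / 2" by (simp add: eps_def left_diff_distrib)
  moreover have "tht * s0 < 1 * s0" using th pos by (intro mult_strict_right_mono)
  moreover have "s0 < s0" if "s0 <= q + eps" "q <= r" "r <= p + eps" "2 * eps = (s0 - p) / 2" "p < 1 * s0" for p q r
   using that by argo
  ultimately show False by blast
 qed
 then obtain sig1 where "sig1 : Z" "sig1 < sig" using cInf_lessD[OF Z(1), of sig] s by (auto simp: s0_def)
 hence "P sig1" "sig1 <= sig" by (auto simp: Z_def)
 thus ?thesis unfolding P_def by (meson order_trans)
qed

section \<open>The positive ground state\<close>

lemma kernel_integral_tendsto:
 fixes u :: "nat => 'a::euclidean_space => real" and k :: "'a => real"
 assumes u: "!!n. continuous_on (cball x r) (u n)" "continuous_on (cball x r) ul" and r: "r > 0"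
  and k: "cont k" "!!z. norm z >= 1 ==> k z = 0"
  and B: "!!n x'. n >= N ==> x' : cball x r ==> abs (u n x') <= B"
  and lim: "!!x'. x' : cball x r ==> (%n. u n x') ----> ul x'"
 shows "(%n. LB z. u n (x + r *R z) * k z) ----> (LB z. ul (x + r *R z) * k z)"
proof -
 from kernel_bounded[OF k] obtain Bk where Bk: "!!z. abs (k z) <= Bk" by metis
 have B0: "B >= 0" using B[of N x] r by force
 show ?thesis
proof (rule LIMSEQ_offset[where k=N], rule integral_dominated_convergence)
 show "(%z. ul (x + r *R z) * k z) : borel_measurable lborel"
  using integrable_mult_kernel[OF u(2) r k] by auto
 show "(%z. u (n + N) (x + r *R z) * k z) : borel_measurable lborel" for n
  using integrable_mult_kernel[OF u(1) r k] by auto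
 show "integrable lborel (%z. (B * Bk) * indicat_real (cball (0::'a) 1) z)"
  using emeasure_bounded_finite[of "cball (0::'a) 1"] by (intro integrable_mult_right integrable_real_indicator) auto
 show "AE z in lborel. (%n. u (n + N) (x + r *R z) * k z) ----> ul (x + r *R z) * k z"
 proof (rule AE_I2)
  fix z :: 'a
  show "(%n. u (n + N) (x + r *R z) * k z) ----> ul (x + r *R z) * k z"
  proof (cases "norm z >= 1")
   case False
   hence "x + r *R z : cball x r" using r by (simp add: dist_norm mult_left_le)
   from LIMSEQ_ignore_initial_segment[OF lim[OF this], of N] show ?thesis by (intro tendsto_intros)
  qed (simp add: k)
 qed
 show "AE z in lborel. norm (u (n + N) (x + r *R z) * k z) <= (B * Bk) * indicat_real (cball (0::'a) 1) z" for n
 proof (rule AE_I2)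
  fix z :: 'a
  show "norm (u (n + N) (x + r *R z) * k z) <= (B * Bk) * indicat_real (cball (0::'a) 1) z"
  proof (cases "norm z >= 1")
   case True thus ?thesis using B0 Bk[of z] by (simp add: k indicator_def)
  next
   case False
   hence "x + r *R z : cball x r" using r by (simp add: dist_norm mult_left_le)
   hence "abs (u (n + N) (x + r *R z)) * abs (k z) <= B * Bk" by (intro mult_mono B Bk B0) auto
   thus ?thesis using False by (simp add: abs_mult)
  qed
 qed
qed
qed

text \<open>The weak equation involves integrals only, so dominated convergence applies.\<close>

lemma wsol_limit:
 fixes y F :: "nat => 'a::euclidean_space => real"
 assumes w: "!!n. wsol S (y n) (F n)" and c: "continuous_on S yl" "continuous_on S Fl"
  and B: "!!K. compact K ==> K <= S ==> EX B N. ALL n>=N. ALL x:K. abs (y n x) <= B & abs (F n x) <= B"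
  and lim: "!!x. x : S ==> (%n. y n x) ----> yl x" "!!x. x : S ==> (%n. F n x) ----> Fl x"
 shows "wsol S yl Fl"
 unfolding wsol_def
proof (intro conjI c allI impI)
 fix x :: 'a and r :: real and m :: nat
 assume r: "0 < r" and m: "3 <= m" and sub: "cball x r <= S"
 obtain B N where BN: "!!n x'. n >= N ==> x' : cball x r ==> abs (y n x') <= B & abs (F n x') <= B"
  using B[OF compact_cball sub] by (elim exE) (rule that, blast)
 have 1: "(%n. LB z. y n (x + r *R z) * lap_bump m z) ----> (LB z. yl (x + r *R z) * lap_bump m z)"
  by (rule kernel_integral_tendsto[where N=N and B=B, OF continuous_on_subset[OF wsol_continuous(1)[OF w] sub] continuous_on_subset[OF c(1) sub] r])
    (use BN lim sub m in "auto intro: lap_bump_outside continuous_intros")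
 have 2: "(%n. LB z. F n (x + r *R z) * bump m z) ----> (LB z. Fl (x + r *R z) * bump m z)"
  by (rule kernel_integral_tendsto[where N=N and B=B, OF continuous_on_subset[OF wsol_continuous(2)[OF w] sub] continuous_on_subset[OF c(2) sub] r])
    (use BN lim sub m in "auto intro: bump_outside continuous_intros")
 have e: "(LB z. y n (x + r *R z) * lap_bump m z) = - r\<^sup>2 * (LB z. F n (x + r *R z) * bump m z)" for n
  using w[of n] r m sub unfolding wsol_def by blast
 show "(LB z. yl (x + r *R z) * lap_bump m z) = - r\<^sup>2 * (LB z. Fl (x + r *R z) * bump m z)"
  by (rule LIMSEQ_unique[OF 1]) (unfold e, intro tendsto_intros 2)
qed

lemma bump_lipschitz: "abs (bump m x - bump m y) <= 2 * real m * norm (x - y)"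
proof -
 define f where "f z = max 0 (1 - z *. z)" for z :: 'a
 have f: "abs (f z) <= 1" for z by (auto simp: f_def)
 have fm: "f z = 1 - (min 1 (norm z))\<^sup>2" for z
  by (auto simp: f_def dot_square_norm min_def max_def abs_square_le_1 power_le_one not_le one_less_power)
 have "abs (f x - f y) = abs (min 1 (norm y) - min 1 (norm x)) * (min 1 (norm y) + min 1 (norm x))"
 proof -
  have "f x - f y = (min 1 (norm y) - min 1 (norm x)) * (min 1 (norm y) + min 1 (norm x))"
   unfolding fm by (simp add: power2_eq_square algebra_simps)
  thus ?thesis by (simp add: abs_mult)
 qed
 also have "... <= norm (x - y) * 2"
  using norm_triangle_ineq3[of x y] by (intro mult_mono) auto
 finally have "abs (f x - f y) <= norm (x - y) * 2" .
 moreover have "abs (f x ^ m - f y ^ m) <= real m * abs (f x - f y)"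
  using norm_power_diff[of "f x" "f y" m] f by simp
 moreover have "real m * abs (f x - f y) <= real m * (norm (x - y) * 2)" by (intro mult_left_mono) (fact, simp)
 ultimately show ?thesis unfolding bump_def f_def by simp
qed

lemma mean_lipschitz:
 fixes y :: "'a::euclidean_space => real"
 assumes y: "cont y" "!!x. abs (y x) <= 1" and s: "s > 0" and m: "m > 0" and d: "norm (x' - x) <= s"
 shows "abs (mean m y x' s - mean m y x s) <= 2 * real m * measure lborel (cball (0::'a) 2) / s * norm (x' - x)"
proof -
 define h where "h = (x' - x) /R s"
 have nh: "norm h = norm (x' - x) / s" using s by (simp add: h_def divide_inverse mult.commute)
 have h1: "norm h <= 1" using d s by (simp add: nh)
 have [measurable]: "y : borel_measurable borel" using y(1) by (rule borel_measurable_continuous_onI)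
 have int: "integrable lborel (%z. y (x + s *R z) * bump m (z - c))" for c
 proof (rule integrable_continuous_bounded_support[of _ "cball c 1"])
  show "cont (%z. y (x + s *R z) * bump m (z - c))"
   by (intro continuous_intros continuous_on_compose2[OF y(1)]) auto
  show "y (x + s *R z) * bump m (z - c) = 0" if "z ~: cball c 1" for z
   using that m by (simp add: bump_outside dist_norm norm_minus_commute)
 qed auto
 have "mean m y x' s = (LB z. y (x + s *R (h + z)) * bump m ((h + z) - h))"
  unfolding mean_def using s by (simp add: h_def scaleR_add_right)
 also have "... = (LB z. y (x + s *R z) * bump m (z - h))"
  by (rule lborel_integral_translate[of "%z. y (x + s *R z) * bump m (z - h)" h]) measurable
 finally have "mean m y x' s - mean m y x s = (LB z. y (x + s *R z) * bump m (z - h) - y (x + s *R z) * bump m (z - 0))"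
  unfolding mean_def using Bochner_Integration.integral_diff[OF int[of h] int[of 0]] by simp
 also have "abs (...) <= (LB z. (2 * real m * norm h) * indicat_real (cball (0::'a) 2) z)"
 proof (rule order_trans[OF integral_abs_bound integral_mono'])
  show "integrable lborel (%z. (2 * real m * norm h) * indicat_real (cball (0::'a) 2) z)"
   using emeasure_bounded_finite[of "cball (0::'a) 2"] by (intro integrable_mult_right integrable_real_indicator) auto
  fix z :: 'a
  show "abs (y (x + s *R z) * bump m (z - h) - y (x + s *R z) * bump m (z - 0)) <= (2 * real m * norm h) * indicat_real (cball (0::'a) 2) z"
  proof (cases "norm z <= 2")
   case True
   have "abs (y (x + s *R z) * (bump m (z - h) - bump m (z - 0))) <= 1 * (2 * real m * norm h)"
    unfolding abs_mult using bump_lipschitz[of m "z - h" z] by (intro mult_mono y) auto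
   thus ?thesis using True by (simp add: right_diff_distrib)
  next
   case False
   hence "norm (z - h) >= 1" using norm_triangle_ineq2[of z h] h1 by simp
   thus ?thesis using False m by (simp add: bump_outside)
  qed
 qed auto
 also have "... = 2 * real m * measure lborel (cball (0::'a) 2) / s * norm (x' - x)" by (simp add: nh)
 finally show ?thesis .
qed

lemma wsol_mean_error:
 fixes y :: "'a::euclidean_space => real"
 assumes w: "wsol S y F" and R: "cball x R <= S" and s: "0 < s" "s < R"
  and B: "!!x'. x' : ball x s ==> abs (F x') <= B" "B >= 0"
 shows "abs (mean 2 y x s - y x * (LB z. bump 2 (z::'a))) <= B * (LB z. bump 1 (z::'a)) * s^2"
proof -
 define b where "b = (LB z. bump 1 (z::'a))"
 have "abs (mean 2 y x s - mean 2 y x 0) <= B * b * s^2"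
 proof (rule abs_le_of_abs_deriv_le[where f = "%s. mean 2 y x s - mean 2 y x 0" and phi = "%s. B * b * s^2"
    and f' = "%r. - (r / (2 * real (2+1))) * mean (2+1) F x r" and phi' = "%s. 2 * B * b * s" and r = s])
  show "continuous_on {0..s} (%s. mean 2 y x s - mean 2 y x 0)"
   using mean_continuous_on[OF w R s, of 2] by (intro continuous_intros) auto
  fix r assume r: "0 < r" "r < s"
  show "DERIV (%s. mean 2 y x s - mean 2 y x 0) r :> - (r / (2 * real (2+1))) * mean (2+1) F x r"
   using DERIV_diff[OF wsol_mean_deriv[OF w R r(1) _ order_refl[of 2]] DERIV_const] r s by simp
  show "DERIV (%s. B * b * s^2) r :> 2 * B * b * r"
   by (auto intro!: derivative_eq_intros)
  have "cball x r <= S" using r s R by (meson order_trans less_imp_le subset_cball)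
  hence "abs (mean (2+1) F x r) <= B * b" unfolding b_def
   by (intro abs_mean_le continuous_on_subset[OF wsol_continuous(2)[OF w]]) (use r B in auto)
  hence "(r / 6) * abs (mean (2+1) F x r) <= (2 * r) * (B * b)" by (simp add: b_def Bochner_Integration.integral_nonneg r B mult_mono)
  thus "abs (- (r / (2 * real (2+1))) * mean (2+1) F x r) <= 2 * B * b * r"
   using r by (simp add: abs_mult mult_ac)
 qed (use s in "auto intro!: continuous_intros")
 thus ?thesis by (simp add: mean_0 b_def)
qed

text \<open>A bounded solution differs from its normalised mean over radius r by O(r^2), and means are Lipschitz.\<close>

lemma interior_equicontinuous:
 fixes y F :: "nat => 'a::euclidean_space => real"
 assumes w: "!!k. wsol UNIV (y k) (F k)" and y: "!!k x. abs (y k x) <= 1" and R: "R > 0"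
  and B: "!!k x'. k >= N ==> x' : cball x R ==> abs (F k x') <= B" and e: "e > 0"
 shows "EX d>0. ALL k>=N. ALL x':cball x d. abs (y k x' - y k x) < e"
proof -
 have B0: "B >= 0" using B[of N x] R by force
 define b c where "b = (LB z. bump 1 (z::'a))" and "c = (LB z. bump 2 (z::'a))"
 have b: "b > 0" and c: "c > 0" unfolding b_def c_def by (rule bump_integral_pos; simp)+
 define q where "q = c * e / (4 * (B * b + 1))"
 have q: "q > 0" using c e B0 b by (simp add: q_def add_nonneg_pos)
 define s where "s = min (R/2) (sqrt q)"
 have s: "0 < s" "s <= R/2" using R q by (auto simp: s_def)
 have s2: "B * b * s^2 <= c * e / 4"
 proof -
  have "s\<^sup>2 <= q" using s q power_mono[of s "sqrt q" 2] by (simp add: s_def)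
  hence "B * b * s^2 <= (B * b + 1) * q" using B0 b by (intro mult_mono) auto
  also have "... = c * e / 4"
  proof -
   have "B * b + 1 > 0" using B0 b by (simp add: add_nonneg_pos)
   moreover have "p * (c * e / (4 * p)) = c * e / 4" if "p > 0" for p :: real using that by simp
   ultimately show ?thesis unfolding q_def by blast
  qed
  finally show ?thesis .
 qed
 define V where "V = 2 * real 2 * measure lborel (cball (0::'a) 2) / s"
 have V: "V >= 0" using s by (simp add: V_def)
 define d where "d = min s (c * e / (4 * (V + 1)))"
 have d: "d > 0" "d <= s" using s c e V by (auto simp: d_def)
 have dV: "V * d <= c * e / 4"
 proof -
  have "V * d <= (V + 1) * (c * e / (4 * (V + 1)))" using V d c e by (intro mult_mono) (auto simp: d_def)
  moreover have "p * (c * e / (4 * p)) = c * e / 4" if "p > 0" for p :: real using that by simp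
  moreover have "V + 1 > 0" using V by simp
  ultimately show ?thesis by metis
 qed
 have "abs (y k x' - y k x) < e" if k: "k >= N" and x': "x' : cball x d" for k x'
 proof -
  have err: "abs (mean 2 (y k) p s - y k p * c) <= c * e / 4" if p: "dist x p <= d" for p
  proof -
   have "abs (mean 2 (y k) p s - y k p * c) <= B * b * s^2"
    unfolding b_def c_def
   proof (rule wsol_mean_error[OF w, where R=R])
    show "abs (F k x') <= B" if "x' : ball p s" for x'
     using that p d s by (intro B k) (metric)
   qed (use s B0 in auto)
   thus ?thesis using s2 by linarith
  qed
  have "abs (mean 2 (y k) x' s - mean 2 (y k) x s) <= V * norm (x' - x)"
   unfolding V_def using x' d s
   by (intro mean_lipschitz wsol_continuous(1)[OF w] y) (auto simp: dist_norm norm_minus_commute)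
  also have "... <= V * d" using x' V by (intro mult_left_mono) (auto simp: dist_norm norm_minus_commute)
  finally have "abs (mean 2 (y k) x' s - mean 2 (y k) x s) <= c * e / 4" using dV by linarith
  moreover have "abs (mean 2 (y k) x' s - y k x' * c) <= c * e / 4" using x' by (intro err) auto
  moreover have "abs (mean 2 (y k) x s - y k x * c) <= c * e / 4" using d by (intro err) auto
  ultimately have "abs (y k x' * c - y k x * c) <= 3 * (c * e / 4)" by linarith
  moreover have "abs (y k x' * c - y k x * c) = abs (y k x' - y k x) * c" using c by (simp add: abs_mult flip: left_diff_distrib)
  moreover have "3 * (c * e / 4) < e * c" using c e by simp
  ultimately show ?thesis by (simp add: c)
 qed
 thus ?thesis using d(1) by blast
qed

lemma eventually_equicontinuous:
 fixes y :: "nat => 'a::euclidean_space => real"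
 assumes c: "!!k. cont (y k)" and e: "e > 0"
  and "EX d>0. ALL k>=N. ALL x':cball x d. abs (y k x' - y k x) < e"
 shows "EX d>0. ALL k x'. norm (x - x') < d --> abs (y k x - y k x') < e"
proof -
 have ex: "EX d>0. ALL k<n. ALL x':cball x d. abs (y k x' - y k x) < e" for n
 proof (induction n)
  case (Suc n)
  then obtain d where d: "d > 0" "ALL k<n. ALL x':cball x d. abs (y k x' - y k x) < e" by blast
  obtain d' where d': "d' > 0" "ALL x'. dist x' x < d' --> dist (y n x') (y n x) < e"
   using c[of n] e unfolding continuous_on_iff by (metis UNIV_I)
  show ?case
   using d d' by (intro exI[of _ "min d (d' / 2)"]) (auto simp: less_Suc_eq dist_real_def dist_commute)
 qed (auto intro: exI[of _ 1])
 obtain d where d: "d > 0" "!!k x'. k >= N ==> x'\<in>cball x d ==> abs (y k x' - y k x) < e" using assms(3) by blast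
 obtain d' where d': "d' > 0" "!!k x'. k < N ==> x'\<in>cball x d' ==> abs (y k x' - y k x) < e" using ex[of N] by blast
 show ?thesis
 proof (intro exI[of _ "min d d'"] conjI allI impI)
  fix k x' assume "norm (x - x') < min d d'"
  hence "x' : cball x d" "x' : cball x d'" by (auto simp: dist_norm)
  hence "abs (y k x' - y k x) < e" using d(2) d'(2) by (cases "k >= N") auto
  thus "abs (y k x - y k x') < e" by (simp add: abs_minus_commute)
 qed (use d d' in auto)
qed

text \<open>The comparison pairs with the approximations y, which satisfy an exact resolvent equation on the whole
  space; so the limit w is kept together with them.\<close>

locale ground_state =
 fixes Om :: "'a::euclidean_space set" and a t eta :: "nat => real" and ch y :: "nat => 'a => real"
  and mu :: real and w :: "'a => real"
 assumes dom: "open Om" "connected Om" "bounded Om"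
  and a: "!!k. a k > 0" "a ----> 0"
  and ch: "!!k. bcont (ch k)" "!!k x. 0 <= ch k x" "!!k x. ch k x <= 1" "!!k x. x ~: Om ==> ch k x = 0"
  and ch1: "!!K. compact K ==> K <= Om ==> EX N. ALL k>=N. ALL x:K. ch k x = 1"
  and y: "!!k. bcont (y k)" "!!k x. 0 <= y k x" "!!k x. y k x <= 1"
  and yeq: "!!k x. y k x = t k * yuk (a k) (%x. ch k x * y k x) x + eta k"
  and pos: "!!k. t k > 0" "!!k. eta k >= 0"
  and mu_lim: "(%k. (t k - 1) / (a k)^2) ----> mu" and mu: "mu >= 0"
  and unif: "!!e. e > 0 ==> EX N. ALL k>=N. ALL x:closure Om. abs (y k x - w x) < e"
  and w: "continuous_on (closure Om) w" "wsol Om w (%x. mu * w x)" "!!x. x : Om ==> w x > 0"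
   "!!x. x : frontier Om ==> w x = 0"

lemma yukM_tail: "(%k. measure (yukM :: 'a::euclidean_space measure) {xi. real (k + K) <= norm xi}) ----> 0"
proof -
 interpret prob_space "yukM :: 'a measure" by (rule prob_yukM)
 have "(%k. measure (yukM :: 'a measure) {xi. real (k + K) <= norm xi}) ----> measure (yukM :: 'a measure) (\<Inter>k. {xi. real (k + K) <= norm xi})"
  by (rule finite_Lim_measure_decseq) (auto simp: decseq_def)
 moreover have "(\<Inter>k. {xi::'a. real (k + K) <= norm xi}) = {}"
 proof -
  have "EX k. norm xi < real (k + K)" for xi :: 'a
   using reals_Archimedean2[of "norm xi"] by (metis le_add1 of_nat_le_iff order_less_le_trans)
  thus ?thesis by (auto simp: not_le[symmetric] simp del: of_nat_add)
 qed
 ultimately show ?thesis by simp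
qed

text \<open>Killing at the boundary is softened to the factor ch, and the scale a of the resolvent tends to 0. The
  normalised blow-up solutions are equicontinuous inside by regularity and at the boundary by decay, so a
  subsequence converges uniformly on the closure; its supremum stays at least 1/2 and its zero set is open
  and closed.\<close>

theorem ground_state_exists:
 fixes Om :: "'a::euclidean_space set"
 assumes dom: "open Om" "connected Om" "bounded Om" and ne: "Om ~= {}"
  and cork: "!!x. x : frontier Om ==> corkscrew Om x"
 obtains a t eta ch y mu w where "ground_state Om a t eta ch y mu w"
proof -
 have nU: "- Om ~= {}" using dom(3) not_bounded_UNIV[where 'a='a] by (metis Compl_empty_eq double_complement)
 define d where "d x = infdist x (- Om)" for x
 have dcont: "cont d" unfolding d_def by (intro continuous_intros)
 have cl: "closed (- Om)" using dom(1) by auto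
 have d0: "d x > 0" if "x : Om" for x
  using in_closed_iff_infdist_zero[OF cl nU, of x] that infdist_nonneg[of x "- Om"] by (auto simp: d_def less_le)
 obtain x0 where x0: "x0 : Om" using ne by blast
 define rho where "rho = d x0 / 2"
 have rho: "rho > 0" using d0[OF x0] by (simp add: rho_def)
 have drho: "d x >= rho" if "x : cball x0 rho" for x
  using infdist_triangle[of x0 "- Om" x] that by (simp add: d_def rho_def)
 define K0 where "K0 = nat \<lceil>2 / rho\<rceil> + 1"
 have K0: "K0 >= 1" "real K0 >= 2 / rho" unfolding K0_def by linarith+
 define n where "n k = real (k + K0)" for k
 have n1: "n k >= 1" for k using K0 by (simp add: n_def)
 have n2: "n k >= 2 / rho" for k using K0 by (simp add: n_def)
 (* scale 1/n^2 against cut-off width 1/n: a resolvent step from outside rarely reaches ch ~= 0 *)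
 define a where "a k = 1 / (n k)^2" for k
 have a0: "a k > 0" for k using n1[of k] by (simp add: a_def)
 have a1: "a k <= 1" for k using n1[of k] by (simp add: a_def)
 have an: "a k * n k = 1 / n k" for k using n1[of k] by (simp add: a_def power2_eq_square)
 have nlim: "filterlim n at_top sequentially"
  unfolding n_def by (intro filterlim_compose[OF filterlim_real_sequentially] filterlim_add_const_nat_at_top)
 have alim: "a ----> 0"
  unfolding a_def by (intro tendsto_divide_0[OF tendsto_const] filterlim_at_top_imp_at_infinity filterlim_pow_at_top nlim) simp
 define ch where "ch k x = min 1 (max 0 (n k * d x - 1))" for k x
 have chb: "bcont (ch k)" for k
  by (rule bcontI[of _ 1]) (auto simp: ch_def intro!: continuous_intros dcont)
 have ch01: "0 <= ch k x" "ch k x <= 1" for k x by (auto simp: ch_def)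
 have ch1: "ch k x = 1" if "n k * d x >= 2" for k x using that by (simp add: ch_def)
 have ch0: "d x > 1 / n k" if "ch k x ~= 0" for k x
  using that n1[of k] by (simp add: ch_def field_simps split: if_splits)
 have ch_out: "ch k x = 0" if "x ~: Om" for k x
  using that by (simp add: ch_def d_def)
 define C where "C = (24 + 6 * real DIM('a))^2 / 96 / rho^2"
 have C: "C >= 0" by (simp add: C_def)
 define BU where "BU k y t eta \<longleftrightarrow> bcont y & (ALL x. 0 <= y x) & (ALL x. y x <= 1) & (EX x. y x >= 1/2) & 0 <= eta & eta <= a k ^ 3 &
  1 - a k ^ 3 <= t & 0 < t & t <= 1 + C * (a k)^2 & (ALL x. y x = t * yuk (a k) (%x. ch k x * y x) x + eta)"
  for k y and t eta :: real
 have "EX y t eta. BU k y t eta" for k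
 proof -
  have e: "a k ^ 3 > 0" using a0[of k] by (rule zero_less_power)
  interpret killed "ch k" "a k" using chb ch01 a0[of k] by unfold_locales auto
  have one: "ch k x = 1" if "x : cball x0 rho" for x
  proof (rule ch1)
   show "2 <= n k * d x" using n2[of k] drho[OF that] rho n1[of k] mult_mono by fastforce
  qed
  have Ca: "1 + C * (a k)^2 = 1 + (24 + 6 * real DIM('a))^2 / 96 * (a k)^2 / rho^2" by (simp add: C_def)
  obtain y t eta where yt: "bcont y" "!!x. 0 <= y x" "!!x. y x <= 1" "EX x. y x >= 1/2" "0 <= eta" "eta <= a k ^ 3"
   "1 - a k ^ 3 <= t" "0 < t" "t <= 1 + (24 + 6 * real DIM('a))^2 / 96 * (a k)^2 / rho^2"
   "!!x. y x = t * yuk (a k) (%x. ch k x * y x) x + eta"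
   by (rule blow_up[where ?x0.0=x0, OF rho _ e]) (erule one, rule that, assumption+)
  have "BU k y t eta" unfolding BU_def Ca by (intro conjI allI yt)
  thus ?thesis by (intro exI)
 qed
 then obtain y t eta where BU: "!!k. BU k (y k) (t k) (eta k)" by metis
 have y: "bcont (y k)" "0 <= y k x" "y k x <= 1" "EX x. y k x >= 1/2"
  and eta: "0 <= eta k" "eta k <= a k ^ 3" and t: "1 - a k ^ 3 <= t k" "0 < t k" "t k <= 1 + C * (a k)^2"
  and yeq: "y k x = t k * yuk (a k) (%x. ch k x * y k x) x + eta k" for k x
  using BU[of k] unfolding BU_def by blast+
 have eta2: "0 <= eta k / (a k)^2" "eta k / (a k)^2 <= a k" for k
 proof -
  show "0 <= eta k / (a k)^2" using eta by simp
  have "eta k / (a k)^2 <= a k ^ 3 / (a k)^2" using eta a0[of k] by (intro divide_right_mono) auto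
  also have "... = a k" using a0[of k] by (simp add: power2_eq_square power3_eq_cube)
  finally show "eta k / (a k)^2 <= a k" .
 qed
 define mk where "mk k = (t k - 1) / (a k)^2" for k
 have mk: "- a k <= mk k" "mk k <= C" for k
 proof -
  have "- (a k ^ 3) / (a k)^2 <= mk k" unfolding mk_def using t(1)[of k] a0[of k] by (intro divide_right_mono) auto
  moreover have "- (a k ^ 3) / (a k)^2 = - a k" using a0[of k] by (simp add: power2_eq_square power3_eq_cube)
  ultimately show "- a k <= mk k" by simp
  have "mk k <= (C * (a k)^2) / (a k)^2" unfolding mk_def using t(3)[of k] by (intro divide_right_mono) auto
  thus "mk k <= C" using a0[of k] by simp
 qed
 define F where "F k x = (t k * (ch k x * y k x) - (y k x - eta k)) / (a k)^2" for k x
 have wF: "wsol UNIV (y k) (F k)" for k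
 proof -
  have wc: "wsol UNIV (%_::'a. eta k) (%_. 0)"
   using laplace_on_imp_wsol[OF laplace_onI[of UNIV "%_. eta k" "%_ _. 0" "%_ _. 0" "%_. 0"] open_UNIV] by (auto intro: continuous_intros)
  have "bcont (%x. ch k x * y k x)" by (intro bcont_mult chb y)
  from wsol_add[OF wsol_cmult[OF yuk_wsol[OF this less_imp_neq[OF a0[of k], symmetric]], of "t k"] wc]
  show ?thesis
  proof (rule wsol_cong)
   fix x
   define g where "g = yuk (a k) (%x. ch k x * y k x) x"
   have gy: "t k * g = y k x - eta k" unfolding g_def by (subst (2) yeq) simp
   show "t k * yuk (a k) (%x. ch k x * y k x) x + eta k = y k x" by (rule yeq[symmetric])
   have "t k * ((ch k x * y k x - g) / (a k)^2) + 0 = (t k * (ch k x * y k x) - t k * g) / (a k)^2"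
    by (simp add: right_diff_distrib)
   thus "t k * ((ch k x * y k x - yuk (a k) (%x. ch k x * y k x) x) / (a k)^2) + 0 = F k x"
    unfolding F_def gy g_def[symmetric] .
  qed
 qed
 have F1: "F k x = mk k * y k x + eta k / (a k)^2" if "ch k x = 1" for k x
  using that a0[of k] by (simp add: F_def mk_def diff_divide_distrib add_divide_distrib algebra_simps)
 have Fle: "F k x <= C + 1" for k x
 proof -
  have "t k * (ch k x * y k x) <= t k * (1 * y k x)" using t(2)[of k] ch01 y by (intro mult_left_mono mult_right_mono) auto
  hence "F k x <= (t k * (1 * y k x) - (y k x - eta k)) / (a k)^2" unfolding F_def by (intro divide_right_mono) auto
  also have "... = mk k * y k x + eta k / (a k)^2"
   by (simp add: mk_def diff_divide_distrib add_divide_distrib algebra_simps)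
  also have "... <= C * 1 + a k" by (intro add_mono mult_mono eta2 mk y C)
  finally show ?thesis using a1[of k] by simp
 qed
 have F1b: "abs (F k x) <= C + 2" if "ch k x = 1" for k x
 proof -
  have "abs (mk k) <= C + 1" using mk[of k] a1[of k] C by linarith
  hence "abs (mk k) * abs (y k x) <= (C + 1) * 1" using y C by (intro mult_mono) auto
  hence "abs (mk k * y k x) <= C + 1" by (simp add: abs_mult)
  thus ?thesis unfolding F1[OF that] using eta2[of k] a1[of k] by linarith
 qed
 have ch1K: "EX N. ALL k>=N. ALL x:K. ch k x = 1" if K: "compact K" "K <= Om" for K
 proof (cases "K = {}")
  case False
  obtain z where z: "z : K" "!!x. x : K ==> d z <= d x"
   using continuous_attains_inf[OF K(1) False continuous_on_subset[OF dcont]] by auto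
  have dz: "d z > 0" using z K d0 by auto
  have "eventually (%k. n k >= 2 / d z) sequentially" using nlim by (simp add: filterlim_at_top)
  then obtain N where N: "!!k. k >= N ==> n k >= 2 / d z" by (auto simp: eventually_sequentially)
  have "ch k x = 1" if "k >= N" "x : K" for k x
  proof (rule ch1)
   have "(2 / d z) * d z <= n k * d x" using N z that dz n1[of k] by (intro mult_mono) auto
   thus "2 <= n k * d x" using dz by simp
  qed
  thus ?thesis by blast
 qed auto
 have out: "EX K. ALL k>=K. ALL x. x ~: Om --> y k x <= eps" if eps: "eps > 0" for eps
 proof -
  define p where "p k = measure (yukM :: 'a measure) {xi. n k <= norm xi}" for k
  have p: "p ----> 0" unfolding p_def n_def by (rule yukM_tail)
  have yp: "y k x <= (1 + C) * p k + a k" if x: "x ~: Om" for k x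
  proof -
   interpret prob_space "yukM :: 'a measure" by (rule prob_yukM)
   have "yuk (a k) (%x. ch k x * y k x) x <= (LINT xi|yukM. indicat_real {xi. n k <= norm xi} (xi::'a))"
    unfolding yuk_def
   proof (rule integral_mono)
    show "integrable yukM (%xi. ch k (x + a k *R xi) * y k (x + a k *R xi))"
     using integrable_yuk[OF bcont_mult[OF chb y(1)]] by blast
    fix xi :: 'a
    show "ch k (x + a k *R xi) * y k (x + a k *R xi) <= indicat_real {xi. n k <= norm xi} xi"
    proof (cases "ch k (x + a k *R xi) = 0")
     case False
     have "d (x + a k *R xi) <= dist (x + a k *R xi) x" unfolding d_def using x by (intro infdist_le) auto
     hence "1 / n k < a k * norm xi" using ch0[OF False] a0[of k] by (simp add: dist_norm)
     hence "a k * n k < a k * norm xi" by (simp add: an)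
     hence "n k <= norm xi" using a0[of k] by simp
     thus ?thesis using mult_mono[OF ch01(2)[of k "x + a k *R xi"] y(3)[of k "x + a k *R xi"]] y by simp
    qed simp
    show "integrable yukM (indicat_real {xi::'a. n k <= norm xi})"
     by (rule integrable_real_indicator) (auto simp: less_top[symmetric])
   qed
   hence 1: "yuk (a k) (%x. ch k x * y k x) x <= p k" by (simp add: p_def)
   have "C * (a k)^2 <= C * 1" using C a1[of k] a0[of k] by (intro mult_left_mono) (auto simp: power_le_one)
   hence 2: "t k <= 1 + C" using t(3)[of k] by linarith
   have "t k * yuk (a k) (%x. ch k x * y k x) x <= t k * p k" using 1 t(2)[of k] by (intro mult_left_mono) auto
   also have "... <= (1 + C) * p k" using 2 by (intro mult_right_mono) (auto simp: p_def)
   finally have 3: "t k * yuk (a k) (%x. ch k x * y k x) x <= (1 + C) * p k" .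
   have "a k ^ 3 <= a k ^ 1" using a0[of k] a1[of k] by (intro power_decreasing) auto
   hence "eta k <= a k" using eta(2)[of k] by simp
   thus ?thesis using 3 by (subst yeq) linarith
  qed
  have "(%k. (1 + C) * p k + a k) ----> (1 + C) * 0 + 0" by (intro tendsto_intros p alim)
  hence "eventually (%k. (1 + C) * p k + a k < eps) sequentially" using eps by (intro order_tendstoD(2)[of _ 0]) auto
  then obtain N where "!!k. k >= N ==> (1 + C) * p k + a k < eps" by (auto simp: eventually_sequentially)
  thus ?thesis using yp by (meson less_imp_le order_trans)
 qed
 have decay: "EX r>0. EX K. ALL k>=K. ALL x:cball x1 r. y k x <= sig" if "x1 : frontier Om" "sig > 0" for x1 sig
  by (rule boundary_decay[OF wF y(3) _ Fle out cork[OF that(1)] that(2)]) (use C in auto)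
 have y1: "abs (y k x) <= 1" for k x using y(2,3)[of k x] by simp
 have equi: "EX d>0. ALL k x'. norm (x - x') < d --> abs (y k x - y k x') < e" if x: "x : closure Om" and e: "e > 0" for x e
 proof -
  have "EX N. EX d>0. ALL k>=N. ALL x':cball x d. abs (y k x' - y k x) < e"
  proof (cases "x : Om")
   case True
   then obtain R where R: "R > 0" "cball x R <= Om" using dom(1) by (meson open_contains_cball)
   obtain N where N: "ALL k>=N. ALL x:cball x R. ch k x = 1" using ch1K[OF compact_cball R(2)] by blast
   show ?thesis by (rule exI[of _ N], rule interior_equicontinuous[OF wF y1 R(1) F1b e]) (use N in auto)
  next
   case False
   hence "x : frontier Om" using x dom(1) by (simp add: frontier_def interior_open)
   then obtain r K where rK: "r > 0" "!!k x'. k >= K ==> x' : cball x r ==> y k x' <= e/2" using decay[OF _ half_gt_zero[OF e]] by blast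
   have "abs (y k x' - y k x) < e" if "k >= K" "x' : cball x r" for k x'
   proof -
    have "x : cball x r" using rK(1) by simp
    from rK(2)[OF that(1) this] rK(2)[OF that] y(2)[of k x] y(2)[of k x'] e show ?thesis by linarith
   qed
   thus ?thesis using rK(1) by blast
  qed
  then obtain N where "EX d>0. ALL k>=N. ALL x':cball x d. abs (y k x' - y k x) < e" by blast
  thus ?thesis by (rule eventually_equicontinuous[OF bcontD(1)[OF y(1)] e])
 qed
 have comp: "compact (closure Om)" using dom(3) by simp
 have y1': "norm (y n x) <= 1" if "x : closure Om" for n x using y1 by simp
 have equi': "EX d. 0 < d & (ALL n x'. x' : closure Om & norm (x - x') < d --> norm (y n x - y n x') < e)"
  if "x : closure Om" "0 < e" for x e
  using equi[OF that] unfolding real_norm_def by blast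
 (* Arzela-Ascoli for the uniform limit, then a further subsequence for the eigenvalues *)
 obtain w s where w: "continuous_on (closure Om) w" "strict_mono (s :: nat => nat)"
  and ws: "!!e. 0 < e ==> EX N. ALL n x. n >= N & x : closure Om --> norm (y (s n) x - w x) < e"
  by (rule Arzela_Ascoli[OF comp y1' equi']) (assumption, assumption, assumption, rule that, assumption+)
 have "bounded (range (mk \<circ> s))"
 proof (rule boundedI[of _ "C + 1"])
  fix x assume "x : range (mk \<circ> s)"
  then obtain k where "x = mk k" by auto
  thus "norm x <= C + 1" using mk[of k] a1[of k] C by simp
 qed
 then obtain mu s' where s': "strict_mono (s' :: nat => nat)" and mulim: "(mk \<circ> s \<circ> s') ----> mu"
  using bounded_imp_convergent_subsequence[of "mk \<circ> s"] by auto
 define q where "q = s \<circ> s'"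
 have q: "strict_mono q" unfolding q_def by (rule strict_mono_o[OF w(2) s'])
 have qge: "q k >= k" for k by (rule seq_suble[OF q])
 have qgeN: "q k >= N" if "k >= N" for k N using qge[of k] that by simp
 have unif: "EX N. ALL k>=N. ALL x:closure Om. abs (y (q k) x - w x) < e" if "e > 0" for e
  using ws[OF that] seq_suble[OF s'] unfolding q_def o_def real_norm_def by (meson order_trans)
 have aq: "(%k. a (q k)) ----> 0" using LIMSEQ_subseq_LIMSEQ[OF alim q] by (simp add: o_def)
 have mq: "(%k. mk (q k)) ----> mu" using mulim by (simp add: o_def q_def)
 have mu0: "mu >= 0"
  by (rule LIMSEQ_le[OF _ mq]) (use tendsto_minus[OF aq] mk in "auto")
 have ptw: "(%k. y (q k) x) ----> w x" if "x : closure Om" for x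
  unfolding LIMSEQ_iff using unif that by (metis real_norm_def)
 have w0: "w x >= 0" if "x : closure Om" for x
  by (rule LIMSEQ_le_const[OF ptw[OF that]]) (use y in auto)
 have wf: "w x = 0" if x: "x : frontier Om" for x
 proof -
  have xc: "x : closure Om" using x by (simp add: frontier_def)
  have "w x <= sig" if s: "sig > 0" for sig
  proof -
   obtain r K where rK: "r > 0" "!!k x'. k >= K ==> x' : cball x r ==> y k x' <= sig" using decay[OF x s] by blast
   have "EX N. ALL k>=N. y (q k) x <= sig" using rK by (intro exI[of _ K] allI impI rK(2)[OF qgeN]) auto
   thus ?thesis by (rule LIMSEQ_le_const2[OF ptw[OF xc]])
  qed
  hence "w x <= 0" by (meson dense_ge)
  thus ?thesis using w0[OF xc] by simp
 qed
 have cw: "continuous_on Om w" by (rule continuous_on_subset[OF w(1) closure_subset])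
 have wsw: "wsol Om w (%x. mu * w x)"
 proof (rule wsol_limit[where y="%k. y (q k)" and F="%k. F (q k)"])
  show "wsol Om (y (q k)) (F (q k))" for k by (rule wsol_subset[OF wF]) simp
  show "continuous_on Om (%x. mu * w x)" using cw by (intro continuous_intros)
  show "(%n. y (q n) x) ----> w x" if "x : Om" for x using ptw that closure_subset by blast
  fix K assume K: "compact K" "K <= Om"
  obtain N where N: "!!k x. k >= N ==> x : K ==> ch k x = 1" using ch1K[OF K] by blast
  show "EX B N. ALL n>=N. ALL x:K. abs (y (q n) x) <= B & abs (F (q n) x) <= B"
  proof (intro exI[of _ "C + 2"] exI[of _ N] allI impI ballI conjI)
   fix k x assume k: "k >= N" "x : K"
   show "abs (y (q k) x) <= C + 2" using y1[of "q k" x] C by simp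
   show "abs (F (q k) x) <= C + 2" using k by (intro F1b N qgeN)
  qed
 next
  fix x assume x: "x : Om"
  have xc: "x : closure Om" using x closure_subset by blast
  obtain N where N: "!!k. k >= N ==> ch k x = 1" using ch1K[of "{x}"] x by auto
  have e0: "(%k. eta (q k) / (a (q k))^2) ----> 0"
   by (rule tendsto_sandwich[OF _ _ tendsto_const aq]) (use eta2 in auto)
  have "(%k. mk (q k) * y (q k) x + eta (q k) / (a (q k))^2) ----> mu * w x + 0"
   by (intro tendsto_intros mq ptw[OF xc] e0)
  moreover have "eventually (%k. mk (q k) * y (q k) x + eta (q k) / (a (q k))^2 = F (q k) x) sequentially"
   unfolding eventually_sequentially by (intro exI[of _ N] allI impI F1[symmetric] N qgeN)
  ultimately show "(%k. F (q k) x) ----> mu * w x" by (simp add: tendsto_cong)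
 qed (rule cw)
 (* the maximum of y is at least 1/2 and cannot escape to the boundary, where y is below 1/4 *)
 obtain z where z: "z : Om" "w z > 0"
 proof -
  obtain N1 where N1: "!!k x. k >= N1 ==> x ~: Om ==> y k x <= 1/4" using out[of "1/4"] zero_less_divide_1_iff[of "4::real"] zero_less_numeral by blast
  obtain N2 where N2: "!!k x. k >= N2 ==> x : closure Om ==> abs (y (q k) x - w x) < 1/4" using unif[of "1/4"] zero_less_divide_1_iff[of "4::real"] zero_less_numeral by blast
  define k where "k = max N1 N2"
  obtain z where z: "y (q k) z >= 1/2" using y(4) by blast
  have zO: "z : Om"
  proof (rule ccontr)
   assume "z ~: Om"
   hence "y (q k) z <= 1/4" by (intro N1 qgeN) (auto simp: k_def)
   thus False using z by simp
  qed
  hence "z : closure Om" using closure_subset by blast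
  hence "abs (y (q k) z - w z) < 1/4" by (intro N2) (auto simp: k_def)
  hence "w z > 0" using z by linarith
  thus thesis using zO that by blast
 qed
 have wpos: "w x > 0" if x: "x : Om" for x
 proof -
  define Z where "Z = {x:Om. w x = 0}"
  have "openin (top_of_set Om) Z"
  proof -
   have "EX R>0. ball x R <= Z" if "x : Z" for x
   proof -
    have x: "x : Om" "w x = 0" using that by (auto simp: Z_def)
    obtain R where R: "R > 0" "cball x R <= Om" using dom(1) x(1) by (meson open_contains_cball)
    have "w x' = 0" if "x' : ball x R" for x'
    proof -
     have nn: "w p >= 0" if "p : ball x R" for p using w0 R that closure_subset[of Om] by (meson ball_subset_cball subsetD)
     have "(- 1) * w x' = (- 1) * w x"
     proof (rule wsol_strong_max[OF wsol_cmult[OF wsw] R(2) _ _ that])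
      show "(- 1) * w p <= (- 1) * w x" if "p : ball x R" for p using nn[OF that] x by simp
      show "(- 1) * (mu * w p) <= 0" if "p : ball x R" for p using nn[OF that] mu0 by simp
     qed
     thus ?thesis using x by simp
    qed
    thus ?thesis using R ball_subset_cball by (intro exI[of _ R]) (auto simp: Z_def)
   qed
   hence "open Z" by (simp add: open_contains_ball)
   thus ?thesis by (rule open_openin_trans[OF dom(1)]) (auto simp: Z_def)
  qed
  moreover have "closedin (top_of_set Om) Z"
   unfolding Z_def using continuous_closedin_preimage_constant[OF cw, of 0] by simp
  ultimately have "Z = {} | Z = Om" using dom(2) by (simp add: connected_clopen)
  moreover have "z ~: Z" using z by (simp add: Z_def)
  ultimately have "x ~: Z" using z(1) by blast
  hence "w x ~= 0" using x by (simp add: Z_def)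
  thus ?thesis using w0[of x] x closure_subset[of Om] by force
 qed
 have "ground_state Om (%k. a (q k)) (%k. t (q k)) (%k. eta (q k)) (%k. ch (q k)) (%k. y (q k)) mu w"
 proof
  show "(%k. (t (q k) - 1) / (a (q k))^2) ----> mu" using mq by (simp add: mk_def)
  show "EX N. ALL k>=N. ALL x:K. ch (q k) x = 1" if "compact K" "K <= Om" for K
   using ch1K[OF that] qgeN by meson
 qed (rule dom a0 aq chb ch01 ch_out y(1,2,3) yeq t(2) eta(1) mu0 unif w(1) wsw wpos wf | assumption)+
 thus thesis by (rule that)
qed

section \<open>Comparison with the ground state\<close>

lemma yuk_tendsto:
 fixes g :: "'a::euclidean_space => real"
 assumes g: "bcont g" and a: "a ----> 0"
 shows "(%k. yuk (a k) g x) ----> g x"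
proof -
 interpret prob_space "yukM :: 'a measure" by (rule prob_yukM)
 obtain B where B: "!!x. abs (g x) <= B" using g unfolding bcont_def by blast
 have "(%k. LINT xi|yukM. g (x + a k *R xi)) ----> (LINT xi|(yukM :: 'a measure). g x)"
 proof (rule integral_dominated_convergence[where w = "%_. B"])
  show "AE xi in yukM. (%k. g (x + a k *R xi)) ----> g x"
  proof (rule AE_I2)
   fix xi :: 'a
   have "(%k. x + a k *R xi) ----> x + 0 *R xi" by (intro tendsto_intros a)
   hence "(%k. x + a k *R xi) ----> x" by simp
   moreover have "isCont g x" using bcontD(1)[OF g] by (simp add: continuous_on_eq_continuous_at)
   ultimately show "(%k. g (x + a k *R xi)) ----> g x" by (rule isCont_tendsto_compose[rotated])
  qed
  show "(%xi. g (x + a k *R xi)) : borel_measurable yukM" for k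
   using integrable_yuk[OF g] by blast
 qed (use B in auto)
 thus ?thesis by (simp add: yuk_def prob_space[simplified])
qed

text \<open>Where p exceeds the level, the maximum principle compares the truncation with the right-hand side;
  elsewhere the left side is zero.\<close>

lemma truncation_subsolution:
 fixes p :: "'a::euclidean_space => real"
 assumes p: "bcont p" and w: "wsol {x. p x > 0} p (%x. lam * p x)" and bd: "bounded {x. p x > 0}"
  and lam: "lam >= 0" and dl: "dl > 0" and a: "a > 0"
 shows "max 0 (p x - dl) <= (1 + lam * a^2) * yuk a (%x. max 0 (p x - dl)) x + a^2 * (lam * dl)"
proof -
 define f where "f x = max 0 (p x - dl)" for x
 have pc: "cont p" by (rule bcontD[OF p])
 have f: "bcont f"
 proof -
  obtain B where B: "B >= 0" "!!x. abs (p x) <= B" by (rule bcont_bound[OF p]) (rule that)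
  show ?thesis unfolding f_def
  proof (rule bcontI[of _ B])
   show "cont (%x. max 0 (p x - dl))" by (intro continuous_intros pc)
   show "abs (max 0 (p x - dl)) <= B" for x using B(2)[of x] B(1) dl by auto
  qed
 qed
 define g where "g = yuk a f"
 have gb: "bcont g" unfolding g_def by (rule yuk_bcont[OF f])
 have g0: "g x >= 0" for x
  using yuk_mono[OF bcont_const[of 0] f, of a x] by (simp add: g_def f_def)
 define S where "S = {x. p x > dl}"
 have So: "open S" unfolding S_def by (intro open_Collect_less continuous_intros pc)
 have Ssub: "S <= {x. p x > 0}" using dl by (auto simp: S_def)
 define D where "D x = (p x - (1 + lam * a^2) * g x) - (dl + a^2 * (lam * dl))" for x
 define FD where "FD x = (lam * p x - (1 + lam * a^2) * ((f x - g x) / a^2)) - 0" for x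
 have wc: "wsol S (%_. k) (%_. 0)" for k
  using laplace_on_imp_wsol[OF laplace_onI[of S "%_. k" "%_ _. 0" "%_ _. 0" "%_. 0"] So] by (auto intro: continuous_intros)
 have wg: "wsol UNIV g (%x. (f x - g x) / a^2)" unfolding g_def by (rule yuk_wsol[OF f]) (use a in simp)
 have wD: "wsol S D FD" unfolding D_def FD_def
  by (intro wsol_diff wsol_cmult wsol_subset[OF w Ssub] wc wsol_subset[OF wg]) simp
 have le: "D x <= 0" if x: "x : S" for x
 proof (rule wsol_max_principle[OF wD So _ _ _ _ x])
  show "bounded S" by (rule bounded_subset[OF bd Ssub])
  show "continuous_on (closure S) D" unfolding D_def
   by (intro continuous_intros continuous_on_subset[OF pc] continuous_on_subset[OF bcontD(1)[OF gb]]) auto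
  fix x assume x: "x : S" "D x > 0"
  have fx: "f x = p x - dl" using x by (simp add: f_def S_def)
  have "lam * p x * a^2 <= (1 + lam * a^2) * (f x - g x)"
   using x(2) unfolding D_def fx by (simp add: algebra_simps)
  hence "lam * p x <= ((1 + lam * a^2) * (f x - g x)) / a^2" using a by (simp add: pos_le_divide_eq)
  thus "FD x <= 0" by (simp add: FD_def)
 next
  fix x assume "x : frontier S"
  hence "p x <= dl" using So frontier_def interior_open S_def not_less by blast
  moreover have "(1 + lam * a^2) * g x >= 0" "a\<^sup>2 * (lam * dl) >= 0" using g0 lam dl by (auto intro!: mult_nonneg_nonneg)
  ultimately show "D x <= 0" unfolding D_def by linarith
 qed
 have "f x <= (1 + lam * a^2) * g x + a^2 * (lam * dl)"
 proof (cases "x : S")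
  case True
  thus ?thesis using le[OF True] by (simp add: D_def f_def S_def)
 next
  case False
  hence "f x = 0" by (simp add: f_def S_def)
  moreover have "(1 + lam * a^2) * g x >= 0" "a\<^sup>2 * (lam * dl) >= 0" using g0 lam dl by (auto intro!: mult_nonneg_nonneg)
  ultimately show ?thesis by simp
 qed
 thus ?thesis by (simp only: f_def[abs_def] g_def)
qed

context ground_state
begin

text \<open>Let f be the truncation and e its nonnegative defect in the resolvent inequality. Testing e with c psi
  gives at most what testing with z = ch y gives, where z is built from the approximate ground states y.
  That is small, because the resolvent is symmetric, y solves the equation with parameter t, and lam is at
  most mu.\<close>

lemma compare_truncation:
 fixes p psi L :: "'a => real"
 assumes p: "bcont p" "!!x. p x >= 0" "!!x. x ~: Om ==> p x = 0"
  and wp: "wsol {x. p x > 0} p (%x. lam * p x)" and lam: "0 <= lam" "lam <= mu" and dl: "dl > 0"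
  and psi: "test_fun psi L" "!!x. 0 <= psi x" "!!x. psi x <= 1"
  and K: "compact K" "K <= Om" "!!x. x ~: K ==> psi x = 0"
  and c: "c > 0" "!!x. x : K ==> 2 * c <= w x"
 shows "c * ((LB x. max 0 (p x - dl) * L x) + lam * (LB x. max 0 (p x - dl) * psi x)) <= lam * dl * measure lborel Om"
proof -
 define f where "f x = max 0 (p x - dl)" for x
 have pc: "cont p" by (rule bcontD[OF p(1)])
 obtain B where B: "B >= 0" "!!x. abs (p x) <= B" by (rule bcont_bound[OF p(1)]) (rule that)
 have f: "bcont f" unfolding f_def
 proof (rule bcontI[of _ B])
  show "cont (%x. max 0 (p x - dl))" by (intro continuous_intros pc)
  show "abs (max 0 (p x - dl)) <= B" for x using B(2)[of x] B(1) dl by auto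
 qed
 have f0: "f x >= 0" for x by (simp add: f_def)
 have fO: "f x = 0" if "x ~: Om" for x using p(3)[OF that] dl by (simp add: f_def)
 have int: "integrable lborel g" if "bcont g" "!!x. x ~: Om ==> g x = 0" for g :: "'a => real"
  by (rule integrable_continuous_bounded_support[OF bcontD(1)[OF that(1)] that(2) dom(3)])
 have intf: "integrable lborel (%x. f x * g x)" if "bcont g" for g by (rule int) (use f that fO in "auto intro: bcont_mult")
 have psib: "bcont psi" "bcont L" by (rule test_fun_bcont[OF psi(1)])+
 have psiO: "psi x = 0" if "x ~: Om" for x using K(2,3) that by blast
 have psiint: "integrable lborel psi" by (rule int[OF psib(1) psiO])
 have intpsi: "integrable lborel (%x. psi x * g x)" if "bcont g" for g by (rule int) (use psib that psiO in "auto intro: bcont_mult")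
 define vol where "vol = measure lborel Om"
 define Kf where "Kf = {x. dl <= p x}"
 have Kf: "compact Kf" "Kf <= Om"
 proof -
  have "closed Kf" unfolding Kf_def by (intro closed_Collect_le continuous_intros pc)
  moreover show "Kf <= Om" using p(3) dl by (force simp: Kf_def)
  ultimately show "compact Kf" using dom(3) by (meson bounded_subset compact_eq_bounded_closed)
 qed
 have fK: "f x = 0" if "x ~: Kf" for x using that by (simp add: f_def Kf_def)
 obtain N1 where N1: "!!k x. k >= N1 ==> x : K \<union> Kf ==> ch k x = 1"
  using ch1[OF compact_Un[OF K(1) Kf(1)] Un_least[OF K(2) Kf(2)]] by (elim exE) (rule that, blast)
 obtain N2 where N2: "!!k x. k >= N2 ==> x : closure Om ==> abs (y k x - w x) < c" using unif[OF c(1)] by blast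
 define mk where "mk k = (t k - 1) / (a k)^2" for k
 define J where "J k = (LB x. f x * yuk (a k) L x) + lam * (LB x. f x * yuk (a k) psi x)" for k
 have key: "t k * (c * J k - lam * dl * vol) <= max 0 (lam - mk k) * (LB x. f x)" if k: "k >= N1" "k >= N2" for k
 proof -
  define alp T where "alp = a k" and "T = t k"
  have al: "alp > 0" and T: "T > 0" using a pos by (auto simp: alp_def T_def)
  define z where "z x = ch k x * y k x" for x
  have zb: "bcont z" unfolding z_def by (intro bcont_mult ch y)
  have z0: "0 <= z x" "z x <= 1" for x using ch y by (auto simp: z_def mult_le_one)
  have zO: "z x = 0" if "x ~: Om" for x using ch(4)[OF that] by (simp add: z_def)
  have zint: "integrable lborel z" by (rule int[OF zb zO])
  have intz: "integrable lborel (%x. z x * g x)" if "bcont g" for g by (rule int) (use zb that zO in "auto intro: bcont_mult")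
  have zvol: "(LB x. z x) <= vol"
  proof -
   have "(LB x. z x) <= (LB x. indicat_real Om x)"
   proof (rule integral_mono[OF zint])
    show "integrable lborel (indicat_real Om)"
     using dom emeasure_bounded_finite[OF dom(3)] by (intro integrable_real_indicator) auto
    show "z x <= indicat_real Om x" for x using zO[of x] z0[of x] by (cases "x : Om") auto
   qed
   thus ?thesis using dom by (simp add: vol_def)
  qed
  have psiz: "c * psi x <= z x" for x
  proof (cases "x : K")
   case True
   hence "x : closure Om" using K closure_subset by blast
   from N2[OF k(2) this] c(2)[OF True] have "c <= y k x" by linarith
   moreover have "c * psi x <= c * 1" using c psi by (intro mult_left_mono) auto
   ultimately show ?thesis using N1[OF k(1), of x] True by (simp add: z_def)
  qed (use z0 K in auto)
  define Yf where "Yf = yuk alp f"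
  have Yf: "bcont Yf" unfolding Yf_def by (rule yuk_bcont[OF f])
  define e where "e x = (1 + lam * alp^2) * Yf x + alp^2 * (lam * dl) - f x" for x
  have "{x. p x > 0} <= Om" using p(3) by force
  hence "bounded {x. p x > 0}" by (rule bounded_subset[OF dom(3)])
  from truncation_subsolution[OF p(1) wp this lam(1) dl al]
  have e0: "e x >= 0" for x unfolding e_def Yf_def f_def[abs_def] by (simp only: diff_ge_0_iff_ge)
  have eb: "bcont e" unfolding e_def by (intro bcont_diff bcont_add bcont_cmult Yf f bcont_const)
  define A where "A = (LB x. f x * y k x)"
  have fz: "(LB x. f x * z x) = A" unfolding A_def
  proof (rule Bochner_Integration.integral_cong[OF refl])
   fix x show "f x * z x = f x * y k x" using N1[OF k(1), of x] fK[of x] by (cases "x : Kf") (auto simp: z_def)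
  qed
  have A0: "A >= 0" "A <= (LB x. f x)"
  proof -
   show "A >= 0" unfolding A_def using f0 y by (intro Bochner_Integration.integral_nonneg) auto
   have "f x * y k x <= f x" for x using mult_left_mono[OF y(3)[of k x] f0[of x]] by simp
   thus "A <= (LB x. f x)" unfolding A_def by (intro integral_mono intf y int[OF f fO])
  qed
  have "(LB x. T * (z x * Yf x)) <= A"
  proof -
   have "(LB x. T * (z x * Yf x)) = T * (LB x. Yf x * z x)" by (simp add: mult.commute)
   also have "(LB x. Yf x * z x) = (LB x. f x * yuk alp z x)"
    unfolding Yf_def by (rule yuk_symmetric[OF f zb zint])
   also have "T * ... = (LB x. f x * (T * yuk alp z x))" by (simp add: mult.left_commute)
   also have "... <= A" unfolding A_def
   proof (rule integral_mono)
    show "integrable lborel (%x. f x * (T * yuk alp z x))" by (intro intf bcont_cmult yuk_bcont zb)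
    show "integrable lborel (%x. f x * y k x)" by (intro intf y)
    fix x
    show "f x * (T * yuk alp z x) <= f x * y k x" by (simp add: yeq[of k x] pos(2)[of k] T_def alp_def z_def[abs_def] f0 mult_left_mono)
   qed
   finally show ?thesis .
  qed
  hence zY: "T * (LB x. z x * Yf x) <= A" by simp
  have ez: "(LB x. z x * e x) = (1 + lam * alp^2) * (LB x. z x * Yf x) + alp^2 * (lam * dl) * (LB x. z x) - A"
  proof -
   have "(LB x. z x * e x) = (LB x. (1 + lam * alp^2) * (z x * Yf x) + alp^2 * (lam * dl) * z x - f x * z x)"
    by (simp add: e_def algebra_simps)
   also have "... = (1 + lam * alp^2) * (LB x. z x * Yf x) + alp^2 * (lam * dl) * (LB x. z x) - (LB x. f x * z x)"
    using intz[OF Yf] zint intf[OF zb] by simp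
   finally show ?thesis unfolding fz .
  qed
  have epsi: "(LB x. psi x * e x) >= alp^2 * J k"
  proof -
   have 1: "(LB x. psi x * e x) = (1 + lam * alp^2) * (LB x. Yf x * psi x) + alp^2 * (lam * dl) * (LB x. psi x) - (LB x. f x * psi x)"
   proof -
    have "(LB x. psi x * e x) = (LB x. (1 + lam * alp^2) * (psi x * Yf x) + alp^2 * (lam * dl) * psi x - f x * psi x)"
     by (simp add: e_def algebra_simps)
    also have "... = (1 + lam * alp^2) * (LB x. psi x * Yf x) + alp^2 * (lam * dl) * (LB x. psi x) - (LB x. f x * psi x)"
     using intpsi[OF Yf] psiint intf[OF psib(1)] by simp
    finally show ?thesis by (simp add: mult.commute)
   qed
   have 2: "(LB x. Yf x * psi x) = (LB x. f x * yuk alp psi x)"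
    unfolding Yf_def by (rule yuk_symmetric[OF f psib(1) psiint])
   have 3: "(LB x. f x * yuk alp psi x) = alp^2 * (LB x. f x * yuk alp L x) + (LB x. f x * psi x)"
   proof -
    have "yuk alp psi x = alp^2 * yuk alp L x + psi x" for x using yuk_test_fun[OF psi(1), of alp x] by linarith
    hence "(LB x. f x * yuk alp psi x) = (LB x. alp\<^sup>2 * (f x * yuk alp L x) + f x * psi x)"
     by (simp add: algebra_simps)
    also have "... = alp^2 * (LB x. f x * yuk alp L x) + (LB x. f x * psi x)"
     using intf[OF yuk_bcont[OF psib(2)], of alp] intf[OF psib(1)] by simp
    finally show ?thesis .
   qed
   have 4: "alp\<^sup>2 * (lam * dl) * (LB x. psi x) >= 0"
    using lam dl psi by (intro mult_nonneg_nonneg Bochner_Integration.integral_nonneg) auto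
   have "alp\<^sup>2 * J k = (1 + lam * alp^2) * (LB x. f x * yuk alp psi x) - (LB x. f x * psi x)"
    using 3 unfolding J_def alp_def[symmetric] by (simp add: algebra_simps)
   thus ?thesis using 1 4 unfolding 2 by linarith
  qed
  have "c * (LB x. psi x * e x) <= (LB x. z x * e x)"
  proof -
   have "c * (LB x. psi x * e x) = (LB x. c * (psi x * e x))" by simp
   also have "... <= (LB x. z x * e x)"
   proof (rule integral_mono)
    show "integrable lborel (%x. c * (psi x * e x))" using intpsi[OF eb] by simp
    show "integrable lborel (%x. z x * e x)" by (rule intz[OF eb])
    fix x show "c * (psi x * e x) <= z x * e x" using mult_right_mono[OF psiz[of x] e0[of x]] by simp
   qed
   finally show ?thesis .
  qed
  hence "T * (c * (alp^2 * J k)) <= T * (LB x. z x * e x)" using mult_left_mono[OF epsi less_imp_le[OF c(1)]] T mult_left_mono by simp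
  also have "... = (1 + lam * alp^2) * (T * (LB x. z x * Yf x)) + T * (alp^2 * (lam * dl) * (LB x. z x)) - T * A"
   unfolding ez by (simp add: algebra_simps)
  also have "... <= (1 + lam * alp^2) * A + T * (alp^2 * (lam * dl) * vol) - T * A"
   using zY zvol T lam dl by (intro diff_right_mono add_mono mult_left_mono) auto
  also have "... = alp^2 * ((lam - mk k) * A + T * (lam * dl * vol))"
  proof -
   have T1: "mk k * alp^2 = T - 1" using al by (simp add: mk_def T_def alp_def)
   have "alp\<^sup>2 * ((lam - mk k) * A) = (lam * alp^2 - (T - 1)) * A" unfolding T1[symmetric] by (simp add: algebra_simps)
   thus ?thesis by (simp add: algebra_simps)
  qed
  finally have "alp\<^sup>2 * (T * (c * J k)) <= alp^2 * ((lam - mk k) * A + T * (lam * dl * vol))" by (simp add: mult_ac)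
  hence "T * (c * J k) <= (lam - mk k) * A + T * (lam * dl * vol)" using al by simp
  moreover have "(lam - mk k) * A <= max 0 (lam - mk k) * A" using A0 by (intro mult_right_mono) auto
  moreover have "... <= max 0 (lam - mk k) * (LB x. f x)" using A0 by (intro mult_left_mono) auto
  ultimately show ?thesis unfolding T_def right_diff_distrib by linarith
 qed
 have mkl: "mk ----> mu" using mu_lim by (simp add: mk_def[abs_def])
 have tl: "t ----> 1"
 proof -
  have "(%k. 1 + mk k * (a k)^2) ----> 1 + mu * 0^2" by (intro tendsto_intros mkl a)
  moreover have "1 + mk k * (a k)^2 = t k" for k using a(1)[of k] by (simp add: mk_def)
  ultimately show ?thesis by simp
 qed
 have lim: "(%k. LB x. f x * yuk (a k) g x) ----> (LB x. f x * g x)" if g: "bcont g" for g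
 proof -
  obtain G where G: "G >= 0" "!!x. abs (g x) <= G" by (rule bcont_bound[OF g]) (rule that)
  show ?thesis
  proof (rule integral_dominated_convergence[where w = "%x. f x * G"])
   show "integrable lborel (%x. f x * G)" by (rule intf[OF bcont_const])
   show "AE x in lborel. (%k. f x * yuk (a k) g x) ----> f x * g x"
    by (intro AE_I2 tendsto_intros yuk_tendsto[OF g a(2)])
   show "AE x in lborel. norm (f x * yuk (a k) g x) <= f x * G" for k
    by (intro AE_I2) (use f0 yuk_bound[OF g G(2)] in "auto simp: abs_mult intro!: mult_left_mono")
   show "(%x. f x * g x) : borel_measurable lborel" using intf[OF g] by blast
   show "(%x. f x * yuk (a k) g x) : borel_measurable lborel" for k using intf[OF yuk_bcont[OF g]] by blast
  qed
 qed
 have Jl: "J ----> (LB x. f x * L x) + lam * (LB x. f x * psi x)"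
  unfolding J_def by (intro tendsto_intros lim psib)
 have "1 * (c * ((LB x. f x * L x) + lam * (LB x. f x * psi x)) - lam * dl * vol) <= max 0 (lam - mu) * (LB x. f x)"
 proof (rule LIMSEQ_le)
  show "(%k. t k * (c * J k - lam * dl * vol)) ----> 1 * (c * ((LB x. f x * L x) + lam * (LB x. f x * psi x)) - lam * dl * vol)"
   by (intro tendsto_intros tl Jl)
  show "(%k. max 0 (lam - mk k) * (LB x. f x)) ----> max 0 (lam - mu) * (LB x. f x)"
   by (intro tendsto_intros mkl)
  show "EX N. ALL k>=N. t k * (c * J k - lam * dl * vol) <= max 0 (lam - mk k) * (LB x. f x)"
   using key by (intro exI[of _ "max N1 N2"]) auto
 qed
 thus ?thesis using lam by (simp add: f_def vol_def)
qed

text \<open>The level dl tends to 0.\<close>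

lemma compare:
 fixes p psi L :: "'a => real"
 assumes p: "bcont p" "!!x. p x >= 0" "!!x. x ~: Om ==> p x = 0"
  and wp: "wsol {x. p x > 0} p (%x. lam * p x)" and lam: "0 <= lam" "lam <= mu"
  and psi: "test_fun psi L" "!!x. 0 <= psi x" "!!x. psi x <= 1"
  and K: "compact K" "K <= Om" "!!x. x ~: K ==> psi x = 0"
 shows "(LB x. p x * L x) + lam * (LB x. p x * psi x) <= 0"
proof -
 obtain c where c: "c > 0" "!!x. x : K ==> 2 * c <= w x"
 proof (cases "K = {}")
  case False
  have "continuous_on K w" by (rule continuous_on_subset[OF w(1)]) (use K(2) closure_subset in blast)
  from continuous_attains_inf[OF K(1) False this] obtain z where z: "z : K" "ALL x:K. w z <= w x" by blast
  have "w z > 0" using w(3) z(1) K(2) by blast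
  show thesis by (rule that[of "w z / 2"]) (use \<open>w z > 0\<close> z in auto)
 next
  case True
  show thesis by (rule that[of 1]) (use True in auto)
 qed
 have psib: "bcont psi" "bcont L" by (rule test_fun_bcont[OF psi(1)])+
 define G where "G x = L x + lam * psi x" for x
 have Gb: "bcont G" unfolding G_def by (intro bcont_add bcont_cmult psib)
 obtain M where M: "M >= 0" "!!x. abs (G x) <= M" by (rule bcont_bound[OF Gb]) (rule that)
 define vol where "vol = measure lborel Om"
 have int: "integrable lborel (%x. q x * g x)" if "bcont g" "bcont q" "!!x. x ~: Om ==> q x = 0" for g q :: "'a => real"
  by (rule integrable_continuous_bounded_support[OF bcontD(1)[OF bcont_mult[OF that(2,1)]] _ dom(3)]) (use that(3) in auto)
 have split: "(LB x. q x * G x) = (LB x. q x * L x) + lam * (LB x. q x * psi x)"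
  if "bcont q" "!!x. x ~: Om ==> q x = 0" for q
 proof -
  have "(LB x. q x * G x) = (LB x. q x * L x + lam * (q x * psi x))" by (simp add: G_def algebra_simps)
  also have "... = (LB x. q x * L x) + lam * (LB x. q x * psi x)"
   using int[OF psib(2) that] int[OF psib(1) that] by simp
  finally show ?thesis .
 qed
 have le: "(LB x. p x * G x) <= dl * (lam * vol / c + M * vol)" if dl: "dl > 0" for dl
 proof -
  define f where "f x = max 0 (p x - dl)" for x
  obtain B where B: "B >= 0" "!!x. abs (p x) <= B" by (rule bcont_bound[OF p(1)]) (rule that)
  have f: "bcont f" unfolding f_def
  proof (rule bcontI[of _ B])
   show "cont (%x. max 0 (p x - dl))" by (intro continuous_intros bcontD[OF p(1)])
   show "abs (max 0 (p x - dl)) <= B" for x using B(2)[of x] B(1) dl by auto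
  qed
  have fO: "f x = 0" if "x ~: Om" for x using p(3)[OF that] dl by (simp add: f_def)
  have e: "(LB x. f x * G x) = (LB x. f x * L x) + lam * (LB x. f x * psi x)"
   by (rule split[OF f fO])
  have "c * (LB x. f x * G x) <= lam * dl * vol"
   unfolding e unfolding f_def vol_def by (rule compare_truncation[OF p wp lam dl psi K c])
  hence 1: "(LB x. f x * G x) <= dl * (lam * vol / c)" using c(1) by (simp add: field_simps)
  have "(LB x. p x * G x) - (LB x. f x * G x) = (LB x. p x * G x - f x * G x)"
   using int[OF Gb p(1,3)] int[OF Gb f fO] by simp
  also have "... <= (LB x. (dl * M) * indicat_real Om x)"
  proof (rule integral_mono)
   show "integrable lborel (%x. p x * G x - f x * G x)" using int[OF Gb p(1,3)] int[OF Gb f fO] by simp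
   show "integrable lborel (%x. (dl * M) * indicat_real Om x)"
    using dom emeasure_bounded_finite[OF dom(3)] by (intro integrable_mult_right integrable_real_indicator) auto
   fix x
   show "p x * G x - f x * G x <= (dl * M) * indicat_real Om x"
   proof (cases "x : Om")
    case True
    have "abs (p x - f x) * abs (G x) <= dl * M" using p(2)[of x] M dl by (intro mult_mono) (auto simp: f_def)
    hence "(p x - f x) * G x <= dl * M" by (simp add: abs_mult[symmetric])
    thus ?thesis using True by (simp add: left_diff_distrib)
   qed (use p(3)[of x] fO[of x] in simp)
  qed
  also have "... = dl * (M * vol)" using dom by (simp add: vol_def)
  finally show ?thesis using 1 by (simp add: distrib_left)
 qed
 have "(LB x. p x * G x) <= 0"
 proof (rule ccontr)
  define I where "I = (LB x. p x * G x)"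
  define D where "D = lam * vol / c + M * vol"
  have D: "D >= 0" using lam c M by (simp add: D_def vol_def)
  assume "~ (LB x. p x * G x) <= 0"
  hence I: "I > 0" by (simp add: I_def)
  hence "I / (2 * (D + 1)) > 0" using D by simp
  from le[OF this] have "I <= (I / (2 * (D + 1))) * D" unfolding I_def[symmetric] D_def[symmetric] .
  also have "... <= (I / (2 * (D + 1))) * (D + 1)" using I D by (intro mult_left_mono) auto
  also have "... = I / 2"
  proof -
   have "(I / (2 * q)) * q = I / 2" if "q > 0" for q using that by simp
   thus ?thesis using D by (metis add_nonneg_pos zero_less_one)
  qed
  finally show False using I by simp
 qed
 moreover have "(LB x. p x * G x) = (LB x. p x * L x) + lam * (LB x. p x * psi x)"
  by (rule split[OF p(1,3)])
 ultimately show ?thesis by linarith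
qed

text \<open>With bumps as psi, the means of p of every order are nonincreasing in the radius; they start at p x0 = 0
  and are nonnegative.\<close>

lemma zero_spreads:
 fixes p :: "'a => real"
 assumes p: "bcont p" "!!x. p x >= 0" "!!x. x ~: Om ==> p x = 0"
  and wp: "wsol {x. p x > 0} p (%x. lam * p x)" and lam: "0 <= lam" "lam <= mu"
  and x0: "p x0 = 0" and R: "R > 0" "cball x0 R <= Om" and x: "x : ball x0 (R/2)"
 shows "p x = 0"
proof -
 have pc: "continuous_on S p" for S using bcontD(1)[OF p(1)] by (rule continuous_on_subset) simp
 have neg: "(LB z. p (x0 + r *R z) * lap_bump (2+1) z) <= 0" if r: "0 < r" "r < R" for r
 proof -
  have "(LB x. p x * (lap_bump 3 ((x - x0) /R r) / r^2)) + lam * (LB x. p x * bump 3 ((x - x0) /R r)) <= 0"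
  proof (rule compare[OF p wp lam test_fun_bump])
   show "compact (cball x0 r)" "cball x0 r <= Om" using r R by auto
   show "bump 3 ((x - x0) /R r) = 0" if "x ~: cball x0 r" for x
   proof (rule bump_outside)
    have "norm ((x - x0) /R r) = norm (x - x0) / r" using r by (simp add: divide_inverse mult.commute)
    thus "1 <= norm ((x - x0) /R r)" using that r by (simp add: dist_norm norm_minus_commute)
   qed simp
  qed (use r in auto)
  moreover have "(LB x. p x * bump 3 ((x - x0) /R r)) >= 0"
   using p(2) by (intro Bochner_Integration.integral_nonneg) simp
  hence "lam * (LB x. p x * bump 3 ((x - x0) /R r)) >= 0" using lam(1) by simp
  ultimately have "(LB x. p x * lap_bump 3 ((x - x0) /R r)) / r^2 <= 0" by simp
  hence 1: "(LB x. p x * lap_bump 3 ((x - x0) /R r)) <= 0" using r by (simp add: divide_le_0_iff)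
  have [measurable]: "p : borel_measurable borel" by (rule bcontD[OF p(1)])
  have "(LB z. p (x0 + r *R z) * lap_bump 3 (((x0 + r *R z) - x0) /R r)) = (LB x. p x * lap_bump 3 ((x - x0) /R r)) / r ^ DIM('a)"
   by (rule lborel_integral_scale) (use r in auto)
  also have "... <= 0" using 1 r by (simp add: divide_le_0_iff)
  finally show ?thesis using r by simp
 qed
 have anti: "mean 2 p x0 (R/2) <= mean 2 p x0 s" if s: "0 < s" "s < R/2" for s
 proof (rule DERIV_nonpos_imp_nonincreasing[where f = "mean 2 p x0" and a = s and b = "R/2"])
  show "s <= R/2" using s by simp
  fix r assume r: "s <= r" "r <= R/2"
  show "EX y. DERIV (%r. mean 2 p x0 r) r :> y & y <= 0"
   by (intro exI conjI, rule mean_deriv[OF pc[of "cball x0 R"]]) (use r s R neg[of r] in "auto simp: divide_le_0_iff")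
 qed
 have "mean 2 p x0 (R/2) <= mean 2 p x0 0"
 proof (rule tendsto_lowerbound[OF mean_tendsto_0[OF pc[of "cball x0 R"] R(1)]])
  show "eventually (%r. mean 2 p x0 (R/2) <= mean 2 p x0 r) (at_right 0)"
   unfolding eventually_at_right[OF half_gt_zero[OF R(1)]] using anti half_gt_zero[OF R(1)] by (intro exI[of _ "R/2"]) auto
 qed auto
 hence m0: "mean 2 p x0 (R/2) <= 0" by (simp add: mean_0 x0)
 have "(- 1) * p x = 0"
 proof (rule mean_eq_imp_const[where y = "%x. (-1) * p x" and c = 0 and m = 2, OF _ _ _ _ _ x])
  show "continuous_on (cball x0 (R/2)) (%x. (-1) * p x)" by (intro continuous_intros pc)
  show "mean 2 (%x. (-1) * p x) x0 (R/2) >= 0 * (LB z. bump 2 (z::'a))" using m0 by (simp add: mean_def)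
 qed (use R p(2) in auto)
 thus ?thesis by simp
qed

text \<open>The positive part of v, extended by zero, is admissible; its zero set in the domain is relatively open
  and closed.\<close>

lemma subeigen_sign:
 fixes v :: "'a => real"
 assumes v: "continuous_on (closure Om) v" "!!x. x : frontier Om ==> v x = 0" "wsol Om v (%x. lam * v x)"
  and lam: "0 <= lam" "lam <= mu" and x0: "x0 : Om" "v x0 <= 0" and x: "x : Om"
 shows "v x <= 0"
proof -
 define p where "p x = (if x : closure Om then max 0 (v x) else 0)" for x
 have pc: "cont p"
 proof -
  have "continuous_on (closure Om \<union> (- Om)) (%x. if x : closure Om then max 0 (v x) else 0)"
  proof (rule continuous_on_cases)
   show "closed (closure Om)" "closed (- Om)" using dom(1) by auto
   show "continuous_on (closure Om) (%x. max 0 (v x))" by (intro continuous_intros v(1))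
   show "ALL x. x : closure Om & x ~: closure Om | x : - Om & x : closure Om --> max 0 (v x) = 0"
    using v(2) dom(1) by (auto simp: frontier_def interior_open)
  qed auto
  moreover have "closure Om \<union> (- Om) = UNIV" using closure_subset[of Om] by auto
  ultimately show ?thesis by (simp add: p_def[abs_def])
 qed
 have comp: "compact (closure Om)" using dom(3) by simp
 obtain B where B: "!!x. x : closure Om ==> abs (v x) <= B"
  using compact_imp_bounded[OF compact_continuous_image[OF v(1) comp]] by (auto simp: bounded_iff)
 have pO: "p x = 0" if "x ~: Om" for x
  using that v(2)[of x] dom(1) by (auto simp: p_def frontier_def interior_open)
 have pv: "p x = max 0 (v x)" if "x : Om" for x using that closure_subset by (auto simp: p_def)
 have p: "bcont p"
 proof (rule bcontI[OF pc, of B])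
  have "0 <= B" using B[of x0] x0 closure_subset by force
  thus "abs (p x) <= B" for x using B[of x] by (auto simp: p_def)
 qed
 have p0: "p x >= 0" for x by (simp add: p_def)
 have sub: "{x. p x > 0} <= Om" using pO by force
 have wp: "wsol {x. p x > 0} p (%x. lam * p x)"
  by (rule wsol_cong[OF wsol_subset[OF v(3) sub]]) (use pv sub in "auto simp: max_def split: if_splits")
 define Z where "Z = {x:Om. p x = 0}"
 have "open Z" unfolding open_contains_ball
 proof
  fix z assume z: "z : Z"
  then obtain R where R: "R > 0" "cball z R <= Om" using dom(1) unfolding Z_def by (auto simp: open_contains_cball)
  have "ball z (R/2) <= Z"
  proof
   fix q assume q: "q : ball z (R/2)"
   hence "q : cball z R" using R(1) by auto
   moreover have "p q = 0" by (rule zero_spreads[OF p p0 pO wp lam _ R q]) (use z in "auto simp: Z_def")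
   ultimately show "q : Z" using R(2) by (auto simp: Z_def)
  qed
  thus "EX e>0. ball z e <= Z" using R(1) by (intro exI[of _ "R/2"]) auto
 qed
 hence "openin (top_of_set Om) Z" by (rule open_openin_trans[OF dom(1)]) (auto simp: Z_def)
 moreover have "closedin (top_of_set Om) Z" unfolding Z_def
  by (rule continuous_closedin_preimage_constant) (rule continuous_on_subset[OF pc subset_UNIV])
 ultimately have "Z = {} | Z = Om" using dom(2) by (simp add: connected_clopen)
 moreover have "x0 : Z" using x0 pv by (simp add: Z_def)
 ultimately have "x : Z" using x by blast
 thus ?thesis using pv[OF x] by (simp add: Z_def max_def split: if_splits)
qed

theorem first_eigenfunction_nonvanishing:
 fixes v :: "'a => real"
 assumes v: "continuous_on (closure Om) v" "!!x. x : frontier Om ==> v x = 0" "wsol Om v (%x. lam * v x)"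
  and lam: "0 <= lam" "lam <= mu" and z: "z : Om" "v z ~= 0" and x: "x : Om"
 shows "v x ~= 0"
proof
 assume 0: "v x = 0"
 have "v z <= 0" by (rule subeigen_sign[OF v lam x _ z(1)]) (use 0 in auto)
 moreover have "(- 1) * v z <= 0"
 proof (rule subeigen_sign[OF _ _ _ lam x _ z(1)])
  show "continuous_on (closure Om) (%x. (-1) * v x)" by (intro continuous_intros v(1))
  show "wsol Om (%x. (-1) * v x) (%x. lam * ((-1) * v x))"
   by (rule wsol_cong[OF wsol_cmult[OF v(3), of "-1"]]) auto
 qed (use v(2) 0 in auto)
 ultimately show False using z(2) by simp
qed

end

section \<open>Polytopes\<close>

definition hplane :: "'a::euclidean_space \<times> real => 'a set" where
 "hplane h = {x. fst h *. x = snd h}"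

text \<open>What remains of being a polytope when only a cone at each frontier point is wanted; it passes to facets.\<close>

definition hplane_bounded :: "'a::euclidean_space set => bool" where
 "hplane_bounded P \<longleftrightarrow> P ~= {} & rel_open P &
   (EX HS. finite HS & rel_frontier P <= (UN h:HS. hplane h) & (ALL h:HS. ~ P <= hplane h))"

lemma separating_hplane:
 fixes Q P :: "'a::euclidean_space set"
 assumes "aff_dim Q < aff_dim P"
 shows "EX h. closure Q <= hplane h & ~ P <= hplane h"
proof -
 have "~ P <= affine hull Q" using assms by (metis aff_dim_affine_hull aff_dim_subset not_le)
 then obtain p where p: "p : P" "p ~: affine hull Q" by blast
 obtain F where F: "affine hull Q = \<Inter>F" "!!h. h : F ==> EX a b. a ~= 0 & h = {x. a *. x = b}"
  using affine_hull_finite_intersection_hyperplanes[of Q] by metis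
 then obtain h where h: "h : F" "p ~: h" using p by blast
 then obtain a b where ab: "h = {x. a *. x = b}" using F(2) by blast
 have "closure Q <= h"
 proof (rule closure_minimal)
  show "Q <= h" using F(1) h(1) hull_subset[of Q affine] by blast
  show "closed h" unfolding ab by (rule closed_hyperplane)
 qed
 thus ?thesis using h p ab by (intro exI[of _ "(a, b)"]) (auto simp: hplane_def)
qed

lemma flat_polytope_facets:
 fixes P :: "'a::euclidean_space set"
 assumes "flat_polytope k P"
 shows "rel_open P & connected P & bounded P &
  (EX F. finite F & rel_frontier P = (UN Q:F. closure Q) &
    (ALL Q:F. aff_dim Q = int k - 1 & ((EX q. Q = {q}) | flat_polytope (k - 1) Q)))"
 using assms
proof (cases rule: flat_polytope.cases)
 case (interval a b)
 have "rel_frontier P = closed_segment a b - open_segment a b"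
  using interval by (simp add: rel_frontier_def rel_interior_open_segment)
 also have "... = {a, b}" by (auto simp: open_segment_def)
 finally have "rel_frontier P = (UN Q:{{a}, {b}}. closure Q)" by auto
 thus ?thesis by (simp add: interval exI[of _ "{{a}, {b}}"] rel_open_def rel_interior_open_segment convex_connected bounded_open_segment)
next
 case (step k' F)
 have "EX F. finite F & rel_frontier P = (UN Q:F. closure Q) &
    (ALL Q:F. aff_dim Q = int k - 1 & ((EX q. Q = {q}) | flat_polytope (k - 1) Q))"
 proof (rule exI[of _ F], intro conjI ballI step(7,8))
  fix Q assume Q: "Q : F"
  have fQ: "flat_polytope k' Q" using step(9) Q by blast
  show "aff_dim Q = int k - 1" using flat_polytope_aff_dim[OF fQ] step(1) by simp
  show "(EX q. Q = {q}) | flat_polytope (k - 1) Q" using fQ step(1) by simp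
 qed
 thus ?thesis using step(4,5,6) by (intro conjI)
qed

lemma flat_polytope_hplane_bounded:
 assumes "flat_polytope k P"
 shows "hplane_bounded P"
proof -
 obtain F where F: "finite F" "rel_frontier P = (UN Q:F. closure Q)" "!!Q. Q : F ==> aff_dim Q = int k - 1"
  and P: "rel_open P" using flat_polytope_facets[OF assms] by blast
 have d: "aff_dim P = int k" by (rule flat_polytope_aff_dim[OF assms])
 have "ALL Q:F. EX h. closure Q <= hplane h & ~ P <= hplane h"
  using F(3) d by (intro ballI separating_hplane) auto
 then obtain h where h: "!!Q. Q : F ==> closure Q <= hplane (h Q) & ~ P <= hplane (h Q)" by metis
 have "EX HS. finite HS & rel_frontier P <= (UN h:HS. hplane h) & (ALL h:HS. ~ P <= hplane h)"
  using F(1,2) h by (intro exI[of _ "h ` F"]) fastforce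
 thus ?thesis using d P hplane_bounded_def by fastforce
qed

text \<open>A finite union of hyperplanes has empty interior.\<close>

lemma point_off_hplanes:
 fixes A :: "'a::euclidean_space set"
 assumes "finite HS" "affine A" "!!h. h : HS ==> ~ A <= hplane h" "p : A" "e > 0"
 shows "EX z:A \<inter> ball p e. ALL h:HS. z ~: hplane h"
 using assms(1,3)
proof (induction HS rule: finite_induct)
 case empty
 thus ?case using assms by (intro bexI[of _ p]) auto
next
 case (insert h HS)
 then obtain z where z: "z : A" "z : ball p e" "!!h. h : HS ==> z ~: hplane h" by auto
 obtain q where q: "q : A" "q ~: hplane h" using insert.prems[of h] by auto
 define g where "g s = z + s *R (q - z)" for s
 have gA: "g s : A" for s
  using mem_affine[OF assms(2) z(1) q(1), of "1 - s" s] by (simp add: g_def algebra_simps)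
 have g0: "(g \<longlongrightarrow> z) (at 0)"
 proof -
  have "(g \<longlongrightarrow> z + 0 *R (q - z)) (at 0)" unfolding g_def by (intro tendsto_intros)
  thus ?thesis by simp
 qed
 have "open (ball p e - (UN h:HS. hplane h))"
  using insert.hyps(1) by (intro open_Diff closed_UN) (auto simp: hplane_def closed_hyperplane)
 hence "eventually (%s. g s : ball p e - (UN h:HS. hplane h)) (at 0)"
  using z by (intro topological_tendstoD[OF g0]) auto
 moreover have "eventually (%s. g s ~: hplane h) (at 0)"
 proof (cases "z : hplane h")
  case True
  have "g s ~: hplane h" if "s ~= 0" for s
   using True q that by (auto simp: hplane_def g_def inner_add_right inner_diff_right)
  thus ?thesis by (auto simp: eventually_at intro: exI[of _ 1])
 next
  case False
  have "open (- hplane h)" by (auto simp: hplane_def closed_hyperplane)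
  from topological_tendstoD[OF g0 this] False show ?thesis by simp
 qed
 ultimately have "eventually (%s. g s : ball p e - (UN h:HS. hplane h) & g s ~: hplane h) (at 0)" by (rule eventually_conj)
 from eventually_happens'[OF at_neq_bot this] obtain s where "g s : ball p e - (UN h:HS. hplane h)" "g s ~: hplane h" by blast
 thus ?case using gA by (intro bexI[of _ "g s"]) auto
qed

text \<open>Shrinking towards a boundary point keeps a generic small ball inside: the way meets none of the
 bounding hyperplanes.\<close>

lemma hplane_bounded_cone:
 fixes P :: "'a::euclidean_space set"
 assumes P: "hplane_bounded P" and x: "x : closure P"
 obtains z rho where "rho > 0" "z : affine hull P"
  "!!s y. 0 < s ==> s <= 1 ==> y : affine hull P ==> dist z y < rho ==> x + s *R (y - x) : P"
proof -
 define A where "A = affine hull P"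
 obtain HS where H: "finite HS" "rel_frontier P <= (UN h:HS. hplane h)" "!!h. h : HS ==> ~ P <= hplane h"
  and ro: "rel_interior P = P" and ne: "P ~= {}" using P unfolding hplane_bounded_def rel_open_def by blast
 have aff: "affine A" by (simp add: A_def)
 have PA: "P <= A" by (simp add: A_def hull_subset)
 have xA: "x : A" using closure_minimal[OF PA] aff affine_closed x by auto
 define HS0 where "HS0 = {h:HS. x ~: hplane h}"
 have "open (- (UN h:HS0. hplane h))"
  using H(1) by (intro open_Compl closed_UN) (auto simp: HS0_def hplane_def closed_hyperplane)
 moreover have "x : - (UN h:HS0. hplane h)" by (auto simp: HS0_def)
 ultimately obtain r1 where r1: "r1 > 0" "ball x r1 <= - (UN h:HS0. hplane h)" unfolding open_contains_ball by blast
 obtain p where p: "p : P" "dist p x < r1" using x r1(1) by (auto simp: closure_approachable)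
 obtain e where e: "e > 0" "ball p e \<inter> A <= P" using p(1) ro mem_rel_interior_ball[of p P] by (auto simp: A_def)
 have "EX z:A \<inter> ball p (min e (r1 - dist p x)). ALL h:HS. z ~: hplane h"
 proof (rule point_off_hplanes[OF H(1) aff])
  show "~ A <= hplane h" if "h : HS" for h using H(3)[OF that] PA by blast
 qed (use PA p e in auto)
 then obtain z where z: "z : A" "dist p z < e" "dist p z < r1 - dist p x" "!!h. h : HS ==> z ~: hplane h" by auto
 have zx: "dist x z < r1" using z(3) dist_triangle[of x z p] by (simp add: dist_commute)
 have "open (ball p e \<inter> ball x r1 - (UN h:HS. hplane h))"
  using H(1) by (intro open_Diff closed_UN) (auto simp: hplane_def closed_hyperplane)
 moreover have "z : ball p e \<inter> ball x r1 - (UN h:HS. hplane h)" using z zx by auto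
 ultimately obtain rho where rho: "rho > 0" "ball z rho <= ball p e \<inter> ball x r1 - (UN h:HS. hplane h)"
  by (meson open_contains_ball)
 have "x + s *R (y - x) : P" if s: "0 < s" "s <= 1" and y: "y : A" "dist z y < rho" for s y
 proof -
  have yb: "y : ball p e" "dist x y < r1" "!!h. h : HS ==> y ~: hplane h"
   using rho(2) y(2) by (auto simp: subset_iff)
  have yP: "y : P" using e yb y by blast
  define T where "T = (%s. x + s *R (y - x)) ` {s..1}"
  have con: "connected T" unfolding T_def by (intro connected_continuous_image continuous_intros) auto
  have TA: "T <= A" unfolding T_def using mem_affine[OF aff xA y(1)]
   by (auto simp: algebra_simps) (metis (no_types, opaque_lifting) add.commute add_diff_cancel_right' diff_add_cancel scaleR_left.diff scaleR_one add_diff_eq)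
  have Tf: "q ~: rel_frontier P" if "q : T" for q
  proof
   assume "q : rel_frontier P"
   then obtain h where h: "h : HS" "q : hplane h" using H(2) by blast
   obtain s' where "s' : {s..1}" and qs: "q = x + s' *R (y - x)" using \<open>q : T\<close> unfolding T_def by blast
   hence s': "0 < s'" "s' <= 1" "q = x + s' *R (y - x)" using s by auto
   have "dist x q = s' * dist x y" using s' by (simp add: dist_norm norm_minus_commute)
   also have "... <= 1 * dist x y" using s' by (intro mult_right_mono) auto
   finally have "q : ball x r1" using yb(2) by simp
   hence "h ~: HS0" using r1(2) h(2) by blast
   hence "x : hplane h" using h(1) by (simp add: HS0_def)
   hence "s' * (fst h *. y - snd h) = 0" using h(2) s'(3) by (simp add: hplane_def inner_add_right inner_diff_right)
   thus False using yb(3)[OF h(1)] s'(1) by (simp add: hplane_def)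
  qed
  have "openin (top_of_set A) P" using openin_rel_interior[of P] ro by (simp add: A_def)
  then obtain U where U: "open U" "P = A \<inter> U" by (auto simp: openin_open)
  have "T <= U \<union> (- closure P)"
  proof
   fix q assume q: "q : T"
   hence "q ~: closure P - P" using Tf[OF q] by (simp add: rel_frontier_def ro)
   thus "q : U \<union> (- closure P)" using U by blast
  qed
  moreover have "U \<inter> (- closure P) \<inter> T = {}" using U(2) TA closure_subset[of P] by blast
  moreover have "y : T" unfolding T_def using s by (intro image_eqI[of _ _ 1]) auto
  hence "U \<inter> T ~= {}" using yP U(2) by blast
  ultimately have "(- closure P) \<inter> T = {}" using connectedD[OF con U(1) open_Compl[OF closed_closure]] by blast
  hence "T <= P" using \<open>T <= U \<union> (- closure P)\<close> TA U(2) by blast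
  moreover have "x + s *R (y - x) : T" unfolding T_def by (rule imageI) (use s in simp)
  ultimately show ?thesis by blast
 qed
 thus thesis by (intro that[OF rho(1) z(1)[unfolded A_def]]) (simp_all add: A_def)
qed

text \<open>Inside the facet the cone gives (n-1)-dimensional discs of comparable size arbitrarily near the boundary
  point, and facets do not meet the domain.\<close>

lemma facet_corkscrew:
 fixes P Om :: "'a::euclidean_space set"
 assumes P: "hplane_bounded P" "P \<inter> Om = {}" and x: "x : closure P" and n: "norm n = 1" "affine hull P = {x. n *. x = b}"
 shows "corkscrew Om x"
proof -
 from hplane_bounded_cone[OF P(1) x] obtain z rho where rho: "rho > 0" and z: "z : affine hull P"
  and cone: "!!s y. 0 < s ==> s <= 1 ==> y : affine hull P ==> dist z y < rho ==> x + s *R (y - x) : P" by metis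
 have "closure P <= affine hull P" by (metis affine_affine_hull affine_closed closure_minimal hull_subset)
 hence nx: "n *. x = b" and nz: "n *. z = b" using x z n(2) by auto
 define D where "D = dist x z + rho"
 have D: "D > 0" "rho <= D" "dist x z <= D" using rho by (auto simp: D_def add_nonneg_pos)
 define c where "c = rho / (2 * D)"
 have c: "0 < c" "c <= 1" using rho D by (auto simp: c_def)
 show ?thesis unfolding corkscrew_def
 proof (rule exI[of _ c], rule exI[of _ D], intro conjI allI impI c D(1))
  fix r assume r: "0 < r" "r < D"
  define s where "s = r / D"
  have s: "0 < s" "s <= 1" using r D by (auto simp: s_def)
  define q where "q = x + s *R (z - x)"
  have "dist q x = s * dist x z" using s by (simp add: q_def dist_norm norm_minus_commute)
  also have "... <= s * D" using s D by (intro mult_left_mono) auto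
  also have "... = r" using D by (simp add: s_def)
  finally have qx: "dist q x <= r" .
  have nq: "n *. q = b" by (simp add: q_def inner_add_right inner_diff_right nx nz)
  show "EX q n. norm n = 1 & dist q x <= r & (ALL x. n *. (x - q) = 0 --> norm (x - q) <= c * r --> x ~: Om)"
  proof (rule exI[of _ q], rule exI[of _ n], intro conjI n qx allI impI)
   fix y assume y: "n *. (y - q) = 0" "norm (y - q) <= c * r"
   define y' where "y' = z + (y - q) /R s"
   have "dist z y' = norm (y - q) / s" using s by (simp add: y'_def dist_norm divide_inverse mult.commute)
   also have "... <= (c * r) / s" using y s by (intro divide_right_mono) auto
   also have "... = rho / 2" using r D by (simp add: c_def s_def)
   finally have "dist z y' < rho" using rho by simp
   moreover have "y' : affine hull P" using y nz by (simp add: n(2) y'_def inner_add_right)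
   ultimately have "x + s *R (y' - x) : P" using s by (intro cone)
   moreover have "x + s *R (y' - x) = y" using s by (simp add: y'_def q_def algebra_simps)
   ultimately show "y ~: Om" using P(2) by auto
  qed
 qed
qed

theorem polytope_facets:
 fixes Om :: "'a::euclidean_space set"
 assumes "flat_polytope DIM('a) Om"
 shows "open Om" "connected Om" "bounded Om" "Om ~= {}"
  and "EX F. finite F & frontier Om = (UN Q:F. closure Q) &
    (ALL Q:F. Q ~= {} & rel_open Q & (EX n b. norm n = 1 & affine hull Q = {x. n *. x = b}))"
  and "!!x. x : frontier Om ==> corkscrew Om x"
proof -
 have d: "aff_dim Om = int DIM('a)" by (rule flat_polytope_aff_dim[OF assms])
 obtain F where F: "finite F" "rel_frontier Om = (UN Q:F. closure Q)"
   "!!Q. Q : F ==> aff_dim Q = int DIM('a) - 1 & ((EX q. Q = {q}) | flat_polytope (DIM('a) - 1) Q)"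
  and O: "rel_open Om" "connected Om" "bounded Om" using flat_polytope_facets[OF assms] by (elim exE conjE) (rule that, auto)
 show op: "open Om" by (metis d aff_dim_eq_full O(1) rel_open_def rel_interior_interior open_interior)
 show "connected Om" "bounded Om" by (fact O)+
 show "Om ~= {}" using d by auto
 have fr: "frontier Om = (UN Q:F. closure Q)"
  using F(2) op by (simp add: rel_frontier_def frontier_def rel_interior_open interior_open)
 have hb: "hplane_bounded Q" if "Q : F" for Q
  using F(3)[OF that]
 proof (elim conjE disjE exE)
  fix q assume "Q = {q}"
  thus ?thesis unfolding hplane_bounded_def rel_open_def by (auto simp: rel_frontier_def intro!: exI[of _ "{}"])
 qed (rule flat_polytope_hplane_bounded)
 have nb: "EX n b. norm n = 1 & affine hull Q = {x. n *. x = b}" if "Q : F" for Q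
 proof -
  have "aff_dim Q = int (DIM('a) - 1)" using F(3)[OF that] by (simp add: of_nat_diff)
  then obtain a b where ab: "a ~= 0" "affine hull Q = {x. a *. x = b}" unfolding aff_dim_eq_hyperplane by blast
  have "affine hull Q = {x. (a /R norm a) *. x = b / norm a}" using ab by (auto simp: field_simps)
  moreover have "norm (a /R norm a) = 1" using ab(1) by simp
  ultimately show ?thesis by blast
 qed
 show "EX F. finite F & frontier Om = (UN Q:F. closure Q) &
    (ALL Q:F. Q ~= {} & rel_open Q & (EX n b. norm n = 1 & affine hull Q = {x. n *. x = b}))"
  using F(1) fr hb nb by (intro exI[of _ F]) (auto simp: hplane_bounded_def)
 fix x assume "x : frontier Om"
 then obtain Q where Q: "Q : F" "x : closure Q" using fr by blast
 have "Q \<inter> Om = {}" using fr Q(1) closure_subset op frontier_def interior_open by blast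
 thus "corkscrew Om x" using facet_corkscrew[OF hb[OF Q(1)] _ Q(2)] nb[OF Q(1)] by blast
qed

section \<open>Real analytic functions of several variables\<close>

lemma Sigma_fibres: "bij_betw (%x. (k x, x)) UNIV (Sigma UNIV (%n. {x. k x = n}))"
 by (rule bij_betwI[where g=snd]) auto

lemma has_sum_transform: "(f has_sum x) A ==> (!!y. y : A ==> f y = g y) ==> (g has_sum x) A"
 by (rule has_sum_cong[THEN iffD1])

lemma summable_on_abs: "(f :: 'a => real) summable_on A ==> (%x. abs (f x)) summable_on A"
 using Infinite_Sum.summable_on_iff_abs_summable_on_real[of f A] by simp

lemma has_sum_group:
 fixes f :: "'a => real" and k :: "'a => nat"
 assumes f: "(f has_sum S) UNIV" and g: "!!n. (f has_sum g n) {x. k x = n}"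
 shows "g sums S"
proof -
 have "((%p. f (snd p)) has_sum S) (Sigma UNIV (%n. {x. k x = n}))"
  using has_sum_reindex_bij_betw[OF Sigma_fibres[of k], of "%p. f (snd p)" S] f by simp
 from has_sum_SigmaD[OF this, of g] g have "(g has_sum S) UNIV" by simp
 thus ?thesis by (rule has_sum_imp_sums)
qed

text \<open>The converse of has_sum_group needs absolute convergence, supplied by h.\<close>

lemma has_sum_ungroup:
 fixes f :: "'a => real" and k :: "'a => nat"
 assumes g: "!!n. (f has_sum g n) {x. k x = n}" and h: "!!n. ((%x. abs (f x)) has_sum h n) {x. k x = n}" "summable h"
 shows "(f has_sum suminf g) UNIV"
proof -
 have h0: "h n >= 0" for n by (rule has_sum_nonneg[OF h(1)]) simp
 have "(%p. norm (f (snd p))) summable_on (Sigma UNIV (%n. {x. k x = n}))"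
  unfolding Infinite_Sum.abs_summable_on_Sigma_iff
 proof (intro conjI ballI)
  show "(%y. norm (f (snd (n, y)))) summable_on {x. k x = n}" for n
   using h(1)[of n] by (auto simp: summable_on_def)
  have "h summable_on UNIV" using h(2) h0 by (simp add: summable_on_UNIV_nonneg_real_iff)
  thus "(%n. norm (infsum (%y. norm (f (snd (n, y)))) {x. k x = n})) summable_on UNIV" by (simp add: infsumI[OF h(1)] h0)
 qed
 hence "(%p. f (snd p)) summable_on (Sigma UNIV (%n. {x. k x = n}))" by (rule abs_summable_summable)
 then obtain S where "((%p. f (snd p)) has_sum S) (Sigma UNIV (%n. {x. k x = n}))" by (auto simp: summable_on_def)
 hence S: "(f has_sum S) UNIV"
  using has_sum_reindex_bij_betw[OF Sigma_fibres[of k], of "%p. f (snd p)" S] by simp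
 show ?thesis using has_sum_group[OF S g] sums_unique S by auto
qed

definition mono :: "('n::finite => nat) => real^'n => real" where
 "mono alp z = (\<Prod>i\<in>UNIV. (z $ i) ^ alp i)"

definition expands :: "(real^'n::finite => real) => (('n => nat) => real) => real^'n => real => bool" where
 "expands f c p r \<longleftrightarrow> (ALL x:ball p r. ((%alp. c alp * mono alp (x - p)) has_sum f x) UNIV)"

text \<open>Real analyticity on the whole space, in unconditional multi-index form.\<close>

definition RA :: "(real^'n::finite => real) => bool" where
 "RA f \<longleftrightarrow> (ALL p. EX r>0. EX c. expands f c p r)"

definition pd :: "'n::finite => (real^'n => real) => real^'n => real" where
 "pd i f x = deriv (%t. f (x + t *R axis i 1)) 0"

definition Dd :: "real^'n::finite => (real^'n => real) => real^'n => real" where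
 "Dd d f x = (SUM i:UNIV. d $ i * pd i f x)"

lemma real_analytic_on_RA:
 assumes "real_analytic_on v UNIV"
 shows "RA (%x. Re (v x))" "RA (%x. Im (v x))"
proof -
 have *: "EX r>0. EX c. expands (%x. h (v x)) c p r"
  if h: "!!(f :: ('a => nat) => complex) a M. (f has_sum a) M ==> ((%x. h (f x)) has_sum h a) M" "!!z r. h (z * of_real r) = h z * r"
  for h :: "complex => real" and p :: "real^'a"
 proof -
  obtain r c where r: "r > 0" "!!x. x : ball p r ==> ((%alp. c alp * of_real (\<Prod>i\<in>UNIV. (x $ i - p $ i) ^ alp i)) has_sum v x) UNIV"
   using assms unfolding real_analytic_on_def by blast
  have "expands (%x. h (v x)) (%alp. h (c alp)) p r"
   unfolding expands_def
  proof
   fix x assume "x : ball p r"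
   from h(1)[OF r(2)[OF this]] show "((%alp. h (c alp) * mono alp (x - p)) has_sum h (v x)) UNIV"
    unfolding h(2) by (simp add: mono_def)
  qed
  thus ?thesis using r(1) by blast
 qed
 show "RA (%x. Re (v x))" unfolding RA_def by (intro allI *) (auto intro: has_sum_Re)
 show "RA (%x. Im (v x))" unfolding RA_def by (intro allI *) (auto intro: has_sum_Im)
qed

lemma RA_add:
 assumes "RA f" "RA g" shows "RA (%x. f x + g x)"
 unfolding RA_def
proof
 fix p
 obtain r c where r: "r > 0" "expands f c p r" using assms(1) unfolding RA_def by blast
 obtain r' c' where r': "r' > 0" "expands g c' p r'" using assms(2) unfolding RA_def by blast
 have "expands (%x. f x + g x) (%alp. c alp + c' alp) p (min r r')"
  using r(2) r'(2) unfolding expands_def by (auto simp: distrib_right intro!: has_sum_add)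
 thus "EX r>0. EX c. expands (%x. f x + g x) c p r" using r(1) r'(1) by (intro exI[of _ "min r r'"]) auto
qed

lemma RA_cmult:
 assumes "RA f" shows "RA (%x. k * f x)"
 unfolding RA_def
proof
 fix p
 obtain r c where r: "r > 0" "expands f c p r" using assms(1) unfolding RA_def by blast
 have "expands (%x. k * f x) (%alp. k * c alp) p r"
  using r(2) unfolding expands_def by (auto simp: mult.assoc intro!: has_sum_cmult_right)
 thus "EX r>0. EX c. expands (%x. k * f x) c p r" using r(1) by blast
qed

lemma RA_zero: "RA (%_. 0)"
 unfolding RA_def expands_def by (intro allI exI[of _ 1] conjI exI[of _ "%_. 0"]) auto

lemma RA_sum: "finite S ==> (!!i. i : S ==> RA (f i)) ==> RA (%x. SUM i:S. f i x)"
 by (induction S rule: finite_induct) (auto intro: RA_zero RA_add)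

lemma finite_multiindices: "finite {alp :: 'n::finite => nat. sum alp UNIV = n}"
proof (rule finite_subset)
 show "{alp :: 'n => nat. sum alp UNIV = n} <= PiE UNIV (%_. {..n})"
 proof
  fix alp :: "'n => nat" assume "alp : {alp. sum alp UNIV = n}"
  hence "alp i <= n" for i using member_le_sum[of i UNIV alp] by simp
  thus "alp : PiE UNIV (%_. {..n})" by (auto simp: PiE_def extensional_def)
 qed
qed (auto intro: finite_PiE)

lemma expands_line:
 fixes d :: "real^'n::finite"
 assumes e: "expands f c p r" and t: "norm (t *R d) < r"
 shows "(%n. (SUM alp:{alp. sum alp UNIV = n}. c alp * mono alp d) * t ^ n) sums f (p + t *R d)"
proof -
 have "((%alp. c alp * mono alp (t *R d)) has_sum f (p + t *R d)) UNIV"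
  using e t unfolding expands_def by (auto simp: dist_norm dest!: bspec[of _ _ "p + t *R d"])
 moreover have "mono alp (t *R d) = mono alp d * t ^ sum alp UNIV" for alp
  by (simp add: mono_def power_mult_distrib prod.distrib power_sum mult.commute)
 ultimately have "((%alp. c alp * mono alp d * t ^ sum alp UNIV) has_sum f (p + t *R d)) UNIV" by (simp add: mult.assoc)
 moreover have "((%alp. c alp * mono alp d * t ^ sum alp UNIV) has_sum
   (SUM alp:{alp. sum alp UNIV = n}. c alp * mono alp d) * t ^ n) {alp. sum alp UNIV = n}" for n
  by (rule has_sum_finiteI[OF finite_multiindices]) (simp add: sum_distrib_right)
 ultimately show ?thesis by (rule has_sum_group)
qed

lemma multiindices_0: "{alp :: 'n::finite => nat. sum alp UNIV = 0} = {%_. 0}"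
 by (auto simp: fun_eq_iff)

lemma multiindices_1: "{alp :: 'n::finite => nat. sum alp UNIV = 1} = range (%i. (%_. 0)(i := 1))"
proof (intro equalityI subsetI)
 fix alp :: "'n => nat" assume "alp : {alp. sum alp UNIV = 1}"
 then obtain a where "alp a = 1" "ALL b. a ~= b --> alp b = 0" by (auto simp: sum_eq_Suc0_iff)
 hence "alp = (%_. 0)(a := 1)" by auto
 thus "alp : range (%i. (%_. 0)(i := 1))" by blast
qed auto

lemma mono_unit: "mono ((%_. 0)(i := 1)) d = d $ i"
proof -
 have "mono ((%_. 0)(i := 1)) d = (\<Prod>k\<in>UNIV. if k = i then d $ i else 1)"
  unfolding mono_def by (rule prod.cong) auto
 thus ?thesis by simp
qed

lemma line_coeff_1: "(SUM alp:{alp :: 'n::finite => nat. sum alp UNIV = 1}. c alp * mono alp d) = (SUM i:UNIV. d $ i * c ((%_. 0)(i := 1)))"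
proof -
 have "inj (%i::'n. (%_. 0::nat)(i := 1))" by (auto simp: inj_on_def fun_eq_iff split: if_splits)
 thus ?thesis unfolding multiindices_1 by (simp only: sum.reindex o_def mono_unit mult.commute)
qed

lemma expands_0: "expands f c p r ==> r > 0 ==> f p = c (%_. 0)"
proof -
 assume e: "expands f c p r" "r > 0"
 have "(%n. (SUM alp:{alp. sum alp UNIV = n}. c alp * mono alp 0) * 0 ^ n) sums f (p + 0 *R 0)"
  by (rule expands_line[OF e(1)]) (use e(2) in simp)
 from sums_unique2[OF this powser_sums_zero] have "f p = (SUM alp:{alp. sum alp UNIV = 0}. c alp * mono alp 0)" by simp
 thus ?thesis unfolding multiindices_0 by (simp add: mono_def)
qed

lemma powser_deriv:
 fixes f :: "real => real"
 assumes "!!s. abs s < rho ==> (%n. a n * s ^ n) sums f s" and s: "abs s < rho"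
 shows "(f has_real_derivative (\<Sum>n. diffs a n * s ^ n)) (at s)" "summable (%n. diffs a n * s ^ n)"
proof -
 have sm: "summable (%n. a n * s ^ n)" if "norm s < rho" for s using assms(1)[of s] that by (auto dest: sums_summable)
 have "DERIV (%s. \<Sum>n. a n * s ^ n) s :> (\<Sum>n. diffs a n * s ^ n)"
  by (rule termdiffs_strong'[OF sm]) (use s in auto)
 thus "(f has_real_derivative (\<Sum>n. diffs a n * s ^ n)) (at s)"
 proof (rule has_field_derivative_transform_within_open[of _ _ _ "{-rho<..<rho}"])
  show "(\<Sum>n. a n * x ^ n) = f x" if "x : {-rho<..<rho}" for x
   using assms(1)[of x] that by (auto simp: sums_iff)
 qed (use s in auto)
 show "summable (%n. diffs a n * s ^ n)" by (rule termdiff_converges[OF _ sm]) (use s in auto)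
qed

lemma expands_dir_deriv:
 assumes e: "expands f c p r" and r: "r > 0"
 shows "((%t. f (p + t *R d)) has_real_derivative (SUM i:UNIV. d $ i * c ((%_. 0)(i := 1)))) (at 0)"
proof -
 define a where "a n = (SUM alp:{alp. sum alp UNIV = n}. c alp * mono alp d)" for n
 define rho where "rho = r / (norm d + 1)"
 have rho: "rho > 0" using r by (simp add: rho_def add_nonneg_pos)
 have "(%n. a n * s ^ n) sums f (p + s *R d)" if s: "abs s < rho" for s
  unfolding a_def
 proof (rule expands_line[OF e])
  have "norm (s *R d) <= abs s * (norm d + 1)" by (simp add: mult_left_mono)
  also have "... < rho * (norm d + 1)" using s by (intro mult_strict_right_mono) (auto simp: add_nonneg_pos)
  also have "... = r" by (simp add: rho_def) (metis add_nonneg_eq_0_iff norm_ge_zero zero_le_one zero_neq_one)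
  finally show "norm (s *R d) < r" .
 qed
 from powser_deriv(1)[OF this, of rho 0] rho
 have "DERIV (%t. f (p + t *R d)) 0 :> (\<Sum>n. diffs a n * 0 ^ n)" by simp
 moreover have "(\<Sum>n. diffs a n * 0 ^ n) = (SUM i:UNIV. d $ i * c ((%_. 0)(i := 1)))"
  by (simp add: diffs_def a_def line_coeff_1[unfolded One_nat_def])
 ultimately show ?thesis by simp
qed

text \<open>Freezing all coordinates but the i-th, the series is an ordinary power series in that coordinate, to be
  differentiated termwise. The radius rho is the half-length of the chord of the ball in direction i, so
  that the chord exhausts what the ball allows.\<close>

lemma expands_pd:
 fixes f :: "real^'n::finite => real"
 assumes e: "expands f c p r"
 shows "expands (pd i f) (%alp. real (alp i + 1) * c (alp(i := alp i + 1))) p r"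
  and "x : ball p r ==> DERIV (%t. f (x + t *R axis i 1)) 0 :> pd i f x"
proof -
 define c' where "c' alp = real (alp i + 1) * c (alp(i := alp i + 1))" for alp
 have main: "EX D. DERIV (%t. f (x + t *R axis i 1)) 0 :> D & ((%alp. c' alp * mono alp (x - p)) has_sum D) UNIV"
  if x: "x : ball p r" for x
 proof -
  define z where "z = x - p"
  define w where "w alp = c alp * (\<Prod>k\<in>UNIV - {i}. z $ k ^ alp k)" for alp
  define rho where "rho = sqrt (r^2 - (norm z)\<^sup>2 + (z $ i)^2)"
  have nz: "norm z < r" using x by (simp add: z_def dist_norm norm_minus_commute)
  have "(norm z)\<^sup>2 < r\<^sup>2" using nz by (intro power_strict_mono) auto
  hence rho2: "rho\<^sup>2 = r^2 - (norm z)\<^sup>2 + (z $ i)^2" "(z $ i)\<^sup>2 < rho\<^sup>2" and rho: "rho > 0"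
   by (auto simp: rho_def add_pos_nonneg)
  have zi: "abs (z $ i) < rho" using rho2(2) rho by (metis abs_of_pos real_sqrt_abs real_sqrt_less_mono)
  have ms: "mono alp (z + (s - z $ i) *R axis i 1) = (\<Prod>k\<in>UNIV - {i}. z $ k ^ alp k) * s ^ alp i" for alp s
   unfolding mono_def by (subst prod.remove[of _ i]) (auto simp: axis_def intro!: prod.cong)
  have F: "((%alp. w alp * s ^ alp i) has_sum f (x + (s - z $ i) *R axis i 1)) UNIV" if s: "abs s < rho" for s
  proof -
   define u where "u = z + (s - z $ i) *R axis i 1"
   have "(norm (z + t *R axis i 1))\<^sup>2 = (norm z)^2 + 2 * t * z $ i + t^2" for t :: real
    unfolding power2_norm_eq_inner by (simp add: inner_add_left inner_add_right inner_axis inner_axis' power2_eq_square algebra_simps)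
   from this[of "s - z $ i"] have "(norm u)\<^sup>2 = (norm z)^2 + 2 * (s - z $ i) * z $ i + (s - z $ i)^2" unfolding u_def .
   also have "... = (norm z)^2 - (z $ i)\<^sup>2 + s^2" by (simp add: power2_eq_square algebra_simps)
   also have "... < r\<^sup>2"
   proof -
    have "s\<^sup>2 < rho\<^sup>2" using s by (metis abs_ge_zero power2_abs power_strict_mono zero_less_numeral)
    thus ?thesis using rho2 by linarith
   qed
   finally have "norm u < r" using nz norm_ge_zero[of z] power2_less_imp_less by fastforce
   moreover have "x + (s - z $ i) *R axis i 1 = p + u" by (simp add: u_def z_def)
   ultimately have "((%alp. c alp * mono alp u) has_sum f (x + (s - z $ i) *R axis i 1)) UNIV"
    using e unfolding expands_def by (auto simp: dist_norm dest!: bspec[of _ _ "p + u"])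
   thus ?thesis by (simp add: u_def ms w_def mult.assoc)
  qed
  define B where "B n = {alp :: 'n => nat. alp i = n}" for n
  define s1 where "s1 = rho / 2"
  have s1: "s1 > 0" "abs s1 < rho" using rho by (auto simp: s1_def)
  have wB: "w summable_on B n" for n
  proof -
   have "(%alp. w alp * s1 ^ alp i) summable_on UNIV"
    using F[OF s1(2)] unfolding summable_on_def by (rule exI)
   hence "(%alp. w alp * s1 ^ alp i) summable_on B n" by (rule summable_on_subset_banach) simp
   moreover have "(%alp. w alp * s1 ^ alp i) summable_on B n \<longleftrightarrow> (%alp. s1 ^ n * w alp) summable_on B n"
    by (rule summable_on_cong) (simp add: B_def mult.commute)
   ultimately have "(%alp. s1 ^ n * w alp) summable_on B n" by blast
   thus ?thesis using s1(1) by (simp add: summable_on_cmult_right')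
  qed
  define a where "a n = infsum w (B n)" for n
  define A where "A n = infsum (%alp. abs (w alp)) (B n)" for n
  have a: "(w has_sum a n) (B n)" for n unfolding a_def by (rule has_sum_infsum[OF wB])
  have A: "((%alp. abs (w alp)) has_sum A n) (B n)" for n
   unfolding A_def by (intro has_sum_infsum summable_on_abs wB)
  have as: "(%n. a n * s ^ n) sums f (x + (s - z $ i) *R axis i 1)" if "abs s < rho" for s
  proof (rule has_sum_group[OF F[OF that], where k = "%alp. alp i"])
   fix n
   have "((%alp. s ^ n * w alp) has_sum s ^ n * a n) (B n)" by (rule has_sum_cmult_right[OF a])
   thus "((%alp. w alp * s ^ alp i) has_sum a n * s ^ n) {alp. alp i = n}"
    unfolding B_def mult.commute[of "a n"] by (rule has_sum_transform) simp
  qed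
  have As: "summable (%n. A n * s ^ n)" if s: "norm s < rho" for s
  proof -
   have "(%alp. w alp * s ^ alp i) summable_on UNIV" using F[of s] s unfolding summable_on_def real_norm_def by (intro exI)
   hence "(%alp. abs (w alp * s ^ alp i)) summable_on UNIV" by (rule summable_on_abs)
   then obtain S where S: "((%alp. abs (w alp * s ^ alp i)) has_sum S) UNIV" by (auto simp: summable_on_def)
   have "((%alp. abs (w alp * s ^ alp i)) has_sum (abs s ^ n * A n)) {alp. alp i = n}" for n
   proof -
    have "((%alp. abs s ^ n * abs (w alp)) has_sum \<bar>s\<bar> ^ n * A n) (B n)" by (rule has_sum_cmult_right[OF A])
    thus ?thesis unfolding B_def by (rule has_sum_transform) (auto simp: abs_mult power_abs)
   qed
   from sums_summable[OF has_sum_group[OF S this]] have "summable (%n. norm (A n * s ^ n))"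
   proof (rule summable_cong[THEN iffD1, rotated, OF _ always_eventually], intro allI)
    have "A n >= 0" for n by (rule has_sum_nonneg[OF A]) simp
    thus "abs s ^ n * A n = norm (A n * s ^ n)" for n by (simp add: abs_mult power_abs)
   qed
   thus ?thesis by (rule summable_norm_cancel)
  qed
  have "DERIV (%t. f (x + t *R axis i 1)) 0 :> (\<Sum>n. diffs a n * (z $ i) ^ n)"
  proof -
   have "DERIV (%t. (%s. f (x + (s - z $ i) *R axis i 1)) (t + z $ i)) 0 :> (\<Sum>n. diffs a n * (z $ i) ^ n)" using powser_deriv(1)[OF as zi] DERIV_shift[of "%s. f (x + (s - z $ i) *R axis i 1)" "\<Sum>n. diffs a n * (z $ i) ^ n" 0 "z $ i"] by simp
   thus ?thesis by simp
  qed
  moreover have "((%alp. c' alp * mono alp z) has_sum (\<Sum>n. diffs a n * (z $ i) ^ n)) UNIV"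
  proof (rule has_sum_ungroup[where k = "%alp. alp i" and h = "%n. diffs A n * abs (z $ i) ^ n"])
   have mz: "mono alp z = (\<Prod>k\<in>UNIV - {i}. z $ k ^ alp k) * (z $ i) ^ alp i" for alp
    using ms[of alp "z $ i"] by simp
   have c'w: "c' alp * mono alp z = (real (Suc n) * (z $ i) ^ n) * w (alp(i := Suc (alp i)))" if "alp i = n" for alp n
   proof -
    show ?thesis using prod.cong that mz c'_def w_def mult_ac by simp
   qed
   have bij: "bij_betw (%alp. alp(i := Suc (alp i))) (B n) (B (Suc n))" for n
    by (rule bij_betwI[where g = "%alp. alp(i := alp i - 1)"]) (auto simp: B_def fun_eq_iff)
   fix n
   have "((%alp. w (alp(i := Suc (alp i)))) has_sum a (Suc n)) (B n)"
    using has_sum_reindex_bij_betw[OF bij[of n], where f = w and S = "a (Suc n)"] a by simp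
   from has_sum_cmult_right[OF this, of "real (Suc n) * (z $ i) ^ n"]
   have "((%alp. c' alp * mono alp z) has_sum (real (Suc n) * (z $ i) ^ n) * a (Suc n)) (B n)"
    by (rule has_sum_transform) (use c'w in "auto simp: B_def")
   thus "((%alp. c' alp * mono alp z) has_sum diffs a n * (z $ i) ^ n) {alp. alp i = n}"
    by (simp add: diffs_def B_def mult_ac)
   have "((%alp. abs (w (alp(i := Suc (alp i))))) has_sum A (Suc n)) (B n)"
    using has_sum_reindex_bij_betw[OF bij[of n], where f = "%alp. abs (w alp)" and S = "A (Suc n)"] A by simp
   from has_sum_cmult_right[OF this, of "real (Suc n) * abs (z $ i) ^ n"]
   have "((%alp. abs (c' alp * mono alp z)) has_sum (real (Suc n) * abs (z $ i) ^ n) * A (Suc n)) (B n)"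
    by (rule has_sum_transform) (use c'w in "auto simp: B_def abs_mult power_abs")
   thus "((%alp. abs (c' alp * mono alp z)) has_sum diffs A n * abs (z $ i) ^ n) {alp. alp i = n}"
    by (simp add: diffs_def B_def mult_ac)
  next
   show "summable (%n. diffs A n * abs (z $ i) ^ n)"
    by (rule termdiff_converges[OF _ As]) (use zi in auto)
  qed
  ultimately show ?thesis unfolding z_def by blast
 qed
 have pdv: "DERIV (%t. f (x + t *R axis i 1)) 0 :> pd i f x"
  and "((%alp. c' alp * mono alp (x - p)) has_sum pd i f x) UNIV" if x: "x : ball p r" for x
 proof -
  obtain D where D: "DERIV (%t. f (x + t *R axis i 1)) 0 :> D" "((%alp. c' alp * mono alp (x - p)) has_sum D) UNIV"
   using main[OF x] by blast
  have "pd i f x = D" unfolding pd_def by (rule DERIV_imp_deriv[OF D(1)])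
  with D show "DERIV (%t. f (x + t *R axis i 1)) 0 :> pd i f x"
   "((%alp. c' alp * mono alp (x - p)) has_sum pd i f x) UNIV" by simp_all
 qed
 thus "expands (pd i f) (%alp. real (alp i + 1) * c (alp(i := alp i + 1))) p r"
  unfolding expands_def c'_def by blast
 show "x : ball p r ==> DERIV (%t. f (x + t *R axis i 1)) 0 :> pd i f x" by (rule pdv)
qed

lemma RA_pd: "RA f ==> RA (pd i f)"
 unfolding RA_def using expands_pd(1) by blast

lemma RA_Dd: "RA f ==> RA (Dd d f)"
 unfolding Dd_def[abs_def] by (intro RA_sum RA_cmult RA_pd) auto

lemma pd_coeff:
 assumes e: "expands f c p r" "r > 0"
 shows "pd i f p = c ((%_. 0)(i := 1))"
 using expands_0[OF expands_pd(1)[OF e(1)] e(2)] by simp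

lemma RA_pd_deriv: "RA f ==> DERIV (%t. f (x + t *R axis i 1)) 0 :> pd i f x"
proof -
 assume "RA f"
 then obtain r c where "r > 0" "expands f c x r" unfolding RA_def by blast
 thus ?thesis by (intro expands_pd(2)) auto
qed

lemma RA_deriv:
 assumes "RA f"
 shows "DERIV (%t. f (x + t *R d)) s :> Dd d f (x + s *R d)"
proof (rule deriv_along_line)
 obtain r c where e: "r > 0" "expands f c (x + s *R d) r" using assms unfolding RA_def by blast
 show "DERIV (%t. f (x + s *R d + t *R d)) 0 :> Dd d f (x + s *R d)"
  using expands_dir_deriv[OF e(2,1)] by (simp add: Dd_def pd_coeff[OF e(2,1)])
qed

lemma pd_commute:
 assumes "RA f" shows "pd i (pd j f) = pd j (pd i f)"
proof
 fix p
 obtain r c where e: "r > 0" "expands f c p r" using assms unfolding RA_def by blast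
 show "pd i (pd j f) p = pd j (pd i f) p"
  unfolding pd_coeff[OF expands_pd(1)[OF e(2)] e(1)] by (auto simp: fun_upd_twist)
qed

lemma pd_cmult: "RA f ==> pd i (%x. k * f x) = (%x. k * pd i f x)"
 unfolding fun_eq_iff pd_def[of i "%x. k * f x"] by (intro allI DERIV_imp_deriv DERIV_cmult RA_pd_deriv)

lemma pd_sum:
 assumes "!!j. j : S ==> RA (f j)"
 shows "pd i (%x. SUM j:S. f j x) = (%x. SUM j:S. pd i (f j) x)"
 unfolding fun_eq_iff pd_def[of i "%x. SUM j:S. f j x"] by (intro allI DERIV_imp_deriv DERIV_sum RA_pd_deriv assms)

definition Lap :: "(real^'n::finite => real) => real^'n => real" where
 "Lap f x = (SUM i:UNIV. pd i (pd i f) x)"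

lemma RA_Lap: "RA f ==> RA (Lap f)"
 unfolding Lap_def[abs_def] by (intro RA_sum RA_pd) auto

lemma pd_Dd: "RA f ==> pd i (Dd d f) = Dd d (pd i f)"
proof -
 assume f: "RA f"
 have "pd i (Dd d f) x = Dd d (pd i f) x" for x
 proof -
  have "pd i (Dd d f) = (%x. SUM j:UNIV. pd i (%x. d $ j * pd j f x) x)"
   unfolding Dd_def[abs_def] by (intro pd_sum RA_cmult RA_pd f)
  also have "... = Dd d (pd i f)"
   by (simp add: pd_cmult RA_pd f Dd_def[abs_def] pd_commute[of f i])
  finally show ?thesis by simp
 qed
 thus ?thesis by (rule ext)
qed

lemma Lap_Dd: "RA f ==> Lap (Dd d f) = Dd d (Lap f)"
proof -
 assume f: "RA f"
 have "Dd d (Lap f) x = (SUM j:UNIV. d $ j * (SUM i:UNIV. pd j (pd i (pd i f)) x))" for x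
  by (simp add: Dd_def Lap_def[abs_def] pd_sum RA_pd f)
 also have "... x = (SUM i:UNIV. Dd d (pd i (pd i f)) x)" for x
  unfolding Dd_def sum_distrib_left by (rule sum.swap)
 also have "... x = Lap (Dd d f) x" for x by (simp add: Lap_def pd_Dd RA_pd f)
 finally show ?thesis by auto
qed

lemma Dd_Dd: "RA f ==> Dd d (Dd e f) x = (SUM i:UNIV. SUM j:UNIV. d $ i * e $ j * pd i (pd j f) x)"
proof -
 assume f: "RA f"
 show ?thesis by (simp add: Dd_def[of d] pd_Dd f Dd_def sum_distrib_left mult.assoc pd_commute[OF f])
qed

text \<open>The tangential directions are the projections of the axes; only these and the normal enter.\<close>

lemma Lap_tangential:
 fixes nu :: "real^'n::finite"
 assumes f: "RA f" and nu: "norm nu = 1"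
 defines "tau \<equiv> %k. axis k 1 - (nu $ k) *R nu"
 shows "Lap f x = Dd nu (Dd nu f) x + (SUM k:UNIV. Dd (tau k) (Dd (tau k) f) x)"
proof -
 define H where "H i j = pd i (pd j f) x" for i j
 have nn: "(SUM k:UNIV. nu $ k * nu $ k) = 1" using nu by (simp add: norm_eq_1 inner_vec_def)
 have "(SUM k:UNIV. tau k $ i * tau k $ j) = (if i = j then 1 else 0) - nu $ i * nu $ j" for i j
 proof -
  have "tau k $ i * tau k $ j = (if k = i then (if i = j then 1 else 0) else 0) - (if k = i then nu $ i * nu $ j else 0)
    - (if k = j then nu $ i * nu $ j else 0) + (nu $ k * nu $ k) * (nu $ i * nu $ j)" for k
   by (auto simp: tau_def axis_def algebra_simps)
  hence "(SUM k:UNIV. tau k $ i * tau k $ j) = (if i = j then 1 else 0) - nu $ i * nu $ j - nu $ i * nu $ j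
    + (SUM k:UNIV. (nu $ k * nu $ k)) * (nu $ i * nu $ j)"
   by (simp add: sum.distrib sum_subtractf sum_distrib_right)
  thus ?thesis by (simp add: nn)
 qed
 note tt = this
 have "(SUM k:UNIV. Dd (tau k) (Dd (tau k) f) x) = (SUM k:UNIV. SUM i:UNIV. SUM j:UNIV. tau k $ i * tau k $ j * H i j)"
  by (simp add: Dd_Dd[OF f] H_def)
 also have "... = (SUM i:UNIV. SUM k:UNIV. SUM j:UNIV. tau k $ i * tau k $ j * H i j)" by (rule sum.swap)
 also have "... = (SUM i:UNIV. SUM j:UNIV. SUM k:UNIV. tau k $ i * tau k $ j * H i j)" by (rule sum.cong[OF refl]) (rule sum.swap)
 also have "... = (SUM i:UNIV. SUM j:UNIV. ((if i = j then 1 else 0) - nu $ i * nu $ j) * H i j)"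
  by (simp add: sum_distrib_right[symmetric] tt)
 also have "... = (SUM i:UNIV. H i i) - (SUM i:UNIV. SUM j:UNIV. nu $ i * nu $ j * H i j)"
  by (simp add: left_diff_distrib sum_subtractf if_distrib[of "%c. c * _"] cong: if_cong)
 finally show ?thesis by (simp add: Dd_Dd[OF f] H_def Lap_def)
qed

lemma powser_zero_near:
 fixes f :: "real => real"
 assumes s: "!!x. abs (x - xi) < r ==> (%n. a n * (x - xi) ^ n) sums f x" and r: "r > 0"
  and acc: "!!e. e > 0 ==> EX x. x ~= xi & abs (x - xi) < e & f x = 0" and x: "abs (x - xi) < r"
 shows "f x = 0"
proof -
 have fxi: "f xi = a 0" using sums_unique2[OF s[of xi] ] powser_sums_zero[of a] r by simp
 have "isCont f xi"
 proof -
  have "(%n. a n * s ^ n) sums f (xi + s)" if "abs s < r" for s using s[of "xi + s"] that by simp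
  from DERIV_isCont[OF powser_deriv(1)[OF this, of r 0]] r have "isCont (%s. f (xi + s)) 0" by simp
  thus ?thesis by (simp add: isCont_iff)
 qed
 have "f xi = 0"
 proof (rule ccontr)
  assume "f xi ~= 0"
  from continuous_at_avoid[OF \<open>isCont f xi\<close> this] obtain e where "e > 0" "!!y. dist xi y < e ==> f y ~= 0" by blast
  thus False using acc[of e] by (auto simp: dist_real_def abs_minus_commute)
 qed
 have "a m = 0" for m
 proof (rule ccontr)
  assume am: "a m ~= 0"
  hence m: "m > 0" using fxi \<open>f xi = 0\<close> by (cases m) auto
  obtain s where s: "0 < s" "!!z. z : cball xi s - {xi} ==> f z ~= 0"
  proof (rule powser_0_nonzero[where f = f and \<xi> = xi and a = a and m = m, OF r _ \<open>f xi = 0\<close> am m])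
   show "(%n. a n * (x - xi) ^ n) sums f x" if "norm (x - xi) < r" for x using that s by simp
  qed (rule that)
  obtain x where "x ~= xi" "abs (x - xi) < s" "f x = 0" using acc[OF s(1)] by blast
  thus False using s(2)[of x] by (auto simp: dist_real_def abs_minus_commute)
 qed
 thus ?thesis using sums_unique2[OF s[OF x]] by simp
qed

lemma RA_powser:
 assumes "RA f"
 shows "EX a r. r > 0 & (ALL t. abs (t - xi) < r --> (%n. a n * (t - xi) ^ n) sums f (x + t *R d))"
proof -
 obtain r c where e: "r > 0" "expands f c (x + xi *R d) r" using assms unfolding RA_def by blast
 define rho where "rho = r / (norm d + 1)"
 have "(%n. (SUM alp:{alp. sum alp UNIV = n}. c alp * mono alp d) * (t - xi) ^ n) sums f (x + t *R d)" if "abs (t - xi) < rho" for t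
 proof -
  have "norm ((t - xi) *R d) <= abs (t - xi) * (norm d + 1)" by (simp add: mult_left_mono)
  also have "... < rho * (norm d + 1)" using that by (intro mult_strict_right_mono) (auto simp: add_nonneg_pos)
  also have "... = r" by (simp add: rho_def) (metis add_nonneg_eq_0_iff norm_ge_zero zero_le_one zero_neq_one)
  finally have "norm ((t - xi) *R d) < r" .
  from expands_line[OF e(2) this] show ?thesis by (simp add: scaleR_diff_left)
 qed
 moreover have "rho > 0" using e by (simp add: rho_def add_nonneg_pos)
 ultimately show ?thesis
  by (intro exI[of _ "%n. SUM alp:{alp. sum alp UNIV = n}. c alp * mono alp d"] exI[of _ rho] conjI allI impI)
qed

text \<open>Beyond the last point up to which g vanishes there would be a power series with accumulating zeros.\<close>

lemma analytic_identity:
 fixes g :: "real => real"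
 assumes ps: "!!xi. EX a r. r > 0 & (ALL t. abs (t - xi) < r --> (%n. a n * (t - xi) ^ n) sums g t)"
  and e: "e > 0" "!!t. abs (t - t0) < e ==> g t = 0"
 shows "g t = 0"
proof -
 define Z where "Z = interior {t. g t = 0}"
 have sub: "Z <= {t. g t = 0}" unfolding Z_def by (rule interior_subset)
 have "t0 : Z" unfolding Z_def
  by (rule interiorI[of "ball t0 e"]) (use e in "auto simp: dist_real_def abs_minus_commute")
 moreover have "closed Z"
 proof -
  have "xi : Z" if cl: "xi : closure Z" for xi
  proof -
   obtain a r where r: "r > 0" "!!t. abs (t - xi) < r ==> (%n. a n * (t - xi) ^ n) sums g t"
    using ps by blast
   have acc: "EX x. x ~= xi & abs (x - xi) < e & g x = 0" if e: "e > 0" for e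
   proof -
    have op: "open (Z \<inter> ball xi e)" by (auto simp: Z_def)
    have "EX q:Z. dist q xi < e" using cl e by (simp add: closure_approachable)
    then obtain q where q: "q : Z \<inter> ball xi e" by (auto simp: dist_commute)
    have "~ Z \<inter> ball xi e <= {xi}"
    proof
     assume "Z \<inter> ball xi e <= {xi}"
     hence "finite (Z \<inter> ball xi e)" by (rule finite_subset) simp
     thus False using q op finite_imp_not_open by blast
    qed
    then obtain y where "y : Z" "y : ball xi e" "y ~= xi" by blast
    thus ?thesis using sub by (intro exI[of _ y]) (auto simp: dist_real_def abs_minus_commute)
   qed
   have "g t = 0" if "abs (t - xi) < r" for t by (rule powser_zero_near[OF r(2,1) acc that])
   thus ?thesis unfolding Z_def
    by (intro interiorI[of "ball xi r"]) (use r in "auto simp: dist_real_def abs_minus_commute")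
  qed
  thus ?thesis using closure_subset_eq by auto
 qed
 moreover have "open Z" by (simp add: Z_def)
 ultimately show ?thesis using clopen[of Z] sub by auto
qed

lemma RA_line_identity:
 assumes f: "RA f" and e: "e > 0" "!!t. abs (t - t0) < e ==> f (x + t *R d) = 0"
 shows "f (x + t *R d) = 0"
 by (rule analytic_identity[OF RA_powser[OF f] e])

lemma RA_zero_on_open:
 assumes f: "RA f" and S: "open S" "S ~= {}" "!!x. x : S ==> f x = 0"
 shows "f y = 0"
proof -
 obtain x where x: "x : S" using S(2) by blast
 have "((%t. x + t *R (y - x)) \<longlongrightarrow> x + 0 *R (y - x)) (at 0)" by (intro tendsto_intros)
 hence "eventually (%t. x + t *R (y - x) : S) (at 0)" using S(1) x by (intro topological_tendstoD) auto
 then obtain e where "e > 0" "!!t. t ~= 0 ==> abs t < e ==> x + t *R (y - x) : S" by (auto simp: eventually_at)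
 hence "f (x + t *R (y - x)) = 0" if "abs (t - 0) < e" for t using S(3) x that by (cases "t = 0") auto
 hence "f (x + 1 *R (y - x)) = 0" by (rule RA_line_identity[OF f \<open>e > 0\<close>])
 thus ?thesis by simp
qed

text \<open>The function g(t) + g(-t) has a vanishing Taylor series at 0.\<close>

lemma even_derivs_zero_odd:
 fixes G :: "nat => real => real"
 assumes d: "!!n t. (G n has_real_derivative G (Suc n) t) (at t)"
  and s: "!!t. abs t < r ==> (%n. a n * t ^ n) sums G 0 t" and r: "r > 0" and 0: "G k 0 = 0"
 shows "a k = 0"
 using d s 0
proof (induction k arbitrary: G a)
 case 0
 thus ?case using sums_unique2[OF 0(2)[of 0] powser_sums_zero] r by simp
next
 case (Suc k)
 have "diffs a k = 0"
 proof (rule Suc.IH[of "%n. G (Suc n)"])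
  show "(%n. diffs a n * t ^ n) sums G (Suc 0) t" if "abs t < r" for t
   using DERIV_unique[OF powser_deriv(1)[OF Suc.prems(2) that] Suc.prems(1)] powser_deriv(2)[OF Suc.prems(2) that]
   by (simp add: sums_iff)
 qed (use Suc.prems in auto)
 thus ?case by (simp add: diffs_def)
qed

definition reflect :: "'a::euclidean_space \<times> real => 'a => 'a" where
 "reflect h x = x - (2 * (fst h *. x - snd h)) *R fst h"

text \<open>Let P be the class of analytic solutions vanishing on the hyperplane. It is closed under tangential
  derivatives and, since the equation expresses the second normal derivative by the function and tangential
  ones, under the second normal derivative. So all even normal derivatives of v vanish on the hyperplane.\<close>

theorem analytic_eigenfunction_odd:
 fixes v :: "real^'n::finite => real"
 assumes v: "RA v" and S: "open S" "S ~= {}" "!!x. x : S ==> Lap v x = - lam * v x"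
  and nu: "norm nu = 1" and Q: "Q ~= {}" "rel_open Q" "affine hull Q = hplane (nu, b)" and v0: "!!x. x : Q ==> v x = 0"
 shows "v (reflect (nu, b) x) = - v x"
proof -
 define P where "P f \<longleftrightarrow> RA f & (ALL x. Lap f x = - lam * f x) & (ALL x. nu *. x = b --> f x = 0)" for f
 have Pv: "P v" unfolding P_def
 proof (intro conjI allI impI v)
  fix x
  have "RA (%x. Lap v x + lam * v x)" by (intro RA_add RA_cmult RA_Lap v)
  from RA_zero_on_open[OF this S(1,2)] S(3) have "Lap v x + lam * v x = 0" by simp
  thus "Lap v x = - lam * v x" by simp
 next
  fix x assume x: "nu *. x = b"
  obtain q where q: "q : Q" using Q(1) by blast
  then obtain e where e: "e > 0" "ball q e \<inter> affine hull Q <= Q" using Q(2) mem_rel_interior_ball[of q Q] by (auto simp: rel_open_def)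
  have nq: "nu *. q = b" using q Q(3) hull_subset[of Q affine] by (auto simp: hplane_def)
  define rho where "rho = e / (norm (x - q) + 1)"
  have "v (q + t *R (x - q)) = 0" if "abs (t - 0) < rho" for t
  proof -
   have "norm (t *R (x - q)) <= abs t * (norm (x - q) + 1)" by (simp add: mult_left_mono)
   also have "... < rho * (norm (x - q) + 1)" using that by (intro mult_strict_right_mono) (auto simp: add_nonneg_pos)
   also have "... = e" by (simp add: rho_def) (metis add_nonneg_eq_0_iff norm_ge_zero zero_le_one zero_neq_one)
   finally have "q + t *R (x - q) : ball q e" by (simp add: dist_norm)
   moreover have "q + t *R (x - q) : affine hull Q" using Q(3) nq x by (simp add: hplane_def inner_add_right inner_diff_right)
   ultimately show ?thesis using e v0 by blast
  qed
  moreover have "rho > 0" using e by (simp add: rho_def add_nonneg_pos)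
  ultimately have "v (q + 1 *R (x - q)) = 0" using RA_line_identity[OF v] by blast
  thus "v x = 0" by simp
 qed
 have tang: "Dd d f x = 0" if f: "RA f" "!!x. nu *. x = b ==> f x = 0" and d: "nu *. d = 0" and x: "nu *. x = b" for f d x
 proof -
  have "DERIV (%t. f (x + t *R d)) 0 :> Dd d f (x + 0 *R d)" by (rule RA_deriv[OF f(1)])
  moreover have "(%t. f (x + t *R d)) = (%_. 0)" using f(2) d x by (auto simp: inner_add_right)
  ultimately have "DERIV (%_. 0) 0 :> Dd d f x" by simp
  thus ?thesis using DERIV_unique DERIV_const by blast
 qed
 have step: "P (Dd nu (Dd nu f))" if "P f" for f
 proof -
  have f: "RA f" "Lap f = (%x. - lam * f x)" "!!x. nu *. x = b ==> f x = 0" using that by (auto simp: P_def)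
  have Dl: "Dd d (%x. k * f x) = (%x. k * Dd d f x)" if "RA f" for d k and f :: "real^'n => real"
   by (simp add: Dd_def[abs_def] pd_cmult[OF that] sum_distrib_left mult_ac)
  have "Dd nu (Dd nu f) x = 0" if x: "nu *. x = b" for x
  proof -
   have "Dd (axis k 1 - (nu $ k) *R nu) (Dd (axis k 1 - (nu $ k) *R nu) f) x = 0" for k
   proof -
    have o: "nu *. (axis k 1 - (nu $ k) *R nu) = 0" using nu by (simp add: inner_diff_right inner_axis norm_eq_1)
    show ?thesis by (rule tang[OF RA_Dd[OF f(1)] _ o x]) (rule tang[OF f(1,3) o])
   qed
   thus ?thesis using Lap_tangential[OF f(1) nu, of x] f(3)[OF x] by (simp add: f(2))
  qed
  moreover have "Lap (Dd nu (Dd nu f)) = (%x. - lam * Dd nu (Dd nu f) x)"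
   unfolding Lap_Dd[OF RA_Dd[OF f(1)]] Lap_Dd[OF f(1)] f(2) Dl[OF f(1)] Dl[OF RA_Dd[OF f(1)]] ..
  ultimately show ?thesis unfolding P_def by (auto intro: RA_Dd f(1))
 qed
 define x0 where "x0 = x - (nu *. x - b) *R nu"
 have x0: "nu *. x0 = b" using nu by (simp add: x0_def inner_diff_right norm_eq_1)
 define G where "G n t = ((Dd nu) ^^ n) v (x0 + t *R nu)" for n t
 have RAn: "RA (((Dd nu) ^^ n) v)" for n by (induction n) (auto intro: v RA_Dd)
 have even: "P (((Dd nu) ^^ (2 * k)) v)" for k
  by (induction k) (auto intro: Pv step)
 have Gd: "(G n has_real_derivative G (Suc n) t) (at t)" for n t
  using RA_deriv[OF RAn[of n]] by (simp add: G_def[abs_def])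
 obtain a r where r: "r > 0" "!!t. abs t < r ==> (%n. a n * t ^ n) sums G 0 t"
  using RA_powser[OF v, of 0 x0 nu] by (auto simp: G_def)
 have a0: "a n = 0" if "even n" for n
 proof (rule even_derivs_zero_odd[OF Gd r(2,1)])
  obtain k where "n = 2 * k" using \<open>even n\<close> by blast
  thus "G n 0 = 0" using even[of k] x0 by (simp add: P_def G_def)
 qed
 have near: "v (x0 + t *R nu) + v (x0 + t *R (- nu)) = 0" if t: "abs t < r" for t
 proof -
  have "(%n. a n * (- t) ^ n) sums G 0 (- t)" using t by (intro r(2)) simp
  moreover have "a n * (- t) ^ n = - (a n * t ^ n)" for n using a0[of n] by (cases "even n") auto
  ultimately have "(%n. - (a n * t ^ n)) sums G 0 (- t)" by simp
  from sums_unique2[OF this sums_minus[OF r(2)[OF t]]] show ?thesis by (simp add: G_def)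
 qed
 define g where "g t = v (x0 + t *R nu) + v (x0 + t *R (- nu))" for t
 have "g t = 0" for t
 proof (rule analytic_identity[where g = g, OF _ r(1)])
  show "g t = 0" if "abs (t - 0) < r" for t using near that by (simp add: g_def)
  show "EX a r. r > 0 & (ALL t. abs (t - xi) < r --> (%n. a n * (t - xi) ^ n) sums g t)" for xi
  proof -
   obtain a r where r: "r > 0" "!!t. abs (t - xi) < r ==> (%n. a n * (t - xi) ^ n) sums v (x0 + t *R nu)"
    using RA_powser[OF v, of xi x0 nu] by blast
   obtain a' r' where r': "r' > 0" "!!t. abs (t - xi) < r' ==> (%n. a' n * (t - xi) ^ n) sums v (x0 + t *R (- nu))"
    using RA_powser[OF v, of xi x0 "- nu"] by blast
   have "(%n. (a n + a' n) * (t - xi) ^ n) sums g t" if "abs (t - xi) < min r r'" for t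
    using sums_add[OF r(2)[of t] r'(2)[of t]] that unfolding g_def distrib_right by simp
   thus ?thesis using r(1) r'(1) by (intro exI[of _ "%n. a n + a' n"] exI[of _ "min r r'"]) simp
  qed
 qed
 from this[of "nu *. x - b"] have "v (x0 + (nu *. x - b) *R nu) + v (x0 + (nu *. x - b) *R (- nu)) = 0" unfolding g_def .
 moreover have "x0 + (nu *. x - b) *R nu = x" by (simp add: x0_def)
 moreover have "x0 + (nu *. x - b) *R (- nu) = reflect (nu, b) x"
 proof -
  have "(2 * c) *R nu = c *R nu + c *R nu" for c :: real by (simp only: mult_2 scaleR_add_left)
  thus ?thesis unfolding x0_def reflect_def fst_conv snd_conv scaleR_minus_right by (simp only: diff_diff_eq add_uminus_conv_diff)
 qed
 ultimately show ?thesis by simp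
qed

section \<open>The reflection group\<close>

definition side :: "'a::euclidean_space \<times> real => 'a => real" where
 "side h x = fst h *. x - snd h"

lemma reflect_side: "reflect h x = x - (2 * side h x) *R fst h"
 by (simp add: reflect_def side_def)

lemma in_hplane_iff: "x : hplane h \<longleftrightarrow> side h x = 0"
 by (simp add: hplane_def side_def)

lemma side_reflect: "norm (fst h) = 1 ==> side h (reflect h x) = - side h x"
 by (simp add: reflect_def side_def inner_diff_right norm_eq_1 algebra_simps)

lemma reflect_reflect: "norm (fst h) = 1 ==> reflect h (reflect h x) = x"
 by (simp add: reflect_side[of h "reflect h x"] side_reflect) (simp add: reflect_side)

lemma reflect_fixed: "side h x = 0 ==> reflect h x = x"
 by (simp add: reflect_side)

text \<open>The group element of a word, the last letter acting first.\<close>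

fun ev :: "('a::euclidean_space \<times> real) list => 'a => 'a" where
 "ev [] x = x"
| "ev (h # w) x = reflect h (ev w x)"

text \<open>The linear part of the group element.\<close>

fun lw :: "('a::euclidean_space \<times> real) list => 'a => 'a" where
 "lw [] x = x"
| "lw (h # w) x = reflect (fst h, 0) (lw w x)"

lemma ev_append: "ev (w @ w') x = ev w (ev w' x)"
 by (induction w) auto

lemma lw_append: "lw (w @ w') x = lw w (lw w' x)"
 by (induction w) auto

lemma reflect_add: "reflect h (x + y) = reflect h x + reflect (fst h, 0) y"
 by (simp add: reflect_def inner_add_right scaleR_add_left scaleR_diff_left algebra_simps)

lemma ev_add: "ev w (x + y) = ev w x + lw w y"
 by (induction w) (auto simp: reflect_add)

lemma ev_eq: "ev w x = lw w x + ev w 0"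
 using ev_add[of w 0 x] by simp

lemma ev_diff: "ev w x - ev w y = lw w (x - y)"
 using ev_add[of w y "x - y"] by simp

lemma linear_lw: "linear (lw w)"
proof (induction w)
 case (Cons h w)
 interpret linear "lw w" by fact
 show ?case by (rule linearI) (simp_all add: add scale reflect_def inner_add_right algebra_simps)
qed (auto intro: linearI)

definition unit_word :: "('a::euclidean_space \<times> real) list => bool" where
 "unit_word w \<longleftrightarrow> (ALL h:set w. norm (fst h) = 1)"

lemma unit_word_simps [simp]: "unit_word []" "unit_word (h # w) \<longleftrightarrow> norm (fst h) = 1 & unit_word w"
  "unit_word (w @ w') \<longleftrightarrow> unit_word w & unit_word w'" "unit_word (rev w) \<longleftrightarrow> unit_word w"
 by (auto simp: unit_word_def)

lemma lw_inner: "unit_word w ==> lw w x *. lw w y = x *. y"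
proof (induction w)
 case (Cons h w)
 have "reflect (fst h, 0) x *. reflect (fst h, 0) y = x *. y" for x y
  using Cons.prems by (simp add: reflect_def inner_diff_left inner_diff_right norm_eq_1 inner_commute algebra_simps)
 thus ?case using Cons by simp
qed simp

lemma norm_lw: "unit_word w ==> norm (lw w x) = norm x"
 by (simp add: norm_eq_sqrt_inner lw_inner)

lemma dist_ev: "unit_word w ==> dist (ev w x) (ev w y) = dist x y"
 by (simp add: dist_norm ev_diff norm_lw)

lemma ev_rev: "unit_word w ==> ev (rev w) (ev w x) = x"
 by (induction w arbitrary: x) (auto simp: ev_append reflect_reflect)

lemma ev_rev': "unit_word w ==> ev w (ev (rev w) x) = x"
 using ev_rev[of "rev w" x] by simp

lemma lw_rev: "unit_word w ==> lw (rev w) (lw w x) = x"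
 by (induction w arbitrary: x) (auto simp: lw_append reflect_reflect)

lemma lw_rev': "unit_word w ==> lw w (lw (rev w) x) = x"
 using lw_rev[of "rev w" x] by simp

lemma ev_continuous: "continuous_on A (ev w)"
proof -
 have "continuous_on A (lw w)" using linear_lw linear_continuous_on linear_conv_bounded_linear by blast
 thus ?thesis by (subst ev_eq[abs_def]) (intro continuous_intros)
qed

lemma side_ev:
 assumes "unit_word w"
 shows "side h (ev w x) = lw (rev w) (fst h) *. x - (snd h - fst h *. ev w 0)"
proof -
 have "fst h *. lw w x = lw (rev w) (fst h) *. x"
  using lw_inner[OF assms, of "lw (rev w) (fst h)" x] by (simp add: lw_rev'[OF assms])
 thus ?thesis by (simp add: side_def ev_eq[of w x] inner_add_right)
qed

lemma hplane_subset_unit: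
 fixes m n :: "'a::euclidean_space"
 assumes m: "norm m = 1" and n: "norm n = 1" and sub: "!!x. n *. x = b ==> m *. x = bet"
 shows "EX s. (s = 1 | s = -1) & m = s *R n & bet = s * b"
proof -
 have nn: "n *. n = 1" "m *. m = 1" using m n by (auto simp: norm_eq_1)
 define s where "s = m *. n"
 have b: "bet = s * b" using sub[of "b *R n"] nn by (simp add: s_def mult.commute)
 define y where "y = m - s *R n"
 have ny: "n *. y = 0" using nn by (simp add: y_def inner_diff_right s_def inner_commute)
 have "m *. (b *R n + y) = bet" using ny nn by (intro sub) (simp add: inner_add_right)
 hence "m *. y = 0" using b by (simp add: inner_add_right s_def)
 hence "y *. y = 0" using ny by (simp add: y_def inner_diff_left inner_commute)
 hence ms: "m = s *R n" by (simp add: y_def)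
 hence "s = 1 | s = -1" using nn square_eq_1_iff by auto
 thus ?thesis using ms b by blast
qed

locale chamber =
 fixes Om :: "'a::euclidean_space set" and HH :: "('a \<times> real) set" and v :: "'a => real"
 assumes dom: "open Om" "connected Om" "bounded Om" "Om ~= {}"
  and HH: "finite HH" "!!h. h : HH ==> norm (fst h) = 1"
  and fr: "frontier Om <= (UN h:HH. hplane h)"
  and facet: "!!h. h : HH ==> EX Q. Q <= closure Om & affine hull Q = hplane h"
  and v: "!!x. x : Om ==> v x ~= 0" "!!h x. h : HH ==> v (reflect h x) = - v x"
begin

abbreviation W where "W \<equiv> lists HH"

lemma unit_W: "w : W ==> unit_word w"
 using HH(2) by (auto simp: unit_word_def)

lemma odd_ev: "(!!h x. h : HH ==> f (reflect h x) = - f x) ==> w : W ==> f (ev w x) = (-1) ^ length w * (f x :: real)"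
 by (induction w) auto

lemma odd_hplane: "(!!h x. h : HH ==> f (reflect h x) = - f x) ==> h : HH ==> side h x = 0 ==> f x = (0::real)"
 using reflect_fixed[of h x] by (metis eq_neg_iff_add_eq_0 mult_2 mult_eq_0_iff zero_neq_numeral)

lemma odd_frontier: "(!!h x. h : HH ==> f (reflect h x) = - f x) ==> y : frontier Om ==> f y = (0::real)"
 using fr odd_hplane[of f _ y] by (auto simp: in_hplane_iff)

lemma closure_cases: "y : closure Om ==> y : Om | y : frontier Om"
 using dom(1) by (simp add: frontier_def interior_open)

lemma side_nonzero: "w : W ==> h : HH ==> x : Om ==> side h (ev w x) ~= 0"
 using odd_hplane[of v h "ev w x"] odd_ev[of v w x] v by auto

lemma side_const_sign:
 assumes w: "w : W" and h: "h : HH" and x: "x : Om" "y : Om"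
 shows "side h (ev w x) * side h (ev w y) > 0"
proof (rule ccontr)
 assume neg: "~ side h (ev w x) * side h (ev w y) > 0"
 define S where "S = (%x. side h (ev w x)) ` Om"
 have "connected S" unfolding S_def side_def
  by (intro connected_continuous_image dom continuous_intros ev_continuous)
 moreover have nz: "0 ~: S" using side_nonzero[OF w h] by (auto simp: S_def)
 ultimately have "a < 0 ==> 0 < b ==> a : S ==> b : S ==> False" for a b
  using connectedD_interval[of S a b 0] by simp
 moreover have "side h (ev w x) : S" "side h (ev w y) : S" using x by (auto simp: S_def)
 moreover have "side h (ev w x) < 0 & side h (ev w y) > 0 | side h (ev w x) > 0 & side h (ev w y) < 0"
  using neg side_nonzero[OF w h x(1)] side_nonzero[OF w h x(2)] by (auto simp: not_less mult_le_0_iff)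
 ultimately show False by blast
qed

lemma side_closure:
 assumes w: "w : W" and h: "h : HH" and x: "x : Om" "q : closure Om"
 shows "side h (ev w x) * side h (ev w q) >= 0"
proof -
 have "(%y. side h (ev w x) * side h (ev w y)) ` closure Om <= {0..}"
 proof (rule image_closure_subset)
  show "continuous_on (closure Om) (%y. side h (ev w x) * side h (ev w y))"
   unfolding side_def by (intro continuous_intros ev_continuous)
  show "(%y. side h (ev w x) * side h (ev w y)) ` Om <= {0..}"
   using side_const_sign[OF w h x(1)] by (auto intro: less_imp_le)
 qed simp
 thus ?thesis using x(2) by auto
qed

text \<open>A mirror separating the chamber from its neighbour across a facet contains the facet, hence is
 its wall.\<close>

lemma separated:
 assumes w: "w : W" and h: "h : HH" and k: "k : HH" and p: "p : Om"
  and sep: "side h (ev w p) * side h (ev w (reflect k p)) < 0"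
 shows "reflect h (ev w x) = ev w (reflect k x)"
proof -
 have uw: "unit_word w" by (rule unit_W[OF w])
 have wk: "w @ [k] : W" using w k by simp
 obtain Q where Q: "Q <= closure Om" "affine hull Q = hplane k" using facet[OF k] by blast
 have s0: "side h (ev w q) = 0" if q: "q : Q" for q
 proof -
  have rq: "reflect k q = q" using Q(2) hull_subset[of Q affine] q in_hplane_iff reflect_fixed by blast
  have "side h (ev w p) * side h (ev w q) >= 0" by (rule side_closure[OF w h p]) (use Q q in blast)
  moreover have "side h (ev w (reflect k p)) * side h (ev w q) >= 0"
   using side_closure[OF wk h p, of q] Q q rq by (auto simp: ev_append)
  ultimately show ?thesis using sep by (smt (verit) mult_less_0_iff mult_neg_neg mult_pos_pos mult_pos_neg mult_neg_pos)
 qed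
 define m where "m = lw (rev w) (fst h)"
 define bet where "bet = snd h - fst h *. ev w 0"
 have sm: "side h (ev w x) = m *. x - bet" for x unfolding m_def bet_def by (rule side_ev[OF uw])
 have "affine hull Q <= {x. m *. x = bet}"
  by (rule hull_minimal) (use s0 sm in "auto simp: affine_hyperplane")
 hence "m *. x = bet" if "fst k *. x = snd k" for x using that Q(2) by (auto simp: hplane_def)
 moreover have "norm m = 1" unfolding m_def using norm_lw[of "rev w"] uw HH(2)[OF h] by simp
 ultimately obtain s where s: "s = 1 | s = -1" "m = s *R fst k" "bet = s * snd k"
  using hplane_subset_unit[of m "fst k" "snd k" bet] HH(2)[OF k] by blast
 have h': "fst h = s *R lw w (fst k)"
 proof -
  show ?thesis by (metis m_def lw_rev'[OF uw] s(2) linear_cmul[OF linear_lw])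
 qed
 have "side h (ev w x) = s * side k x" unfolding sm by (simp add: s side_def right_diff_distrib)
 hence "reflect h (ev w x) = ev w x - (2 * (s * side k x)) *R (s *R lw w (fst k))"
  by (simp add: reflect_side h'[symmetric])
 also have "... = ev w x + lw w (- (2 * side k x) *R fst k)"
  using s(1) by (auto simp: linear_cmul[OF linear_lw] linear_neg[OF linear_lw])
 also have "... = ev w (reflect k x)" by (simp only: ev_add[symmetric] reflect_side) simp
 finally show ?thesis .
qed

text \<open>The exchange argument. Follow the images of p under the initial segments of the word: the wall of the
  first letter is crossed again at some letter, and deleting both letters leaves the same map.\<close>

lemma stabilizer:
 assumes "w : W" "p : Om" "ev w p : Om"
 shows "ev w x = x"
 using assms(1,3)
proof (induction "length w" arbitrary: w rule: less_induct)
 case less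
 show ?case
 proof (cases w)
  case (Cons h u)
  hence h: "h : HH" and u: "u : W" using less.prems by auto
  define f where "f j = side h (ev (take j w) p)" for j
  have tW: "take j w : W" "drop j w : W" "take j u : W" for j using less.prems(1) u by (auto dest: in_set_takeD in_set_dropD)
  have fn: "f j ~= 0" for j unfolding f_def by (rule side_nonzero[OF tW(1) h assms(2)])
  (* the first initial segment that brings p back to its own side of the wall of h *)
  define j where "j = (LEAST j. 1 <= j & f 0 * f j > 0)"
  have ex: "1 <= length w & f 0 * f (length w) > 0" using side_const_sign[of "[]" h p "ev w p"] h assms(2) less.prems f_def Cons by simp
  have j: "1 <= j" "f 0 * f j > 0" using LeastI[of "%j. 1 <= j & f 0 * f j > 0", OF ex] by (auto simp: j_def)
  have jl: "j <= length w" unfolding j_def by (rule Least_le[of "%j. 1 <= j & f 0 * f j > 0", OF ex])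
  have j1: "j ~= 1"
  proof
   assume "j = 1"
   hence "0 < - (f 0 * f 0)" using HH(2)[OF h] f_def Cons side_reflect j(2) by fastforce
   moreover have "f 0 * f 0 >= 0" by simp
   ultimately show False by linarith
  qed
  define i where "i = j - 1"
  have i: "1 <= i" "j = Suc i" "i < length w" using j(1) j1 jl by (auto simp: i_def)
  have "f 0 * f i < 0" using not_less_Least[of i "%j. 1 <= j & f 0 * f j > 0"] i j_def[symmetric] fn[of 0] fn[of i] not_less less_le by fastforce
  hence sep: "f i * f (Suc i) < 0" using j(2) i(2) by (auto simp: mult_less_0_iff zero_less_mult_iff)
  define k where "k = w ! i"
  have k: "k : HH" using i less.prems(1) by (auto simp: k_def)
  have tS: "take (Suc i) w = take i w @ [k]" using i by (simp add: take_Suc_conv_app_nth k_def)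
  have "side h (ev (take i w) p) * side h (ev (take i w) (reflect k p)) < 0"
   using sep by (simp add: f_def tS ev_append)
  from separated[OF tW(1) h k assms(2) this]
  have sepr: "reflect h (ev (take i w) x) = ev (take i w) (reflect k x)" for x .
  obtain i' where i': "i = Suc i'" using i(1) by (cases i) auto
  have evw: "ev w x = ev (take i' u @ drop (Suc i) w) x" for x
  proof -
   have "w = take (Suc i) w @ drop (Suc i) w" by simp
   hence "ev w x = ev (take (Suc i) w) (ev (drop (Suc i) w) x)" by (metis ev_append)
   also have "... = reflect h (ev (take i w) (ev (drop (Suc i) w) x))" by (simp add: tS ev_append sepr)
   also have "... = ev (take i' u) (ev (drop (Suc i) w) x)" by (simp add: Cons i' reflect_reflect HH(2)[OF h])
   finally show ?thesis by (simp add: ev_append)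
  qed
  have "ev (take i' u @ drop (Suc i) w) x = x"
  proof (rule less.hyps)
   show "length (take i' u @ drop (Suc i) w) < length w" using i i' by (simp add: Cons)
   show "take i' u @ drop (Suc i) w : W" using tW by simp
   show "ev (take i' u @ drop (Suc i) w) p : Om" using less.prems(2) by (simp add: evw)
  qed
  thus ?thesis by (simp add: evw)
 qed simp
qed

lemma translate_unique:
 assumes w: "w : W" "w' : W" and x: "x : Om" "y : Om" "ev w x = ev w' y"
 shows "ev w z = ev w' z" "x = y"
proof -
 have u: "unit_word w'" by (rule unit_W[OF w(2)])
 have "rev w' @ w : W" using w by auto
 moreover have "ev (rev w' @ w) x = y" using x(3) by (simp add: ev_append ev_rev[OF u])
 ultimately have e: "ev (rev w' @ w) z = z" for z using stabilizer[of "rev w' @ w" x z] x by simp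
 have "ev w z = ev w' (ev (rev w' @ w) z)" for z by (simp add: ev_append ev_rev'[OF u])
 thus "ev w z = ev w' z" using e by simp
 show "x = y" using e[of x] \<open>ev (rev w' @ w) x = y\<close> by simp
qed

lemma sign_unique:
 assumes w: "w : W" "w' : W" and x: "x : Om" "y : Om" "ev w x = ev w' y"
 shows "(-1::real) ^ length w = (-1) ^ length w'"
 using odd_ev[of v w x] odd_ev[of v w' x] v w translate_unique(1)[OF assms, of x] x(1) by auto

lemma orbit_discrete:
 assumes p: "p : Om"
 obtains r where "r > 0" "!!w w'. w : W ==> w' : W ==> dist (ev w p) (ev w' p) < r ==> ev w p = ev w' p"
proof -
 obtain r where r: "r > 0" "ball p r <= Om" using dom(1) p by (meson open_contains_ball)
 have "ev w p = ev w' p" if w: "w : W" "w' : W" and d: "dist (ev w p) (ev w' p) < r" for w w'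
 proof -
  have u: "unit_word w'" by (rule unit_W[OF w(2)])
  define q where "q = ev (rev w') (ev w p)"
  have "dist p q = dist (ev w' p) (ev w p)" using dist_ev[of "rev w'" "ev w' p" "ev w p"] u by (simp add: q_def ev_rev)
  hence "q : Om" using d r by (auto simp: dist_commute)
  moreover have e: "ev w' q = ev w p" by (simp add: q_def ev_rev'[OF u])
  ultimately have "q = p" using translate_unique(2)[OF w(2,1) _ p] by blast
  thus ?thesis using e by simp
 qed
 with r(1) show thesis by (rule that)
qed

text \<open>The orbit of p is closed, so some orbit point is nearest to z. Move it to p: if z were outside the closed
  chamber, the segment to p would cross a wall, and reflecting p in that wall would bring it closer.\<close>

lemma cover:
 shows "EX w:W. EX y:closure Om. z = ev w y"
proof -
 obtain p where p: "p : Om" using dom(4) by blast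
 obtain r where r: "r > 0" "!!w w'. w : W ==> w' : W ==> dist (ev w p) (ev w' p) < r ==> ev w p = ev w' p"
  by (rule orbit_discrete[OF p]) (rule that)
 define Orb where "Orb = (%w. ev w p) ` W"
 have "closed Orb"
 proof (rule discrete_imp_closed[OF r(1)], intro ballI impI)
  fix a b assume "a : Orb" "b : Orb" "dist b a < r"
  then obtain w w' where "w : W" "a = ev w p" "w' : W" "b = ev w' p" "dist b a < r" unfolding Orb_def by blast
  thus "b = a" using r(2)[of w' w] by metis
 qed
 moreover have "Orb ~= {}" by (auto simp: Orb_def)
 ultimately obtain a where a: "a : Orb" "!!b. b : Orb ==> dist z a <= dist z b" using distance_attains_inf by blast
 obtain w where w: "w : W" "a = ev w p" using a unfolding Orb_def by blast
 have u: "unit_word w" by (rule unit_W[OF w(1)])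
 define y where "y = ev (rev w) z"
 have zy: "z = ev w y" by (simp add: y_def ev_rev'[OF u])
 have min: "dist y p <= dist y (ev w' p)" if "w' : W" for w'
 proof -
  have "dist z a <= dist z (ev (w @ w') p)" using that w by (intro a) (auto simp: Orb_def)
  thus ?thesis by (simp add: zy w(2) ev_append dist_ev[OF u])
 qed
 have "y : closure Om"
 proof (rule ccontr)
  assume y: "y ~: closure Om"
  have "closed_segment p y \<inter> frontier Om ~= {}"
   by (rule connected_Int_frontier) (use p y closure_subset[of Om] in "auto intro: ends_in_segment")
  then obtain q where q: "q : closed_segment p y" "q : frontier Om" by blast
  then obtain h where h: "h : HH" "side h q = 0" using fr by (auto simp: in_hplane_iff)
  obtain t where t: "0 <= t" "t <= 1" "q = (1 - t) *R p + t *R y" using q(1) by (auto simp: closed_segment_def)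
  have lin: "side h q = (1 - t) * side h p + t * side h y"
   unfolding t(3) side_def by (simp add: inner_add_right algebra_simps)
  have sp: "side h p ~= 0" using side_nonzero[of "[]" h p] h p by simp
  have t1: "t ~= 1" using q(2) y t(3) by (auto simp: frontier_def)
  have t0: "t ~= 0" using sp lin h(2) by auto
  have neg: "side h y * side h p < 0"
  proof -
   have "t * side h y = - ((1 - t) * side h p)" using lin h(2) by linarith
   hence "(t * side h y) * side h p = - ((1 - t) * side h p) * side h p" by (simp only:)
   hence "t * (side h y * side h p) = - ((1 - t) * (side h p * side h p))" by (simp only: mult.assoc mult_minus_left)
   moreover have "(1 - t) * (side h p * side h p) > 0"
   proof (rule mult_pos_pos)
    show "1 - t > 0" using t t1 by simp
    show "side h p * side h p > 0" using sp not_real_square_gt_zero by blast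
   qed
   ultimately have "t * (side h y * side h p) < 0" by linarith
   thus ?thesis using t(1) by (simp add: mult_less_0_iff)
  qed
  have n1: "fst h *. fst h = 1" using HH(2)[OF h(1)] by (simp add: norm_eq_1)
  have "(dist y (reflect h p))\<^sup>2 = (dist y p)^2 + 4 * (side h y * side h p)"
  proof -
   have e: "y - reflect h p = (y - p) + (2 * side h p) *R fst h" by (simp add: reflect_side)
   have "(norm (a + c *R fst h))\<^sup>2 = (norm a)^2 + 2 * c * (fst h *. a) + c * c" for a c
    unfolding power2_norm_eq_inner using n1 by (simp add: inner_add_left inner_add_right inner_commute algebra_simps)
   hence e1: "(dist y (reflect h p))\<^sup>2 = (dist y p)^2 + 2 * (2 * side h p) * (fst h *. (y - p)) + (2 * side h p) * (2 * side h p)"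
    unfolding dist_norm e .
   have e2: "fst h *. (y - p) = side h y - side h p" by (simp add: side_def inner_diff_right)
   show ?thesis unfolding e1 e2 by (simp add: algebra_simps)
  qed
  hence "(dist y (reflect h p))\<^sup>2 < (dist y p)\<^sup>2" using neg by linarith
  hence "dist y (reflect h p) < dist y p" by (rule power2_less_imp_less) simp
  thus False using min[of "[h]"] h(1) by simp
 qed
 thus ?thesis using zy w(1) by blast
qed

lemma odd_zero:
 assumes f: "!!h x. h : HH ==> f (reflect h x) = - f x" "!!x. x : Om ==> f x = (0::real)"
 shows "f z = 0"
proof -
 obtain w y where w: "w : W" "y : closure Om" "z = ev w y" using cover[of z] by blast
 have "f y = 0" using closure_cases[OF w(2)] odd_frontier[of f y] f by blast
 thus ?thesis using odd_ev[of f w y] f(1) w by simp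
qed

text \<open>Two points in a common chamber are compared inside it. Two nearby points in different chambers are each
  close to a wall, where u vanishes.\<close>

lemma odd_extension:
 fixes u :: "'a => real"
 assumes u: "continuous_on (closure Om) u" "!!x. x : frontier Om ==> u x = 0"
 obtains U where "bcont U" "!!x. x : closure Om ==> U x = u x" "!!h x. h : HH ==> U (reflect h x) = - U x"
proof -
 define R where "R z c \<longleftrightarrow> (EX w:W. EX x:Om. z = ev w x & c = (-1) ^ length w * u x)" for z and c :: real
 have Runiq: "c = c'" if "R z c" "R z c'" for z c c'
 proof -
  from that(1) obtain w x where w: "w : W" "x : Om" "z = ev w x" "c = (-1) ^ length w * u x" unfolding R_def by blast
  from that(2) obtain w' x' where w': "w' : W" "x' : Om" "z = ev w' x'" "c' = (-1) ^ length w' * u x'" unfolding R_def by blast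
  have "ev w x = ev w' x'" using w w' by simp
  from translate_unique(2)[OF w(1) w'(1) w(2) w'(2) this] sign_unique[OF w(1) w'(1) w(2) w'(2) this]
  show ?thesis using w w' by simp
 qed
 define U where "U z = (if EX c. R z c then THE c. R z c else 0)" for z
 have UR: "U z = c" if "R z c" for z c
 proof -
  show ?thesis using that Runiq the_equality U_def by auto
 qed
 have U0: "U z = 0" if "~ (EX c. R z c)" for z using that by (simp add: U_def)
 have Uev: "U (ev w x) = (-1) ^ length w * u x" if "w : W" "x : Om" for w x
  using that by (intro UR) (auto simp: R_def)
 have vR: "EX c. R z c" if "v z ~= 0" for z
 proof -
  obtain w y where w: "w : W" "y : closure Om" "z = ev w y" using cover[of z] by blast
  have "y : Om"
  proof (rule ccontr)
   assume "y ~: Om"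
   hence "v y = 0" using closure_cases[OF w(2)] odd_frontier[of v y] v(2) by blast
   thus False using odd_ev[of v w y] v(2) w that by simp
  qed
  thus ?thesis using w unfolding R_def by blast
 qed
 have Rv: "v z ~= 0" if "R z c" for z c
 proof -
  from that obtain w x where "w : W" "x : Om" "z = ev w x" unfolding R_def by blast
  thus ?thesis using odd_ev[of v w x] v by simp
 qed
 have Ufr: "U y = 0" if "y : frontier Om" for y
  using U0 Rv odd_frontier[OF v(2) that] by blast
 have Ucl: "U x = u x" if "x : closure Om" for x
 proof (cases "x : Om")
  case True thus ?thesis using Uev[of "[]" x] by simp
 next
  case False
  thus ?thesis by (simp add: that dom(1) frontier_def interior_open Ufr u(2))
 qed
 have odd: "U (reflect h x) = - U x" if h: "h : HH" for h x
 proof (cases "EX c. R x c")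
  case True
  then obtain w y where w: "w : W" "y : Om" "x = ev w y" unfolding R_def by blast
  show ?thesis using Uev[of w y] Uev[of "h # w" y] w h by simp
 next
  case False
  hence "v (reflect h x) = 0" using vR v(2)[OF h] by auto
  thus ?thesis using Rv U0 False by fastforce
 qed
 have comp: "compact (closure Om)" using dom(3) by simp
 obtain B where B: "!!x. x : closure Om ==> abs (u x) <= B"
  using compact_imp_bounded[OF compact_continuous_image[OF u(1) comp]] by (auto simp: bounded_iff)
 have "bcont U"
 proof (rule bcontI[of _ B])
  show "abs (U z) <= B" for z
  proof -
   obtain w y where w: "w : W" "y : closure Om" "z = ev w y" using cover[of z] by blast
   thus ?thesis using odd_ev[of U w y] odd B[OF w(2)] Ucl[OF w(2)] by (simp add: abs_mult power_abs)
  qed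
  have uc: "uniformly_continuous_on (closure Om) u" by (rule compact_uniformly_continuous[OF u(1) comp])
  show "cont U"
   unfolding continuous_on_iff
  proof (intro ballI allI impI)
   fix z :: 'a and e :: real assume e: "e > 0"
   obtain d where d: "d > 0" "!!x x'. x : closure Om ==> x' : closure Om ==> dist x' x < d ==> dist (u x') (u x) < e/2"
    using uc e unfolding uniformly_continuous_on_def by (metis half_gt_zero)
   have small: "abs (U a) < e/2" if a: "R a c" and b: "dist a b < d" "!!w x y. w : W ==> x : Om ==> y : Om ==> ~ (a = ev w x & b = ev w y)" for a b c
   proof -
    obtain w x where w: "w : W" "x : Om" "a = ev w x" using a unfolding R_def by blast
    have uw: "unit_word w" by (rule unit_W[OF w(1)])
    define y where "y = ev (rev w) b"
    have by': "b = ev w y" by (simp add: y_def ev_rev'[OF uw])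
    have "y ~: Om" using b(2)[OF w(1,2)] w(3) by' by blast
    have "closed_segment x y \<inter> frontier Om ~= {}"
     by (rule connected_Int_frontier) (use w(2) \<open>y ~: Om\<close> in "auto intro: ends_in_segment")
    then obtain q where q: "q : closed_segment x y" "q : frontier Om" by blast
    have "dist x q < d" using b(1) w(3) by' dist_ev[OF uw] dist_in_closed_segment[OF q(1)] dist_commute by (smt (verit))
    hence "dist (u x) (u q) < e/2" using q(2) w(2) closure_subset by (intro d) (auto simp: frontier_def)
    thus ?thesis using Uev[OF w(1,2)] u(2)[OF q(2)] by (simp add: w(3) abs_mult power_abs)
   qed
   have "dist (U z') (U z) < e" if z': "dist z' z < d" for z'
   proof (cases "EX w:W. EX x:Om. EX y:Om. z = ev w x & z' = ev w y")
    case True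
    then obtain w x y where w: "w : W" "x : Om" "y : Om" "z = ev w x" "z' = ev w y" by blast
    have "dist y x < d" using z' w dist_ev[OF unit_W[OF w(1)]] by simp
    hence "dist (u y) (u x) < e/2" using w closure_subset by (intro d) auto
    moreover have "dist (U z') (U z) = dist (u y) (u x)"
     using Uev[OF w(1,2)] Uev[OF w(1,3)] by (simp add: w dist_real_def abs_mult power_abs right_diff_distrib[symmetric])
    ultimately show ?thesis using e by linarith
   next
    case False
    have "abs (U z) < e/2"
    proof (cases "EX c. R z c")
     case True
     then obtain c where "R z c" by blast
     from small[OF this] z' False show ?thesis by (auto simp: dist_commute)
    qed (use U0 e in auto)
    moreover have "abs (U z') < e/2"
    proof (cases "EX c. R z' c")
     case True
     then obtain c where "R z' c" by blast
     from small[OF this z'] False show ?thesis by blast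
    qed (use U0 e in auto)
    ultimately show ?thesis by (simp add: dist_real_def)
   qed
   thus "EX d>0. ALL x':UNIV. dist x' z < d --> dist (U x') (U z) < e" using d(1) by blast
  qed
 qed
 thus thesis by (rule that[OF _ Ucl odd])
qed

text \<open>Mirrors are words followed by a wall. Those meeting the closed chamber are finitely many.\<close>

definition mirrors where "mirrors = {(w, h). w : W & h : HH}"
definition normal where "normal M = lw (fst M) (fst (snd M))"
definition on_mirror where "on_mirror M y \<longleftrightarrow> side (snd M) (ev (rev (fst M)) y) = 0"

lemma mirrorsE:
 assumes "M : mirrors"
 obtains w h where "M = (w, h)" "w : W" "h : HH"
 using assms unfolding mirrors_def by blast

lemma norm_normal: "M : mirrors ==> norm (normal M) = 1"
 by (elim mirrorsE) (simp add: normal_def norm_lw unit_W HH(2) del: in_lists_conv_set)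

lemma mirror_reflection:
 assumes M: "(w, h) : mirrors"
 shows "ev (w @ [h] @ rev w) y = y - (2 * side h (ev (rev w) y)) *R normal (w, h)"
proof -
 have u: "unit_word w" using M by (auto simp: mirrors_def unit_W)
 have "ev (w @ [h] @ rev w) y = ev w (ev (rev w) y + (- 2 * side h (ev (rev w) y)) *R fst h)"
  by (simp add: ev_append reflect_side)
 also have "... = ev w (ev (rev w) y) + (- 2 * side h (ev (rev w) y)) *R normal (w, h)"
  unfolding ev_add by (simp add: linear_cmul[OF linear_lw] linear_neg[OF linear_lw] normal_def)
 finally show ?thesis by (simp add: ev_rev'[OF u])
qed

lemma orbit_finite:
 assumes p: "p : Om"
 shows "finite ((%w. ev w p) ` W \<inter> cball p R)"
proof -
 obtain r where r: "r > 0" "!!w w'. w : W ==> w' : W ==> dist (ev w p) (ev w' p) < r ==> ev w p = ev w' p"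
  by (rule orbit_discrete[OF p]) (rule that)
 have "uniform_discrete ((%w. ev w p) ` W \<inter> cball p R)"
  unfolding uniform_discrete_def
 proof (intro exI[of _ r] conjI r(1) ballI impI)
  fix a b assume "a : (%w. ev w p) ` W \<inter> cball p R" "b : (%w. ev w p) ` W \<inter> cball p R" "dist a b < r"
  then obtain w w' where "w : W" "a = ev w p" "w' : W" "b = ev w' p" "dist a b < r" by blast
  thus "a = b" using r(2)[of w w'] by metis
 qed
 thus ?thesis using uniform_discrete_finite_iff[of "(%w. ev w p) ` W \<inter> cball p R"] by auto
qed

text \<open>The reflection in such a mirror moves p by a bounded amount along the normal, to one of finitely many
  orbit points.\<close>

lemma near_normals_finite: "finite (normal ` {M:mirrors. EX y:closure Om. on_mirror M y})"
proof -
 obtain p where p: "p : Om" using dom(4) by blast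
 have "bounded (closure Om)" using dom(3) by (rule bounded_closure)
 then obtain R where R: "!!y. y : closure Om ==> dist p y <= R" unfolding bounded_any_center[of _ p] by blast
 define A where "A = (%w. ev w p) ` W \<inter> cball p (2 * R)"
 have "normal M : (%a. (p - a) /R norm (p - a)) ` A \<union> (%a. - ((p - a) /R norm (p - a))) ` A"
  if M: "M : mirrors" "y : closure Om" "on_mirror M y" for M y
 proof -
  obtain w h where wh: "M = (w, h)" "w : W" "h : HH" using M(1) by (auto simp: mirrors_def)
  define g where "g = w @ [h] @ rev w"
  have g: "g : W" using wh by (auto simp: g_def)
  define c where "c = 2 * side h (ev (rev w) p)"
  have c0: "c ~= 0"
  proof -
   have "rev w : W" using wh(2) by auto
   from side_nonzero[OF this wh(3) p] show ?thesis by (simp add: c_def)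
  qed
  have gp: "ev g p = p - c *R normal M" unfolding g_def c_def wh(1) by (rule mirror_reflection) (use M wh in simp)
  have gy: "ev g y = y"
   using mirror_reflection[of w h y] M wh by (simp add: g_def on_mirror_def)
  have "dist p (ev g p) <= dist p y + dist y (ev g p)" by (rule dist_triangle)
  also have "dist y (ev g p) = dist y p" using dist_ev[OF unit_W[OF g], of y p] gy by simp
  finally have "ev g p : A" using R[OF M(2)] g by (auto simp: A_def dist_commute)
  moreover have "p - ev g p = c *R normal M" by (simp add: gp)
  hence "(p - ev g p) /R norm (p - ev g p) = (c / abs c) *R normal M"
   using norm_normal[OF M(1)] by (simp add: divide_inverse mult.commute)
  hence "normal M = (p - ev g p) /R norm (p - ev g p) | normal M = - ((p - ev g p) /R norm (p - ev g p))"
   using c0 by (cases "c > 0") auto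
  ultimately show ?thesis by blast
 qed
 hence "normal ` {M:mirrors. EX y:closure Om. on_mirror M y}
   <= (%a. (p - a) /R norm (p - a)) ` A \<union> (%a. - ((p - a) /R norm (p - a))) ` A" by blast
 moreover have "finite A" unfolding A_def by (rule orbit_finite[OF p])
 ultimately show ?thesis by (meson finite_UnI finite_imageI finite_subset)
qed

lemma normals_meet:
 assumes M: "M : mirrors" "M' : mirrors" and ne: "normal M ~= normal M'" "normal M ~= - normal M'"
 shows "EX x. on_mirror M x & on_mirror M' x"
proof -
 define m m' c where "m = normal M" and "m' = normal M'" and "c = m *. m'"
 have u: "m *. m = 1" "m' *. m' = 1" using norm_normal M by (auto simp: m_def m'_def norm_eq_1)
 have om: "EX bet. ALL y. on_mirror M y \<longleftrightarrow> normal M *. y = bet" if "M : mirrors" for M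
 proof -
  have "unit_word (rev (fst M))" using that by (elim mirrorsE) (simp add: unit_W del: in_lists_conv_set)
  from side_ev[OF this, of "snd M"] show ?thesis
   by (intro exI[of _ "snd (snd M) - fst (snd M) *. ev (rev (fst M)) 0"]) (simp add: on_mirror_def normal_def)
 qed
 obtain bet bet' where b: "!!y. on_mirror M y \<longleftrightarrow> m *. y = bet" "!!y. on_mirror M' y \<longleftrightarrow> m' *. y = bet'"
  using om[OF M(1)] om[OF M(2)] unfolding m_def m'_def by blast
 have d: "1 - c * c ~= 0"
 proof
  assume "1 - c * c = 0"
  hence "c = 1 | c = -1" by (simp add: square_eq_1_iff)
  moreover have "(m - c *R m') *. (m - c *R m') = 1 - c * c"
   using u by (simp add: inner_diff_left inner_diff_right c_def inner_commute)
  hence "m = c *R m'" using \<open>1 - c * c = 0\<close> by simp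
  ultimately show False using ne by (auto simp: m_def m'_def)
 qed
 define s t where "s = (bet - c * bet') / (1 - c * c)" and "t = (bet' - c * bet) / (1 - c * c)"
 have st: "s * (1 - c * c) = bet - c * bet'" "t * (1 - c * c) = bet' - c * bet" using d by (auto simp: s_def t_def)
 have "(s + t * c) * (1 - c * c) = bet * (1 - c * c)" "(s * c + t) * (1 - c * c) = bet' * (1 - c * c)"
 proof -
  have "(s + t * c) * (1 - c * c) = s * (1 - c * c) + c * (t * (1 - c * c))"
   "(s * c + t) * (1 - c * c) = c * (s * (1 - c * c)) + t * (1 - c * c)" by (simp_all add: algebra_simps)
  thus "(s + t * c) * (1 - c * c) = bet * (1 - c * c)" "(s * c + t) * (1 - c * c) = bet' * (1 - c * c)"
   unfolding st by (simp_all add: algebra_simps)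
 qed
 hence "s + t * c = bet" "s * c + t = bet'" using d by auto
 hence "on_mirror M (s *R m + t *R m')" "on_mirror M' (s *R m + t *R m')"
  using u by (auto simp: b inner_add_right c_def inner_commute)
 thus ?thesis by blast
qed

text \<open>Two non-parallel mirrors meet; moving their intersection to the closed chamber shows that only
 finitely many angles occur. Hence the unit normals are uniformly discrete.\<close>

lemma normals_finite: "finite (normal ` mirrors)"
proof -
 define N0 where "N0 = normal ` {M:mirrors. EX y:closure Om. on_mirror M y}"
 define D where "D = insert (-1) ((%(m, m'). m *. m') ` (N0 \<times> N0))"
 have finD: "finite D" unfolding D_def N0_def using near_normals_finite by auto
 have inD: "m *. m' : D" if mm: "m : normal ` mirrors" "m' : normal ` mirrors" "m ~= m'" for m m'
 proof (cases "m = - m'")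
  case True
  thus ?thesis using mm norm_normal norm_eq_1 D_def by auto
 next
  case False
  obtain M M' where M: "M : mirrors" "m = normal M" "M' : mirrors" "m' = normal M'" using mm by blast
  obtain x where x: "on_mirror M x" "on_mirror M' x" using normals_meet[OF M(1,3)] mm(3) False M by blast
  obtain w y where w: "w : W" "y : closure Om" "x = ev w y" using cover[of x] by blast
  have u: "unit_word w" by (rule unit_W[OF w(1)])
  define mv where "mv M = (rev w @ fst M, snd M)" for M :: "('a \<times> real) list \<times> 'a \<times> real"
  have mv: "mv M : mirrors & normal (mv M) = lw (rev w) (normal M) & on_mirror (mv M) y" if "M : mirrors" "on_mirror M x" for M
   using that w(1) by (auto simp: mv_def mirrors_def normal_def on_mirror_def lw_append ev_append w(3))
  have "normal (mv M) *. normal (mv M') = m *. m'"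
   using mv[OF M(1) x(1)] mv[OF M(3) x(2)] lw_inner[of "rev w"] u by (simp add: M)
  moreover have "normal (mv M) : N0" "normal (mv M') : N0"
   using mv[OF M(1) x(1)] mv[OF M(3) x(2)] w(2) unfolding N0_def by blast+
  ultimately show ?thesis
   unfolding D_def by (intro insertI2 image_eqI[of _ _ "(normal (mv M), normal (mv M'))"]) auto
 qed
 define dl where "dl = Min (insert 1 ((%c. sqrt (2 - 2 * c)) ` {c:D. c < 1}))"
 have fin: "finite (insert 1 ((%c. sqrt (2 - 2 * c)) ` {c:D. c < 1}))" using finD by auto
 have dl: "dl > 0" unfolding dl_def using fin by (subst Min_gr_iff) auto
 have "uniform_discrete (normal ` mirrors)"
  unfolding uniform_discrete_def
 proof (intro exI[of _ dl] conjI dl ballI impI)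
  fix m m' assume mm: "m : normal ` mirrors" "m' : normal ` mirrors" and d: "dist m m' < dl"
  show "m = m'"
  proof (rule ccontr)
   assume ne: "m ~= m'"
   have u: "m *. m = 1" "m' *. m' = 1" using mm norm_normal by (auto simp: norm_eq_1)
   have d2: "(dist m m')\<^sup>2 = 2 - 2 * (m *. m')"
    using u by (simp add: dist_norm power2_norm_eq_inner inner_diff_left inner_diff_right inner_commute)
   have "(dist m m')\<^sup>2 > 0" using ne by simp
   hence "m *. m' < 1" using d2 by simp
   hence "dl <= sqrt (2 - 2 * (m *. m'))" unfolding dl_def using inD[OF mm ne] by (intro Min_le fin) auto
   also have "... = dist m m'" unfolding d2[symmetric] by simp
   finally show False using d by simp
  qed
 qed
 moreover have "bounded (normal ` mirrors)" by (rule boundedI[of _ 1]) (auto simp: norm_normal)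
 ultimately show ?thesis using uniform_discrete_finite_iff by blast
qed

text \<open>Otherwise a line orthogonal to all walls would run inside the bounded domain.\<close>

lemma normals_span: "span (fst ` HH) = UNIV"
proof (rule ccontr)
 assume "span (fst ` HH) ~= UNIV"
 then obtain d where d: "d ~= 0" "!!x. x : span (fst ` HH) ==> d *. x = 0" using span_not_UNIV_orthogonal by blast
 obtain p where p: "p : Om" using dom(4) by blast
 define L where "L = range (%t. p + t *R d)"
 have side: "side h (p + t *R d) ~= 0" if "h : HH" for h t
  using side_nonzero[of "[]" h p] d(2)[of "fst h"] that p by (simp add: side_def inner_add_right inner_commute span_base)
 have "~ bounded L"
 proof
  assume "bounded L"
  then obtain B where B: "!!t. dist p (p + t *R d) <= B" unfolding L_def bounded_any_center[of _ p] by auto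
  have "B >= 0" using B[of 0] by simp
  have "abs ((B + 1) / norm d) * norm d <= B" using B[of "(B + 1) / norm d"] by (simp add: dist_norm)
  thus False using d(1) \<open>B >= 0\<close> by simp
 qed
 hence "L - Om ~= {}" using bounded_subset[OF dom(3)] by blast
 moreover have "p + 0 *R d : L" unfolding L_def by blast
 hence "L \<inter> Om ~= {}" using p by auto
 moreover have "connected L" unfolding L_def by (intro connected_continuous_image continuous_intros) simp
 ultimately have "L \<inter> frontier Om ~= {}" using connected_Int_frontier by blast
 thus False using fr side unfolding L_def by (auto simp: in_hplane_iff)
qed

text \<open>A linear part permutes the finite set of normals and is determined by this permutation.\<close>

lemma linear_parts_finite: "finite (lw ` W)"
proof -
 define N where "N = normal ` mirrors"
 have sub: "fst ` HH <= N"
 proof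
  fix m assume "m : fst ` HH"
  then obtain h where "h : HH" "m = fst h" by blast
  thus "m : N" unfolding N_def by (intro image_eqI[of _ _ "([], h)"]) (auto simp: normal_def mirrors_def)
 qed
 have maps: "lw w m : N" if w: "w : W" and m: "m : N" for w m
 proof -
  from m obtain M where M: "M : mirrors" "m = normal M" unfolding N_def by blast
  from M(1) obtain w' h where "M = (w', h)" "w' : W" "h : HH" by (rule mirrorsE)
  hence "w' : W" "h : HH" "m = lw w' (fst h)" using M(2) by (simp_all add: normal_def)
  thus ?thesis using w unfolding N_def by (intro image_eqI[of _ _ "(w @ w', h)"]) (auto simp: normal_def mirrors_def lw_append)
 qed
 have "inj_on (%L. restrict L N) (lw ` W)"
 proof (rule inj_onI, elim imageE)
  fix L L' w w' assume L: "L = lw w" "L' = lw w'" and r: "restrict L N = restrict L' N"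
  have "L m = L' m" if "m : N" for m using r that by (metis restrict_apply)
  moreover have "span N = UNIV" using normals_span span_mono[OF sub] by blast
  ultimately have "L x = L' x" for x
   using linear_eq_on_span[OF linear_lw[of w] linear_lw[of w'], of N x] L by auto
  thus "L = L'" by blast
 qed
 moreover have "(%L. restrict L N) ` (lw ` W) <= PiE N (%_. N)"
 proof (intro subsetI, elim imageE)
  fix g L w assume "g = restrict L N" "L = lw w" "w : W"
  thus "g : PiE N (%_. N)" using maps by simp
 qed
 moreover have "finite (PiE N (%_. N))" using normals_finite by (intro finite_PiE) (auto simp: N_def)
 ultimately show ?thesis by (rule finite_imageD[OF finite_subset, rotated 2])
qed

text \<open>As the linear parts are finitely many and the chambers cover the space, the translations in the
 group are cobounded, so they span.\<close>

theorem periods: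
 obtains B :: "'a set" where "independent B" "span B = UNIV"
  "!!(U :: 'a => real) b x. (!!h x. h : HH ==> U (reflect h x) = - U x) ==> b : B ==> U (x + b) = U x"
proof -
 define Lam where "Lam = {a. EX w:W. ALL x. ev w x = x + a}"
 have "EX r. r : W & lw r = L" if "L : lw ` W" for L using that by blast
 then obtain r where r: "!!L. L : lw ` W ==> r L : W & lw (r L) = L" by metis
 have inL: "ev w 0 - ev (r (lw w)) 0 : Lam" if w: "w : W" for w
 proof -
  define q where "q = r (lw w)"
  have q: "q : W" "lw q = lw w" using r w by (auto simp: q_def)
  have "ev (w @ rev q) x = x + (ev w 0 - ev q 0)" for x
  proof -
   have "ev w z = ev q z + (ev w 0 - ev q 0)" for z using ev_eq[of w z] ev_eq[of q z] q(2) by simp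
   from this[of "ev (rev q) x"] show ?thesis by (simp add: ev_append ev_rev'[OF unit_W[OF q(1)]])
  qed
  moreover have "w @ rev q : W" using w q by auto
  ultimately show ?thesis unfolding Lam_def q_def by blast
 qed
 obtain B1 where B1: "!!y. y : closure Om ==> norm y <= B1" using dom(3) bounded_closure by (metis bounded_iff)
 have "finite ((%L. ev (r L) 0) ` (lw ` W))" using linear_parts_finite by auto
 from finite_imp_bounded[OF this] obtain B2 where B2: "!!w. w : W ==> norm (ev (r (lw w)) 0) <= B2"
  unfolding bounded_iff by blast
 have cob: "EX a:Lam. dist x a <= B1 + B2" for x
 proof -
  obtain w y where w: "w : W" "y : closure Om" "x = ev w y" using cover[of x] by blast
  have e: "x - (ev w 0 - ev (r (lw w)) 0) = lw w y + ev (r (lw w)) 0" by (simp add: w(3) ev_eq[of w y])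
  have "dist x (ev w 0 - ev (r (lw w)) 0) <= norm (lw w y) + norm (ev (r (lw w)) 0)"
   unfolding dist_norm e by (rule norm_triangle_ineq)
  also have "... <= B1 + B2" using B1[OF w(2)] B2[OF w(1)] norm_lw[OF unit_W[OF w(1)]] by (intro add_mono) auto
  finally show ?thesis using inL[OF w(1)] by blast
 qed
 have sp: "span Lam = UNIV"
 proof (rule ccontr)
  assume "span Lam ~= UNIV"
  then obtain d where d: "d ~= 0" "!!x. x : span Lam ==> d *. x = 0" using span_not_UNIV_orthogonal by blast
  define t where "t = (abs (B1 + B2) + 1) / norm d"
  obtain a where a: "a : Lam" "dist (t *R d) a <= B1 + B2" using cob by blast
  have "t * (norm d)^2 = d *. (t *R d - a)" using d(2)[of a] a(1) by (simp add: inner_diff_right span_base power2_norm_eq_inner)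
  also have "... <= norm d * norm (t *R d - a)" by (rule norm_cauchy_schwarz)
  also have "... <= norm d * (B1 + B2)" using a(2) by (intro mult_left_mono) (auto simp: dist_norm)
  finally have "(t * norm d) * norm d <= (B1 + B2) * norm d" by (simp add: power2_eq_square mult_ac)
  hence "t * norm d <= B1 + B2" using d(1) by (simp add: mult_le_cancel_right)
  thus False using d(1) by (simp add: t_def)
 qed
 obtain B where B: "B <= Lam" "independent B" "Lam <= span B" by (rule maximal_independent_subset)
 have spB: "span B = UNIV" using sp span_mono[OF B(3)] unfolding span_span by (simp add: top.extremum_unique)
 show thesis
 proof (rule that[of "(%b. 2 *R b) ` B"])
  have li: "linear (%b::'a. 2 *R b)" by (rule linear_scaleR)
  show "independent ((%b. 2 *R b) ` B)" by (simp add: inj_on_def linear_independent_injective_image[OF li B(2)] inj_on_subset subset_UNIV)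
  have "x : (%b. 2 *R b) ` UNIV" for x :: 'a by (rule image_eqI[of _ _ "(1/2) *R x"]) auto
  thus "span ((%b. 2 *R b) ` B) = UNIV" unfolding linear_span_image[OF li] spB by blast
  fix U :: "'a => real" and b x assume odd: "!!h x. h : HH ==> U (reflect h x) = - U x" and b: "b : (%b. 2 *R b) ` B"
  obtain a where a: "a : B" "b = a + a" using b by (auto simp: scaleR_2)
  obtain w where w: "w : W" "!!x. ev w x = x + a" using a(1) B(1) unfolding Lam_def by blast
  have "x + b = ev (w @ w) x" by (simp add: ev_append w(2) a(2))
  thus "U (x + b) = U x" using odd_ev[of U "w @ w" x] odd w(1) by (simp add: power_add[symmetric] mult_2[symmetric])
 qed
qed

end

section \<open>Means of almost periodic functions\<close>

text \<open>Trigonometric polynomials with frequencies in G; the phase c makes sines available.\<close>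

inductive trig :: "'a::euclidean_space set => ('a => real) => bool" for G where
 cos: "xi : G ==> trig G (%x. k * cos (xi *. x + c))"
| add: "trig G f ==> trig G g ==> trig G (%x. f x + g x)"

text \<open>The mean value of an almost periodic function, as the limit of resolvents over growing scales: they
  annihilate every nonconstant frequency and commute with translations.\<close>

definition has_mean :: "('a::euclidean_space => real) => real => bool" where
 "has_mean f c \<longleftrightarrow> (ALL x. (%k. yuk (real k) f x) ----> c)"

lemma bcont_cos: "bcont (%x. cos (xi *. x + c))"
 by (rule test_fun_bcont(1)[OF test_fun_cos])

lemma trig_bcont: "trig G f ==> bcont f"
proof (induction rule: trig.induct)
 case (cos xi k c)
 show ?case by (intro bcont_cmult bcont_cos)
qed (rule bcont_add)

lemma trig_cmult: "trig G f ==> trig G (%x. k * f x)"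
proof (induction rule: trig.induct)
 case (cos xi k' c)
 thus ?case using trig.cos[of xi G "k * k'" c] by (simp add: mult.assoc)
next
 case (add f g)
 thus ?case using trig.add[OF add.IH] by (simp add: distrib_left)
qed

lemma yuk_cos: "yuk a (%x. cos (xi *. x + c)) x = cos (xi *. x + c) / (1 + a^2 * (xi *. xi))"
proof -
 have "yuk a (%x. - (xi *. xi) * cos (xi *. x + c)) x = - (xi *. xi) * yuk a (%x. cos (xi *. x + c)) x" by (rule yuk_cmult)
 hence "yuk a (%x. cos (xi *. x + c)) x * (1 + a^2 * (xi *. xi)) = cos (xi *. x + c)"
  using yuk_test_fun[OF test_fun_cos[of xi c], of a x] by (simp add: algebra_simps)
 moreover have "1 + a^2 * (xi *. xi) > 0" by (simp add: add_pos_nonneg)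
 ultimately show ?thesis by (simp add: field_simps)
qed

lemma mean_cos: "xi ~= 0 ==> has_mean (%x. cos (xi *. x + c)) 0"
 unfolding has_mean_def yuk_cos
proof
 fix x :: 'a assume xi: "xi ~= 0"
 have "filterlim (%k. 1 + (real k)^2 * (xi *. xi)) at_top sequentially"
  using xi by (intro filterlim_tendsto_add_at_top[OF tendsto_const] filterlim_at_top_mult_tendsto_pos[OF tendsto_const])
   (auto intro!: filterlim_pow_at_top filterlim_real_sequentially)
 thus "(%k. cos (xi *. x + c) / (1 + (real k)^2 * (xi *. xi))) ----> 0"
  by (intro tendsto_divide_0[OF tendsto_const] filterlim_at_top_imp_at_infinity)
qed

lemma has_mean_const: "has_mean (%_. c) c" by (simp add: has_mean_def)

lemma mean_add: "bcont f ==> bcont g ==> has_mean f c ==> has_mean g d ==> has_mean (%x. f x + g x) (c + d)"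
 by (simp add: has_mean_def yuk_add tendsto_add)

lemma mean_cmult: "has_mean f c ==> has_mean (%x. k * f x) (k * c)"
 by (simp add: has_mean_def yuk_cmult tendsto_mult_left)

lemma mean_diff: "bcont f ==> bcont g ==> has_mean f c ==> has_mean g d ==> has_mean (%x. f x - g x) (c - d)"
 by (simp add: has_mean_def yuk_diff tendsto_diff)

lemma mean_sum:
 "finite S ==> (!!i. i : S ==> bcont (f i)) ==> (!!i. i : S ==> has_mean (f i) (c i)) ==>
  bcont (%x. SUM i:S. f i x) & has_mean (%x. SUM i:S. f i x) (SUM i:S. c i)"
 by (induction S rule: finite_induct) (auto intro!: has_mean_const mean_add bcont_add)

lemma mean_unique: "has_mean f c ==> has_mean f d ==> c = d"
 unfolding has_mean_def using LIMSEQ_unique by blast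

lemma mean_le: "bcont f ==> bcont g ==> has_mean f c ==> has_mean g d ==> (!!x. f x <= g x) ==> c <= d"
 unfolding has_mean_def by (rule LIMSEQ_le[of "%k. yuk (real k) f 0" _ "%k. yuk (real k) g 0"]) (auto intro!: yuk_mono)

lemma mean_bound: "bcont f ==> has_mean f c ==> (!!x. abs (f x) <= e) ==> abs c <= e"
proof -
 assume f: "bcont f" "has_mean f c" and b: "!!x. abs (f x) <= e"
 have "c <= e" using b by (intro mean_le[OF f(1) bcont_const f(2) has_mean_const]) (simp add: abs_le_iff)
 moreover have "- e <= c" using b by (intro mean_le[OF bcont_const f(1) has_mean_const f(2)]) (metis abs_le_iff minus_le_iff)
 ultimately show "abs c <= e" by linarith
qed

lemma mean_translate: "has_mean f c ==> has_mean (%x. f (x + z)) c"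
proof -
 have "yuk a (%x. f (x + z)) x = yuk a f (x + z)" for a x unfolding yuk_def by (rule Bochner_Integration.integral_cong[OF refl]) (simp add: algebra_simps)
 thus "has_mean f c ==> has_mean (%x. f (x + z)) c" by (simp add: has_mean_def)
qed

lemma trig_mean: "trig G f ==> EX c. has_mean f c"
proof (induction rule: trig.induct)
 case (cos xi k c)
 show ?case
 proof (cases "xi = 0")
  case True thus ?thesis by (auto intro: has_mean_const)
 next
  case False thus ?thesis using mean_cmult[OF mean_cos] by blast
 qed
next
 case (add f g) thus ?case using mean_add trig_bcont by blast
qed

definition AP :: "'a::euclidean_space set => ('a => real) => bool" where
 "AP G f \<longleftrightarrow> bcont f & (ALL e>0. EX g. trig G g & (ALL x. abs (f x - g x) <= e))"

lemma AP_trig: "trig G f ==> AP G f"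
 unfolding AP_def using trig_bcont by (metis abs_zero diff_self less_imp_le)

text \<open>Means of approximating trigonometric polynomials form a Cauchy sequence.\<close>

lemma AP_mean:
 assumes f: "AP G f"
 shows "EX c. has_mean f c"
proof -
 have fb: "bcont f" using f by (simp add: AP_def)
 have close: "EX N c. ALL k>=N. abs (yuk (real k) f x - c) <= e & abs (yuk (real k) f 0 - c) <= e" if e: "e > 0" for e x
 proof -
  obtain g where g: "trig G g" "!!x. abs (f x - g x) <= e/2" using f half_gt_zero[OF e] unfolding AP_def by blast
  obtain c where c: "has_mean g c" using trig_mean[OF g(1)] by blast
  have gb: "bcont g" by (rule trig_bcont[OF g(1)])
  have d: "abs (yuk (real k) f x - yuk (real k) g x) <= e/2" for k x
   unfolding yuk_diff[OF fb gb, symmetric] by (rule yuk_bound[OF bcont_diff[OF fb gb] g(2)])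
  have "EX N. ALL k>=N. abs (yuk (real k) g x - c) < e/2" for x
   using c half_gt_zero[OF e] unfolding has_mean_def LIMSEQ_iff real_norm_def by blast
  then obtain N1 N2 where N: "!!k. k >= N1 ==> abs (yuk (real k) g x - c) < e/2" "!!k. k >= N2 ==> abs (yuk (real k) g 0 - c) < e/2" by blast
  show ?thesis
  proof (intro exI[of _ "max N1 N2"] exI[of _ c] allI impI conjI)
   fix k assume "max N1 N2 <= k"
   hence "k >= N1" "k >= N2" by auto
   from N(1)[OF this(1)] N(2)[OF this(2)] d[of k x] d[of k 0]
   show "abs (yuk (real k) f x - c) <= e" "abs (yuk (real k) f 0 - c) <= e" by linarith+
  qed
 qed
 have "Cauchy (%k. yuk (real k) f 0)"
  unfolding Cauchy_def dist_real_def
 proof (intro allI impI)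
  fix e :: real assume e: "e > 0"
  from e have "e/3 > 0" by simp
  from close[OF this, of 0] obtain N c where N: "!!k. k >= N ==> abs (yuk (real k) f 0 - c) <= e/3" by blast
  show "EX M. ALL m>=M. ALL n>=M. abs (yuk (real m) f 0 - yuk (real n) f 0) < e"
  proof (intro exI[of _ N] allI impI)
   fix m n assume "N <= m" "N <= n"
   from N[OF this(1)] N[OF this(2)] e show "abs (yuk (real m) f 0 - yuk (real n) f 0) < e" by linarith
  qed
 qed
 then obtain C where C: "(%k. yuk (real k) f 0) ----> C" using Cauchy_convergent convergent_def by blast
 have "(%k. yuk (real k) f x) ----> C" for x
 proof -
  have "(%k. yuk (real k) f x - yuk (real k) f 0) ----> 0"
   unfolding LIMSEQ_iff real_norm_def
  proof (intro allI impI)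
   fix e :: real assume e: "e > 0"
   from e have "e/3 > 0" by simp
   from close[OF this, of x] obtain N c where N: "!!k. k >= N ==> abs (yuk (real k) f x - c) <= e/3 & abs (yuk (real k) f 0 - c) <= e/3" by blast
   show "EX N. ALL k>=N. abs (yuk (real k) f x - yuk (real k) f 0 - 0) < e"
   proof (intro exI[of _ N] allI impI)
    fix k assume "N <= k"
    from N[OF this] e show "abs (yuk (real k) f x - yuk (real k) f 0 - 0) < e" by linarith
   qed
  qed
  from tendsto_add[OF this C] show ?thesis by simp
 qed
 thus ?thesis unfolding has_mean_def by blast
qed

lemma AP_add:
 assumes "AP G f" "AP G g" shows "AP G (%x. f x + g x)"
 unfolding AP_def
proof (intro conjI allI impI)
 show "bcont (%x. f x + g x)" using assms by (auto simp: AP_def intro: bcont_add)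
 fix e :: real assume "e > 0"
 hence e: "e/2 > 0" by simp
 obtain f' where f': "trig G f'" "!!x. abs (f x - f' x) <= e/2" using assms(1) e unfolding AP_def by blast
 obtain g' where g': "trig G g'" "!!x. abs (g x - g' x) <= e/2" using assms(2) e unfolding AP_def by blast
 have "abs (f x + g x - (f' x + g' x)) <= e" for x using f'(2)[of x] g'(2)[of x] by linarith
 thus "EX h. trig G h & (ALL x. abs (f x + g x - h x) <= e)" using trig.add[OF f'(1) g'(1)] by blast
qed

text \<open>The resolvent multiplies a frequency by a factor that depends on its length alone.\<close>

lemma trig_reflection:
 assumes l: "!!x y. x *. l y = l x *. y" "!!x. l x *. l x = x *. x" and p: "trig G p"
 shows "bcont (%x. p (k + l x)) & yuk a (%x. p (k + l x)) x = yuk a p (k + l x)"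
 using p
proof (induction rule: trig.induct)
 case (cos xi b c)
 have e: "xi *. (k + l x) + c = l xi *. x + (xi *. k + c)" for x by (simp add: inner_add_right l(1))
 show ?case unfolding yuk_cmult yuk_cos e l(2) by (intro conjI bcont_cmult bcont_cos refl)
next
 case (add f g)
 note b = conjunct1[OF add.IH(1)] conjunct1[OF add.IH(2)]
 have "yuk a (%x. f (k + l x) + g (k + l x)) x = yuk a (%x. f (k + l x)) x + yuk a (%x. g (k + l x)) x" by (rule yuk_add[OF b])
 also have "... = yuk a f (k + l x) + yuk a g (k + l x)" by (simp only: add.IH)
 also have "... = yuk a (%x. f x + g x) (k + l x)"
  by (rule yuk_add[OF trig_bcont[OF add.hyps(1)] trig_bcont[OF add.hyps(2)], symmetric])
 finally show ?case using bcont_add[OF b] by (intro conjI)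
qed

lemma AP_reflection:
 assumes U: "AP G U" and l: "!!x y. x *. l y = l x *. y" "!!x. l x *. l x = x *. x" and b: "bcont (%x. U (k + l x))"
 shows "yuk a (%x. U (k + l x)) x = yuk a U (k + l x)"
proof (rule ccontr)
 define e where "e = abs (yuk a (%x. U (k + l x)) x - yuk a U (k + l x)) / 3"
 assume "yuk a (%x. U (k + l x)) x ~= yuk a U (k + l x)"
 hence e: "e > 0" by (simp add: e_def)
 then obtain p where p: "trig G p" "!!x. abs (U x - p x) <= e" using U unfolding AP_def by blast
 have bU: "bcont U" "bcont p" using U trig_bcont[OF p(1)] by (simp_all add: AP_def)
 note r = trig_reflection[OF l p(1), of k a x]
 have "abs (yuk a U (k + l x) - yuk a p (k + l x)) <= e"
  using yuk_bound[OF bcont_diff[OF bU] p(2), of a "k + l x"] by (simp add: yuk_diff[OF bU])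
 moreover have "abs (yuk a (%x. U (k + l x)) x - yuk a (%x. p (k + l x)) x) <= e"
  using yuk_bound[OF bcont_diff[OF b conjunct1[OF r]] p(2), of a x] by (simp add: yuk_diff[OF b conjunct1[OF r]])
 ultimately have "abs (yuk a (%x. U (k + l x)) x - yuk a U (k + l x)) <= 2 * e" using r by linarith
 thus False using e by (simp add: e_def)
qed

lemma AP_yuk:
 assumes "AP G f" shows "AP G (yuk 1 f)"
 unfolding AP_def
proof (intro conjI allI impI)
 have fb: "bcont f" using assms by (simp add: AP_def)
 show "bcont (yuk 1 f)" by (rule yuk_bcont[OF fb])
 have ty: "trig G g ==> trig G (yuk 1 g)" for g
 proof (induction rule: trig.induct)
  case (cos xi k c)
  have "yuk 1 (%x. k * cos (xi *. x + c)) = (%x. (k / (1 + xi *. xi)) * cos (xi *. x + c))"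
   by (simp add: fun_eq_iff yuk_cmult yuk_cos)
  thus ?case using trig.cos[OF cos, of "k / (1 + xi *. xi)" c] by (simp only:)
 next
  case (add f g)
  have "yuk 1 (%x. f x + g x) = (%x. yuk 1 f x + yuk 1 g x)"
   by (simp add: fun_eq_iff yuk_add[OF trig_bcont[OF add.hyps(1)] trig_bcont[OF add.hyps(2)]])
  thus ?case using trig.add[OF add.IH] by simp
 qed
 fix e :: real assume "e > 0"
 then obtain g where g: "trig G g" "!!x. abs (f x - g x) <= e" using assms unfolding AP_def by blast
 have gb: "bcont g" by (rule trig_bcont[OF g(1)])
 have "abs (yuk 1 f x - yuk 1 g x) <= e" for x
  unfolding yuk_diff[OF fb gb, symmetric] by (rule yuk_bound[OF bcont_diff[OF fb gb] g(2)])
 thus "EX g. trig G g & (ALL x. abs (yuk 1 f x - g x) <= e)" using ty[OF g(1)] by blast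
qed

locale freq_group =
 fixes G :: "'a::euclidean_space set"
 assumes G0: "0 : G" and Gadd: "!!x y. x : G ==> y : G ==> x + y : G" and Gneg: "!!x. x : G ==> - x : G"
begin

lemma Gdiff: "x : G ==> y : G ==> x - y : G"
 using Gadd[OF _ Gneg] by fastforce

lemma trig_const: "trig G (%_. k)"
 using trig.cos[OF G0, of k 0] by simp

lemma cos_times_cos':
 "(k * cos (xi *. x + c)) * (k' * cos (eta *. x + c')) =
  (k * k' / 2) * cos ((xi - eta) *. x + (c - c')) + (k * k' / 2) * cos ((xi + eta) *. x + (c + c'))"
proof -
 have "cos (xi *. x + c) * cos (eta *. x + c') = (cos ((xi - eta) *. x + (c - c')) + cos ((xi + eta) *. x + (c + c'))) / 2"
  unfolding cos_times_cos by (simp add: inner_diff_left inner_add_left algebra_simps)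
 moreover have "(k * p) * (k' * q) = (k * k' / 2) * X + (k * k' / 2) * Y" if "p * q = (X + Y) / 2" for p q X Y
 proof -
  have "(k * p) * (k' * q) = (k * k') * (p * q)" by (simp add: mult_ac)
  thus ?thesis unfolding that by (simp add: field_simps)
 qed
 ultimately show ?thesis by blast
qed

lemma trig_mult_cos: "trig G f ==> eta : G ==> trig G (%x. f x * (k' * cos (eta *. x + c')))"
proof (induction rule: trig.induct)
 case (cos xi k c)
 show ?case unfolding cos_times_cos' by (intro trig.intros Gdiff Gadd cos)
next
 case (add f g)
 thus ?case unfolding distrib_right by (intro trig.add) auto
qed

lemma trig_mult: "trig G g ==> trig G f ==> trig G (%x. f x * g x)"
proof (induction rule: trig.induct)
 case (cos xi k c)
 thus ?case by (intro trig_mult_cos)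
next
 case (add g g')
 thus ?case unfolding distrib_left by (intro trig.add) auto
qed

lemma trig_sum: "finite S ==> (!!i. i : S ==> trig G (f i)) ==> trig G (%x. SUM i:S. f i x)"
 by (induction S rule: finite_induct) (auto intro: trig_const trig.add)

lemma AP_mult:
 assumes f: "AP G f" and g: "AP G g"
 shows "AP G (%x. f x * g x)"
 unfolding AP_def
proof (intro conjI allI impI)
 have fb: "bcont f" and gb: "bcont g" using f g by (auto simp: AP_def)
 show "bcont (%x. f x * g x)" by (rule bcont_mult[OF fb gb])
 obtain B where B: "B >= 0" "!!x. abs (f x) <= B" by (rule bcont_bound[OF fb]) (rule that)
 obtain B' where B': "B' >= 0" "!!x. abs (g x) <= B'" by (rule bcont_bound[OF gb]) (rule that)
 fix e :: real assume e: "e > 0"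
 define d where "d = min 1 (e / (B + B' + 1))"
 have d: "d > 0" "d <= 1" "d <= e / (B + B' + 1)" using e B B' by (auto simp: d_def add_nonneg_pos)
 have de: "d * (B + B' + 1) <= e"
 proof -
  have "B + B' + 1 > 0" using B B' by simp
  thus ?thesis using d(3) by (simp add: pos_le_divide_eq)
 qed
 obtain f' where f': "trig G f'" "!!x. abs (f x - f' x) <= d" using f d(1) unfolding AP_def by blast
 obtain g' where g': "trig G g'" "!!x. abs (g x - g' x) <= d" using g d(1) unfolding AP_def by blast
 have "abs (f x * g x - f' x * g' x) <= e" for x
 proof -
  have "f x * g x - f' x * g' x = (f x - f' x) * g' x + f x * (g x - g' x)" by (simp add: algebra_simps)
  moreover have "abs ((f x - f' x) * g' x) <= d * (B' + 1)"
   unfolding abs_mult using f'(2)[of x] g'(2)[of x] B'(2)[of x] d by (intro mult_mono) auto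
  moreover have "abs (f x * (g x - g' x)) <= B * d"
   unfolding abs_mult using g'(2)[of x] B by (intro mult_mono) auto
  ultimately show ?thesis using de by (simp add: algebra_simps)
 qed
 thus "EX h. trig G h & (ALL x. abs (f x * g x - h x) <= e)" using trig_mult[OF g'(1) f'(1)] by blast
qed

text \<open>Clear for trigonometric polynomials, as only the frequencies xi and - xi contribute to the mean; it
  passes to uniform limits.\<close>

lemma resolvent_coeff:
 assumes U: "AP G U" and xi: "xi : G"
 shows "EX m. has_mean (%x. U x * cos (xi *. x + c)) m & has_mean (%x. yuk 1 U x * cos (xi *. x + c)) (m / (1 + xi *. xi))"
proof -
 define C where "C x = cos (xi *. x + c)" for x
 have Ct: "trig G C" using trig.cos[OF xi, of 1 c] by (simp add: C_def[abs_def])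
 have Cb: "bcont C" by (rule trig_bcont[OF Ct])
 have C1: "abs (C x) <= 1" for x by (simp add: C_def)
 define q where "q = 1 + xi *. xi"
 have q: "q >= 1" by (simp add: q_def)
 have tr: "trig G f ==> EX m. has_mean (%x. f x * C x) m & has_mean (%x. yuk 1 f x * C x) (m / q)" for f
 proof (induction rule: trig.induct)
  case (cos eta k d)
  define f where "f x = k * cos (eta *. x + d)" for x
  have yf: "yuk 1 f x * C x = inverse (1 + eta *. eta) * (f x * C x)" for x
   unfolding f_def by (simp add: yuk_cmult yuk_cos divide_inverse)
  obtain m where m: "has_mean (%x. f x * C x) m"
   using trig_mean[OF trig_mult[OF Ct trig.cos[OF cos]]] unfolding f_def by blast
  have m': "has_mean (%x. yuk 1 f x * C x) (inverse (1 + eta *. eta) * m)" unfolding yf by (rule mean_cmult[OF m])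
  have "inverse (1 + eta *. eta) * m = m / q"
  proof (cases "eta *. eta = xi *. xi")
   case True thus ?thesis by (simp add: q_def divide_inverse)
  next
   case False
   hence ne: "eta - xi ~= 0" "eta + xi ~= 0" by (auto simp: add_eq_0_iff2)
   have "f x * C x = (k * 1 / 2) * cos ((eta - xi) *. x + (d - c)) + (k * 1 / 2) * cos ((eta + xi) *. x + (d + c))" for x
    using cos_times_cos'[of k eta x d 1 xi c] by (simp add: f_def C_def)
   moreover have "has_mean (%x. (k * 1 / 2) * cos ((eta - xi) *. x + (d - c)) + (k * 1 / 2) * cos ((eta + xi) *. x + (d + c))) ((k * 1 / 2) * 0 + (k * 1 / 2) * 0)"
    by (intro mean_add mean_cmult mean_cos ne bcont_cmult bcont_cos)
   ultimately have "has_mean (%x. f x * C x) 0" by simp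
   hence "m = 0" using mean_unique m by blast
   thus ?thesis by simp
  qed
  thus ?case using m m' unfolding f_def by auto
 next
  case (add f g)
  then obtain m n where m: "has_mean (%x. f x * C x) m" "has_mean (%x. yuk 1 f x * C x) (m / q)"
   "has_mean (%x. g x * C x) n" "has_mean (%x. yuk 1 g x * C x) (n / q)" by blast
  have b: "bcont f" "bcont g" using add trig_bcont by auto
  have "has_mean (%x. (f x + g x) * C x) (m + n)"
   unfolding distrib_right by (intro mean_add m bcont_mult b Cb)
  moreover have "has_mean (%x. yuk 1 (%x. f x + g x) x * C x) ((m + n) / q)"
   unfolding yuk_add[OF b] distrib_right add_divide_distrib by (intro mean_add m bcont_mult b Cb yuk_bcont)
  ultimately show ?case by blast
 qed
 have Ub: "bcont U" using U by (simp add: AP_def)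
 obtain m where m: "has_mean (%x. U x * C x) m" using AP_mean[OF AP_mult[OF U AP_trig[OF Ct]]] by blast
 obtain n where n: "has_mean (%x. yuk 1 U x * C x) n" using AP_mean[OF AP_mult[OF AP_yuk[OF U] AP_trig[OF Ct]]] by blast
 have "abs (n - m / q) <= e" if e: "e > 0" for e
 proof -
  obtain g where g: "trig G g" "!!x. abs (U x - g x) <= e/2" using U half_gt_zero[OF e] unfolding AP_def by blast
  have gb: "bcont g" by (rule trig_bcont[OF g(1)])
  obtain m' where m': "has_mean (%x. g x * C x) m'" "has_mean (%x. yuk 1 g x * C x) (m' / q)" using tr[OF g(1)] by blast
  have small: "abs (h x * C x) <= e/2" if "!!x. abs (h x) <= e/2" for h x
   using mult_mono[OF that[of x] C1[of x]] e by (simp add: abs_mult)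
  have "abs (m - m') <= e/2"
  proof (rule mean_bound)
   show "has_mean (%x. U x * C x - g x * C x) (m - m')" by (intro mean_diff m m' bcont_mult Ub gb Cb)
   show "bcont (%x. U x * C x - g x * C x)" by (intro bcont_diff bcont_mult Ub gb Cb)
   show "abs (U x * C x - g x * C x) <= e/2" for x using small[OF g(2)] by (simp add: left_diff_distrib)
  qed
  hence "abs (m - m') / q <= (e/2) / 1" using q e by (intro frac_le) auto
  moreover have "abs (m - m') / q = abs (m / q - m' / q)" using q by (simp add: diff_divide_distrib[symmetric])
  moreover have "abs (n - m' / q) <= e/2"
  proof (rule mean_bound)
   show "has_mean (%x. yuk 1 U x * C x - yuk 1 g x * C x) (n - m' / q)" by (intro mean_diff n m' bcont_mult yuk_bcont Ub gb Cb)
   show "bcont (%x. yuk 1 U x * C x - yuk 1 g x * C x)" by (intro bcont_diff bcont_mult yuk_bcont Ub gb Cb)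
   have "abs (yuk 1 U x - yuk 1 g x) <= e/2" for x
    unfolding yuk_diff[OF Ub gb, symmetric] by (rule yuk_bound[OF bcont_diff[OF Ub gb] g(2)])
   from small[OF this] show "abs (yuk 1 U x * C x - yuk 1 g x * C x) <= e/2" for x by (simp add: left_diff_distrib)
  qed
  ultimately show ?thesis by linarith
 qed
 hence "abs (n - m / q) <= 0" by (meson dense_ge)
 hence "n = m / q" by simp
 thus ?thesis using m n unfolding C_def q_def by blast
qed

text \<open>The orthogonality of cosines, with respect to the mean.\<close>

lemma mean_cos_cos:
 assumes "xi ~= 0"
 shows "has_mean (%x. cos (xi *. x + d) * cos (eta *. x + c))
  ((if eta = xi then cos (c - d) / 2 else 0) + (if eta = - xi then cos (c + d) / 2 else 0))"
proof -
 have e: "cos (xi *. x + d) * cos (eta *. x + c) = (1/2) * cos ((eta - xi) *. x + (c - d)) + (1/2) * cos ((eta + xi) *. x + (c + d))" for x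
  using cos_times_cos'[of 1 eta x c 1 xi d] by (simp add: mult.commute)
 have *: "has_mean (%x. (1/2) * cos (zet *. x + b)) (if zet = 0 then cos b / 2 else 0)" for zet b
 proof (cases "zet = 0")
  case True
  thus ?thesis using has_mean_const[of "(1/2) * cos b"] by simp
 next
  case False
  thus ?thesis using mean_cmult[OF mean_cos[OF False, of b], of "1/2"] by simp
 qed
 have "has_mean (%x. cos (xi *. x + d) * cos (eta *. x + c)) ((if eta - xi = 0 then cos (c - d) / 2 else 0) + (if eta + xi = 0 then cos (c + d) / 2 else 0))"
  unfolding e by (intro mean_add * bcont_cmult bcont_cos)
 thus ?thesis by (simp add: add_eq_0_iff2)
qed

text \<open>The coefficients m vanish off the sphere. Subtracting the finite sum P leaves an almost periodic R with
  all coefficients zero; approximating R by trigonometric polynomials, the mean of R^2 is zero, so R is.\<close>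

lemma fourier_expansion:
 assumes U: "AP G U" "!!x. U x = (1 + lam) * yuk 1 U x" and lam: "lam > 0"
  and S: "finite S" "S = {xi:G. xi *. xi = lam}"
  and faithful: "!!f. AP G f ==> has_mean (%x. f x * f x) 0 ==> (!!x. f x = 0)"
 shows "EX a b. ALL x. U x = (SUM xi:S. a xi * cos (xi *. x) + b xi * sin (xi *. x))"
proof -
 have Ub: "bcont U" using U(1) by (simp add: AP_def)
 have "EX m. ALL xi:G. has_mean (%x. U x * cos (xi *. x + c)) (m xi)" for c
  using resolvent_coeff[OF U(1)] by (intro bchoice ballI) blast
 then obtain m where m: "!!c xi. xi : G ==> has_mean (%x. U x * cos (xi *. x + c)) (m c xi)" by metis
 have m0: "m c xi = 0" if xi: "xi : G" "xi *. xi ~= lam" for c xi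
 proof -
  obtain n where n: "has_mean (%x. U x * cos (xi *. x + c)) n" "has_mean (%x. yuk 1 U x * cos (xi *. x + c)) (n / (1 + xi *. xi))"
   using resolvent_coeff[OF U(1) xi(1)] by blast
  have "has_mean (%x. (1 + lam) * (yuk 1 U x * cos (xi *. x + c))) ((1 + lam) * (n / (1 + xi *. xi)))" by (rule mean_cmult[OF n(2)])
  moreover have "(1 + lam) * (yuk 1 U x * cos (xi *. x + c)) = U x * cos (xi *. x + c)" for x using U(2)[of x] by simp
  ultimately have "(1 + lam) * (n / (1 + xi *. xi)) = n" using mean_unique n(1) by simp
  moreover have "1 + xi *. xi > 0" by (simp add: add_pos_nonneg)
  ultimately have "(1 + lam) * n = n * (1 + xi *. xi)" by (simp add: field_simps)
  hence "n * (lam - xi *. xi) = 0" by (simp add: algebra_simps)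
  hence "n = 0" using xi(2) by simp
  thus ?thesis using mean_unique[OF m[OF xi(1)] n(1)] by simp
 qed
 have SG: "xi : G" "xi ~= 0" "- xi : S" if "xi : S" for xi using that S(2) lam Gneg by auto
 define P where "P x = (SUM xi:S. m 0 xi * cos (xi *. x + 0) + m (- pi/2) xi * cos (xi *. x + - pi/2))" for x
 have Pt: "trig G P" unfolding P_def[abs_def] by (intro trig_sum S(1) trig.intros SG)
 define R where "R x = U x - P x" for x
 have RAP: "AP G R"
  using AP_add[OF U(1) AP_trig[OF trig_cmult[OF Pt, of "-1"]]] by (simp add: R_def[abs_def])
 have Rb: "bcont R" using RAP by (simp add: AP_def)
 have Rcos: "has_mean (%x. R x * cos (eta *. x + c)) 0" if eta: "eta : G" for eta c
 proof -
  define K where "K d xi = (if eta = xi then cos (c - d) / 2 else 0) + (if eta = - xi then cos (c + d) / 2 else 0)" for d xi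
  have PC: "has_mean (%x. P x * cos (eta *. x + c)) (SUM xi:S. m 0 xi * K 0 xi + m (- pi/2) xi * K (- pi/2) xi)"
  proof -
   have "has_mean (%x. SUM xi:S. m 0 xi * (cos (xi *. x + 0) * cos (eta *. x + c)) + m (- pi/2) xi * (cos (xi *. x + - pi/2) * cos (eta *. x + c)))
     (SUM xi:S. m 0 xi * K 0 xi + m (- pi/2) xi * K (- pi/2) xi)"
    unfolding K_def
    by (intro mean_sum[THEN conjunct2] S(1) mean_add mean_cmult mean_cos_cos SG bcont_add bcont_cmult bcont_mult bcont_cos)
   thus ?thesis by (simp only: P_def sum_distrib_right distrib_right mult.assoc)
  qed
  have "(SUM xi:S. m 0 xi * K 0 xi + m (- pi/2) xi * K (- pi/2) xi) = m c eta"
  proof (cases "eta : S")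
   case False
   hence "eta ~= xi" "eta ~= - xi" if "xi : S" for xi using SG that by auto
   hence "(SUM xi:S. m 0 xi * K 0 xi + m (- pi/2) xi * K (- pi/2) xi) = 0" by (intro sum.neutral) (simp add: K_def)
   thus ?thesis using m0[OF eta] False eta S(2) by simp
  next
   case True
   have ne: "eta ~= - eta" using SG(2)[OF True] by (metis add.right_inverse scaleR_2 scaleR_eq_0_iff zero_neq_numeral)
   have mneg: "m d (- eta) = m (- d) eta" for d
   proof -
    have a: "has_mean (%x. U x * cos (- eta *. x + d)) (m d (- eta))" by (rule m[OF Gneg[OF eta]])
    have "cos (- eta *. x + d) = cos (eta *. x + - d)" for x using cos_minus[of "eta *. x - d"] by simp
    hence fe: "(%x. U x * cos (- eta *. x + d)) = (%x. U x * cos (eta *. x + - d))" by (simp only:)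
    have "has_mean (%x. U x * cos (- eta *. x + d)) (m (- d) eta)" unfolding fe by (rule m[OF eta])
    from mean_unique[OF a this] show ?thesis .
   qed
   have "(SUM xi:S. m 0 xi * K 0 xi + m (- pi/2) xi * K (- pi/2) xi) = (SUM xi:{eta, - eta}. m 0 xi * K 0 xi + m (- pi/2) xi * K (- pi/2) xi)"
    using S(1) True SG(3)[OF True] by (intro sum.mono_neutral_right) (auto simp: K_def)
   also have "... = cos c * m 0 eta + (cos (c + pi/2) * m (- pi/2) eta + cos (c - pi/2) * m (pi/2) eta) / 2"
    using ne mneg[of 0] mneg[of "- pi/2"] by (auto simp: K_def field_simps)
   also have "... = m c eta"
   proof (rule mean_unique[OF _ m[OF eta]])
    have "U x * cos (eta *. x + c) = cos c * (U x * cos (eta *. x + 0)) + ((1/2) * (cos (c + pi/2) * (U x * cos (eta *. x + - pi/2))) + (1/2) * (cos (c - pi/2) * (U x * cos (eta *. x + pi/2))))" for x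
     by (simp add: cos_add cos_diff algebra_simps)
    moreover have "has_mean (%x. cos c * (U x * cos (eta *. x + 0)) + ((1/2) * (cos (c + pi/2) * (U x * cos (eta *. x + - pi/2))) + (1/2) * (cos (c - pi/2) * (U x * cos (eta *. x + pi/2)))))
      (cos c * m 0 eta + ((1/2) * (cos (c + pi/2) * m (- pi/2) eta) + (1/2) * (cos (c - pi/2) * m (pi/2) eta)))"
     by (intro mean_add mean_cmult m eta bcont_add bcont_cmult bcont_mult Ub bcont_cos)
    ultimately show "has_mean (%x. U x * cos (eta *. x + c)) (cos c * m 0 eta + (cos (c + pi/2) * m (- pi/2) eta + cos (c - pi/2) * m (pi/2) eta) / 2)"
     by (simp add: add_divide_distrib)
   qed
   finally show ?thesis .
  qed
  with PC have PC': "has_mean (%x. P x * cos (eta *. x + c)) (m c eta)" by simp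
  have "has_mean (%x. U x * cos (eta *. x + c) - P x * cos (eta *. x + c)) (m c eta - m c eta)"
   by (intro mean_diff m eta PC' bcont_mult Ub trig_bcont[OF Pt] bcont_cos)
  thus ?thesis by (simp add: R_def left_diff_distrib)
 qed
 have Rt: "trig G g ==> has_mean (%x. R x * g x) 0" for g
 proof (induction rule: trig.induct)
  case (cos xi k c)
  show ?case using mean_cmult[OF Rcos[OF cos, of c], of k] by (simp add: mult.left_commute)
 next
  case (add f g)
  have "has_mean (%x. R x * f x + R x * g x) (0 + 0)" using add trig_bcont by (intro mean_add bcont_mult Rb) auto
  thus ?case by (simp add: distrib_left)
 qed
 obtain M where M: "has_mean (%x. R x * R x) M" using AP_mean[OF AP_mult[OF RAP RAP]] by blast
 obtain B where B: "B >= 0" "!!x. abs (R x) <= B" by (rule bcont_bound[OF Rb]) (rule that)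
 have "abs M <= e" if e: "e > 0" for e
 proof -
  define d where "d = e / (B + 1)"
  have d: "d > 0" "B * d <= e" using e B by (auto simp: d_def field_simps)
  obtain g where g: "trig G g" "!!x. abs (R x - g x) <= d" using RAP d(1) unfolding AP_def by blast
  have "abs (M - 0) <= e"
  proof (rule mean_bound)
   show "has_mean (%x. R x * R x - R x * g x) (M - 0)" by (intro mean_diff M Rt g bcont_mult Rb trig_bcont[OF g(1)])
   show "bcont (%x. R x * R x - R x * g x)" by (intro bcont_diff bcont_mult Rb trig_bcont[OF g(1)])
   fix x
   have "abs (R x) * abs (R x - g x) <= B * d" using B g(2) by (intro mult_mono) auto
   thus "abs (R x * R x - R x * g x) <= e" using d(2) by (simp add: abs_mult right_diff_distrib[symmetric])
  qed
  thus ?thesis by simp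
 qed
 hence "abs M <= 0" by (meson dense_ge)
 hence "has_mean (%x. R x * R x) 0" using M by simp
 from faithful[OF RAP this] have "U x = P x" for x by (simp add: R_def)
 hence "ALL x. U x = (SUM xi:S. m 0 xi * cos (xi *. x) + m (- pi/2) xi * sin (xi *. x))"
  by (simp add: P_def cos_diff)
 thus ?thesis by blast
qed

end

section \<open>Periodic functions\<close>

text \<open>The periods are the images under A of the integer vectors; N is the inverse of A.\<close>

locale lattice =
 fixes A N :: "'a::euclidean_space => 'a"
 assumes lin: "linear A" "linear N" and inv: "!!x. N (A x) = x" "!!x. A (N x) = x"
begin

definition integral_vec :: "'a => bool" where "integral_vec z \<longleftrightarrow> (ALL i:Basis. z *. i : \<int>)"

text \<open>The dual lattice, scaled so that the exponentials are periodic.\<close>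

definition freqs where "freqs = (%eta. (2 * pi) *R adjoint N eta) ` Collect integral_vec"
definition periodic :: "('a => real) => bool" where "periodic U \<longleftrightarrow> (ALL i:Basis. ALL x. U (x + A i) = U x)"

lemma freq_inner: "((2 * pi) *R adjoint N eta) *. x = 2 * pi * (eta *. N x)"
 using adjoint_works[OF lin(2), of x eta] by (simp add: inner_commute)

lemma linear_adjoint: "linear (adjoint N)" by (rule adjoint_linear[OF lin(2)])

sublocale freq_group freqs
proof
 have z: "integral_vec 0" "integral_vec x ==> integral_vec y ==> integral_vec (x + y)" "integral_vec x ==> integral_vec (- x)" for x y
  by (auto simp: integral_vec_def inner_add_left)
 show "0 : freqs" unfolding freqs_def
  by (intro image_eqI[of _ _ 0]) (auto simp: linear_0[OF linear_adjoint] z)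
 show "x + y : freqs" if xy: "x : freqs" "y : freqs" for x y
 proof -
  from xy obtain a b where "integral_vec a" "integral_vec b" "x = (2 * pi) *R adjoint N a" "y = (2 * pi) *R adjoint N b"
   unfolding freqs_def by blast
  thus ?thesis unfolding freqs_def
   by (intro image_eqI[of _ _ "a + b"]) (auto simp: linear_add[OF linear_adjoint] z scaleR_add_right)
 qed
 show "- x : freqs" if x: "x : freqs" for x
 proof -
  from x obtain a where "integral_vec a" "x = (2 * pi) *R adjoint N a" unfolding freqs_def by blast
  thus ?thesis unfolding freqs_def
   by (intro image_eqI[of _ _ "- a"]) (auto simp: linear_neg[OF linear_adjoint] z)
 qed
qed

text \<open>Frequencies correspond to integer vectors, which are uniformly discrete, and the sphere is bounded.\<close>

lemma shell_finite: "finite {xi:freqs. xi *. xi = lam}"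
proof -
 define Z where "Z = {eta. integral_vec eta & ((2 * pi) *R adjoint N eta) *. ((2 * pi) *R adjoint N eta) = lam}"
 have eta: "eta *. i = (1 / (2 * pi)) * (((2 * pi) *R adjoint N eta) *. A i)" for eta i
  unfolding freq_inner by (simp add: inv)
 have "uniform_discrete Z" unfolding uniform_discrete_def
 proof (intro exI[of _ 1] conjI ballI impI)
  fix x y assume xy: "x : Z" "y : Z" "dist x y < 1"
  show "x = y"
  proof (rule euclidean_eqI)
   fix i :: 'a assume i: "i : Basis"
   have "abs ((x - y) *. i) < 1" using Basis_le_norm[OF i, of "x - y"] xy(3) by (simp add: dist_norm)
   moreover have "(x - y) *. i : \<int>" using xy i by (auto simp: Z_def integral_vec_def inner_diff_left)
   ultimately have "(x - y) *. i = 0" using Ints_nonzero_abs_less1 by blast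
   thus "x *. i = y *. i" by (simp add: inner_diff_left)
  qed
 qed simp
 moreover have "bounded Z"
 proof (rule boundedI)
  fix eta assume "eta : Z"
  hence n: "norm ((2 * pi) *R adjoint N eta) = sqrt lam" unfolding Z_def norm_eq_sqrt_inner by simp
  have "norm eta <= (SUM i:Basis. abs (eta *. i))" by (rule norm_le_l1)
  also have "... <= (SUM i:Basis. (1 / (2 * pi)) * (sqrt lam * norm (A i)))"
  proof (rule sum_mono)
   fix i :: 'a
   have "abs (((2 * pi) *R adjoint N eta) *. A i) <= sqrt lam * norm (A i)"
    using Cauchy_Schwarz_ineq2[of "(2 * pi) *R adjoint N eta" "A i"] unfolding n .
   thus "abs (eta *. i) <= (1 / (2 * pi)) * (sqrt lam * norm (A i))"
    unfolding eta[of eta i] abs_mult by (intro mult_mono) auto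
  qed
  finally show "norm eta <= (SUM i:Basis. (1 / (2 * pi)) * (sqrt lam * norm (A i)))" .
 qed
 ultimately have "finite Z" using uniform_discrete_finite_iff by blast
 moreover have "{xi:freqs. xi *. xi = lam} <= (%eta. (2 * pi) *R adjoint N eta) ` Z" unfolding freqs_def Z_def by blast
 ultimately show ?thesis by (meson finite_imageI finite_subset)
qed

lemma periodic_integral:
 assumes U: "periodic U" and z: "integral_vec (N z)"
 shows "U (x + z) = U x"
proof -
 have nat: "U (x + real n *R A i) = U x" if "i : Basis" for n i x
 proof (induction n)
  case (Suc n)
  have "U (x + real (Suc n) *R A i) = U ((x + real n *R A i) + A i)" by (simp add: scaleR_add_left algebra_simps)
  thus ?case using U that Suc by (simp add: periodic_def)
 qed simp
 have int: "U (x + of_int n *R A i) = U x" if "i : Basis" for n i x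
 proof (cases "n >= 0")
  case True
  thus ?thesis using nat[OF that, of x "nat n"] by simp
 next
  case False
  thus ?thesis using nat[OF that, of "x + of_int n *R A i" "nat (- n)"] by simp
 qed
 have "U (x + (SUM i:S. (N z *. i) *R A i)) = U x" if "finite S" "S <= Basis" for S
  using that
 proof (induction S rule: finite_induct)
  case (insert i S)
  hence i: "i : Basis" by simp
  obtain n where n: "N z *. i = of_int n" using z i unfolding integral_vec_def by (metis Ints_cases)
  have "U (x + (SUM i:insert i S. (N z *. i) *R A i)) = U ((x + (SUM i:S. (N z *. i) *R A i)) + of_int n *R A i)"
   using insert.hyps by (simp add: n algebra_simps)
  thus ?case using int[OF i] insert by simp
 qed simp
 moreover have "(SUM i:Basis. (N z *. i) *R A i) = z"
 proof -
  have "(SUM i:Basis. (N z *. i) *R A i) = A (SUM i:Basis. (N z *. i) *R i)"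
   by (simp add: linear_sum[OF lin(1)] linear_cmul[OF lin(1)])
  thus ?thesis by (simp add: euclidean_representation inv)
 qed
 ultimately show ?thesis using finite_Basis by (metis order_refl)
qed

definition cell where "cell = A ` cbox 0 One"

lemma cont_lin: "continuous_on S A" "continuous_on S N"
 using lin linear_continuous_on linear_conv_bounded_linear by blast+

lemma compact_cell: "compact cell"
 unfolding cell_def by (intro compact_continuous_image cont_lin compact_cbox)

lemma cell_cover: "EX s:cell. integral_vec (N (x - s))"
proof -
 define t where "t = (SUM i:Basis. frac (N x *. i) *R (i::'a))"
 have ti: "t *. i = frac (N x *. i)" if "i : Basis" for i using that by (simp add: t_def)
 have "t : cbox 0 One" using ti by (auto simp: mem_box frac_lt_1[THEN less_imp_le])
 moreover have "integral_vec (N (x - A t))"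
  unfolding integral_vec_def using ti by (auto simp: linear_diff[OF lin(2)] inv inner_diff_left frac_def)
 ultimately show ?thesis unfolding cell_def by blast
qed

lemma trig_periodic: "trig freqs f ==> periodic f"
proof (induction rule: trig.induct)
 case (cos xi k c)
 then obtain eta where e: "integral_vec eta" "xi = (2 * pi) *R adjoint N eta" unfolding freqs_def by blast
 show ?case unfolding periodic_def
 proof (intro ballI allI)
  fix i x :: 'a assume i: "i : Basis"
  obtain n where n: "eta *. i = of_int n" using e(1) i unfolding integral_vec_def by (metis Ints_cases)
  have "xi *. (x + A i) + c = (xi *. x + c) + 2 * pi * of_int n" unfolding e(2) freq_inner
   by (simp add: linear_add[OF lin(2)] inv inner_add_right n algebra_simps)
  thus "k * cos (xi *. (x + A i) + c) = k * cos (xi *. x + c)" using sin_cos_eq_iff by metis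
 qed
qed (simp add: periodic_def)

lemma AP_imp_periodic:
 assumes "AP freqs f"
 shows "periodic f"
 unfolding periodic_def
proof (intro ballI allI)
 fix i x :: 'a assume i: "i : Basis"
 have "abs (f (x + A i) - f x) <= e" if "e > 0" for e
 proof -
  from that have "e/2 > 0" by simp
  then obtain g where g: "trig freqs g" "!!x. abs (f x - g x) <= e/2" using assms unfolding AP_def by blast
  have "g (x + A i) = g x" using trig_periodic[OF g(1)] i by (simp add: periodic_def)
  thus ?thesis using g(2)[of x] g(2)[of "x + A i"] by linarith
 qed
 hence "abs (f (x + A i) - f x) <= 0" by (meson dense_ge)
 thus "f (x + A i) = f x" by simp
qed

text \<open>Finitely many translates of the set where a nonzero square is large cover everything.\<close>

lemma mean_faithful:
 assumes f: "AP freqs f" and m: "has_mean (%x. f x * f x) 0"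
 shows "f x0 = 0"
proof (rule ccontr)
 assume ne: "f x0 ~= 0"
 have fb: "bcont f" and fc: "cont f" using f bcontD by (auto simp: AP_def)
 define q where "q x = f x * f x" for x
 define dl where "dl = q x0 / 2"
 have d: "dl > 0" "dl < q x0"
 proof -
  have "q x0 > 0" unfolding q_def using ne not_real_square_gt_zero by blast
  thus "dl > 0" "dl < q x0" by (auto simp: dl_def)
 qed
 have q: "bcont q" unfolding q_def by (rule bcont_mult[OF fb fb])
 have q0: "q x >= 0" for x by (simp add: q_def)
 have "open {x. dl < q x}" by (intro open_Collect_less continuous_intros bcontD(1)[OF q])
 then obtain r where r: "r > 0" "ball x0 r <= {x. dl < q x}" using d(2) unfolding open_contains_ball by blast
 have "cell <= (UN z:cell. ball z r)" using r(1) by auto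
 then obtain Z where Z: "Z <= cell" "finite Z" "cell <= (UN z:Z. ball z r)"
  by (rule compactE_image[OF compact_cell, rotated]) (auto intro: that)
 have ge: "(SUM z:Z. q (x + (x0 - z))) >= dl" for x
 proof -
  obtain s where s: "s : cell" "integral_vec (N (x - s))" using cell_cover by blast
  obtain z where z: "z : Z" "s : ball z r" using Z(3) s(1) by blast
  have "f (s + (x0 - z) + (x - s)) = f (s + (x0 - z))" by (rule periodic_integral[OF AP_imp_periodic[OF f] s(2)])
  moreover have "s + (x0 - z) + (x - s) = x + (x0 - z)" by simp
  ultimately have "q (x + (x0 - z)) = q (s + (x0 - z))" by (simp add: q_def)
  moreover have "s + (x0 - z) : ball x0 r" using z(2) by (simp add: dist_norm norm_minus_commute)
  ultimately have "dl <= q (x + (x0 - z))" using r(2) by (auto intro: less_imp_le)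
  also have "... <= (SUM z:Z. q (x + (x0 - z)))" by (rule member_le_sum[OF z(1)]) (use q0 Z(2) in auto)
  finally show ?thesis .
 qed
 have "bcont (%x. SUM z:Z. q (x + (x0 - z))) & has_mean (%x. SUM z:Z. q (x + (x0 - z))) (SUM z:Z. 0)"
 proof (rule mean_sum[OF Z(2)])
  show "bcont (%x. q (x + (x0 - z)))" for z by (rule bcont_compose[OF q]) (intro continuous_intros)
  show "has_mean (%x. q (x + (x0 - z))) 0" for z by (rule mean_translate) (use m in "simp add: q_def[abs_def]")
 qed
 hence b: "bcont (%x. SUM z:Z. q (x + (x0 - z)))" and h: "has_mean (%x. SUM z:Z. q (x + (x0 - z))) 0" by auto
 have "dl <= 0" by (rule mean_le[OF bcont_const b has_mean_const h ge])
 thus False using d(1) by simp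
qed

definition torus :: "'a => 'a \<times> 'a" where
 "torus x = ((SUM i:Basis. cos (2 * pi * (i *. N x)) *R i), (SUM i:Basis. sin (2 * pi * (i *. N x)) *R i))"

lemma torus_eq:
 assumes "torus x = torus y"
 shows "integral_vec (N (x - y))"
 unfolding integral_vec_def
proof
 fix i :: 'a assume i: "i : Basis"
 have "fst (torus x) *. i = cos (2 * pi * (i *. N x))" "snd (torus x) *. i = sin (2 * pi * (i *. N x))" for x
  using i by (simp_all add: torus_def)
 hence "cos (2 * pi * (i *. N x)) = cos (2 * pi * (i *. N y))" "sin (2 * pi * (i *. N x)) = sin (2 * pi * (i *. N y))"
  using assms by metis+
 then obtain n :: int where "2 * pi * (i *. N x) = 2 * pi * (i *. N y) + 2 * pi * of_int n"
  using sin_cos_eq_iff[of "2 * pi * (i *. N x)" "2 * pi * (i *. N y)"] by auto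
 hence "2 * pi * (i *. N x - i *. N y) = 2 * pi * of_int n" by (simp add: algebra_simps)
 hence "i *. N x - i *. N y = of_int n" by simp
 thus "N (x - y) *. i : \<int>" by (simp add: linear_diff[OF lin(2)] inner_diff_right inner_commute[of _ i])
qed

lemma continuous_torus: "continuous_on S torus"
 unfolding torus_def by (intro continuous_intros cont_lin)

lemma Basis_freq: "i : Basis ==> (2 * pi) *R adjoint N i : freqs"
 unfolding freqs_def integral_vec_def by (intro imageI) (auto simp: inner_Basis)

lemma trig_polynomial:
 assumes "real_polynomial_function g"
 shows "trig freqs (%x. g (torus x))"
 using assms
proof (induction rule: real_polynomial_function.induct)
 case (linear h)
 interpret bounded_linear h by fact
 have c: "trig freqs (%x. cos (2 * pi * (i *. N x)))" "trig freqs (%x. sin (2 * pi * (i *. N x)))" if "i : Basis" for i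
  using trig.cos[OF Basis_freq[OF that], of 1 0] trig.cos[OF Basis_freq[OF that], of 1 "- pi/2"] unfolding freq_inner
  by (auto simp: cos_diff)
 have "h (torus x) = (SUM i:Basis. h (i, 0) * cos (2 * pi * (i *. N x))) + (SUM i:Basis. h (0, i) * sin (2 * pi * (i *. N x)))" for x
 proof -
  have "torus x = (SUM i:Basis. cos (2 * pi * (i *. N x)) *R (i, 0)) + (SUM i:Basis. sin (2 * pi * (i *. N x)) *R (0, i))"
   by (simp add: torus_def prod_eq_iff fst_sum snd_sum)
  thus ?thesis by (simp only: add sum scaleR real_scaleR_def mult.commute)
 qed
 thus ?case using c by (simp, intro trig.add trig_sum trig_cmult) auto
next
 case (const c)
 show ?case by (rule trig_const)
next
 case (add f g)
 thus ?case by (intro trig.add)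
next
 case (mult f g)
 thus ?case by (intro trig_mult)
qed

text \<open>A periodic function factors through the torus, embedded by the cosines and sines of the coordinates;
  Stone-Weierstrass on the compact image approximates it by polynomials in them.\<close>

lemma periodic_AP:
 assumes U: "bcont U" "periodic U"
 shows "AP freqs U"
 unfolding AP_def
proof (intro conjI U(1) allI impI)
 fix e :: real assume e: "e > 0"
 define K where "K = torus ` cell"
 have K: "compact K" unfolding K_def by (intro compact_continuous_image continuous_torus compact_cell)
 have tK: "torus x : K" for x
 proof -
  obtain s where s: "s : cell" "integral_vec (N (x - s))" using cell_cover by blast
  have "torus s = torus x"
  proof -
   have "EX n::int. 2 * pi * (i *. N x) = 2 * pi * (i *. N s) + 2 * pi * of_int n" if i: "i : Basis" for i
   proof -
    obtain n where "N (x - s) *. i = of_int n" using s(2) i unfolding integral_vec_def by (metis Ints_cases)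
    hence "i *. N x = i *. N s + of_int n" by (simp add: linear_diff[OF lin(2)] inner_diff_right inner_commute[of _ i] algebra_simps)
    thus ?thesis by (intro exI[of _ n]) (simp add: algebra_simps)
   qed
   hence "sin (2 * pi * (i *. N x)) = sin (2 * pi * (i *. N s)) & cos (2 * pi * (i *. N x)) = cos (2 * pi * (i *. N s))" if "i : Basis" for i
    using that unfolding sin_cos_eq_iff by blast
   thus ?thesis unfolding torus_def by simp
  qed
  thus ?thesis unfolding K_def using s(1) by (metis imageI)
 qed
 define F where "F k = U (SOME x. torus x = k)" for k
 have F: "F (torus x) = U x" for x
 proof -
  define y where "y = (SOME y. torus y = torus x)"
  have "torus y = torus x" unfolding y_def by (rule someI[of _ x]) simp
  from periodic_integral[OF U(2) torus_eq[OF this], of x] show ?thesis by (simp add: F_def y_def)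
 qed
 have Fc: "continuous_on K F"
  unfolding continuous_on_closed_vimage[OF compact_imp_closed[OF K]]
 proof (intro allI impI)
  fix T :: "real set" assume T: "closed T"
  have "closed (U -` T)" using T bcontD(1)[OF U(1)] by (simp add: closed_vimage)
  hence "compact (torus ` (cell \<inter> U -` T))"
   by (intro compact_continuous_image continuous_torus compact_Int_closed compact_cell)
  moreover have "F -` T \<inter> K = torus ` (cell \<inter> U -` T)" unfolding K_def using F by auto
  ultimately show "closed (F -` T \<inter> K)" by (simp add: compact_imp_closed)
 qed
 obtain g where g: "real_polynomial_function g" "!!x. x : K ==> abs (F x - g x) < e"
  using Stone_Weierstrass_real_polynomial_function[OF K Fc e] by metis
 have "abs (U x - g (torus x)) <= e" for x using g(2)[OF tK[of x]] by (simp add: F)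
 thus "EX g. trig freqs g & (ALL x. abs (U x - g x) <= e)" using trig_polynomial[OF g(1)] by blast
qed

end

lemma lattice_exists:
 fixes B :: "'a::euclidean_space set"
 assumes B: "independent B" "span B = UNIV"
 obtains A N where "lattice A N" "A ` Basis = B"
proof -
 have "card B = DIM('a)" using B dim_eq_card_independent[OF B(1)] dim_span[of B] by simp
 moreover have "finite B" by (rule independent_imp_finite[OF B(1)])
 ultimately obtain bet where bet: "bij_betw bet (Basis :: 'a set) B" using finite_same_card_bij[of "Basis :: 'a set" B] by auto
 obtain A :: "'a => 'a" where A: "linear A" "!!i. i : Basis ==> A i = bet i"
  using linear_independent_extend[OF independent_Basis, of bet] by blast
 have AB: "A ` Basis = B" using A(2) bet by (auto simp: bij_betw_def)
 hence "range A = UNIV" using linear_span_image[OF A(1), of Basis] B(2) by simp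
 hence s: "surj A" .
 hence i: "inj A" using linear_surjective_imp_injective[OF A(1)] by blast
 obtain N where N: "linear N" "N \<circ> A = id" using linear_injective_left_inverse[OF A(1) i] by blast
 have NA: "N (A x) = x" for x using N(2) by (simp add: pointfree_idE)
 hence "A (N x) = x" for x using s by (metis surjD)
 thus thesis using A(1) N(1) NA AB by (intro that[of A N] lattice.intro)
qed

lemma periodic_AP_ex:
 assumes B: "independent B" "span B = UNIV" and per: "!!b x. b : B ==> U (x + b) = U x" and U: "bcont U"
 shows "EX G. AP G U"
proof -
 obtain A N where L: "lattice A N" "A ` Basis = B" by (rule lattice_exists[OF B]) (rule that)
 interpret lattice A N by (rule L(1))
 have "periodic U" unfolding periodic_def using L(2) per by blast
 thus ?thesis using periodic_AP[OF U] by blast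
qed

theorem periodic_resolvent_trig:
 fixes U :: "'a::euclidean_space => real"
 assumes B: "independent B" "span B = UNIV" and per: "!!b x. b : B ==> U (x + b) = U x"
  and U: "bcont U" "!!x. U x = (1 + lam) * yuk 1 U x" and lam: "lam > 0"
 shows "EX S a b. finite S & (ALL xi:S. xi *. xi = lam) & (ALL x. U x = (SUM xi:S. a xi * cos (xi *. x) + b xi * sin (xi *. x)))"
proof -
 obtain A N where L: "lattice A N" "A ` Basis = B" by (rule lattice_exists[OF B]) (rule that)
 interpret lattice A N by (rule L(1))
 have pU: "periodic U" unfolding periodic_def using L(2) per by blast
 have "EX a b. ALL x. U x = (SUM xi:{xi:freqs. xi *. xi = lam}. a xi * cos (xi *. x) + b xi * sin (xi *. x))"
 proof (rule fourier_expansion[where lam=lam])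
  show "AP freqs U" by (rule periodic_AP[OF U(1) pU])
  show "U x = (1 + lam) * yuk 1 U x" for x by (rule U(2))
 qed (use lam shell_finite mean_faithful in "simp_all")
 thus ?thesis using shell_finite[of lam] by (intro exI[of _ "{xi:freqs. xi *. xi = lam}"]) auto
qed

section \<open>Eigenfunctions of polytopes\<close>

lemma Basis_axis: "(Basis :: (real^'n) set) = range (%i. axis i 1)"
 by (auto simp: Basis_vec_def)

lemma sum_Basis_axis: "(SUM i:(Basis :: (real^'n) set). f i) = (SUM i:UNIV. f (axis i 1))"
 unfolding Basis_axis by (subst sum.reindex) (auto simp: inj_on_def axis_eq_axis)

lemma deriv_local:
 fixes f g :: "'a::real_normed_vector => real"
 assumes "DERIV (%t. f (x + t *R d)) 0 :> D" "open S" "x : S" "!!y. y : S ==> f y = g y"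
 shows "DERIV (%t. g (x + t *R d)) 0 :> D"
proof (rule has_field_derivative_transform_within_open[OF assms(1)])
 show "open ((%t. x + t *R d) -` S)" by (intro open_vimage assms(2) continuous_intros)
qed (use assms in auto)

lemma deriv_part:
 assumes h: "bounded_linear (h :: complex => real)" and u: "(%t::real. u (x + t *R axis i 1)) differentiable (at 0)"
 shows "DERIV (%t. h (u (x + t *R axis i 1))) 0 :> h (partial_deriv i u x)"
 unfolding partial_deriv_def has_real_derivative_iff_has_vector_derivative
 by (rule bounded_linear.has_vector_derivative[OF h]) (use u in "simp add: vector_derivative_works")

lemma eigenfunction_deriv:
 assumes "dirichlet_eigenfunction Om lam u" "bounded_linear (h :: complex => real)" "x : Om"
 shows "DERIV (%t. h (u (x + t *R axis i 1))) 0 :> h (partial_deriv i u x)"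
  and "DERIV (%t. h (partial_deriv i u (x + t *R axis j 1))) 0 :> h (partial_deriv j (partial_deriv i u) x)"
  and "(SUM i:UNIV. h (partial_deriv i (partial_deriv i u) x)) = - lam * h (u x)"
proof -
 interpret bounded_linear h by fact
 show "DERIV (%t. h (u (x + t *R axis i 1))) 0 :> h (partial_deriv i u x)"
  "DERIV (%t. h (partial_deriv i u (x + t *R axis j 1))) 0 :> h (partial_deriv j (partial_deriv i u) x)"
  using assms by (auto simp: dirichlet_eigenfunction_def numeral_2_eq_2 intro!: deriv_part)
 have "(SUM i:UNIV. partial_deriv i (partial_deriv i u) x) = - laplacian u x" by (simp add: laplacian_def)
 also have "... = (- lam) *R u x" using assms by (simp add: dirichlet_eigenfunction_def scaleR_conv_of_real)
 finally have "h (SUM i:UNIV. partial_deriv i (partial_deriv i u) x) = h ((- lam) *R u x)" by simp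
 thus "(SUM i:UNIV. h (partial_deriv i (partial_deriv i u) x)) = - lam * h (u x)"
  by (simp only: sum scale real_scaleR_def)
qed

lemma eigenfunction_part:
 fixes Om :: "(real^'n::finite) set"
 assumes u: "dirichlet_eigenfunction Om lam u" and h: "bounded_linear (h :: complex => real)" and Om: "open Om"
 shows "continuous_on (closure Om) (%x. h (u x))" "x : frontier Om ==> h (u x) = 0"
  and "wsol Om (%x. h (u x)) (%x. lam * h (u x))"
proof -
 interpret bounded_linear h by fact
 show "continuous_on (closure Om) (%x. h (u x))" using u by (auto simp: dirichlet_eigenfunction_def intro: continuous_on)
 show "x : frontier Om ==> h (u x) = 0" using u by (simp add: dirichlet_eigenfunction_def zero)
 have ax: "EX j. i = axis j 1" if "i : (Basis :: (real^'n) set)" for i using that unfolding Basis_axis by auto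
 define ix where "ix i = (THE j. i = axis j (1::real))" for i :: "real^'n"
 have ix: "ix (axis j 1) = j" for j unfolding ix_def by (auto simp: axis_eq_axis)
 have "laplace_on Om (%x. h (u x)) (%x. - lam * h (u x))"
 proof (rule laplace_onI[where g="%i x. h (partial_deriv (ix i) u x)" and h="%i x. h (partial_deriv (ix i) (partial_deriv (ix i) u) x)"])
  show "- lam * h (u x) = (SUM i:Basis. h (partial_deriv (ix i) (partial_deriv (ix i) u) x))" if "x : Om" for x
   unfolding sum_Basis_axis ix by (rule eigenfunction_deriv(3)[OF u h that, symmetric])
 next
  fix i x assume i: "i : (Basis :: (real^'n) set)" and x: "x : Om"
  obtain j where j: "i = axis j 1" using ax[OF i] by blast
  show "DERIV (%t. h (u (x + t *R i))) 0 :> h (partial_deriv (ix i) u x)"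
   "DERIV (%t. h (partial_deriv (ix i) u (x + t *R i))) 0 :> h (partial_deriv (ix i) (partial_deriv (ix i) u) x)"
   unfolding j ix by (rule eigenfunction_deriv[OF u h x])+
 qed (use u in "auto simp: dirichlet_eigenfunction_def numeral_2_eq_2 intro!: continuous_on")
 from laplace_on_imp_wsol[OF this Om] show "wsol Om (%x. h (u x)) (%x. lam * h (u x))" by simp
qed

lemma Lap_extension:
 assumes u: "dirichlet_eigenfunction Om lam u" and h: "bounded_linear (h :: complex => real)" and Om: "open Om"
  and v: "RA v" "!!x. x : Om ==> h (u x) = v x" and x: "x : Om"
 shows "Lap v x = - lam * v x"
proof -
 have 1: "h (partial_deriv i u y) = pd i v y" if y: "y : Om" for i y
  using deriv_local[OF eigenfunction_deriv(1)[OF u h y] Om y v(2)] RA_pd_deriv[OF v(1)] by (rule DERIV_unique)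
 have 2: "h (partial_deriv i (partial_deriv i u) x) = pd i (pd i v) x" for i
  using deriv_local[OF eigenfunction_deriv(2)[OF u h x] Om x 1] RA_pd_deriv[OF RA_pd[OF v(1)]] by (rule DERIV_unique)
 show ?thesis using eigenfunction_deriv(3)[OF u h x] v(2)[OF x] by (simp add: Lap_def 2)
qed

text \<open>For lam at most 0 the maximum principle applies to all real-linear images of u.\<close>

lemma eigenvalue_positive:
 fixes Om :: "(real^'n::finite) set"
 assumes u: "dirichlet_eigenfunction Om lam u" and Om: "open Om" "bounded Om"
 shows "lam > 0"
proof (rule ccontr)
 assume l: "~ lam > 0"
 obtain x where x: "x : Om" "u x ~= 0" using u by (auto simp: dirichlet_eigenfunction_def)
 have le: "h (u x) <= 0" if h: "bounded_linear h" for h :: "complex => real"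
  by (rule wsol_max_principle[OF eigenfunction_part(3)[OF u h Om(1)] Om eigenfunction_part(1)[OF u h Om(1)] _ _ x(1)])
   (use l eigenfunction_part(2)[OF u h Om(1)] in "auto simp: mult_le_0_iff")
 have "h (u x) = 0" if h: "bounded_linear h" for h :: "complex => real"
  using le[OF h] le[OF bounded_linear_minus[OF h]] by simp
 from this[OF bounded_linear_Re] this[OF bounded_linear_Im] x(2) show False by (simp add: complex_eq_iff)
qed

text \<open>The positive ground state is a classical eigenfunction, hence competes in the definition of the first
  eigenvalue.\<close>

lemma wsol_eigenfunction:
 fixes Om :: "(real^'n::finite) set"
 assumes w: "continuous_on (closure Om) w" "wsol Om w (%x. mu * w x)" "!!x. x : Om ==> w x > 0"
   "!!x. x : frontier Om ==> w x = 0" and mu: "mu >= 0" and Om: "open Om" "Om ~= {}"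
 shows "dirichlet_eigenfunction Om mu (%x. complex_of_real (w x))"
proof -
 obtain g h where gh: "!!i. continuous_on Om (g i)" "!!i j. continuous_on Om (h i j)"
   "!!i x. x : Om ==> DERIV (%t. w (x + t *R i)) 0 :> g i x"
   "!!i j x. x : Om ==> DERIV (%t. g i (x + t *R j)) 0 :> h i j x"
   "!!x. x : Om ==> (SUM i:Basis. h i i x) = - mu * w x"
  by (rule helmholtz_regular[OF w(2) mu Om(1)]) (rule that)
 define W where "W x = complex_of_real (w x)" for x
 have c: "continuous_on (closure Om) W" unfolding W_def using w(1) by (intro continuous_intros)
 have D1: "((%t. W (x + t *R axis i 1)) has_vector_derivative of_real (g (axis i 1) x)) (at 0)" if "x : Om" for x i
  unfolding W_def using gh(3)[OF that, of "axis i 1"] unfolding has_real_derivative_iff_has_vector_derivative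
  by (rule bounded_linear.has_vector_derivative[OF bounded_linear_of_real])
 have P1: "partial_deriv i W x = of_real (g (axis i 1) x)" if "x : Om" for x i
  unfolding partial_deriv_def by (rule vector_derivative_at[OF D1[OF that]])
 have D2: "((%t. partial_deriv i W (x + t *R axis j 1)) has_vector_derivative of_real (h (axis i 1) (axis j 1) x)) (at 0)" if x: "x : Om" for x i j
 proof (rule has_vector_derivative_transform_within_open)
  show "((%t. complex_of_real (g (axis i 1) (x + t *R axis j 1))) has_vector_derivative of_real (h (axis i 1) (axis j 1) x)) (at 0)"
   using gh(4)[OF x, of "axis i 1" "axis j 1"] unfolding has_real_derivative_iff_has_vector_derivative
   by (rule bounded_linear.has_vector_derivative[OF bounded_linear_of_real])
  show "open ((%t. x + t *R axis j 1) -` Om)" by (intro open_vimage Om continuous_intros)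
 qed (use x in "auto simp: P1")
 have P2: "partial_deriv j (partial_deriv i W) x = of_real (h (axis i 1) (axis j 1) x)" if "x : Om" for x i j
  unfolding partial_deriv_def[of j] by (rule vector_derivative_at[OF D2[OF that]])
 have "continuous_on Om (partial_deriv i W)" "continuous_on Om (partial_deriv j (partial_deriv i W))" for i j
  using gh(1,2) by (auto simp: P1 P2 cong: continuous_on_cong intro!: continuous_intros)
 moreover have "continuous_on Om W" using c closure_subset by (rule continuous_on_subset)
 moreover have "laplacian W x = of_real mu * W x" if "x : Om" for x
 proof -
  have "laplacian W x = - of_real (SUM i:UNIV. h (axis i 1) (axis i 1) x)" using that by (simp add: laplacian_def P2)
  also have "... = of_real mu * W x" using gh(5)[OF that] unfolding sum_Basis_axis by (simp add: W_def)
  finally show ?thesis .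
 qed
 moreover have "EX x:Om. W x ~= 0" using Om(2) w(3) by (force simp: W_def)
 moreover have "(%t. W (x + t *R axis i 1)) differentiable (at 0)" "(%t. partial_deriv i W (x + t *R axis j 1)) differentiable (at 0)"
  if "x : Om" for x i j by (rule differentiableI_vector[OF D1[OF that]] differentiableI_vector[OF D2[OF that]])+
 moreover have "W x = 0" if "x : frontier Om" for x using w(4)[OF that] by (simp add: W_def)
 ultimately have "dirichlet_eigenfunction Om mu W"
  using c unfolding dirichlet_eigenfunction_def numeral_2_eq_2
  by auto
 thus ?thesis by (simp add: W_def[abs_def])
qed

text \<open>The defect D of the resolvent equation is odd, as reflections commute with the resolvent on almost
  periodic functions. Inside the domain its Laplacian is D, and D vanishes on the walls.\<close>

lemma (in chamber) eigenfunction_trig: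
 fixes f :: "'a => real"
 assumes f: "continuous_on (closure Om) f" "!!x. x : frontier Om ==> f x = 0" "wsol Om f (%x. lam * f x)" and lam: "lam > 0"
 shows "EX S a b. finite S & (ALL xi:S. xi *. xi = lam) &
  (ALL x:closure Om. f x = (SUM xi:S. a xi * cos (xi *. x) + b xi * sin (xi *. x)))"
proof -
 obtain U where U: "bcont U" "!!x. x : closure Om ==> U x = f x" "!!h x. h : HH ==> U (reflect h x) = - U x"
  by (rule odd_extension[OF f(1,2)]) (assumption, rule that)
 obtain B where B: "independent B" "span B = UNIV" and per: "!!b x. b : B ==> U (x + b) = U x"
 proof (rule periods)
  fix B :: "'a set" assume B: "independent B" "span B = UNIV"
   "!!(U :: 'a => real) b x. (!!h x. h : HH ==> U (reflect h x) = - U x) ==> b : B ==> U (x + b) = U x"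
  show thesis by (rule that[OF B(1,2)]) (rule B(3)[OF U(3)])
 qed
 obtain G where G: "AP G U" using periodic_AP_ex[OF B _ U(1)] per by blast
 define D where "D x = (1 + lam) * yuk 1 U x - U x" for x
 have D: "bcont D" unfolding D_def[abs_def] by (intro bcont_diff bcont_cmult yuk_bcont U(1))
 have odd: "D (reflect h x) = - D x" if h: "h : HH" for h x
 proof -
  define l where "l = reflect (fst h, 0)"
  define k where "k = reflect h 0"
  have rl: "reflect h x = k + l x" for x using reflect_add[of h 0 x] by (simp add: l_def k_def)
  have l: "x *. l y = l x *. y" "l x *. l x = x *. x" for x y
   using HH(2)[OF h] by (simp_all add: l_def reflect_def inner_diff_left inner_diff_right norm_eq_1 inner_commute algebra_simps)
  have "bcont (%x. U (k + l x))" unfolding rl[symmetric] U(3)[OF h] using bcont_cmult[OF U(1), of "-1"] by simp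
  from AP_reflection[OF G l this] have "yuk 1 U (reflect h x) = yuk 1 (%x. U (reflect h x)) x" unfolding rl ..
  also have "... = - yuk 1 U x" using yuk_cmult[of 1 "-1" U x] by (simp add: U(3)[OF h])
  finally show ?thesis by (simp add: D_def U(3)[OF h] algebra_simps)
 qed
 have fr0: "D x = 0" if "x : frontier Om" for x
  using that fr odd_hplane[OF odd] by (auto simp: in_hplane_iff)
 have sub: "Om <= closure Om" by (rule closure_subset)
 have "wsol Om (yuk 1 U) (%x. (U x - yuk 1 U x) / 1^2)" by (rule wsol_subset[OF yuk_wsol[OF U(1)]]) auto
 from wsol_diff[OF wsol_cmult[OF this, of "1 + lam"] f(3)] have wD: "wsol Om D (%x. - D x)"
  by (rule wsol_cong) (use U(2) sub in "auto simp: D_def algebra_simps")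
 have cD: "c * D x <= 0" if "x : Om" for x and c :: real
 proof (rule wsol_max_principle[OF wsol_cmult[OF wD, of c] dom(1,3) _ _ _ that])
  show "continuous_on (closure Om) (%x. c * D x)"
   by (intro continuous_intros continuous_on_subset[OF bcontD(1)[OF D]]) auto
 qed (auto simp: fr0)
 have D0: "D x = 0" if "x : Om" for x using cD[OF that, of 1] cD[OF that, of "-1"] by simp
 have "D x = 0" for x using odd D0 by (rule odd_zero)
 hence res: "U x = (1 + lam) * yuk 1 U x" for x by (simp add: D_def)
 have "EX S a b. finite S & (ALL xi:S. xi *. xi = lam) & (ALL x. U x = (SUM xi:S. a xi * cos (xi *. x) + b xi * sin (xi *. x)))"
  by (rule periodic_resolvent_trig[OF B _ U(1) res lam]) (rule per)
 then obtain S a b where S: "finite S" "ALL xi:S. xi *. xi = lam"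
   "ALL x. U x = (SUM xi:S. a xi * cos (xi *. x) + b xi * sin (xi *. x))" by (elim exE conjE)
 have "f x = (SUM xi:S. a xi * cos (xi *. x) + b xi * sin (xi *. x))" if "x : closure Om" for x
  using spec[OF S(3), of x] U(2)[OF that] by (simp only:)
 with S(1,2) show ?thesis by (intro exI[of _ S] exI[of _ a] exI[of _ b] conjI ballI) simp_all
qed

lemma trigonometric_eigenfunctionI:
 assumes u: "dirichlet_eigenfunction Om lam u"
  and tr: "!!h :: complex => real. bounded_linear h ==> EX S a b. finite S & (ALL xi:S. xi *. xi = lam) &
   (ALL x:closure Om. h (u x) = (SUM xi:S. a xi * cos (xi *. x) + b xi * sin (xi *. x)))"
 shows "trigonometric_eigenfunction Om lam u"
proof -
 from tr[OF bounded_linear_Re] obtain S a b where S: "finite S" "ALL xi:S. xi *. xi = lam"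
  "ALL x:closure Om. Re (u x) = (SUM xi:S. a xi * cos (xi *. x) + b xi * sin (xi *. x))" by blast
 from tr[OF bounded_linear_Im] obtain T c d where T: "finite T" "ALL xi:T. xi *. xi = lam"
  "ALL x:closure Om. Im (u x) = (SUM xi:T. c xi * cos (xi *. x) + d xi * sin (xi *. x))" by blast
 define A where "A xi = Complex (if xi : S then b xi else 0) (if xi : T then d xi else 0)" for xi
 define B where "B xi = Complex (if xi : S then a xi else 0) (if xi : T then c xi else 0)" for xi
 have ext: "sum f S = (SUM xi:S \<union> T. if xi : S then f xi else 0)" "sum f T = (SUM xi:S \<union> T. if xi : T then f xi else 0)" for f :: "_ => real"
  using S(1) T(1) by (simp_all add: sum.If_cases Int_absorb1)
 have ux: "u x = (SUM xi:S \<union> T. A xi * of_real (sin (xi *. x)) + B xi * of_real (cos (xi *. x)))" if x: "x : closure Om" for x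
  unfolding complex_eq_iff using S(3) T(3) x
  by (auto simp: A_def B_def ext intro!: sum.cong)
 obtain bet where bet: "bij_betw bet {1..card (S \<union> T)} (S \<union> T)" using ex_bij_betw_nat_finite_1[of "S \<union> T"] S(1) T(1) by auto
 have n: "(norm (bet j))\<^sup>2 = lam" if "j : {1..card (S \<union> T)}" for j
  using bij_betwE[OF bet] that S(2) T(2) by (auto simp: power2_norm_eq_inner)
 have "u x = (\<Sum>j=1..card (S \<union> T). A (bet j) * of_real (sin (bet j *. x)) + B (bet j) * of_real (cos (bet j *. x)))" if "x : closure Om" for x
  unfolding ux[OF that] by (rule sum.reindex_bij_betw[OF bet, symmetric])
 thus ?thesis unfolding trigonometric_eigenfunction_def
  by (intro conjI u exI[of _ "card (S \<union> T)"] exI[of _ "%j. A (bet j)"] exI[of _ "%j. B (bet j)"] exI[of _ bet]) (use n in auto)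
qed

theorem corollary1:
  fixes \<Omega> :: "(real^'n) set" and lam1 :: real and u1 :: "real^'n \<Rightarrow> complex"
  assumes "polytope_domain \<Omega>"
    and "first_dirichlet_eigenfunction \<Omega> lam1 u1"
    and "\<exists>v :: real^'n \<Rightarrow> complex. real_analytic_on v UNIV \<and> (\<forall>x\<in>closure \<Omega>. v x = u1 x)"
  shows "trigonometric_eigenfunction \<Omega> lam1 u1 \<and>
    (\<forall>(lam :: real) (u :: real^'n \<Rightarrow> complex).
       dirichlet_eigenfunction \<Omega> lam u \<longrightarrow> trigonometric_eigenfunction \<Omega> lam u)"
proof -
 have pol: "flat_polytope DIM(real^'n) \<Omega>" using assms(1) by (simp add: polytope_domain_def)
 have op: "open \<Omega>" and con: "connected \<Omega>" and bd: "bounded \<Omega>" and ne: "\<Omega> ~= {}" using polytope_facets(1-4)[OF pol] .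
 obtain F where F: "finite F" "frontier \<Omega> = (UN Q:F. closure Q)"
   "!!Q. Q : F ==> Q ~= {} & rel_open Q & (EX n b. norm n = 1 & affine hull Q = {x. n *. x = b})"
  using polytope_facets(5)[OF pol] by (elim exE conjE) (rule that, auto)
 have "EX h. norm (fst h) = 1 & affine hull Q = hplane h" if "Q : F" for Q
  using F(3)[OF that] by (auto simp: hplane_def)
 then obtain hp where hp: "!!Q. Q : F ==> norm (fst (hp Q)) = 1 & affine hull Q = hplane (hp Q)" by metis
 have u1: "dirichlet_eigenfunction \<Omega> lam1 u1" and min: "!!mu w. dirichlet_eigenfunction \<Omega> mu w ==> lam1 <= mu"
  using assms(2) by (auto simp: first_dirichlet_eigenfunction_def)
 obtain v where v: "real_analytic_on v UNIV" "!!x. x : closure \<Omega> ==> v x = u1 x" using assms(3) by blast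
 obtain z where z: "z : \<Omega>" "u1 z ~= 0" using u1 by (auto simp: dirichlet_eigenfunction_def)
 obtain h :: "complex => real" where h: "bounded_linear h" "RA (%x. h (v x))" "h (u1 z) ~= 0"
 proof (cases "Re (u1 z) = 0")
  case True
  hence "Im (u1 z) ~= 0" using z(2) by (simp add: complex_eq_iff)
  thus thesis using that[OF bounded_linear_Im] real_analytic_on_RA(2)[OF v(1)] by blast
 next
  case False
  thus thesis using that[OF bounded_linear_Re] real_analytic_on_RA(1)[OF v(1)] by blast
 qed
 note p1 = eigenfunction_part[OF u1 h(1) op]
 have sub: "\<Omega> <= closure \<Omega>" by (rule closure_subset)
 have nz: "h (v x) ~= 0" if x: "x : \<Omega>" for x
 proof -
  obtain a t eta ch y mu w where "ground_state \<Omega> a t eta ch y mu w"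
   by (rule ground_state_exists[OF op con bd ne polytope_facets(6)[OF pol]]) (assumption, rule that)
  then interpret ground_state \<Omega> a t eta ch y mu w .
  have "0 <= lam1" using eigenvalue_positive[OF u1 op bd] by simp
  moreover have "lam1 <= mu" by (rule min[OF wsol_eigenfunction[OF w mu op ne]])
  ultimately have "h (u1 x) ~= 0" using first_eigenfunction_nonvanishing[OF p1(1) p1(2) p1(3) _ _ z(1) h(3) x] by blast
  thus ?thesis using v(2) sub x by auto
 qed
 have QF: "Q <= frontier \<Omega>" if "Q : F" for Q using F(2) that closure_subset by blast
 have odd: "h (v (reflect (hp Q) x)) = - h (v x)" if Q: "Q : F" for Q x
 proof -
  obtain n b where nb: "hp Q = (n, b)" by (cases "hp Q")
  have Lv: "Lap (%x. h (v x)) x = - lam1 * h (v x)" if "x : \<Omega>" for x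
   by (rule Lap_extension[OF u1 h(1) op h(2) _ that]) (use v(2) sub in auto)
  have "h (v x) = 0" if "x : Q" for x
  proof -
   have "x : frontier \<Omega>" using QF[OF Q] that by blast
   moreover from this have "x : closure \<Omega>" by (simp add: frontier_def)
   ultimately show ?thesis using p1(2) v(2) by simp
  qed
  thus ?thesis unfolding nb using hp[OF Q] F(3)[OF Q]
   by (intro analytic_eigenfunction_odd[OF h(2) op ne Lv, of n Q b]) (auto simp: nb)
 qed
 have "chamber \<Omega> (hp ` F) (%x. h (v x))"
 proof
  show "frontier \<Omega> <= (UN h:hp ` F. hplane h)"
  proof
   fix x assume "x : frontier \<Omega>"
   then obtain Q where Q: "Q : F" "x : closure Q" using F(2) by blast
   have "closure Q <= affine hull Q" by (intro closure_minimal hull_subset closed_affine_hull)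
   thus "x : (UN h:hp ` F. hplane h)" using Q hp by blast
  qed
  show "\<exists>Q\<subseteq>closure \<Omega>. affine hull Q = hplane k" if k: "k : hp ` F" for k
  proof -
   obtain Q where Q: "Q : F" "k = hp Q" using k by blast
   have "Q <= closure \<Omega>" using QF[OF Q(1)] by (auto simp: frontier_def)
   with hp[OF Q(1)] Q(2) show ?thesis by blast
  qed
 qed (use op con bd ne F(1) hp nz odd in auto)
 then interpret chamber \<Omega> "hp ` F" "%x. h (v x)" .
 have all: "trigonometric_eigenfunction \<Omega> lam u" if u: "dirichlet_eigenfunction \<Omega> lam u" for lam u
 proof (rule trigonometric_eigenfunctionI[OF u])
  fix k :: "complex => real" assume "bounded_linear k"
  note p = eigenfunction_part[OF u this op]
  show "EX S a b. finite S & (ALL xi:S. xi *. xi = lam) &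
   (ALL x:closure \<Omega>. k (u x) = (SUM xi:S. a xi * cos (xi *. x) + b xi * sin (xi *. x)))"
   by (rule eigenfunction_trig[OF p(1) p(2) p(3) eigenvalue_positive[OF u op bd]])
 qed
 with u1 show ?thesis by blast
qed

end
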